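(* Let $(M^n,g)$ be a connected smooth Riemannian manifold of dimension $n\ge2$ and let $\Omega\subset M$ be a domain with compact closure and $C^2$-boundary. Let $k\in\mathbb R$, $f\in C^1(\mathbb R)$, and let $u\in C^3(\Omega)\cap C^2(\overline\Omega)$ be a positive solution of $$\Delta u=-f(u)\ \text{ in }\Omega,\qquad u=0\ \text{ on }\partial\Omega .$$ Assume that $\mathrm{Ric}\ge(n-1)k\,g$ on $\Omega$, $H>0$ on $\partial\Omega$, and $$\mathcal E(u):=\int_\Omega(f'(u)-nk)|\nabla u|^2\,d\Omega\le0 .$$ Then $$\frac{n-1}{n}f(0)^2\int_{\partial\Omega}\frac1H\,d\sigma\ \ge\ f(0)\int_\Omega f(u)\,d\Omega .$$ If $\mathcal E(u)<0$, this inequality is strict.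
   Context: $\eta$ is the outward unit normal along $\partial\Omega$, and $H$ is the non-normalized mean curvature, $H=\mathrm{tr}_{\partial\Omega}(X\mapsto\nabla_X\eta)$ (so a Euclidean sphere of radius $r$ has $H=(n-1)/r$). $d\Omega$ and $d\sigma$ are the Riemannian volume elements of $\Omega$ and $\partial\Omega$. $\Delta$ is the Laplace--Beltrami operator (trace of the Hessian). "$\mathrm{Ric}\ge(n-1)kg$ on $\Omega$" means $\mathrm{Ric}_q(X,X)\ge (n-1)k\,g_q(X,X)$ for all $q\in\Omega$, $X\in T_qM$, with the convention that $\mathbb S^n$ has $\mathrm{Ric}=(n-1)g$. "Positive" means $u>0$ in $\Omega$. *)

theory Defs
  imports "HOL-Analysis.Analysis"
begin

section \<open>Functions of class \<open>C\<^sup>k\<close> in Euclidean space\<close>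

definition pd :: "'n \<Rightarrow> (real^'n \<Rightarrow> 'b) \<Rightarrow> real^'n \<Rightarrow> 'b::real_normed_vector" where
  "pd i f x = frechet_derivative f (at x) (axis i 1)"

text \<open>Only meant for open \<open>S\<close>.\<close>

primrec Ck_on :: "nat \<Rightarrow> (real^'n) set \<Rightarrow> (real^'n \<Rightarrow> 'b::real_normed_vector) \<Rightarrow> bool" where
  "Ck_on 0 S f \<longleftrightarrow> continuous_on S f"
| "Ck_on (Suc k) S f \<longleftrightarrow> (\<forall>x\<in>S. f differentiable (at x)) \<and> (\<forall>i. Ck_on k S (pd i f))"

text \<open>\<open>f\<close> is \<open>C\<^sup>k\<close> on the open set \<open>V\<close>, and all its partial derivatives of order at most \<open>k\<close> extend
  continuously from \<open>V\<close> to \<open>S \<supseteq> V\<close>.\<close>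

primrec Ck_upto :: "nat \<Rightarrow> (real^'n) set \<Rightarrow> (real^'n) set \<Rightarrow> (real^'n \<Rightarrow> real) \<Rightarrow> bool" where
  "Ck_upto 0 V S f \<longleftrightarrow> (\<exists>h. continuous_on S h \<and> (\<forall>x\<in>V. h x = f x))"
| "Ck_upto (Suc k) V S f \<longleftrightarrow> (\<exists>h. continuous_on S h \<and> (\<forall>x\<in>V. h x = f x))
     \<and> (\<forall>x\<in>V. f differentiable (at x)) \<and> (\<forall>i. Ck_upto k V S (pd i f))"


section \<open>Smooth manifolds and Riemannian metrics\<close>

text \<open>The manifold is a Hausdorff, second countable type \<open>'a\<close> with a smooth atlas \<open>A\<close>, not necessarily
  maximal. A chart is a pair of an open set and a coordinate map whose values outside that set are
  irrelevant.\<close>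

type_synonym ('a, 'n) chart = "'a set \<times> ('a \<Rightarrow> real^'n)"

abbreviation cdom :: "('a, 'n) chart \<Rightarrow> 'a set" where "cdom c \<equiv> fst c"
abbreviation cmap :: "('a, 'n) chart \<Rightarrow> 'a \<Rightarrow> real^'n" where "cmap c \<equiv> snd c"
abbreviation cinv :: "('a, 'n) chart \<Rightarrow> real^'n \<Rightarrow> 'a" where "cinv c \<equiv> inv_into (cdom c) (cmap c)"

definition is_chart :: "('a::topological_space, 'n::finite) chart \<Rightarrow> bool" where
  "is_chart c \<longleftrightarrow> open (cdom c) \<and> open (cmap c ` cdom c)
     \<and> homeomorphism (cdom c) (cmap c ` cdom c) (cmap c) (cinv c)"

definition smooth_atlas :: "('a::{t2_space,second_countable_topology}, 'n::finite) chart set \<Rightarrow> bool" where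
  "smooth_atlas A \<longleftrightarrow> (\<forall>c\<in>A. is_chart c) \<and> (\<Union>c\<in>A. cdom c) = UNIV
     \<and> (\<forall>c\<in>A. \<forall>d\<in>A. \<forall>k. Ck_on k (cmap c ` (cdom c \<inter> cdom d)) (cmap d \<circ> cinv c))"

text \<open>A (0,2)-tensor field is given by its component matrices: \<open>g c x\<close> is the matrix of the metric in
  the chart \<open>c\<close> at the point with coordinates \<open>x\<close>. The last clause is the tensor transformation law.
  Likewise, a tangent vector at \<open>p\<close> is represented by its components in a chart around \<open>p\<close>.\<close>

type_synonym ('a, 'n) tensor2 = "('a, 'n) chart \<Rightarrow> real^'n \<Rightarrow> real^'n^'n"

definition riemannian_metric ::
    "('a::{t2_space,second_countable_topology}, 'n::finite) chart set \<Rightarrow> ('a, 'n) tensor2 \<Rightarrow> bool" where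
  "riemannian_metric A g \<longleftrightarrow>
     (\<forall>c\<in>A. (\<forall>k. Ck_on k (cmap c ` cdom c) (g c))
        \<and> (\<forall>x\<in>cmap c ` cdom c. transpose (g c x) = g c x
             \<and> (\<forall>v. v \<noteq> 0 \<longrightarrow> v \<bullet> (g c x *v v) > 0)))
     \<and> (\<forall>c\<in>A. \<forall>d\<in>A. \<forall>p\<in>cdom c \<inter> cdom d. \<forall>v w.
          (let J = frechet_derivative (cmap d \<circ> cinv c) (at (cmap c p))
           in v \<bullet> (g c (cmap c p) *v w) = J v \<bullet> (g d (cmap d p) *v J w)))"

text \<open>Used for scalar quantities that do not depend on the chart.\<close>

definition chart_at :: "('a, 'n) chart set \<Rightarrow> 'a \<Rightarrow> ('a, 'n) chart" where
  "chart_at A p = (SOME c. c \<in> A \<and> p \<in> cdom c)"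


section \<open>Local expressions in coordinates\<close>

text \<open>Here \<open>G\<close> is the matrix function of the metric in one chart.\<close>

text \<open>\<open>christoffel G k i j = \<Gamma>\<^sup>k\<^sub>i\<^sub>j\<close>, i.e. \<open>\<nabla>\<^bsub>\<partial>i\<^esub> \<partial>\<^sub>j = (\<Sum>k. \<Gamma>\<^sup>k\<^sub>i\<^sub>j \<partial>\<^sub>k)\<close>.\<close>

definition christoffel :: "(real^'n \<Rightarrow> real^'n^'n) \<Rightarrow> 'n::finite \<Rightarrow> 'n \<Rightarrow> 'n \<Rightarrow> real^'n \<Rightarrow> real" where
  "christoffel G k i j x =
     (1/2) * (\<Sum>l\<in>UNIV. matrix_inv (G x) $ k $ l
                * (pd i G x $ j $ l + pd j G x $ i $ l - pd l G x $ i $ j))"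

text \<open>\<open>R(\<partial>\<^sub>i,\<partial>\<^sub>j)\<partial>\<^sub>k = (\<Sum>l. riemann G l k i j \<partial>\<^sub>l)\<close> with
  \<open>R(X,Y)Z = \<nabla>\<^sub>X \<nabla>\<^sub>Y Z - \<nabla>\<^sub>Y \<nabla>\<^sub>X Z - \<nabla>\<^bsub>[X,Y]\<^esub> Z\<close>, and \<open>Ric(Y,Z) = tr (X \<mapsto> R(X,Y)Z)\<close>; with these signs the
  unit sphere has \<open>Ric = (n-1) g\<close>.\<close>

definition riemann :: "(real^'n \<Rightarrow> real^'n^'n) \<Rightarrow> 'n::finite \<Rightarrow> 'n \<Rightarrow> 'n \<Rightarrow> 'n \<Rightarrow> real^'n \<Rightarrow> real" where
  "riemann G l k i j x =
     pd i (christoffel G l j k) x - pd j (christoffel G l i k) x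
     + (\<Sum>m\<in>UNIV. christoffel G l i m x * christoffel G m j k x
                 - christoffel G l j m x * christoffel G m i k x)"

definition ricci :: "(real^'n \<Rightarrow> real^'n^'n) \<Rightarrow> real^'n \<Rightarrow> real^'n^'n::finite" where
  "ricci G x = (\<chi> j k. \<Sum>l\<in>UNIV. riemann G l k l j x)"

definition hessian :: "(real^'n \<Rightarrow> real^'n^'n) \<Rightarrow> (real^'n \<Rightarrow> real) \<Rightarrow> real^'n \<Rightarrow> real^'n^'n::finite" where
  "hessian G w x = (\<chi> i j. pd i (pd j w) x - (\<Sum>k\<in>UNIV. christoffel G k i j x * pd k w x))"

definition gradient :: "(real^'n \<Rightarrow> real^'n^'n) \<Rightarrow> (real^'n \<Rightarrow> real) \<Rightarrow> real^'n \<Rightarrow> real^'n::finite" where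
  "gradient G w x = matrix_inv (G x) *v (\<chi> j. pd j w x)"


section \<open>Scalar differential operators and curvature bounds on the manifold\<close>

definition laplacian ::
    "('a, 'n::finite) chart set \<Rightarrow> ('a, 'n) tensor2 \<Rightarrow> ('a \<Rightarrow> real) \<Rightarrow> 'a \<Rightarrow> real" where
  "laplacian A g u p =
     (let c = chart_at A p; x = cmap c p
      in trace (matrix_inv (g c x) ** hessian (g c) (u \<circ> cinv c) x))"

definition grad_norm_sq ::
    "('a, 'n::finite) chart set \<Rightarrow> ('a, 'n) tensor2 \<Rightarrow> ('a \<Rightarrow> real) \<Rightarrow> 'a \<Rightarrow> real" where
  "grad_norm_sq A g u p =
     (let c = chart_at A p; x = cmap c p; v = gradient (g c) (u \<circ> cinv c) x
      in v \<bullet> (g c x *v v))"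

definition ricci_bounded_below ::
    "('a, 'n::finite) chart set \<Rightarrow> ('a, 'n) tensor2 \<Rightarrow> 'a set \<Rightarrow> real \<Rightarrow> bool" where
  "ricci_bounded_below A g \<Omega> \<kappa> \<longleftrightarrow>
     (\<forall>c\<in>A. \<forall>q\<in>\<Omega> \<inter> cdom c. \<forall>X.
        X \<bullet> (ricci (g c) (cmap c q) *v X) \<ge> \<kappa> * (X \<bullet> (g c (cmap c q) *v X)))"

definition Ck_open ::
    "nat \<Rightarrow> ('a, 'n::finite) chart set \<Rightarrow> 'a set \<Rightarrow> ('a \<Rightarrow> real) \<Rightarrow> bool" where
  "Ck_open k A \<Omega> u \<longleftrightarrow> (\<forall>c\<in>A. Ck_on k (cmap c ` (cdom c \<inter> \<Omega>)) (u \<circ> cinv c))"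

definition Ck_closure ::
    "nat \<Rightarrow> ('a::topological_space, 'n::finite) chart set \<Rightarrow> 'a set \<Rightarrow> ('a \<Rightarrow> real) \<Rightarrow> bool" where
  "Ck_closure k A \<Omega> u \<longleftrightarrow> continuous_on (closure \<Omega>) u
     \<and> (\<forall>c\<in>A. Ck_upto k (cmap c ` (cdom c \<inter> \<Omega>)) (cmap c ` (cdom c \<inter> closure \<Omega>)) (u \<circ> cinv c))"


section \<open>The boundary: \<open>C\<^sup>2\<close> regularity, outward unit normal, mean curvature\<close>

text \<open>\<open>r\<close> is a \<open>C\<^sup>2\<close> local defining function of \<open>\<Omega>\<close> near the boundary point \<open>p\<close>, in the coordinates of
  the chart \<open>c\<close>, negative inside \<open>\<Omega>\<close>.\<close>

definition local_defining_fun ::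
    "('a::topological_space, 'n::finite) chart \<Rightarrow> 'a set \<Rightarrow> 'a \<Rightarrow> (real^'n \<Rightarrow> real) \<Rightarrow> bool" where
  "local_defining_fun c \<Omega> p r \<longleftrightarrow> p \<in> cdom c \<inter> frontier \<Omega> \<and>
     (\<exists>V. open V \<and> cmap c p \<in> V \<and> V \<subseteq> cmap c ` cdom c \<and> Ck_on 2 V r
        \<and> (\<exists>v. frechet_derivative r (at (cmap c p)) v \<noteq> 0)
        \<and> (\<forall>x\<in>V. (cinv c x \<in> \<Omega> \<longleftrightarrow> r x < 0) \<and> (cinv c x \<in> frontier \<Omega> \<longleftrightarrow> r x = 0)))"

definition C2_boundary :: "('a::topological_space, 'n::finite) chart set \<Rightarrow> 'a set \<Rightarrow> bool" where
  "C2_boundary A \<Omega> \<longleftrightarrow> (\<forall>p\<in>frontier \<Omega>. \<exists>c\<in>A. \<exists>r. local_defining_fun c \<Omega> p r)"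

text \<open>Components of \<open>\<eta>\<close> at \<open>p\<close> in the chart \<open>c\<close>; the tangent space of the boundary is the kernel of
  \<open>dr\<close>.\<close>

definition outward_normal ::
    "('a::topological_space, 'n::finite) tensor2 \<Rightarrow> 'a set \<Rightarrow> ('a, 'n) chart \<Rightarrow> 'a \<Rightarrow> real^'n" where
  "outward_normal g \<Omega> c p = (THE \<nu>. \<exists>r. local_defining_fun c \<Omega> p r
     \<and> (let x = cmap c p; dr = frechet_derivative r (at x)
        in \<nu> \<bullet> (g c x *v \<nu>) = 1 \<and> dr \<nu> > 0 \<and> (\<forall>v. dr v = 0 \<longrightarrow> v \<bullet> (g c x *v \<nu>) = 0)))"

definition boundary_tangent_space ::
    "('a::topological_space, 'n::finite) tensor2 \<Rightarrow> 'a set \<Rightarrow> ('a, 'n) chart \<Rightarrow> 'a \<Rightarrow> (real^'n) set" where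
  "boundary_tangent_space g \<Omega> c p = {v. v \<bullet> (g c (cmap c p) *v outward_normal g \<Omega> c p) = 0}"

text \<open>\<open>\<nabla>\<^sub>X \<eta>\<close> for \<open>X\<close> tangent to the boundary. Since \<open>\<eta>\<close> lives on the boundary only, it is differentiated
  within the boundary; the derivative is then determined on tangent vectors, the only ones used.\<close>

definition normal_covariant_derivative ::
    "('a::topological_space, 'n::finite) tensor2 \<Rightarrow> 'a set \<Rightarrow> ('a, 'n) chart \<Rightarrow> 'a \<Rightarrow> real^'n \<Rightarrow> real^'n" where
  "normal_covariant_derivative g \<Omega> c p X =
     (let x = cmap c p
      in frechet_derivative (\<lambda>y. outward_normal g \<Omega> c (cinv c y))
           (at x within cmap c ` (cdom c \<inter> frontier \<Omega>)) X
         + (\<chi> k. \<Sum>i\<in>UNIV. \<Sum>j\<in>UNIV.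
              christoffel (g c) k i j x * X $ i * outward_normal g \<Omega> c p $ j))"

definition orthonormal_basis_of :: "real^'n^'n \<Rightarrow> (real^'n) set \<Rightarrow> (real^'n) set \<Rightarrow> bool" where
  "orthonormal_basis_of M T B \<longleftrightarrow> span B = T
     \<and> (\<forall>v\<in>B. \<forall>w\<in>B. v \<bullet> (M *v w) = (if v = w then 1 else 0))"

text \<open>The trace of \<open>X \<mapsto> \<nabla>\<^sub>X \<eta>\<close> over the tangent space of the boundary, computed in an orthonormal basis.\<close>

definition mean_curvature ::
    "('a::topological_space, 'n::finite) chart set \<Rightarrow> ('a, 'n) tensor2 \<Rightarrow> 'a set \<Rightarrow> 'a \<Rightarrow> real" where
  "mean_curvature A g \<Omega> p =
     (let c = chart_at A p; M = g c (cmap c p);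
          B = (SOME B. orthonormal_basis_of M (boundary_tangent_space g \<Omega> c p) B)
      in \<Sum>e\<in>B. normal_covariant_derivative g \<Omega> c p e \<bullet> (M *v e))"


section \<open>Riemannian volume\<close>

text \<open>\<open>F\<close> is a local \<open>C\<^sup>1\<close> parametrization, defined on the open set \<open>W\<close>, of the embedded submanifold \<open>S\<close>,
  with image inside the chart \<open>c\<close>.\<close>

definition local_parametrization ::
    "('a::topological_space, 'n::finite) chart set \<Rightarrow> 'a set \<Rightarrow> ('a, 'n) chart
      \<Rightarrow> (real^'m::finite) set \<Rightarrow> (real^'m \<Rightarrow> 'a) \<Rightarrow> bool" where
  "local_parametrization A S c W F \<longleftrightarrow> c \<in> A \<and> open W \<and> F ` W \<subseteq> S \<inter> cdom c
     \<and> openin (top_of_set S) (F ` W) \<and> homeomorphism W (F ` W) F (inv_into W F)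
     \<and> Ck_on 1 W (cmap c \<circ> F) \<and> (\<forall>x\<in>W. inj (frechet_derivative (cmap c \<circ> F) (at x)))"

definition induced_metric ::
    "('a, 'n::finite) tensor2 \<Rightarrow> ('a, 'n) chart \<Rightarrow> (real^'m::finite \<Rightarrow> 'a) \<Rightarrow> real^'m \<Rightarrow> real^'m^'m" where
  "induced_metric g c F x =
     (\<chi> a b. pd a (cmap c \<circ> F) x \<bullet> (g c (cmap c (F x)) *v pd b (cmap c \<circ> F) x))"

text \<open>The Riemannian volume measure of an embedded submanifold \<open>S\<close> of dimension \<open>CARD('m)\<close> with the
  induced metric \<open>h\<close>, extended by zero to a Borel measure on the whole manifold: in every local
  parametrization it is \<open>sqrt (det h) dx\<close>. The dimension is passed as a type, which does not occur in
  the type of the measure.\<close>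

definition riemannian_measure ::
    "'m::finite itself \<Rightarrow> ('a::{t2_space,second_countable_topology}, 'n::finite) chart set
      \<Rightarrow> ('a, 'n) tensor2 \<Rightarrow> 'a set \<Rightarrow> 'a measure" where
  "riemannian_measure _ A g S = (THE \<mu>. sets \<mu> = sets borel \<and> emeasure \<mu> (- S) = 0
     \<and> (\<forall>c W (F :: real^'m \<Rightarrow> 'a). local_parametrization A S c W F \<longrightarrow>
          (\<forall>B\<in>sets borel. B \<subseteq> F ` W \<longrightarrow>
             emeasure \<mu> B =
               (\<integral>\<^sup>+x\<in>{x\<in>W. F x \<in> B}. ennreal (sqrt (det (induced_metric g c F x))) \<partial>lborel))))"

definition volume_measure ::
    "('a::{t2_space,second_countable_topology}, 'n::finite) chart set \<Rightarrow> ('a, 'n) tensor2 \<Rightarrow> 'a measure" where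
  "volume_measure A g = riemannian_measure TYPE('n) A g UNIV"

definition energy ::
    "('a::{t2_space,second_countable_topology}, 'n::finite) chart set \<Rightarrow> ('a, 'n) tensor2 \<Rightarrow> 'a set
      \<Rightarrow> real \<Rightarrow> (real \<Rightarrow> real) \<Rightarrow> ('a \<Rightarrow> real) \<Rightarrow> real" where
  "energy A g \<Omega> k f u =
     (LINT p:\<Omega>|volume_measure A g. (deriv f (u p) - real CARD('n) * k) * grad_norm_sq A g u p)"

end

theory Submission
  imports Defs
begin

text \<open>Write \<open>v = \<nabla>u\<close> and \<open>N = \<partial>u/\<partial>\<eta> \<le> 0\<close>. The divergence theorem \<open>\<integral>\<^sub>\<Omega> \<Delta>b = \<integral>\<^bsub>\<partial>\<Omega>\<^esub> \<partial>b/\<partial>\<eta>\<close> is applied to three functions \<open>b\<close>.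
  For \<open>b = u\<close> it gives \<open>\<integral>N = - \<integral>f(u)\<close>, and for \<open>b = F(u)\<close> with \<open>F' = f\<close> it gives
  \<open>\<integral>f(u)\<^sup>2 = \<integral>f'(u)|v|\<^sup>2 + f(0) \<integral>f(u)\<close>. For \<open>b = |v|\<^sup>2\<close> the normal derivative is \<open>- 2 N (f(0) + H N)\<close>, because
  \<open>\<Delta>u = \<nabla>\<^sup>2u(\<eta>,\<eta>) + H N\<close> on the boundary, while Bochner's formula together with \<open>|\<nabla>\<^sup>2u|\<^sup>2 \<ge> (\<Delta>u)\<^sup>2/n\<close> and
  the Ricci bound estimates \<open>\<Delta>|v|\<^sup>2\<close> from below. With \<open>Y = f(0) \<integral>f(u)\<close> the three identities combine to
  \<open>\<integral>H N\<^sup>2 \<le> (n-1)/n (E + Y)\<close>. Since \<open>(\<integral>N)\<^sup>2 \<le> \<integral>1/H \<integral>H N\<^sup>2\<close> by Cauchy-Schwarz, it follows that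
  \<open>Y \<ge> - E \<ge> 0\<close> and \<open>Y\<^sup>2 \<le> R (E + Y)\<close> for \<open>R = (n-1)/n f(0)\<^sup>2 \<integral>1/H\<close>, hence \<open>Y \<le> R\<close>, strictly if \<open>E < 0\<close>.\<close>

section \<open>Calculus of \<open>C\<^sup>k\<close> functions\<close>

text \<open>The regularity at the boundary shapes the proof. Up to the boundary \<open>u\<close> is
  only C^2, so |\<nabla>u|^2 is only C^1 there and its Laplacian is defined inside only. Bochner's
  formula together with the equation rewrites this Laplacian through derivatives of \<open>u\<close>
  of order at most two, so it stays bounded; accordingly the divergence theorem is proved for fields
  that are continuous up to the boundary, C^1 inside and of bounded divergence. Derivatives of
  \<open>u\<close> on the boundary are continuous extensions in a chart; the relations du = l dr
  and, on tangent vectors, Hess u = l Hess r come from differentiating along curves in the boundary.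
  Two kinds of objects are defined through choices. The operators are evaluated in a selected chart,
  so their invariance is shown; for the Hessian it follows from a Koszul-type formula in inner
  products of gradients. The measures are definite descriptions, whose existence and uniqueness rest
  on a change of variables between parametrizations. The bound Y \<ge> -E is the nonnegativity of
  \<integral>H N^2, so H > 0 enters both there and in the Cauchy-Schwarz step.\<close>

lemma pd_eqI: "(f has_derivative D) (at x) \<Longrightarrow> pd i f x = D (axis i 1)"
  unfolding pd_def by (rule fun_cong[OF frechet_derivative_at, symmetric])

lemma has_derivative_pd:
  fixes f :: "real^'n::finite \<Rightarrow> 'b::real_normed_vector"
  assumes "f differentiable (at x)"
  shows "(f has_derivative (\<lambda>v. \<Sum>i\<in>UNIV. v $ i *\<^sub>R pd i f x)) (at x)"
proof -
  let ?D = "frechet_derivative f (at x)"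
  have D: "(f has_derivative ?D) (at x)" using assms by (simp add: frechet_derivative_works)
  then interpret linear ?D by (rule has_derivative_linear)
  have *: "?D v = (\<Sum>i\<in>UNIV. v $ i *\<^sub>R ?D (axis i 1))" for v
    by (subst basis_expansion[of v, symmetric])
       (simp add: sum scale scalar_mult_eq_scaleR)
  have "?D = (\<lambda>v. \<Sum>i\<in>UNIV. v $ i *\<^sub>R pd i f x)"
    unfolding pd_def by (rule ext, rule *)
  with D show ?thesis by metis
qed

lemma frechet_derivative_eq_pd:
  fixes f :: "real^'n::finite \<Rightarrow> 'b::real_normed_vector"
  assumes "f differentiable (at x)"
  shows "frechet_derivative f (at x) v = (\<Sum>i\<in>UNIV. v $ i *\<^sub>R pd i f x)"
  by (rule fun_cong[OF frechet_derivative_at[OF has_derivative_pd[OF assms], symmetric]])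

lemma has_derivative_cong_open:
  assumes "open S" "x \<in> S" "\<And>y. y \<in> S \<Longrightarrow> f y = g y"
  shows "(f has_derivative D) (at x) \<longleftrightarrow> (g has_derivative D) (at x)"
proof
  assume "(f has_derivative D) (at x)"
  then show "(g has_derivative D) (at x)"
    by (rule has_derivative_transform_within_open[OF _ assms(1,2)]) (rule assms(3))
next
  assume "(g has_derivative D) (at x)"
  then show "(f has_derivative D) (at x)"
    by (rule has_derivative_transform_within_open[OF _ assms(1,2)]) (rule assms(3)[symmetric])
qed

lemma pd_cong:
  assumes "open S" "x \<in> S" "\<And>y. y \<in> S \<Longrightarrow> f y = g y"
  shows "pd i f x = pd i g x"
  unfolding pd_def frechet_derivative_def
  by (simp only: has_derivative_cong_open[of S x f g, OF assms])

lemma differentiable_cong_open: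
  assumes "open S" "x \<in> S" "\<And>y. y \<in> S \<Longrightarrow> f y = g y"
  shows "f differentiable (at x) \<longleftrightarrow> g differentiable (at x)"
  unfolding differentiable_def using has_derivative_cong_open[of S x f g, OF assms] by blast

lemma Ck_on_cong:
  assumes "open S" "\<And>y. y \<in> S \<Longrightarrow> f y = g y" "Ck_on k S f"
  shows "Ck_on k S g"
  using assms(2,3)
proof (induction k arbitrary: f g)
  case 0
  then show ?case by (simp cong: continuous_on_cong)
next
  case (Suc k)
  have "Ck_on k S (pd i g)" for i
    by (rule Suc.IH[of "pd i f"]) (use Suc.prems pd_cong[OF assms(1) _ Suc.prems(1)] in auto)
  then show ?case
    using Suc.prems differentiable_cong_open[OF assms(1) _ Suc.prems(1)] by auto
qed

lemma Ck_on_subset: "Ck_on k S f \<Longrightarrow> T \<subseteq> S \<Longrightarrow> Ck_on k T f"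
  by (induction k arbitrary: f) (auto intro: continuous_on_subset)

lemma Ck_on_Suc_imp: "Ck_on (Suc k) S f \<Longrightarrow> Ck_on k S f"
proof (induction k arbitrary: f)
  case 0
  then show ?case
    by (auto intro!: continuous_at_imp_continuous_on differentiable_imp_continuous_within)
qed auto

lemma Ck_on_le: "Ck_on k S f \<Longrightarrow> l \<le> k \<Longrightarrow> Ck_on l S f"
proof (induction k)
  case (Suc k)
  then show ?case by (cases "l = Suc k") (simp_all del: Ck_on.simps(2) add: Ck_on_Suc_imp)
qed simp

lemma Ck_on_continuous: "Ck_on k S f \<Longrightarrow> continuous_on S f"
  using Ck_on_le[of k S f 0] by simp

lemma Ck_on_differentiable: "Ck_on k S f \<Longrightarrow> k > 0 \<Longrightarrow> x \<in> S \<Longrightarrow> f differentiable (at x)"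
  by (cases k) auto

lemma Ck_on_pd: "Ck_on k S f \<Longrightarrow> Suc l \<le> k \<Longrightarrow> Ck_on l S (pd i f)"
  using Ck_on_le[of k S f "Suc l"] by simp

lemma Ck_on_const [simp]: "Ck_on k S (\<lambda>x. c)"
proof (induction k arbitrary: c)
  case (Suc k)
  have "pd i (\<lambda>x. c) = (\<lambda>x. 0)" for i :: 'a
    by (rule ext, subst pd_eqI[OF has_derivative_const]) auto
  then show ?case using Suc by auto
qed auto

lemma pd_add:
  fixes f g :: "real^'n::finite \<Rightarrow> 'b::real_normed_vector"
  assumes "f differentiable (at x)" "g differentiable (at x)"
  shows "pd i (\<lambda>x. f x + g x) x = pd i f x + pd i g x"
  using pd_eqI[OF has_derivative_add[of f "frechet_derivative f (at x)" "at x" g "frechet_derivative g (at x)"], of i] assms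
  by (simp add: frechet_derivative_works) (simp add: pd_def)

lemma Ck_on_add:
  fixes f g :: "real^'n::finite \<Rightarrow> 'b::real_normed_vector"
  assumes "open S"
  shows "Ck_on k S f \<Longrightarrow> Ck_on k S g \<Longrightarrow> Ck_on k S (\<lambda>x. f x + g x)"
proof (induction k arbitrary: f g)
  case (Suc k)
  have "Ck_on k S (pd i (\<lambda>x. f x + g x))" for i
    by (rule Ck_on_cong[OF assms _ Suc.IH[of "pd i f" "pd i g"]]) (use Suc.prems pd_add in fastforce)+
  then show ?case using Suc.prems by (auto intro: differentiable_add)
qed (auto intro: continuous_on_add)

lemma pd_bounded_linear:
  assumes "bounded_linear L" "f differentiable (at x)"
  shows "pd i (\<lambda>x. L (f x)) x = L (pd i f x)"
proof -
  obtain D where D: "(f has_derivative D) (at x)" using assms(2) by (auto simp: differentiable_def)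
  show ?thesis
    using pd_eqI[OF bounded_linear.has_derivative[OF assms(1) D], of i] pd_eqI[OF D, of i] by simp
qed

lemma Ck_on_bounded_linear:
  assumes "open S" "bounded_linear L"
  shows "Ck_on k S f \<Longrightarrow> Ck_on k S (\<lambda>x. L (f x))"
proof (induction k arbitrary: f)
  case 0
  then show ?case using assms by (auto intro: bounded_linear.continuous_on)
next
  case (Suc k)
  have "Ck_on k S (pd i (\<lambda>x. L (f x)))" for i
    by (rule Ck_on_cong[OF assms(1) _ Suc.IH[of "pd i f"]])
       (use Suc.prems pd_bounded_linear[OF assms(2)] in fastforce)+
  moreover have "(\<lambda>x. L (f x)) differentiable (at x)" if "x \<in> S" for x
    using Suc.prems that bounded_linear.has_derivative[OF assms(2), of f _ "at x"] unfolding differentiable_def Ck_on.simps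
    by blast
  ultimately show ?case by auto
qed

lemmas Ck_on_nth = Ck_on_bounded_linear[OF _ bounded_linear_vec_nth]

lemma pd_cmult:
  fixes f :: "real^'n::finite \<Rightarrow> real"
  shows "f differentiable (at x) \<Longrightarrow> pd i (\<lambda>x. c * f x) x = c * pd i f x"
  by (rule pd_bounded_linear[OF bounded_linear_mult_right])

lemma Ck_on_uminus:
  fixes f :: "real^'n::finite \<Rightarrow> real"
  shows "open S \<Longrightarrow> Ck_on k S f \<Longrightarrow> Ck_on k S (\<lambda>x. - f x)"
  by (rule Ck_on_bounded_linear[OF _ bounded_linear_minus[OF bounded_linear_ident]])

lemma Ck_on_diff:
  fixes f g :: "real^'n::finite \<Rightarrow> real"
  shows "open S \<Longrightarrow> Ck_on k S f \<Longrightarrow> Ck_on k S g \<Longrightarrow> Ck_on k S (\<lambda>x. f x - g x)"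
  using Ck_on_add[of S k f "\<lambda>x. - g x"] Ck_on_uminus[of S k g] by simp

lemma differentiable_scaleR:
  fixes f :: "'a::real_normed_vector \<Rightarrow> real" and g :: "'a \<Rightarrow> 'b::real_normed_vector"
  assumes "f differentiable (at x)" "g differentiable (at x)"
  shows "(\<lambda>x. f x *\<^sub>R g x) differentiable (at x)"
  using assms unfolding differentiable_def by (blast intro: has_derivative_scaleR)

lemma pd_scaleR:
  fixes f :: "real^'n::finite \<Rightarrow> real" and g :: "real^'n \<Rightarrow> 'b::real_normed_vector"
  assumes "f differentiable (at x)" "g differentiable (at x)"
  shows "pd i (\<lambda>x. f x *\<^sub>R g x) x = f x *\<^sub>R pd i g x + pd i f x *\<^sub>R g x"
proof -
  obtain F G where *: "(f has_derivative F) (at x)" "(g has_derivative G) (at x)"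
    using assms unfolding differentiable_def by auto
  show ?thesis
    using pd_eqI[OF has_derivative_scaleR[OF *], of i] pd_eqI[OF *(1), of i] pd_eqI[OF *(2), of i] by simp
qed

lemma Ck_on_scaleR:
  fixes f :: "real^'n::finite \<Rightarrow> real" and g :: "real^'n \<Rightarrow> 'b::real_normed_vector"
  assumes "open S"
  shows "Ck_on k S f \<Longrightarrow> Ck_on k S g \<Longrightarrow> Ck_on k S (\<lambda>x. f x *\<^sub>R g x)"
proof (induction k arbitrary: f g)
  case (Suc k)
  have "Ck_on k S (pd i (\<lambda>x. f x *\<^sub>R g x))" for i
  proof (rule Ck_on_cong[OF assms _ Ck_on_add[OF assms Suc.IH[of f "pd i g"] Suc.IH[of "pd i f" g]]])
    show "f y *\<^sub>R pd i g y + pd i f y *\<^sub>R g y = pd i (\<lambda>x. f x *\<^sub>R g x) y" if "y \<in> S" for y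
      using Suc.prems that by (intro pd_scaleR[symmetric]) auto
  qed (use Suc.prems in \<open>auto intro: Ck_on_Suc_imp[OF Suc.prems(1)] Ck_on_Suc_imp[OF Suc.prems(2)]\<close>)
  then show ?case using Suc.prems by (auto intro: differentiable_scaleR)
qed (auto intro: continuous_on_scaleR)

lemma Ck_on_mult:
  fixes f g :: "real^'n::finite \<Rightarrow> real"
  shows "open S \<Longrightarrow> Ck_on k S f \<Longrightarrow> Ck_on k S g \<Longrightarrow> Ck_on k S (\<lambda>x. f x * g x)"
  using Ck_on_scaleR[of S k f g] by simp

lemma pd_mult:
  fixes f g :: "real^'n::finite \<Rightarrow> real"
  shows "f differentiable (at x) \<Longrightarrow> g differentiable (at x)
    \<Longrightarrow> pd i (\<lambda>x. f x * g x) x = pd i f x * g x + f x * pd i g x"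
  using pd_scaleR[of f x g i] by simp

lemma Ck_on_sum:
  fixes f :: "'c \<Rightarrow> real^'n::finite \<Rightarrow> 'b::real_normed_vector"
  assumes "open S"
  shows "(\<And>j. j \<in> J \<Longrightarrow> Ck_on k S (f j)) \<Longrightarrow> Ck_on k S (\<lambda>x. \<Sum>j\<in>J. f j x)"
  by (induction J rule: infinite_finite_induct) (auto intro: Ck_on_add[OF assms])

lemma pd_sum:
  fixes f :: "'c \<Rightarrow> real^'n::finite \<Rightarrow> 'b::real_normed_vector"
  assumes "finite J" "\<And>j. j \<in> J \<Longrightarrow> f j differentiable (at x)"
  shows "pd i (\<lambda>x. \<Sum>j\<in>J. f j x) x = (\<Sum>j\<in>J. pd i (f j) x)"
proof -
  have "((\<lambda>x. \<Sum>j\<in>J. f j x) has_derivative (\<lambda>v. \<Sum>j\<in>J. frechet_derivative (f j) (at x) v)) (at x)"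
    by (rule has_derivative_sum) (use assms(2) frechet_derivative_works in blast)
  from pd_eqI[OF this] show ?thesis by (simp add: pd_def)
qed

lemma Ck_on_prod:
  fixes f :: "'c \<Rightarrow> real^'n::finite \<Rightarrow> real"
  assumes "open S"
  shows "(\<And>j. j \<in> J \<Longrightarrow> Ck_on k S (f j)) \<Longrightarrow> Ck_on k S (\<lambda>x. \<Prod>j\<in>J. f j x)"
  by (induction J rule: infinite_finite_induct) (auto intro: Ck_on_mult[OF assms])

lemma Ck_on_vec:
  fixes f :: "real^'n::finite \<Rightarrow> 'b::real_normed_vector^'m::finite"
  assumes "open S" "\<And>i. Ck_on k S (\<lambda>x. f x $ i)"
  shows "Ck_on k S f"
proof -
  have bl: "bounded_linear (\<lambda>t::'b. axis i t :: 'b^'m)" for i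
  proof -
    have "norm (axis i t :: 'b^'m) \<le> norm t * 1" for t
      by (simp add: norm_vec_def axis_def L2_set_def if_distrib[of norm] if_distrib[of "\<lambda>z. z\<^sup>2"] sum.delta cong: if_cong)
    moreover have "linear (\<lambda>t::'b. axis i t :: 'b^'m)"
      by (rule linearI) (auto simp: vec_eq_iff axis_def)
    ultimately show ?thesis
      by (intro bounded_linear_intro[where K=1]) (auto simp: linear_add linear_cmul)
  qed
  have "f x = (\<Sum>i\<in>UNIV. axis i (f x $ i))" for x
    by (simp add: vec_eq_iff axis_def if_distrib sum.delta cong: if_cong)
  then have "f = (\<lambda>x. \<Sum>i\<in>UNIV. axis i (f x $ i))" by auto
  moreover have "Ck_on k S (\<lambda>x. \<Sum>i\<in>UNIV. axis i (f x $ i))"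
    by (intro Ck_on_sum[OF assms(1)] Ck_on_bounded_linear[OF assms(1) bl] assms(2))
  ultimately show ?thesis by simp
qed

lemma pd_id: "pd i (\<lambda>x. x) = (\<lambda>x. axis i 1)"
  by (rule ext, subst pd_eqI[OF has_derivative_ident]) auto

lemma Ck_on_id: "Ck_on k S (\<lambda>x. x)"
  by (cases k) (auto simp: pd_id)

lemma pd_compose:
  fixes f :: "real^'n::finite \<Rightarrow> 'b::real_normed_vector" and \<phi> :: "real^'m::finite \<Rightarrow> real^'n"
  assumes "f differentiable (at (\<phi> x))" "\<phi> differentiable (at x)"
  shows "pd i (\<lambda>x. f (\<phi> x)) x = (\<Sum>j\<in>UNIV. pd i \<phi> x $ j *\<^sub>R pd j f (\<phi> x))"
proof -
  have "((\<lambda>x. f (\<phi> x)) has_derivative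
      (\<lambda>v. \<Sum>j\<in>UNIV. frechet_derivative \<phi> (at x) v $ j *\<^sub>R pd j f (\<phi> x))) (at x)"
    using has_derivative_compose[of \<phi> "frechet_derivative \<phi> (at x)" x UNIV f, OF _ has_derivative_pd[OF assms(1)]] assms(2)
    by (simp add: frechet_derivative_works)
  from pd_eqI[OF this] show ?thesis by (simp add: pd_def)
qed

lemma Ck_on_compose:
  fixes f :: "real^'n::finite \<Rightarrow> 'b::real_normed_vector" and \<phi> :: "real^'m::finite \<Rightarrow> real^'n"
  assumes "open S" "\<phi> ` S \<subseteq> T"
  shows "Ck_on k T f \<Longrightarrow> Ck_on k S \<phi> \<Longrightarrow> Ck_on k S (\<lambda>x. f (\<phi> x))"
proof (induction k arbitrary: f)
  case 0
  then show ?case using assms by (auto intro: continuous_on_compose2)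
next
  case (Suc k)
  have d: "f differentiable (at (\<phi> x))" "\<phi> differentiable (at x)" if "x \<in> S" for x
    using Suc.prems that assms(2) by auto
  have "Ck_on k S (\<lambda>x. \<Sum>j\<in>UNIV. pd i \<phi> x $ j *\<^sub>R pd j f (\<phi> x))" for i
    by (intro Ck_on_sum[OF assms(1)] Ck_on_scaleR[OF assms(1)] Ck_on_nth[OF assms(1)] Suc.IH)
       (use Suc.prems in \<open>auto intro: Ck_on_Suc_imp[OF Suc.prems(2)]\<close>)
  then have "Ck_on k S (pd i (\<lambda>x. f (\<phi> x)))" for i
    by (rule Ck_on_cong[OF assms(1), rotated]) (simp add: pd_compose d)
  then show ?case
    using d differentiable_chain_at[of \<phi> _ f] by (auto simp: o_def)
qed

lemma pd_chain:
  fixes f :: "real^'n::finite \<Rightarrow> real"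
  assumes "(h has_real_derivative h') (at (f x))" "f differentiable (at x)"
  shows "pd i (\<lambda>x. h (f x)) x = h' * pd i f x" "(\<lambda>x. h (f x)) differentiable (at x)"
proof -
  have "((\<lambda>x. h (f x)) has_derivative (\<lambda>v. h' * frechet_derivative f (at x) v)) (at x)"
    using has_derivative_compose[of f "frechet_derivative f (at x)" x UNIV h, OF _ assms(1)[unfolded has_field_derivative_def]] assms(2)
    by (simp add: frechet_derivative_works)
  then show "pd i (\<lambda>x. h (f x)) x = h' * pd i f x" "(\<lambda>x. h (f x)) differentiable (at x)"
    using pd_eqI[of "\<lambda>x. h (f x)"] by (auto simp: pd_def[of i f] differentiable_def)
qed

text \<open>The outer function enters only through \<open>h'\<close> composed with \<open>f\<close>.
  For the inverse and the square root, \<open>h'\<close> is an expression in \<open>h\<close>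
  itself, so the preceding order of the induction supplies its regularity; for a primitive F of the
  nonlinearity it is the nonlinearity.\<close>

lemma Ck_on_chain:
  fixes f :: "real^'n::finite \<Rightarrow> real"
  assumes "open S" "\<And>x. x \<in> S \<Longrightarrow> (h has_real_derivative h' (f x)) (at (f x))"
    and "Ck_on (Suc k) S f" "Ck_on k S (\<lambda>x. h' (f x))"
  shows "Ck_on (Suc k) S (\<lambda>x. h (f x))"
proof -
  have "Ck_on k S (pd i (\<lambda>x. h (f x)))" for i
    by (rule Ck_on_cong[OF assms(1) _ Ck_on_mult[OF assms(1,4), of "pd i f"]])
       (use assms(2,3) pd_chain(1) in fastforce)+
  then show ?thesis using assms(2,3) pd_chain(2) by fastforce
qed

lemma Ck_on_inverse:
  fixes f :: "real^'n::finite \<Rightarrow> real"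
  assumes "open S" "\<And>x. x \<in> S \<Longrightarrow> f x \<noteq> 0"
  shows "Ck_on k S f \<Longrightarrow> Ck_on k S (\<lambda>x. inverse (f x))"
proof (induction k)
  case 0
  then show ?case using assms by (auto intro: continuous_on_inverse)
next
  case (Suc k)
  have i: "Ck_on k S (\<lambda>x. inverse (f x))" using Suc Ck_on_Suc_imp by blast
  show ?case
  proof (rule Ck_on_chain[where h = inverse and h' = "\<lambda>t. - (inverse t * inverse t)"])
    show "(inverse has_real_derivative - (inverse (f x) * inverse (f x))) (at (f x))" if "x \<in> S" for x
      using DERIV_inverse[of "f x"] assms(2)[OF that] by (simp add: numeral_2_eq_2)
    show "Ck_on k S (\<lambda>x. - (inverse (f x) * inverse (f x)))"
      by (intro Ck_on_uminus Ck_on_mult assms i)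
  qed (use assms Suc.prems in auto)
qed

lemma Ck_on_divide:
  fixes f g :: "real^'n::finite \<Rightarrow> real"
  assumes "open S" "\<And>x. x \<in> S \<Longrightarrow> g x \<noteq> 0" "Ck_on k S f" "Ck_on k S g"
  shows "Ck_on k S (\<lambda>x. f x / g x)"
  unfolding divide_inverse by (intro Ck_on_mult Ck_on_inverse assms)

lemma Ck_on_sqrt:
  fixes f :: "real^'n::finite \<Rightarrow> real"
  assumes "open S" "\<And>x. x \<in> S \<Longrightarrow> f x > 0"
  shows "Ck_on k S f \<Longrightarrow> Ck_on k S (\<lambda>x. sqrt (f x))"
proof (induction k)
  case 0
  then show ?case by (auto intro: continuous_on_real_sqrt)
next
  case (Suc k)
  have i: "Ck_on k S (\<lambda>x. sqrt (f x))" using Suc Ck_on_Suc_imp by blast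
  show ?case
  proof (rule Ck_on_chain[where h = sqrt and h' = "\<lambda>t. inverse (sqrt t) / 2"])
    show "(sqrt has_real_derivative inverse (sqrt (f x)) / 2) (at (f x))" if "x \<in> S" for x
      using DERIV_real_sqrt assms(2)[OF that] by blast
    show "Ck_on k S (\<lambda>x. inverse (sqrt (f x)) / 2)"
      by (rule Ck_on_divide[OF assms(1)]) (use assms i in \<open>auto intro!: Ck_on_inverse simp: less_imp_neq[symmetric] dest: less_imp_neq\<close>)
  qed (use assms Suc.prems in auto)
qed

section \<open>Symmetry of second partial derivatives\<close>

lemma line_has_derivative:
  fixes f :: "real^'n::finite \<Rightarrow> real"
  assumes "f differentiable (at (x + t *\<^sub>R axis i 1))"
  shows "((\<lambda>t. f (x + t *\<^sub>R axis i 1)) has_real_derivative pd i f (x + t *\<^sub>R axis i 1)) (at t)"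
proof -
  have 1: "((\<lambda>t. x + t *\<^sub>R axis i 1) has_derivative (\<lambda>h. h *\<^sub>R axis i 1)) (at t)"
    by (auto intro!: derivative_eq_intros)
  have 2: "(f has_derivative frechet_derivative f (at (x + t *\<^sub>R axis i 1))) (at (x + t *\<^sub>R axis i 1))"
    using assms by (simp add: frechet_derivative_works)
  show ?thesis
    using has_derivative_compose[OF 1 2] linear_cmul[OF has_derivative_linear[OF 2]]
    by (simp add: has_field_derivative_def pd_def mult.commute[of _ "frechet_derivative _ _ _"] mult_commute_abs)
qed

text \<open>The mean value theorem is applied twice: in direction \<open>i\<close> to the increment
  of \<open>f\<close> in direction \<open>j\<close>, then in direction \<open>j\<close> to the
  resulting increment of \<open>pd i f\<close>. All points involved are displaced by at most 2h,
  whence the radius of the ball.\<close>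

lemma second_difference:
  fixes f :: "real^'n::finite \<Rightarrow> real"
  assumes "Ck_on 2 S f" "cball x (2 * h) \<subseteq> S" "h > 0"
  shows "\<exists>y\<in>cball x (2 * h). f (x + h *\<^sub>R axis i 1 + h *\<^sub>R axis j 1) - f (x + h *\<^sub>R axis i 1)
     - f (x + h *\<^sub>R axis j 1) + f x = h * h * pd j (pd i f) y"
proof -
  have in_S: "x + s *\<^sub>R axis i 1 + t *\<^sub>R axis j 1 \<in> cball x (2 * h)" if "0 \<le> s" "s \<le> h" "0 \<le> t" "t \<le> h" for s t
  proof -
    have "norm (s *\<^sub>R axis i 1 + t *\<^sub>R axis j 1 :: real^'n) \<le> s + t"
      using norm_triangle_ineq[of "s *\<^sub>R axis i 1 :: real^'n" "t *\<^sub>R axis j 1"] that by (simp add: norm_axis_1)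
    also have "\<dots> \<le> 2 * h" using that by simp
    finally have "dist x (x + (s *\<^sub>R axis i 1 + t *\<^sub>R axis j 1)) \<le> 2 * h" by (simp add: dist_norm norm_minus_commute add.commute)
    then show ?thesis by (simp add: add.assoc)
  qed
  have dif: "f differentiable (at y)" "pd i f differentiable (at y)" if "y \<in> cball x (2 * h)" for y
    using assms(1,2) that by (auto simp: numeral_2_eq_2 subset_iff)
  let ?p = "\<lambda>s. f (x + h *\<^sub>R axis j 1 + s *\<^sub>R axis i 1) - f (x + s *\<^sub>R axis i 1)"
  have "\<exists>z>0. z < h \<and> ?p h - ?p 0 = (h - 0) * (pd i f (x + h *\<^sub>R axis j 1 + z *\<^sub>R axis i 1) - pd i f (x + z *\<^sub>R axis i 1))"
  proof (rule MVT2[OF assms(3)])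
    fix s assume "0 \<le> s" "s \<le> h"
    then show "(?p has_real_derivative pd i f (x + h *\<^sub>R axis j 1 + s *\<^sub>R axis i 1) - pd i f (x + s *\<^sub>R axis i 1)) (at s)"
      using in_S[of s h] in_S[of s 0] assms(3)
      by (intro DERIV_diff line_has_derivative dif) (auto simp: algebra_simps)
  qed
  then obtain z where z: "0 < z" "z < h"
    "?p h - ?p 0 = h * (pd i f (x + h *\<^sub>R axis j 1 + z *\<^sub>R axis i 1) - pd i f (x + z *\<^sub>R axis i 1))" by auto
  let ?q = "\<lambda>t. pd i f (x + z *\<^sub>R axis i 1 + t *\<^sub>R axis j 1)"
  have "\<exists>w>0. w < h \<and> ?q h - ?q 0 = (h - 0) * pd j (pd i f) (x + z *\<^sub>R axis i 1 + w *\<^sub>R axis j 1)"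
  proof (rule MVT2[OF assms(3)])
    fix t assume "0 \<le> t" "t \<le> h"
    then show "(?q has_real_derivative pd j (pd i f) (x + z *\<^sub>R axis i 1 + t *\<^sub>R axis j 1)) (at t)"
      using in_S[of z t] z by (intro line_has_derivative dif) auto
  qed
  then obtain w where w: "0 < w" "w < h" "?q h - ?q 0 = h * pd j (pd i f) (x + z *\<^sub>R axis i 1 + w *\<^sub>R axis j 1)" by auto
  have "?p h - ?p 0 = h * (?q h - ?q 0)" using z(3) by (simp add: algebra_simps)
  also have "\<dots> = h * h * pd j (pd i f) (x + z *\<^sub>R axis i 1 + w *\<^sub>R axis j 1)" using w(3) by simp
  finally show ?thesis using in_S[of z w] z w by (intro bexI[of _ "x + z *\<^sub>R axis i 1 + w *\<^sub>R axis j 1"]) (auto simp: algebra_simps)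
qed

text \<open>The second difference is symmetric in the two directions, so the two mixed derivatives
  take equal values at points arbitrarily close to \<open>x\<close>, and continuity transfers this
  to \<open>x\<close>.\<close>

lemma pd_commute:
  fixes f :: "real^'n::finite \<Rightarrow> real"
  assumes "Ck_on 2 S f" "open S" "x \<in> S"
  shows "pd i (pd j f) x = pd j (pd i f) x"
proof (rule ccontr)
  assume ne: "pd i (pd j f) x \<noteq> pd j (pd i f) x"
  \<comment> \<open>Half of the supposed gap: numbers within \<open>e\<close> of the two mixed
    derivatives at \<open>x\<close> cannot coincide.\<close>
  define e where "e = \<bar>pd i (pd j f) x - pd j (pd i f) x\<bar> / 2"
  have e: "e > 0" using ne by (simp add: e_def)
  have cont: "isCont (pd a (pd b f)) x" for a b
    using assms by (auto simp: numeral_2_eq_2 continuous_on_eq_continuous_at)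
  have ex: "\<exists>d>0. \<forall>y. dist y x < d \<longrightarrow> \<bar>pd a (pd b f) y - pd a (pd b f) x\<bar> < e" for a b
    using cont[of a b] e unfolding continuous_at_eps_delta dist_real_def by blast
  obtain d1 where d1: "d1 > 0" "\<And>y. dist y x < d1 \<Longrightarrow> \<bar>pd i (pd j f) y - pd i (pd j f) x\<bar> < e"
    using ex[of i j] by blast
  obtain d2 where d2: "d2 > 0" "\<And>y. dist y x < d2 \<Longrightarrow> \<bar>pd j (pd i f) y - pd j (pd i f) x\<bar> < e"
    using ex[of j i] by blast
  obtain d3 where d3: "d3 > 0" "cball x d3 \<subseteq> S" using assms(2,3) open_contains_cball by blast
  define h where "h = min d1 (min d2 d3) / 4"
  have h: "h > 0" "2 * h < d1" "2 * h < d2" "2 * h \<le> d3" using d1 d2 d3 by (auto simp: h_def)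
  have cb: "cball x (2 * h) \<subseteq> S" using d3 h by auto
  obtain y where y: "y \<in> cball x (2*h)" "f (x + h *\<^sub>R axis i 1 + h *\<^sub>R axis j 1) - f (x + h *\<^sub>R axis i 1)
     - f (x + h *\<^sub>R axis j 1) + f x = h * h * pd j (pd i f) y" using second_difference[OF assms(1) cb h(1)] by blast
  obtain z where z: "z \<in> cball x (2*h)" "f (x + h *\<^sub>R axis j 1 + h *\<^sub>R axis i 1) - f (x + h *\<^sub>R axis j 1)
     - f (x + h *\<^sub>R axis i 1) + f x = h * h * pd i (pd j f) z" using second_difference[OF assms(1) cb h(1)] by blast
  have "h * h * pd j (pd i f) y = h * h * pd i (pd j f) z" using y(2) z(2) by (simp add: algebra_simps)
  then have "pd j (pd i f) y = pd i (pd j f) z" using h by simp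
  moreover have "\<bar>pd j (pd i f) y - pd j (pd i f) x\<bar> < e" using y(1) h by (intro d2) (auto simp: dist_commute)
  moreover have "\<bar>pd i (pd j f) z - pd i (pd j f) x\<bar> < e" using z(1) h by (intro d1) (auto simp: dist_commute)
  ultimately show False unfolding e_def by (simp add: abs_if field_simps split: if_splits)
qed

section \<open>Linear algebra of positive definite matrices\<close>

lemma matrix_inv_works:
  fixes M :: "real^'n::finite^'n"
  assumes "invertible M"
  shows "M ** matrix_inv M = mat 1" "matrix_inv M ** M = mat 1"
  using someI_ex[OF assms[unfolded invertible_def]] unfolding matrix_inv_def by auto

lemma matrix_inv_unique:
  fixes M :: "real^'n::finite^'n"
  assumes "N ** M = mat 1"
  shows "matrix_inv M = N"
proof -
  have "invertible M" using assms by (auto simp: invertible_left_inverse)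
  then have "N = N ** (M ** matrix_inv M)" by (simp add: matrix_inv_works)
  also have "\<dots> = matrix_inv M" by (simp add: matrix_mul_assoc assms)
  finally show ?thesis ..
qed

lemma inner_matrix_sum: "v \<bullet> (M *v w) = (\<Sum>i\<in>UNIV. \<Sum>j\<in>UNIV. v $ i * M $ i $ j * w $ j)"
  for M :: "real^'n::finite^'m::finite"
  by (simp add: inner_vec_def matrix_vector_mult_def sum_distrib_left mult.assoc)

lemma inner_matrix_transpose: "v \<bullet> (M *v w) = (transpose M *v v) \<bullet> w"
  for M :: "real^'n::finite^'m::finite"
  by (simp add: dot_lmul_matrix transpose_matrix_vector)

lemma gram_entry:
  fixes M :: "real^'n::finite^'n" and P :: "real^'m::finite^'n"
  shows "(transpose P ** M ** P) $ i $ j = column i P \<bullet> (M *v column j P)"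
  unfolding inner_matrix_sum
  by (simp add: matrix_matrix_mult_def transpose_def column_def sum_distrib_right)
     (rule sum.swap)

definition posdef :: "real^'n^'n::finite \<Rightarrow> bool" where
  "posdef M \<longleftrightarrow> transpose M = M \<and> (\<forall>v. v \<noteq> 0 \<longrightarrow> v \<bullet> (M *v v) > 0)"

lemma posdef_sym: "posdef M \<Longrightarrow> v \<bullet> (M *v w) = w \<bullet> (M *v v)"
  unfolding posdef_def by (subst inner_matrix_transpose) (simp add: inner_commute)

lemma posdef_entry_sym: "posdef M \<Longrightarrow> M $ i $ j = M $ j $ i"
proof -
  assume "posdef M"
  then have "transpose M $ i $ j = M $ i $ j" by (simp add: posdef_def)
  then show ?thesis by (simp add: transpose_def)
qed

lemma posdef_invertible:
  assumes "posdef M" shows "invertible M"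
proof -
  have "M *v v = 0 \<Longrightarrow> v = 0" for v
    using assms unfolding posdef_def by (metis inner_zero_right less_irrefl)
  then show ?thesis
    by (simp add: invertible_left_inverse matrix_left_invertible_ker)
qed

lemma posdef_inv:
  assumes "posdef M" shows "posdef (matrix_inv M)"
proof -
  note inv = matrix_inv_works[OF posdef_invertible[OF assms]]
  have "transpose (matrix_inv M) ** M = transpose (transpose M ** matrix_inv M)"
    by (simp add: matrix_transpose_mul)
  also have "\<dots> = mat 1" using assms inv by (simp add: posdef_def)
  finally have sym: "transpose (matrix_inv M) = matrix_inv M" using matrix_inv_unique by metis
  have "v \<bullet> (matrix_inv M *v v) > 0" if "v \<noteq> 0" for v
  proof -
    let ?w = "matrix_inv M *v v"
    have v: "M *v ?w = v" by (simp add: matrix_vector_mul_assoc inv)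
    then have "?w \<noteq> 0" using that by auto
    then have "?w \<bullet> (M *v ?w) > 0" using assms by (simp add: posdef_def)
    then show ?thesis by (simp add: v inner_commute)
  qed
  with sym show ?thesis by (simp add: posdef_def)
qed

lemma posdef_inv_cancel:
  assumes "posdef M"
  shows "M *v (matrix_inv M *v v) = v" "matrix_inv M *v (M *v v) = v"
  by (simp_all add: matrix_vector_mul_assoc matrix_inv_works[OF posdef_invertible[OF assms]])

text \<open>All matrices on the segment from the identity to \<open>M\<close> are positive definite
  and have trivial kernel. The determinant is 1 at the start, and it would vanish somewhere on the
  way if it were not positive at the end.\<close>

lemma posdef_det_pos:
  assumes "posdef M" shows "det M > 0"
proof (rule ccontr)
  let ?N = "\<lambda>t. (1 - t) *\<^sub>R mat 1 + t *\<^sub>R M"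
  assume "\<not> det M > 0"
  then have le: "det (?N 1) \<le> 0" by simp
  have ge: "0 \<le> det (?N 0)" by simp
  have "continuous_on {0..1} (\<lambda>t. det (?N t))"
    unfolding det_def by (intro continuous_intros)
  then obtain t where t: "0 \<le> t" "t \<le> 1" "det (?N t) = 0"
    using IVT2'[of "\<lambda>t. det (?N t)" 1 0 0] le ge by auto
  then have "\<not> invertible (?N t)" by (simp add: invertible_det_nz)
  then obtain v where v: "v \<noteq> 0" "?N t *v v = 0"
    by (auto simp: invertible_left_inverse matrix_left_invertible_ker)
  have "0 = v \<bullet> (?N t *v v)" by (simp add: v)
  also have "\<dots> = (1 - t) * (v \<bullet> v) + t * (v \<bullet> (M *v v))"
    by (simp add: matrix_vector_mult_add_rdistrib scaleR_matrix_vector_assoc[symmetric] inner_add_right)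
  also have "\<dots> > 0"
  proof (cases "t = 0")
    case False
    then have "t * (v \<bullet> (M *v v)) > 0" using t v assms by (auto simp: posdef_def)
    then show ?thesis using t by (simp add: add_nonneg_pos)
  qed (use v in auto)
  finally show False by simp
qed

lemma posdef_gram:
  fixes M :: "real^'n::finite^'n" and P :: "real^'m::finite^'n"
  assumes "posdef M" "inj ((*v) P)"
  shows "posdef (transpose P ** M ** P)"
proof -
  have "v \<bullet> (transpose P ** M ** P *v v) = (P *v v) \<bullet> (M *v (P *v v))" for v
    by (simp add: matrix_vector_mul_assoc[symmetric] inner_matrix_transpose[of v "transpose P"] del: transpose_matrix_vector)
  moreover have "P *v v \<noteq> 0" if "v \<noteq> 0" for v
    using assms(2) that by (metis injD matrix_vector_mult_0_right)
  ultimately show ?thesis using assms(1)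
    by (simp add: posdef_def matrix_transpose_mul matrix_mul_assoc)
qed

text \<open>Gram-Schmidt as an induction on the dimension: a normalized vector \<open>e\<close> of
  \<open>T\<close> is joined to a basis of its \<open>M\<close>-orthogonal complement in
  \<open>T\<close>.\<close>

lemma ex_orthonormal_basis:
  fixes M :: "real^'n::finite^'n"
  assumes "posdef M"
  shows "subspace T \<Longrightarrow> \<exists>B. orthonormal_basis_of M T B"
proof (induction "dim T" arbitrary: T rule: less_induct)
  case less
  show ?case
  proof (cases "T \<subseteq> {0}")
    case True
    then have "T = span {}" using subspace_0[OF less.prems] by auto
    then show ?thesis by (intro exI[of _ "{}"]) (simp add: orthonormal_basis_of_def)
  next
    case False
    then obtain v where v: "v \<in> T" "v \<noteq> 0" by auto
    define s where "s = sqrt (v \<bullet> (M *v v))"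
    define e where "e = (1 / s) *\<^sub>R v"
    have pos: "v \<bullet> (M *v v) > 0" using v assms by (simp add: posdef_def)
    have ss: "s * s = v \<bullet> (M *v v)" "s > 0" using pos by (simp_all add: s_def)
    have e: "e \<in> T" "e \<bullet> (M *v e) = 1"
      using v ss by (auto simp: e_def subspace_scale[OF less.prems] matrix_vector_mult_scaleR)
    define T' where "T' = {w \<in> T. w \<bullet> (M *v e) = 0}"
    have sub: "subspace T'"
      using less.prems unfolding T'_def subspace_def by (auto simp: inner_add_left)
    have "T' \<subseteq> T" "e \<notin> T'" using e by (auto simp: T'_def)
    then have "T' \<subset> T" using e by blast
    then have "dim T' < dim T"
      by (metis dim_psubset less.prems span_eq_iff sub)
    then obtain B' where B': "span B' = T'" "\<And>v w. v \<in> B' \<Longrightarrow> w \<in> B' \<Longrightarrow> v \<bullet> (M *v w) = (if v = w then 1 else 0)"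
      using less.hyps[OF _ sub] unfolding orthonormal_basis_of_def by blast
    have B'T: "w \<bullet> (M *v e) = 0" "e \<bullet> (M *v w) = 0" "w \<noteq> e" if "w \<in> B'" for w
      using span_base[OF that] e posdef_sym[OF assms, of e w] by (auto simp: B'(1) T'_def)
    have "span (insert e B') = T"
    proof
      have "B' \<subseteq> T" using span_superset[of B'] B'(1) by (auto simp: T'_def)
      then show "span (insert e B') \<subseteq> T" using e less.prems by (intro span_minimal) auto
      show "T \<subseteq> span (insert e B')"
      proof
        fix w assume w: "w \<in> T"
        let ?k = "w \<bullet> (M *v e)"
        have "w - ?k *\<^sub>R e \<in> T'"
          using w e less.prems
          by (auto simp: T'_def inner_diff_left intro!: subspace_diff subspace_scale)
        then show "w \<in> span (insert e B')" unfolding span_breakdown_eq B'(1) by blast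
      qed
    qed
    moreover have "e \<notin> B'" using B'T(3) by blast
    ultimately show ?thesis using B'(2) B'T e unfolding orthonormal_basis_of_def
      by (intro exI[of _ "insert e B'"]) auto
  qed
qed

lemma orthonormal_basis_independent:
  fixes M :: "real^'n::finite^'n"
  assumes "orthonormal_basis_of M T B"
  shows "independent B" "finite B"
proof -
  have on: "v \<bullet> (M *v w) = (if v = w then 1 else 0)" if "v \<in> B" "w \<in> B" for v w
    using assms that by (auto simp: orthonormal_basis_of_def)
  show i: "independent B"
    unfolding independent_explicit_finite_subsets
  proof (intro allI impI ballI)
    fix S u v assume S: "S \<subseteq> B" "finite S" "(\<Sum>v\<in>S. u v *\<^sub>R v) = 0" "v \<in> S"
    have "0 = (\<Sum>w\<in>S. u w *\<^sub>R w) \<bullet> (M *v v)" by (simp add: S)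
    also have "\<dots> = (\<Sum>w\<in>S. u w * (if w = v then 1 else 0))"
      unfolding inner_sum_left by (rule sum.cong) (use S on in \<open>auto simp: subset_iff\<close>)
    also have "\<dots> = u v" using S by (simp add: if_distrib sum.delta cong: if_cong)
    finally show "u v = 0" by simp
  qed
  then show "finite B" by (rule finiteI_independent)
qed

lemma orthonormal_basis_expansion:
  fixes M :: "real^'n::finite^'n"
  assumes "orthonormal_basis_of M T B" "w \<in> T"
  shows "w = (\<Sum>e\<in>B. (w \<bullet> (M *v e)) *\<^sub>R e)"
proof -
  have fin: "finite B" using orthonormal_basis_independent[OF assms(1)] by simp
  have on: "v \<bullet> (M *v w) = (if v = w then 1 else 0)" if "v \<in> B" "w \<in> B" for v w
    using assms that by (auto simp: orthonormal_basis_of_def)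
  have "w \<in> span B" using assms by (simp add: orthonormal_basis_of_def)
  then obtain u where u: "w = (\<Sum>v\<in>B. u v *\<^sub>R v)" by (auto simp: span_finite[OF fin])
  have "w \<bullet> (M *v e) = u e" if "e \<in> B" for e
  proof -
    have "w \<bullet> (M *v e) = (\<Sum>v\<in>B. u v * (if v = e then 1 else 0))"
      unfolding u inner_sum_left by (rule sum.cong) (use that on in auto)
    then show ?thesis using that fin by (simp add: if_distrib sum.delta cong: if_cong)
  qed
  then show ?thesis using u by simp
qed

text \<open>Reads the inverse metric as the sum of e e^T over an orthonormal basis: the coefficient
  along \<open>e\<close> is y \<bullet> e, because \<open>M\<close> cancels against its
  inverse.\<close>

lemma inv_orthonormal_basis:
  fixes M :: "real^'n::finite^'n"
  assumes "posdef M" "orthonormal_basis_of M UNIV B"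
  shows "matrix_inv M *v y = (\<Sum>e\<in>B. (y \<bullet> e) *\<^sub>R e)"
proof -
  have "(matrix_inv M *v y) \<bullet> (M *v e) = y \<bullet> e" for e
    using posdef_sym[OF assms(1), of "matrix_inv M *v y" e]
    by (simp add: posdef_inv_cancel[OF assms(1)] inner_commute)
  then show ?thesis
    using orthonormal_basis_expansion[OF assms(2), of "matrix_inv M *v y"] by simp
qed

text \<open>Links the coordinate formula of the Laplacian with traces over frames, so that at the
  boundary a trace can be split into its tangential and its normal part.\<close>

lemma trace_orthonormal_basis:
  fixes M :: "real^'n::finite^'n"
  assumes "posdef M" "orthonormal_basis_of M UNIV B"
  shows "trace (matrix_inv M ** K) = (\<Sum>e\<in>B. e \<bullet> (K *v e))"
proof -
  have "trace (matrix_inv M ** K) = (\<Sum>i\<in>UNIV. (matrix_inv M *v column i K) $ i)"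
    by (simp add: trace_def matrix_matrix_mult_def matrix_vector_mult_def column_def)
  also have "\<dots> = (\<Sum>i\<in>UNIV. \<Sum>e\<in>B. (column i K \<bullet> e) * e $ i)"
    by (simp add: inv_orthonormal_basis[OF assms])
  also have "\<dots> = (\<Sum>e\<in>B. \<Sum>i\<in>UNIV. \<Sum>j\<in>UNIV. e $ j * K $ j $ i * e $ i)"
    by (subst sum.swap) (simp add: inner_vec_def column_def sum_distrib_left sum_distrib_right mult_ac)
  also have "\<dots> = (\<Sum>e\<in>B. e \<bullet> (K *v e))"
    by (rule sum.cong[OF refl], subst sum.swap) (simp add: inner_matrix_sum)
  finally show ?thesis .
qed

text \<open>In an orthonormal basis the left side is the square of a sum of CARD('n) diagonal
  entries. Cauchy-Schwarz bounds it by the squares of these entries, and adding the off-diagonal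
  squares gives the full norm of \<open>K\<close>. For the Hessian of \<open>u\<close> this is n
  |\<nabla>^2 u|^2 \<ge> (\<Delta>u)^2.\<close>

lemma trace_square_ge:
  fixes M K :: "real^'n::finite^'n"
  assumes "posdef M" "transpose K = K"
  shows "(trace (matrix_inv M ** K))\<^sup>2 \<le> real CARD('n) * trace (matrix_inv M ** K ** (matrix_inv M ** K))"
proof -
  obtain B where B: "orthonormal_basis_of M UNIV B" using ex_orthonormal_basis[OF assms(1) subspace_UNIV] by blast
  note ind = orthonormal_basis_independent[OF B]
  have card: "card B = CARD('n)"
    using dim_span_eq_card_independent[OF ind(1)] B by (simp add: orthonormal_basis_of_def del: dim_span)
  have "(trace (matrix_inv M ** K))\<^sup>2 = (\<Sum>e\<in>B. e \<bullet> (K *v e))\<^sup>2"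
    by (simp add: trace_orthonormal_basis[OF assms(1) B])
  also have "\<dots> \<le> (\<Sum>e\<in>B. (e \<bullet> (K *v e))\<^sup>2) * real (card B)"
    by (rule sum_squared_le_sum_of_squares)
  also have "\<dots> \<le> (\<Sum>e\<in>B. \<Sum>f\<in>B. ((K *v e) \<bullet> f)\<^sup>2) * real (card B)"
  proof (intro mult_right_mono sum_mono)
    show "(e \<bullet> (K *v e))\<^sup>2 \<le> (\<Sum>f\<in>B. ((K *v e) \<bullet> f)\<^sup>2)" if "e \<in> B" for e
      using member_le_sum[OF that, of "\<lambda>f. ((K *v e) \<bullet> f)\<^sup>2"] ind by (simp add: inner_commute)
  qed simp
  also have "(\<Sum>e\<in>B. \<Sum>f\<in>B. ((K *v e) \<bullet> f)\<^sup>2) = (\<Sum>e\<in>B. e \<bullet> (K *v (matrix_inv M *v (K *v e))))"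
  proof (rule sum.cong[OF refl])
    fix e
    have "e \<bullet> (K *v (matrix_inv M *v (K *v e))) = (K *v e) \<bullet> (matrix_inv M *v (K *v e))"
      by (subst inner_matrix_transpose) (simp add: assms)
    then show "(\<Sum>f\<in>B. ((K *v e) \<bullet> f)\<^sup>2) = e \<bullet> (K *v (matrix_inv M *v (K *v e)))"
      by (simp add: inv_orthonormal_basis[OF assms(1) B] inner_sum_right power2_eq_square)
  qed
  also have "\<dots> = trace (matrix_inv M ** (K ** matrix_inv M ** K))"
    by (subst trace_orthonormal_basis[OF assms(1) B]) (simp add: matrix_vector_mul_assoc matrix_mul_assoc)
  finally show ?thesis by (simp add: card matrix_mul_assoc mult.commute)
qed

text \<open>\<open>M\<close> and \<open>K\<close> both transform as bilinear forms under a Jacobian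
  \<open>J\<close>. The inverse of the transformed metric carries the inverse \<open>L\<close> of
  \<open>J\<close> on the left and its transpose on the right, and cyclicity of the trace removes
  what does not cancel directly. This makes the Laplacian independent of coordinates.\<close>

lemma trace_congruence:
  fixes J M K :: "real^'n::finite^'n"
  assumes "posdef M" "invertible J"
  shows "trace (matrix_inv (transpose J ** M ** J) ** (transpose J ** K ** J)) = trace (matrix_inv M ** K)"
proof -
  obtain L where L: "J ** L = mat 1" "L ** J = mat 1" using assms(2) by (auto simp: invertible_def)
  have LT: "transpose L ** transpose J = mat 1"
    by (simp add: matrix_transpose_mul[symmetric] L)
  have M: "matrix_inv M ** M = mat 1" by (rule matrix_inv_works[OF posdef_invertible[OF assms(1)]])
  have c: "transpose L ** (transpose J ** X) = X" "L ** (J ** X) = X" "J ** (L ** X) = X"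
    "matrix_inv M ** (M ** X) = X" for X :: "real^'n^'n"
    by (simp_all add: matrix_mul_assoc L LT M)
  have "matrix_inv (transpose J ** M ** J) = L ** matrix_inv M ** transpose L"
    by (rule matrix_inv_unique) (simp add: matrix_mul_assoc[symmetric] c L)
  then have "trace (matrix_inv (transpose J ** M ** J) ** (transpose J ** K ** J))
      = trace (L ** (matrix_inv M ** (K ** J)))"
    by (simp add: matrix_mul_assoc[symmetric] c)
  also have "\<dots> = trace (matrix_inv M ** (K ** J) ** L)" by (rule trace_mul_sym)
  also have "\<dots> = trace (matrix_inv M ** K)" by (simp add: matrix_mul_assoc[symmetric] c L)
  finally show ?thesis .
qed

lemma orthonormal_basis_insert_normal:
  fixes M :: "real^'n::finite^'n"
  assumes "posdef M" "\<nu> \<bullet> (M *v \<nu>) = 1" "orthonormal_basis_of M {v. v \<bullet> (M *v \<nu>) = 0} B"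
  shows "orthonormal_basis_of M UNIV (insert \<nu> B)" "\<nu> \<notin> B"
proof -
  have B: "span B = {v. v \<bullet> (M *v \<nu>) = 0}" using assms(3) by (simp add: orthonormal_basis_of_def)
  have o: "v \<bullet> (M *v \<nu>) = 0" "\<nu> \<bullet> (M *v v) = 0" if "v \<in> B" for v
    using span_base[OF that] posdef_sym[OF assms(1), of v \<nu>] by (auto simp: B)
  then show nB: "\<nu> \<notin> B" using assms(2) by auto
  have "w \<in> span (insert \<nu> B)" for w
  proof -
    have "w - (w \<bullet> (M *v \<nu>)) *\<^sub>R \<nu> \<in> span B"
      using assms(2) by (simp add: B inner_diff_left)
    then show ?thesis unfolding span_breakdown_eq by blast
  qed
  then show "orthonormal_basis_of M UNIV (insert \<nu> B)"
    using assms(2,3) o nB unfolding orthonormal_basis_of_def by auto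
qed

section \<open>Determinants\<close>

text \<open>Moves a permutation along an injection into another index type, so that Leibniz
  expansions of determinants of different sizes can be compared.\<close>

definition ext_perm :: "('m \<Rightarrow> 'n) \<Rightarrow> ('m \<Rightarrow> 'm) \<Rightarrow> 'n \<Rightarrow> 'n" where
  "ext_perm \<sigma> p y = (if y \<in> range \<sigma> then \<sigma> (p (inv \<sigma> y)) else y)"

text \<open>Induction over transpositions: a transposition of \<open>a\<close> and \<open>b\<close>
  becomes one of \<sigma> a and \<sigma> b, so the sign changes simultaneously on both
  sides.\<close>

lemma sign_ext_perm:
  fixes \<sigma> :: "'m::finite \<Rightarrow> 'n::finite"
  assumes "inj \<sigma>" "p permutes UNIV"
  shows "ext_perm \<sigma> p permutes range \<sigma> \<and> sign (ext_perm \<sigma> p) = sign p"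
  using assms(2) finite_class.finite_UNIV
proof (induction p rule: permutes_induct)
  case id
  have "ext_perm \<sigma> id = id" using assms(1) by (auto simp: ext_perm_def fun_eq_iff)
  then show ?case by (simp add: permutes_id id_def[symmetric])
next
  case (swap a b p)
  have e: "ext_perm \<sigma> (Transposition.transpose a b \<circ> p) = Transposition.transpose (\<sigma> a) (\<sigma> b) \<circ> ext_perm \<sigma> p"
    using assms(1) by (auto simp: ext_perm_def fun_eq_iff Transposition.transpose_def inj_eq)
  have tp: "Transposition.transpose (\<sigma> a) (\<sigma> b) permutes range \<sigma>"
    by (rule permutes_swap_id) auto
  have perm: "permutation p" "permutation (ext_perm \<sigma> p)"
    using swap by (auto intro: permutes_imp_permutation[of UNIV] permutes_imp_permutation[of "range \<sigma>"])
  have "sign (Transposition.transpose (\<sigma> a) (\<sigma> b) \<circ> ext_perm \<sigma> p) = sign (Transposition.transpose a b \<circ> p)"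
    unfolding sign_compose[OF permutation_swap_id perm(2)] sign_compose[OF permutation_swap_id perm(1)]
    using swap assms(1) by (simp add: sign_swap_id inj_eq)
  moreover have "Transposition.transpose (\<sigma> a) (\<sigma> b) \<circ> ext_perm \<sigma> p permutes range \<sigma>"
    using swap by (intro permutes_compose[OF _ tp]) simp
  ultimately show ?case unfolding e by blast
qed

lemma bij_betw_ext_perm:
  fixes \<sigma> :: "'m::finite \<Rightarrow> 'n::finite"
  assumes "inj \<sigma>"
  shows "bij_betw (ext_perm \<sigma>) {p. p permutes UNIV} {q. q permutes range \<sigma>}"
proof (rule bij_betwI')
  fix p p' :: "'m \<Rightarrow> 'm"
  show "(ext_perm \<sigma> p = ext_perm \<sigma> p') = (p = p')"
  proof
    assume *: "ext_perm \<sigma> p = ext_perm \<sigma> p'"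
    have "p a = p' a" for a
      using fun_cong[OF *, of "\<sigma> a"] assms by (auto simp: ext_perm_def inj_eq)
    then show "p = p'" by auto
  qed simp
next
  fix p :: "'m \<Rightarrow> 'm" assume "p \<in> {p. p permutes UNIV}"
  then show "ext_perm \<sigma> p \<in> {q. q permutes range \<sigma>}" using sign_ext_perm[OF assms] by simp
next
  fix q assume "q \<in> {q. q permutes range \<sigma>}"
  then have q: "q permutes range \<sigma>" by simp
  define p where "p = inv \<sigma> \<circ> q \<circ> \<sigma>"
  have sp: "\<sigma> (p a) = q (\<sigma> a)" for a
    using permutes_in_image[OF q, of "\<sigma> a"] by (simp add: p_def f_inv_into_f)
  have "inj p"
  proof (rule injI)
    fix a b assume "p a = p b"
    then have "q (\<sigma> a) = q (\<sigma> b)" by (simp flip: sp)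
    then show "a = b" using permutes_inj[OF q] assms by (simp add: inj_eq)
  qed
  then have "bij p" by (simp add: bij_def finite_UNIV_inj_surj)
  then have "p permutes UNIV" by (rule bij_imp_permutes) simp
  moreover have "q = ext_perm \<sigma> p"
    using q assms by (auto simp: ext_perm_def fun_eq_iff sp permutes_def)
  ultimately show "\<exists>x\<in>{p. p permutes UNIV}. q = ext_perm \<sigma> x" by auto
qed

text \<open>The rows outside the range of \<sigma> are diagonal, so only permutations fixing all
  those indices contribute. With one missing index this is an expansion along a row; with \<sigma>
  bijective it is invariance of the determinant under renaming the indices.\<close>

lemma det_embed:
  fixes \<sigma> :: "'m::finite \<Rightarrow> 'n::finite" and A :: "real^'n^'n"
  assumes "inj \<sigma>" "\<And>i j. i \<notin> range \<sigma> \<Longrightarrow> A $ i $ j = (if i = j then q i else 0)"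
  shows "det A = (\<Prod>i\<in>- range \<sigma>. q i) * det (\<chi> a b. A $ \<sigma> a $ \<sigma> b)"
proof -
  let ?t = "\<lambda>p. of_int (sign p) * (\<Prod>i\<in>UNIV. A $ i $ p i)"
  have "det A = sum ?t {p. p permutes range \<sigma>}"
    unfolding det_def
  proof (rule sum.mono_neutral_right)
    show "{p. p permutes range \<sigma>} \<subseteq> {p. p permutes UNIV}"
      using permutes_subset by blast
    show "\<forall>p\<in>{p. p permutes UNIV} - {p. p permutes range \<sigma>}. ?t p = 0"
    proof
      fix p assume p: "p \<in> {p. p permutes UNIV} - {p. p permutes range \<sigma>}"
      then obtain i where "i \<notin> range \<sigma>" "p i \<noteq> i" by (auto simp: permutes_def)
      then have "A $ i $ p i = 0" using assms(2) by auto
      then show "?t p = 0" by (auto intro: prod_zero)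
    qed
  qed (simp add: finite_permutations)
  also have "\<dots> = (\<Sum>p\<in>{p. p permutes UNIV}. ?t (ext_perm \<sigma> p))"
    by (rule sum.reindex_bij_betw[OF bij_betw_ext_perm[OF assms(1)], symmetric])
  also have "\<dots> = (\<Sum>p\<in>{p. p permutes UNIV}. (\<Prod>i\<in>- range \<sigma>. q i) * (of_int (sign p) * (\<Prod>a\<in>UNIV. A $ \<sigma> a $ \<sigma> (p a))))"
  proof (rule sum.cong[OF refl])
    fix p :: "'m \<Rightarrow> 'm" assume "p \<in> {p. p permutes UNIV}"
    then have s: "sign (ext_perm \<sigma> p) = sign p" using sign_ext_perm[OF assms(1)] by simp
    have "(\<Prod>i\<in>UNIV. A $ i $ ext_perm \<sigma> p i)
        = (\<Prod>i\<in>- range \<sigma>. A $ i $ ext_perm \<sigma> p i) * (\<Prod>i\<in>range \<sigma>. A $ i $ ext_perm \<sigma> p i)"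
      by (subst prod.union_disjoint[symmetric]) (auto simp: Un_commute intro: prod.cong)
    also have "(\<Prod>i\<in>- range \<sigma>. A $ i $ ext_perm \<sigma> p i) = (\<Prod>i\<in>- range \<sigma>. q i)"
      by (rule prod.cong) (auto simp: assms(2) ext_perm_def)
    also have "(\<Prod>i\<in>range \<sigma>. A $ i $ ext_perm \<sigma> p i) = (\<Prod>a\<in>UNIV. A $ \<sigma> a $ \<sigma> (p a))"
      using assms(1) by (subst prod.reindex) (auto simp: ext_perm_def)
    finally show "?t (ext_perm \<sigma> p) = (\<Prod>i\<in>- range \<sigma>. q i) * (of_int (sign p) * (\<Prod>a\<in>UNIV. A $ \<sigma> a $ \<sigma> (p a)))"
      by (simp add: s)
  qed
  also have "\<dots> = (\<Prod>i\<in>- range \<sigma>. q i) * det (\<chi> a b. A $ \<sigma> a $ \<sigma> b)"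
    by (simp add: det_def sum_distrib_left)
  finally show ?thesis .
qed

text \<open>At the identity only the trivial permutation survives: any other one moves at least two
  indices, so an off-diagonal zero remains after one factor has been differentiated.\<close>

lemma pd_det_at_id:
  fixes N :: "real^'k::finite \<Rightarrow> real^'n::finite^'n"
  assumes "\<And>a b. (\<lambda>x. N x $ a $ b) differentiable (at x)" "N x = mat 1"
  shows "pd i (\<lambda>x. det (N x)) x = (\<Sum>a\<in>UNIV. pd i (\<lambda>x. N x $ a $ a) x)"
proof -
  let ?D = "\<lambda>a b. frechet_derivative (\<lambda>x. N x $ a $ b) (at x)"
  have D: "((\<lambda>x. N x $ a $ b) has_derivative ?D a b) (at x)" for a b
    using assms(1) by (simp add: frechet_derivative_works)
  have "((\<lambda>x. det (N x)) has_derivative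
      (\<lambda>y. \<Sum>p | p permutes (UNIV::'n set). of_int (sign p) * (\<Sum>a\<in>UNIV. ?D a (p a) y * (\<Prod>b\<in>UNIV - {a}. N x $ b $ p b)))) (at x)"
    unfolding det_def
    by (intro has_derivative_sum has_derivative_mult_right has_derivative_prod D)
  from pd_eqI[OF this, of i]
  have "pd i (\<lambda>x. det (N x)) x = (\<Sum>p | p permutes (UNIV::'n set). of_int (sign p) *
      (\<Sum>a\<in>UNIV. ?D a (p a) (axis i 1) * (\<Prod>b\<in>UNIV - {a}. N x $ b $ p b)))" .
  also have "\<dots> = (\<Sum>p\<in>{id}. of_int (sign p) *
      (\<Sum>a\<in>UNIV. ?D a (p a) (axis i 1) * (\<Prod>b\<in>UNIV - {a}. N x $ b $ p b)))"
  proof (rule sum.mono_neutral_right)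
    show "\<forall>p\<in>{p. p permutes (UNIV::'n set)} - {id}. of_int (sign p) *
      (\<Sum>a\<in>UNIV. ?D a (p a) (axis i 1) * (\<Prod>b\<in>UNIV - {a}. N x $ b $ p b)) = 0"
    proof
      fix p assume p: "p \<in> {p. p permutes (UNIV::'n set)} - {id}"
      have "(\<Prod>b\<in>UNIV - {a}. N x $ b $ p b) = 0" for a
      proof -
        obtain c where c: "p c \<noteq> c" using p by (auto simp: fun_eq_iff)
        have pp: "p (p c) \<noteq> p c" using c p by (metis DiffD1 mem_Collect_eq permutes_inj injD)
        \<comment> \<open>Both \<open>c\<close> and \<open>p c\<close> are moved by
          \<open>p\<close>, and at least one of them differs from the differentiated index
          \<open>a\<close>.\<close>
        define b where "b = (if c = a then p c else c)"
        have "b \<noteq> a" "p b \<noteq> b" using c pp by (auto simp: b_def)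
        then show ?thesis by (intro prod_zero) (auto simp: assms(2) mat_def intro!: bexI[of _ b])
      qed
      then show "of_int (sign p) * (\<Sum>a\<in>UNIV. ?D a (p a) (axis i 1) * (\<Prod>b\<in>UNIV - {a}. N x $ b $ p b)) = 0"
        by (simp only: mult_zero_right sum.neutral_const)
    qed
  qed (auto simp: finite_permutations permutes_id)
  also have "\<dots> = (\<Sum>a\<in>UNIV. pd i (\<lambda>x. N x $ a $ a) x)"
    by (simp add: assms(2) mat_def pd_def)
  finally show ?thesis .
qed

text \<open>Jacobi's formula. Factoring the constant matrix \<open>N x\<close> out of
  \<open>N y\<close> reduces it to the derivative of the determinant at the identity.\<close>

lemma pd_det:
  fixes N :: "real^'k::finite \<Rightarrow> real^'n::finite^'n"
  assumes d: "\<And>a b. (\<lambda>x. N x $ a $ b) differentiable (at x)" and inv: "invertible (N x)"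
  shows "pd i (\<lambda>x. det (N x)) x
    = det (N x) * (\<Sum>a\<in>UNIV. \<Sum>b\<in>UNIV. matrix_inv (N x) $ a $ b * pd i (\<lambda>x. N x $ b $ a) x)"
proof -
  let ?I = "matrix_inv (N x)"
  let ?Q = "\<lambda>y. ?I ** N y"
  have Q: "?Q y $ a $ b = (\<Sum>c\<in>UNIV. ?I $ a $ c * N y $ c $ b)" for y a b
    by (simp add: matrix_matrix_mult_def)
  have dQ: "(\<lambda>y. ?Q y $ a $ b) differentiable (at x)" for a b
    unfolding Q by (intro differentiable_sum) (auto intro!: differentiable_mult d)
  have *: "det (N y) = det (N x) * det (?Q y)" for y
  proof -
    have "N y = N x ** ?Q y" by (simp add: matrix_mul_assoc matrix_inv_works[OF inv])
    then show ?thesis by (metis det_mul)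
  qed
  have "pd i (\<lambda>x. det (N x)) x = pd i (\<lambda>y. det (N x) * det (?Q y)) x"
    by (rule arg_cong[of _ _ "\<lambda>h. pd i h x"], rule ext, rule *)
  also have "\<dots> = det (N x) * pd i (\<lambda>y. det (?Q y)) x"
  proof (rule pd_cmult)
    show "(\<lambda>y. det (?Q y)) differentiable (at x)" unfolding det_def
    proof (intro differentiable_sum ballI differentiable_mult differentiable_const)
      fix p :: "'n \<Rightarrow> 'n"
      have "((\<lambda>y. \<Prod>a\<in>UNIV. ?Q y $ a $ p a) has_derivative
          (\<lambda>h. \<Sum>a\<in>UNIV. frechet_derivative (\<lambda>y. ?Q y $ a $ p a) (at x) h * (\<Prod>b\<in>UNIV - {a}. ?Q x $ b $ p b))) (at x)"
        by (rule has_derivative_prod) (use dQ in \<open>simp add: frechet_derivative_works\<close>)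
      then show "(\<lambda>y. \<Prod>a\<in>UNIV. ?Q y $ a $ p a) differentiable (at x)"
        unfolding differentiable_def by blast
    qed (simp add: finite_permutations)
  qed
  also have "pd i (\<lambda>y. det (?Q y)) x = (\<Sum>a\<in>UNIV. pd i (\<lambda>y. ?Q y $ a $ a) x)"
    by (rule pd_det_at_id[OF dQ]) (simp add: matrix_inv_works[OF inv])
  also have "\<dots> = (\<Sum>a\<in>UNIV. \<Sum>b\<in>UNIV. ?I $ a $ b * pd i (\<lambda>x. N x $ b $ a) x)"
    unfolding Q by (subst pd_sum) (auto intro!: differentiable_mult d simp: pd_cmult[OF d])
  finally show ?thesis .
qed

text \<open>The vectors \<open>J a\<close> span the tangent space of a hypersurface that is a graph
  over the coordinates other than \<open>z\<close>, and \<nu> is its conormal with entry 1 at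
  \<open>z\<close>. Completing them by the \<open>M\<close>-normal vector w = M^{-1} \<nu> makes the
  Gram matrix block diagonal with extra entry q = \<nu> \<bullet> w, while the completed matrix
  itself has determinant q. Of the factor q^2 on one side, one q cancels.\<close>

lemma graph_gram_det:
  fixes M :: "real^'n::finite^'n" and \<sigma> :: "'m::finite \<Rightarrow> 'n" and J :: "'m \<Rightarrow> real^'n"
  assumes M: "posdef M" and \<sigma>: "inj \<sigma>" "range \<sigma> = - {z}"
    and J: "\<And>a b. J a $ \<sigma> b = (if a = b then 1 else 0)"
    and \<nu>: "\<nu> $ z = 1" "\<And>a. \<nu> \<bullet> J a = 0"
  shows "det (\<chi> a b. J a \<bullet> (M *v J b)) = det M * (\<nu> \<bullet> (matrix_inv M *v \<nu>))"
proof -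
  define w where "w = matrix_inv M *v \<nu>"
  define q where "q = \<nu> \<bullet> w"
  have Mw: "M *v w = \<nu>" by (simp add: w_def posdef_inv_cancel[OF M])
  have "\<nu> \<noteq> 0" using \<nu>(1) by auto
  then have q: "q > 0" using posdef_inv[OF M] by (simp add: q_def w_def posdef_def)
  have cz: "- range \<sigma> = {z}" using \<sigma> by auto
  have znr: "z \<notin> range \<sigma>" "\<And>a. \<sigma> a \<noteq> z" using \<sigma>(2) by auto
  define P :: "real^'n^'n" where "P = (\<chi> i j. if j = z then w $ i else J (inv \<sigma> j) $ i)"
  \<comment> \<open>The identity with row \<open>z\<close> replaced by \<nu>. It has determinant 1,
    and the product with \<open>P\<close> has only the entry q left in row \<open>z\<close>, so
    \<open>det P\<close> can be read off.\<close>
  define N :: "real^'n^'n" where "N = (\<chi> i j. if i = z then \<nu> $ j else if i = j then 1 else 0)"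
  have cP: "column z P = w" "\<And>a. column (\<sigma> a) P = J a"
    using znr \<sigma> by (auto simp: P_def column_def vec_eq_iff)
  have id: "(\<chi> a b. if a = b then 1 else 0) = (mat 1 :: real^'m^'m)" by (simp add: mat_def)
  have "det (transpose N) = (\<Prod>i\<in>- range \<sigma>. 1) * det (\<chi> a b. transpose N $ \<sigma> a $ \<sigma> b)"
    by (rule det_embed[OF \<sigma>(1)]) (use cz \<nu> in \<open>auto simp: transpose_def N_def\<close>)
  also have "(\<chi> a b. transpose N $ \<sigma> a $ \<sigma> b) = mat 1"
    using \<sigma>(1) znr by (auto simp: transpose_def N_def vec_eq_iff mat_def inj_eq)
  finally have detN: "det N = 1" by (simp add: det_transpose)
  have NP: "(N ** P) $ i $ j = (if i = z then \<nu> \<bullet> column j P else P $ i $ j)" for i j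
    by (auto simp: N_def matrix_matrix_mult_def inner_vec_def column_def if_distrib[of "\<lambda>x. x * _"] cong: if_cong)
  have zc: "j = z \<or> (\<exists>a. j = \<sigma> a)" for j using \<sigma>(2) by auto
  have "det (N ** P) = (\<Prod>i\<in>- range \<sigma>. q) * det (\<chi> a b. (N ** P) $ \<sigma> a $ \<sigma> b)"
  proof (rule det_embed[OF \<sigma>(1)])
    fix i j assume "i \<notin> range \<sigma>"
    then have [simp]: "i = z" using cz by auto
    show "(N ** P) $ i $ j = (if i = j then q else 0)"
      using zc[of j] \<nu>(2) znr by (auto simp: NP cP q_def)
  qed
  also have "(\<chi> a b. (N ** P) $ \<sigma> a $ \<sigma> b) = mat 1"
    using \<sigma>(1) znr J by (auto simp: NP vec_eq_iff mat_def) (auto simp: P_def)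
  finally have detP: "det P = q" by (simp add: cz det_mul detN)
  have "det (transpose P ** M ** P) = (\<Prod>i\<in>- range \<sigma>. q) * det (\<chi> a b. (transpose P ** M ** P) $ \<sigma> a $ \<sigma> b)"
  proof (rule det_embed[OF \<sigma>(1)])
    fix i j assume "i \<notin> range \<sigma>"
    then have [simp]: "i = z" using cz by auto
    show "(transpose P ** M ** P) $ i $ j = (if i = j then q else 0)"
      using zc[of j] znr \<nu>(2) posdef_sym[OF M, of w]
      by (auto simp: gram_entry cP Mw q_def inner_commute)
  qed
  then have "q * q * det M = q * det (\<chi> a b. J a \<bullet> (M *v J b))"
    by (simp add: det_mul det_transpose detP cz gram_entry cP mult_ac)
  then have "q * (det M * q - det (\<chi> a b. J a \<bullet> (M *v J b))) = 0" by (simp add: algebra_simps)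
  then have "det M * q = det (\<chi> a b. J a \<bullet> (M *v J b))" using q by simp
  then show ?thesis by (simp add: q_def w_def)
qed

section \<open>Riemannian calculus in one chart\<close>

text \<open>The Riemannian inner product of the two gradients, written as the differential of
  \<open>b\<close> applied to the gradient of \<open>a\<close>.\<close>

definition grad_ip :: "(real^'n \<Rightarrow> real^'n^'n) \<Rightarrow> (real^'n \<Rightarrow> real) \<Rightarrow> (real^'n \<Rightarrow> real) \<Rightarrow> real^'n::finite \<Rightarrow> real" where
  "grad_ip G a b x = (\<Sum>i\<in>UNIV. gradient G a x $ i * pd i b x)"

definition lap :: "(real^'n \<Rightarrow> real^'n^'n) \<Rightarrow> (real^'n \<Rightarrow> real) \<Rightarrow> real^'n::finite \<Rightarrow> real" where
  "lap G b x = trace (matrix_inv (G x) ** hessian G b x)"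

lemma sum3_swap12:
  "(\<Sum>i\<in>A. \<Sum>j\<in>B. \<Sum>k\<in>C. f i j k) = (\<Sum>j\<in>B. \<Sum>i\<in>A. \<Sum>k\<in>C. f i j k)"
  by (rule sum.swap)

lemma sum3_swap23:
  "(\<Sum>i\<in>A. \<Sum>j\<in>B. \<Sum>k\<in>C. f i j k) = (\<Sum>i\<in>A. \<Sum>k\<in>C. \<Sum>j\<in>B. f i j k)"
  by (rule sum.cong[OF refl], rule sum.swap)

lemma Ck_on_det:
  fixes N :: "real^'k::finite \<Rightarrow> real^'n::finite^'n"
  assumes "open S" "\<And>a b. Ck_on k S (\<lambda>x. N x $ a $ b)"
  shows "Ck_on k S (\<lambda>x. det (N x))"
  unfolding det_def
  by (intro Ck_on_sum Ck_on_mult Ck_on_prod Ck_on_const assms)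

text \<open>Cramer's rule presents the entries as quotients of determinants, from which the
  smoothness of the inverse metric is read off.\<close>

lemma matrix_inv_cramer:
  fixes M :: "real^'n::finite^'n"
  assumes "invertible M"
  shows "matrix_inv M $ a $ b = det (\<chi> i j. if j = a then axis b 1 $ i else M $ i $ j) / det M"
proof -
  have "M *v (matrix_inv M *v axis b 1) = axis b 1"
    by (simp add: matrix_vector_mul_assoc matrix_inv_works[OF assms])
  moreover have "det M \<noteq> 0" using assms by (simp add: invertible_det_nz)
  ultimately have "matrix_inv M *v axis b 1
      = (\<chi> k. det (\<chi> i j. if j = k then axis b 1 $ i else M $ i $ j) / det M)"
    by (simp add: cramer)
  then have "(matrix_inv M *v axis b 1) $ a
      = det (\<chi> i j. if j = a then axis b 1 $ i else M $ i $ j) / det M" by simp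
  then show ?thesis
    by (simp add: matrix_vector_mult_basis column_def)
qed

text \<open>A metric on an open set of coordinates, detached from any atlas, so that the calculus
  applies to the image of a chart and to every open part of it.\<close>

locale local_metric =
  fixes S :: "(real^'n::finite) set" and G :: "real^'n \<Rightarrow> real^'n^'n"
  assumes open_S: "open S" and G_smooth: "\<And>k. Ck_on k S G"
    and G_posdef: "\<And>x. x \<in> S \<Longrightarrow> posdef (G x)"
begin

lemma local_metric_subset: "open T \<Longrightarrow> T \<subseteq> S \<Longrightarrow> local_metric T G"
  using G_smooth G_posdef Ck_on_subset by unfold_locales blast+

abbreviation gi :: "real^'n \<Rightarrow> 'n \<Rightarrow> 'n \<Rightarrow> real" where
  "gi x a b \<equiv> matrix_inv (G x) $ a $ b"

abbreviation dG :: "'n \<Rightarrow> real^'n \<Rightarrow> 'n \<Rightarrow> 'n \<Rightarrow> real" where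
  "dG i x a b \<equiv> pd i G x $ a $ b"

lemma G_entry_Ck: "Ck_on k S (\<lambda>x. G x $ a $ b)"
  by (intro Ck_on_nth open_S G_smooth)

lemma dG_Ck: "Ck_on k S (\<lambda>x. dG i x a b)"
  by (intro Ck_on_nth open_S Ck_on_pd[OF G_smooth[of "Suc k"]]) simp

lemma G_differentiable: "x \<in> S \<Longrightarrow> G differentiable (at x)"
  using Ck_on_differentiable[OF G_smooth[of 1]] by simp

lemma pd_G_entry: "x \<in> S \<Longrightarrow> pd i (\<lambda>x. G x $ a $ b) x = dG i x a b"
  using pd_bounded_linear[OF bounded_linear_vec_nth[of b], where f = "\<lambda>x. G x $ a" and x = x and i = i]
    pd_bounded_linear[OF bounded_linear_vec_nth[of a], where f = G and x = x and i = i] G_differentiable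
    Ck_on_differentiable[OF Ck_on_nth[OF open_S G_smooth[of 1]]] by simp

lemma G_entry_sym: "x \<in> S \<Longrightarrow> G x $ a $ b = G x $ b $ a"
  using posdef_entry_sym[OF G_posdef] .

lemma gi_sym: "x \<in> S \<Longrightarrow> gi x a b = gi x b a"
  using posdef_entry_sym[OF posdef_inv[OF G_posdef]] .

lemma dG_sym: "x \<in> S \<Longrightarrow> dG i x a b = dG i x b a"
  using pd_cong[OF open_S, of x "\<lambda>x. G x $ a $ b" "\<lambda>x. G x $ b $ a" i] by (simp add: pd_G_entry G_entry_sym)

lemma det_Ck: "Ck_on k S (\<lambda>x. det (G x))"
  by (rule Ck_on_det[OF open_S G_entry_Ck])

lemma gi_Ck: "Ck_on k S (\<lambda>x. gi x a b)"
proof (rule Ck_on_cong[OF open_S])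
  show "Ck_on k S (\<lambda>x. det (\<chi> i j. if j = a then axis b 1 $ i else G x $ i $ j) / det (G x))"
  proof (rule Ck_on_divide[OF open_S _ Ck_on_det[OF open_S] det_Ck])
    show "det (G x) \<noteq> 0" if "x \<in> S" for x using posdef_det_pos[OF G_posdef[OF that]] by simp
    show "Ck_on k S (\<lambda>x. (\<chi> i j. if j = a then axis b 1 $ i else G x $ i $ j) $ c $ d)" for c d
      by (cases "d = a") (simp_all add: G_entry_Ck)
  qed
qed (simp add: matrix_inv_cramer posdef_invertible G_posdef)

lemma christoffel_Ck: "Ck_on m S (christoffel G k i j)"
  unfolding christoffel_def[abs_def]
  by (intro Ck_on_mult Ck_on_sum Ck_on_add Ck_on_diff Ck_on_const open_S gi_Ck dG_Ck)

lemma sqrt_det_Ck: "Ck_on k S (\<lambda>x. sqrt (det (G x)))"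
  by (rule Ck_on_sqrt[OF open_S posdef_det_pos[OF G_posdef] det_Ck])

lemma riemann_Ck: "Ck_on m S (riemann G l k i j)"
  unfolding riemann_def[abs_def]
  by (intro Ck_on_mult Ck_on_sum Ck_on_add Ck_on_diff open_S christoffel_Ck
       Ck_on_pd[OF christoffel_Ck[of "Suc m"]]) simp_all

lemma ricci_Ck: "Ck_on m S (\<lambda>x. ricci G x $ j $ k)"
  unfolding ricci_def by (simp add: Ck_on_sum[OF open_S] riemann_Ck)

lemma gi_G: "x \<in> S \<Longrightarrow> (\<Sum>l\<in>UNIV. gi x a l * G x $ l $ b) = (if a = b then 1 else 0)"
  and G_gi: "x \<in> S \<Longrightarrow> (\<Sum>l\<in>UNIV. G x $ a $ l * gi x l b) = (if a = b then 1 else 0)"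
  using matrix_inv_works[OF posdef_invertible[OF G_posdef[of x]]]
  by (auto simp: vec_eq_iff matrix_matrix_mult_def mat_def)

lemma gi_G_cancel:
  assumes "x \<in> S" shows "(\<Sum>a\<in>UNIV. gi x c a * (\<Sum>j\<in>UNIV. G x $ a $ j * y j)) = y c"
proof -
  have "(\<Sum>a\<in>UNIV. gi x c a * (\<Sum>j\<in>UNIV. G x $ a $ j * y j)) = (\<Sum>j\<in>UNIV. (\<Sum>a\<in>UNIV. gi x c a * G x $ a $ j) * y j)"
    by (simp add: sum_distrib_left sum_distrib_right mult.assoc) (rule sum.swap)
  then show ?thesis by (simp add: gi_G[OF assms] if_distrib[of "\<lambda>t. t * _"] cong: if_cong)
qed

lemma G_gi_cancel:
  assumes "x \<in> S" shows "(\<Sum>a\<in>UNIV. G x $ c $ a * (\<Sum>j\<in>UNIV. gi x a j * y j)) = y c"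
proof -
  have "(\<Sum>a\<in>UNIV. G x $ c $ a * (\<Sum>j\<in>UNIV. gi x a j * y j)) = (\<Sum>j\<in>UNIV. (\<Sum>a\<in>UNIV. G x $ c $ a * gi x a j) * y j)"
    by (simp add: sum_distrib_left sum_distrib_right mult.assoc) (rule sum.swap)
  then show ?thesis by (simp add: G_gi[OF assms] if_distrib[of "\<lambda>t. t * _"] cong: if_cong)
qed

lemma christoffel_sym: "x \<in> S \<Longrightarrow> christoffel G k i j x = christoffel G k j i x"
  unfolding christoffel_def
  by (intro arg_cong2[of _ _ _ _ "(*)"] refl sum.cong) (simp add: dG_sym[of x _ i j])

lemma christoffel_lower:
  assumes "x \<in> S"
  shows "(\<Sum>k\<in>UNIV. G x $ a $ k * christoffel G k i j x) = (dG i x j a + dG j x i a - dG a x i j) / 2"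
proof -
  have "christoffel G k i j x = (\<Sum>l\<in>UNIV. gi x k l * ((dG i x j l + dG j x i l - dG l x i j) / 2))" for k
    by (simp add: christoffel_def sum_distrib_left)
  then show ?thesis by (simp only: G_gi_cancel[OF assms])
qed

text \<open>The connection is compatible with the metric: in the sum of the two lowered Christoffel
  symbols the derivatives in directions \<open>i\<close> and \<open>j\<close> cancel, and the one in
  direction \<open>k\<close> appears twice with weight 1/2.\<close>

lemma metric_compatible:
  assumes "x \<in> S"
  shows "dG k x i j = (\<Sum>l\<in>UNIV. G x $ j $ l * christoffel G l k i x) + (\<Sum>l\<in>UNIV. G x $ i $ l * christoffel G l k j x)"
  unfolding christoffel_lower[OF assms]
  using dG_sym[OF assms, of k i j] dG_sym[OF assms, of j k i] dG_sym[OF assms, of i k j] by (simp add: field_simps)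

text \<open>In the contracted Christoffel symbol two of the three terms cancel by symmetry of the
  inverse metric, leaving half the trace of g^{-1} \<partial>_i g. Jacobi's formula produces the
  same trace.\<close>

lemma pd_sqrt_det:
  assumes "x \<in> S"
  shows "pd i (\<lambda>x. sqrt (det (G x))) x = sqrt (det (G x)) * (\<Sum>k\<in>UNIV. christoffel G k k i x)"
proof -
  have d: "det (G x) > 0" using posdef_det_pos[OF G_posdef[OF assms]] .
  have sw: "(\<Sum>k\<in>UNIV. \<Sum>l\<in>UNIV. gi x k l * dG l x k i) = (\<Sum>k\<in>UNIV. \<Sum>l\<in>UNIV. gi x k l * dG k x i l)"
    by (subst sum.swap) (simp add: gi_sym[OF assms, of _ "_::'n"] dG_sym[OF assms] cong: sum.cong)
  have "(\<Sum>k\<in>UNIV. christoffel G k k i x) = (1/2) * ((\<Sum>k\<in>UNIV. \<Sum>l\<in>UNIV. gi x k l * dG k x i l)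
      + (\<Sum>k\<in>UNIV. \<Sum>l\<in>UNIV. gi x k l * dG i x k l) - (\<Sum>k\<in>UNIV. \<Sum>l\<in>UNIV. gi x k l * dG l x k i))"
    by (simp add: christoffel_def sum_distrib_left sum.distrib sum_subtractf algebra_simps)
  then have t: "(\<Sum>k\<in>UNIV. christoffel G k k i x) = (\<Sum>k\<in>UNIV. \<Sum>l\<in>UNIV. gi x k l * dG i x k l) / 2"
    by (simp add: sw)
  have dG: "(\<lambda>x. G x $ a $ b) differentiable (at x)" for a b
    using Ck_on_differentiable[OF G_entry_Ck[of 1] _ assms] by simp
  have "pd i (\<lambda>x. det (G x)) x = det (G x) * (\<Sum>a\<in>UNIV. \<Sum>b\<in>UNIV. gi x a b * pd i (\<lambda>x. G x $ b $ a) x)"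
    by (rule pd_det[OF dG posdef_invertible[OF G_posdef[OF assms]]])
  also have "(\<Sum>a\<in>UNIV. \<Sum>b\<in>UNIV. gi x a b * pd i (\<lambda>x. G x $ b $ a) x) = 2 * (\<Sum>k\<in>UNIV. christoffel G k k i x)"
    unfolding t by (simp add: pd_G_entry[OF assms] dG_sym[OF assms, of i _ "_::'n"] cong: sum.cong)
  finally have "pd i (\<lambda>x. sqrt (det (G x))) x = inverse (sqrt (det (G x))) / 2 * (det (G x) * (2 * (\<Sum>k\<in>UNIV. christoffel G k k i x)))"
    using pd_chain(1)[of sqrt _ "\<lambda>x. det (G x)", OF DERIV_real_sqrt[OF d], of i] Ck_on_differentiable[OF det_Ck[of 1] _ assms] by simp
  also have "\<dots> = sqrt (det (G x)) * (\<Sum>k\<in>UNIV. christoffel G k k i x)"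
    using d by (simp add: field_simps real_sqrt_mult_self flip: mult.assoc)
  finally show ?thesis .
qed

lemma gradient_nth: "gradient G b x $ i = (\<Sum>j\<in>UNIV. gi x i j * pd j b x)"
  by (simp add: gradient_def matrix_vector_mult_def)

lemma gradient_Ck: "Ck_on (Suc k) S b \<Longrightarrow> Ck_on k S (\<lambda>x. gradient G b x $ i)"
  unfolding gradient_nth by (intro Ck_on_sum Ck_on_mult open_S gi_Ck) auto

lemma G_gradient: "x \<in> S \<Longrightarrow> (\<Sum>j\<in>UNIV. G x $ i $ j * gradient G b x $ j) = pd i b x"
  by (simp add: gradient_nth G_gi_cancel)

lemma grad_ip_Ck: "Ck_on (Suc k) S a \<Longrightarrow> Ck_on (Suc k) S b \<Longrightarrow> Ck_on k S (grad_ip G a b)"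
  unfolding grad_ip_def[abs_def] by (intro Ck_on_sum Ck_on_mult open_S gradient_Ck) auto

lemma hessian_nth: "hessian G b x $ i $ j = pd i (pd j b) x - (\<Sum>k\<in>UNIV. christoffel G k i j x * pd k b x)"
  by (simp add: hessian_def)

lemma hessian_Ck: "Ck_on (Suc (Suc k)) S b \<Longrightarrow> Ck_on k S (\<lambda>x. hessian G b x $ i $ j)"
  unfolding hessian_nth
  by (intro Ck_on_diff Ck_on_sum Ck_on_mult open_S christoffel_Ck)
     (auto dest: Ck_on_Suc_imp simp del: Ck_on.simps intro: Ck_on_pd)

lemma hessian_sym:
  assumes "Ck_on 2 S b" "x \<in> S"
  shows "hessian G b x $ i $ j = hessian G b x $ j $ i"
  using pd_commute[OF assms(1) open_S assms(2), of i j] by (simp add: hessian_nth christoffel_sym[OF assms(2), of _ i j])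

text \<open>Differentiating the identity G \<nabla>b = db and inserting metric compatibility gives
  the claim with the index lowered; the inverse metric raises it again.\<close>

lemma covariant_derivative_gradient:
  assumes b: "Ck_on 2 S b" and x: "x \<in> S"
  shows "pd i (\<lambda>x. gradient G b x $ j) x + (\<Sum>k\<in>UNIV. christoffel G j i k x * gradient G b x $ k)
    = (\<Sum>l\<in>UNIV. gi x j l * hessian G b x $ i $ l)"
proof -
  let ?v = "gradient G b"
  let ?D = "\<lambda>j. pd i (\<lambda>x. ?v x $ j) x + (\<Sum>k\<in>UNIV. christoffel G j i k x * ?v x $ k)"
  have dv: "(\<lambda>x. ?v x $ j) differentiable (at x)" for j
    using Ck_on_differentiable[OF gradient_Ck[of 1 b] _ x] b by (simp add: numeral_2_eq_2)
  have dG: "(\<lambda>x. G x $ a $ j) differentiable (at x)" for a j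
    using Ck_on_differentiable[OF G_entry_Ck[of 1] _ x] by simp
  have "(\<Sum>j\<in>UNIV. G x $ a $ j * ?D j) = hessian G b x $ i $ a" for a
  proof -
    have "pd i (pd a b) x = pd i (\<lambda>x. \<Sum>j\<in>UNIV. G x $ a $ j * ?v x $ j) x"
      by (rule pd_cong[OF open_S x]) (simp add: G_gradient)
    also have "\<dots> = (\<Sum>j\<in>UNIV. dG i x a j * ?v x $ j + G x $ a $ j * pd i (\<lambda>x. ?v x $ j) x)"
      by (subst pd_sum) (auto intro!: differentiable_mult dv dG simp: pd_mult dv dG pd_G_entry x)
    also have "\<dots> = (\<Sum>j\<in>UNIV. dG i x a j * ?v x $ j) + (\<Sum>j\<in>UNIV. G x $ a $ j * pd i (\<lambda>x. ?v x $ j) x)"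
      by (rule sum.distrib)
    also have "(\<Sum>j\<in>UNIV. dG i x a j * ?v x $ j)
        = (\<Sum>j\<in>UNIV. \<Sum>l\<in>UNIV. G x $ j $ l * christoffel G l i a x * ?v x $ j)
        + (\<Sum>j\<in>UNIV. \<Sum>l\<in>UNIV. G x $ a $ l * christoffel G l i j x * ?v x $ j)"
      by (simp add: metric_compatible[OF x, of i a] sum_distrib_right sum.distrib distrib_right)
    also have "(\<Sum>j\<in>UNIV. \<Sum>l\<in>UNIV. G x $ j $ l * christoffel G l i a x * ?v x $ j)
        = (\<Sum>l\<in>UNIV. christoffel G l i a x * pd l b x)"
      by (subst sum.swap)
         (simp add: G_gradient[OF x, symmetric] sum_distrib_left G_entry_sym[OF x, of _ "_::'n"] mult_ac cong: sum.cong)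
    also have "(\<Sum>j\<in>UNIV. \<Sum>l\<in>UNIV. G x $ a $ l * christoffel G l i j x * ?v x $ j)
        = (\<Sum>l\<in>UNIV. G x $ a $ l * (\<Sum>j\<in>UNIV. christoffel G l i j x * ?v x $ j))"
      by (subst sum.swap) (simp add: sum_distrib_left mult.assoc)
    finally show ?thesis by (simp add: hessian_nth distrib_left sum.distrib)
  qed
  then have "(\<Sum>l\<in>UNIV. gi x j l * hessian G b x $ i $ l) = (\<Sum>l\<in>UNIV. gi x j l * (\<Sum>m\<in>UNIV. G x $ l $ m * ?D m))"
    by simp
  also have "\<dots> = ?D j" by (rule gi_G_cancel[OF x])
  finally show ?thesis by simp
qed

text \<open>Product rule for the connection: the Christoffel terms hidden in the covariant
  derivative of the gradient of \<open>a\<close> are exactly those that turn the second derivatives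
  of \<open>b\<close> into its Hessian.\<close>

lemma pd_grad_ip:
  assumes a: "Ck_on 2 S a" and b: "Ck_on 2 S b" and x: "x \<in> S"
  shows "pd k (grad_ip G a b) x = (\<Sum>l\<in>UNIV. hessian G a x $ k $ l * gradient G b x $ l)
     + (\<Sum>l\<in>UNIV. hessian G b x $ k $ l * gradient G a x $ l)"
proof -
  let ?v = "gradient G a"
  have dv: "(\<lambda>x. ?v x $ j) differentiable (at x)" for j
    using Ck_on_differentiable[OF gradient_Ck[of 1 a] _ x] a by (simp add: numeral_2_eq_2)
  have db: "pd j b differentiable (at x)" for j
    using b x by (simp add: numeral_2_eq_2)
  have "pd k (grad_ip G a b) x = (\<Sum>i\<in>UNIV. pd k (\<lambda>x. ?v x $ i) x * pd i b x + ?v x $ i * pd k (pd i b) x)"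
    unfolding grad_ip_def[abs_def]
    by (subst pd_sum) (auto intro!: differentiable_mult dv db simp: pd_mult dv db)
  also have "\<dots> = (\<Sum>i\<in>UNIV. (\<Sum>l\<in>UNIV. gi x i l * hessian G a x $ k $ l) * pd i b x
      - (\<Sum>m\<in>UNIV. christoffel G i k m x * ?v x $ m) * pd i b x + ?v x $ i * pd k (pd i b) x)"
    by (simp flip: covariant_derivative_gradient[OF a x] add: algebra_simps)
  also have "\<dots> = (\<Sum>i\<in>UNIV. \<Sum>l\<in>UNIV. gi x i l * hessian G a x $ k $ l * pd i b x)
      - (\<Sum>i\<in>UNIV. \<Sum>m\<in>UNIV. christoffel G i k m x * ?v x $ m * pd i b x) + (\<Sum>i\<in>UNIV. ?v x $ i * pd k (pd i b) x)"
    by (simp add: sum.distrib sum_subtractf sum_distrib_right)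
  also have "(\<Sum>i\<in>UNIV. \<Sum>l\<in>UNIV. gi x i l * hessian G a x $ k $ l * pd i b x)
      = (\<Sum>l\<in>UNIV. hessian G a x $ k $ l * gradient G b x $ l)"
    by (subst sum.swap) (simp add: gradient_nth sum_distrib_left gi_sym[OF x, of _ "_::'n"] mult_ac cong: sum.cong)
  also have "(\<Sum>i\<in>UNIV. \<Sum>m\<in>UNIV. christoffel G i k m x * ?v x $ m * pd i b x)
      = (\<Sum>m\<in>UNIV. (\<Sum>i\<in>UNIV. christoffel G i k m x * pd i b x) * ?v x $ m)"
    by (subst sum.swap) (simp add: sum_distrib_left sum_distrib_right mult_ac)
  finally show ?thesis
    by (simp add: hessian_nth left_diff_distrib right_diff_distrib sum_subtractf mult.commute)
qed

lemma lap_sum: "lap G b x = (\<Sum>i\<in>UNIV. \<Sum>l\<in>UNIV. gi x i l * hessian G b x $ l $ i)"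
  by (simp add: lap_def trace_def matrix_matrix_mult_def)

lemma lap_Ck: "Ck_on (Suc (Suc k)) S b \<Longrightarrow> Ck_on k S (lap G b)"
  unfolding lap_sum[abs_def] by (intro Ck_on_sum Ck_on_mult open_S gi_Ck hessian_Ck)

text \<open>The trace of the Hessian with one index raised is the divergence of the gradient. This
  form is the starting point of both the integral identities and Bochner's formula.\<close>

lemma lap_divergence:
  assumes b: "Ck_on 2 S b" and x: "x \<in> S"
  shows "lap G b x = (\<Sum>i\<in>UNIV. pd i (\<lambda>x. gradient G b x $ i) x + (\<Sum>k\<in>UNIV. christoffel G i i k x * gradient G b x $ k))"
  unfolding lap_sum covariant_derivative_gradient[OF assms]
  by (simp add: hessian_sym[OF assms, of _ "_::'n"] cong: sum.cong)

text \<open>Bridge to Euclidean space: the derivative of the volume factor is a contracted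
  Christoffel symbol, so the coordinate divergence of \<zeta> sqrt(det g) \<nabla>b is the volume
  factor times the Riemannian divergence of \<zeta> \<nabla>b. Later \<zeta> is a member of a
  partition of unity.\<close>

lemma weighted_divergence:
  assumes b: "Ck_on 2 S b" and z: "Ck_on 1 S \<zeta>" and x: "x \<in> S"
  shows "(\<Sum>i\<in>UNIV. pd i (\<lambda>x. \<zeta> x * (sqrt (det (G x)) * gradient G b x $ i)) x)
    = sqrt (det (G x)) * (\<zeta> x * lap G b x + grad_ip G b \<zeta> x)"
proof -
  let ?v = "gradient G b" and ?s = "\<lambda>x. sqrt (det (G x))"
  have dv: "(\<lambda>x. ?v x $ j) differentiable (at x)" for j
    using Ck_on_differentiable[OF gradient_Ck[of 1 b] _ x] b by (simp add: numeral_2_eq_2)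
  have ds: "?s differentiable (at x)" using Ck_on_differentiable[OF sqrt_det_Ck[of 1] _ x] by simp
  have dz: "\<zeta> differentiable (at x)" using Ck_on_differentiable[OF z _ x] by simp
  have "(\<Sum>i\<in>UNIV. pd i (\<lambda>x. \<zeta> x * (?s x * ?v x $ i)) x)
     = (\<Sum>i\<in>UNIV. pd i \<zeta> x * (?s x * ?v x $ i) + \<zeta> x * (?s x * (\<Sum>k\<in>UNIV. christoffel G k k i x) * ?v x $ i + ?s x * pd i (\<lambda>x. ?v x $ i) x))"
    by (simp add: pd_mult dv ds dz differentiable_mult pd_sqrt_det[OF x])
  also have "\<dots> = ?s x * grad_ip G b \<zeta> x + ?s x * \<zeta> x * ((\<Sum>i\<in>UNIV. \<Sum>k\<in>UNIV. christoffel G k k i x * ?v x $ i) + (\<Sum>i\<in>UNIV. pd i (\<lambda>x. ?v x $ i) x))"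
    by (simp add: grad_ip_def sum.distrib sum_distrib_left sum_distrib_right algebra_simps)
  also have "(\<Sum>i\<in>UNIV. \<Sum>k\<in>UNIV. christoffel G k k i x * ?v x $ i) = (\<Sum>i\<in>UNIV. \<Sum>k\<in>UNIV. christoffel G i i k x * ?v x $ k)"
    by (rule sum.swap)
  finally show ?thesis by (simp add: lap_divergence[OF b x] sum.distrib algebra_simps)
qed

end

text \<open>The purely algebraic part of Bochner's formula: \<open>v\<close>, \<open>a i j\<close>, \<open>dd i l j\<close>, \<open>\<gamma> j i k\<close> and
  \<open>d\<gamma> i j l k\<close> stand for a vector field, \<open>\<partial>\<^sub>i v\<^sup>j\<close>, \<open>\<partial>\<^sub>i \<partial>\<^sub>l v\<^sup>j\<close>, \<open>\<Gamma>\<^sup>j\<^sub>i\<^sub>k\<close> and \<open>\<partial>\<^sub>i \<Gamma>\<^sup>j\<^sub>l\<^sub>k\<close> at a point.\<close>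

lemma bochner_algebra:
  fixes v :: "'n::finite \<Rightarrow> real" and a :: "'n \<Rightarrow> 'n \<Rightarrow> real" and dd \<gamma> :: "'n \<Rightarrow> 'n \<Rightarrow> 'n \<Rightarrow> real"
    and d\<gamma> :: "'n \<Rightarrow> 'n \<Rightarrow> 'n \<Rightarrow> 'n \<Rightarrow> real"
  assumes dd: "\<And>i l j. dd i l j = dd l i j" and \<gamma>: "\<And>j i k. \<gamma> j i k = \<gamma> j k i"
  defines "D \<equiv> \<lambda>l i. a l i + (\<Sum>k\<in>UNIV. \<gamma> i l k * v k)"
  shows "(\<Sum>i\<in>UNIV. \<Sum>l\<in>UNIV. a i l * D l i)
      + (\<Sum>i\<in>UNIV. \<Sum>l\<in>UNIV. v l * (dd i l i + (\<Sum>k\<in>UNIV. d\<gamma> i i l k * v k + \<gamma> i l k * a i k)))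
      + (\<Sum>i\<in>UNIV. \<Sum>k\<in>UNIV. \<gamma> i i k * (\<Sum>l\<in>UNIV. v l * D l k))
    = (\<Sum>i\<in>UNIV. \<Sum>l\<in>UNIV. D i l * D l i)
      + (\<Sum>j\<in>UNIV. \<Sum>k\<in>UNIV. v j * (\<Sum>l\<in>UNIV. d\<gamma> l l j k - d\<gamma> j l l k + (\<Sum>m\<in>UNIV. \<gamma> l l m * \<gamma> m j k - \<gamma> l j m * \<gamma> m l k)) * v k)
      + (\<Sum>l\<in>UNIV. v l * (\<Sum>i\<in>UNIV. dd l i i + (\<Sum>k\<in>UNIV. d\<gamma> l i i k * v k + \<gamma> i i k * a l k)))"
proof -
  let ?S = "\<lambda>f. \<Sum>i\<in>(UNIV::'n set). f i"
  \<comment> \<open>Both sides expand into these sums: \<open>Q\<close> with second derivatives of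
    the field, \<open>W1\<close> and \<open>W2\<close> with derivatives of Christoffel symbols,
    \<open>P\<close> and \<open>P'\<close> with first derivatives of the field, \<open>Z1\<close>
    and \<open>Z2\<close> quadratic in the symbols. The curvature term is W1 - W2 + Z1 - Z2.\<close>
  define Q where "Q = ?S (\<lambda>i. ?S (\<lambda>l. v l * dd i l i))"
  define W1 where "W1 = ?S (\<lambda>i. ?S (\<lambda>l. ?S (\<lambda>k. v l * d\<gamma> i i l k * v k)))"
  define W2 where "W2 = ?S (\<lambda>i. ?S (\<lambda>l. ?S (\<lambda>k. v l * d\<gamma> l i i k * v k)))"
  define P where "P = ?S (\<lambda>i. ?S (\<lambda>l. ?S (\<lambda>k. v l * \<gamma> i l k * a i k)))"
  define P' where "P' = ?S (\<lambda>i. ?S (\<lambda>l. ?S (\<lambda>k. v l * \<gamma> i i k * a l k)))"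
  define Z1 where "Z1 = ?S (\<lambda>i. ?S (\<lambda>l. ?S (\<lambda>k. ?S (\<lambda>m. v l * \<gamma> i i k * \<gamma> k l m * v m))))"
  define Z2 where "Z2 = ?S (\<lambda>i. ?S (\<lambda>l. ?S (\<lambda>k. ?S (\<lambda>m. v l * \<gamma> i l k * \<gamma> k i m * v m))))"
  have 1: "?S (\<lambda>i. ?S (\<lambda>l. v l * (dd i l i + ?S (\<lambda>k. d\<gamma> i i l k * v k + \<gamma> i l k * a i k)))) = Q + W1 + P"
    by (simp add: Q_def W1_def P_def sum.distrib sum_distrib_left distrib_left mult.assoc)
  have 2: "?S (\<lambda>i. ?S (\<lambda>k. \<gamma> i i k * ?S (\<lambda>l. v l * D l k))) = P' + Z1"
  proof -
    have "?S (\<lambda>i. ?S (\<lambda>k. \<gamma> i i k * ?S (\<lambda>l. v l * D l k))) = ?S (\<lambda>i. ?S (\<lambda>k. ?S (\<lambda>l. \<gamma> i i k * (v l * D l k))))"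
      by (simp add: sum_distrib_left)
    also have "\<dots> = ?S (\<lambda>i. ?S (\<lambda>l. ?S (\<lambda>k. \<gamma> i i k * (v l * D l k))))" by (rule sum3_swap23)
    finally show ?thesis
      by (simp add: P'_def Z1_def D_def sum.distrib sum_distrib_left distrib_left mult_ac)
  qed
  have 3: "?S (\<lambda>l. v l * ?S (\<lambda>i. dd l i i + ?S (\<lambda>k. d\<gamma> l i i k * v k + \<gamma> i i k * a l k))) = Q + W2 + P'"
  proof -
    have "?S (\<lambda>l. v l * ?S (\<lambda>i. dd l i i + ?S (\<lambda>k. d\<gamma> l i i k * v k + \<gamma> i i k * a l k)))
       = ?S (\<lambda>l. ?S (\<lambda>i. v l * (dd l i i + ?S (\<lambda>k. d\<gamma> l i i k * v k + \<gamma> i i k * a l k))))"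
      by (simp add: sum_distrib_left)
    also have "\<dots> = ?S (\<lambda>i. ?S (\<lambda>l. v l * (dd l i i + ?S (\<lambda>k. d\<gamma> l i i k * v k + \<gamma> i i k * a l k))))"
      by (rule sum.swap)
    finally show ?thesis
      by (simp add: Q_def W2_def P'_def dd[of _ "_::'n"] sum.distrib sum_distrib_left distrib_left mult.assoc)
  qed
  have 4: "?S (\<lambda>i. ?S (\<lambda>l. D i l * D l i)) = ?S (\<lambda>i. ?S (\<lambda>l. a i l * D l i)) + P + Z2"
  proof -
    have "?S (\<lambda>i. ?S (\<lambda>l. D i l * D l i)) = ?S (\<lambda>i. ?S (\<lambda>l. a i l * D l i)) + ?S (\<lambda>i. ?S (\<lambda>l. ?S (\<lambda>k. \<gamma> l i k * v k * D l i)))"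
      by (subst (1) D_def) (simp add: distrib_right sum.distrib sum_distrib_right)
    also have "?S (\<lambda>i. ?S (\<lambda>l. ?S (\<lambda>k. \<gamma> l i k * v k * D l i))) = ?S (\<lambda>l. ?S (\<lambda>i. ?S (\<lambda>k. \<gamma> l i k * v k * D l i)))"
      by (rule sum3_swap12)
    also have "\<dots> = ?S (\<lambda>l. ?S (\<lambda>k. ?S (\<lambda>i. \<gamma> l i k * v k * D l i)))"
      by (rule sum3_swap23)
    also have "\<dots> = ?S (\<lambda>l. ?S (\<lambda>k. ?S (\<lambda>i. v k * \<gamma> l k i * D l i)))"
      by (intro sum.cong refl) (simp add: \<gamma>)
    also have "\<dots> = P + Z2"
      by (simp add: P_def Z2_def D_def distrib_left sum.distrib sum_distrib_left mult_ac)
    finally show ?thesis by simp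
  qed
  have 5: "?S (\<lambda>j. ?S (\<lambda>k. v j * ?S (\<lambda>l. d\<gamma> l l j k - d\<gamma> j l l k + ?S (\<lambda>m. \<gamma> l l m * \<gamma> m j k - \<gamma> l j m * \<gamma> m l k)) * v k))
      = W1 - W2 + (Z1 - Z2)"
  proof -
    let ?f = "\<lambda>l j k. v j * (d\<gamma> l l j k - d\<gamma> j l l k + ?S (\<lambda>m. \<gamma> l l m * \<gamma> m j k - \<gamma> l j m * \<gamma> m l k)) * v k"
    have "?S (\<lambda>j. ?S (\<lambda>k. v j * ?S (\<lambda>l. d\<gamma> l l j k - d\<gamma> j l l k + ?S (\<lambda>m. \<gamma> l l m * \<gamma> m j k - \<gamma> l j m * \<gamma> m l k)) * v k))
      = ?S (\<lambda>j. ?S (\<lambda>k. ?S (\<lambda>l. ?f l j k)))"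
      by (simp only: sum_distrib_left sum_distrib_right)
    also have "\<dots> = ?S (\<lambda>j. ?S (\<lambda>l. ?S (\<lambda>k. ?f l j k)))" by (rule sum3_swap23)
    also have "\<dots> = ?S (\<lambda>l. ?S (\<lambda>j. ?S (\<lambda>k. ?f l j k)))" by (rule sum3_swap12)
    also have "\<dots> = W1 - W2 + (?S (\<lambda>l. ?S (\<lambda>j. ?S (\<lambda>k. ?S (\<lambda>m. v j * \<gamma> l l m * \<gamma> m j k * v k))))
        - ?S (\<lambda>l. ?S (\<lambda>j. ?S (\<lambda>k. ?S (\<lambda>m. v j * \<gamma> l j m * \<gamma> m l k * v k)))))"
      by (simp add: W1_def W2_def distrib_left distrib_right left_diff_distrib right_diff_distrib
          sum.distrib sum_subtractf sum_distrib_left sum_distrib_right mult.assoc)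
    also have "?S (\<lambda>l. ?S (\<lambda>j. ?S (\<lambda>k. ?S (\<lambda>m. v j * \<gamma> l l m * \<gamma> m j k * v k)))) = Z1"
      unfolding Z1_def by (rule sum.cong[OF refl], rule sum3_swap23)
    also have "?S (\<lambda>l. ?S (\<lambda>j. ?S (\<lambda>k. ?S (\<lambda>m. v j * \<gamma> l j m * \<gamma> m l k * v k)))) = Z2"
      unfolding Z2_def by (rule sum.cong[OF refl], rule sum3_swap23)
    finally show ?thesis .
  qed
  show ?thesis unfolding 1 2 3 4 5 by simp
qed

context local_metric
begin

text \<open>\<open>D l i\<close> is the covariant derivative of the gradient v of \<open>u\<close>.
  The gradient of |v|^2 has components 2 v^l D_l^i; its divergence in coordinates is what
  \<open>bochner_algebra\<close> splits into |D|^2, the Ricci term and the derivative along v of tr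
  D = \<Delta>u.\<close>

lemma bochner:
  assumes u: "Ck_on 3 S u" and x: "x \<in> S"
  defines "D \<equiv> \<lambda>l i x. \<Sum>j\<in>UNIV. gi x i j * hessian G u x $ l $ j"
  shows "lap G (grad_ip G u u) x = 2 * ((\<Sum>i\<in>UNIV. \<Sum>l\<in>UNIV. D i l x * D l i x)
     + gradient G u x \<bullet> (ricci G x *v gradient G u x) + grad_ip G u (lap G u) x)"
proof -
  let ?v = "\<lambda>i x. gradient G u x $ i" and ?C = "christoffel G"
  let ?D = "\<lambda>l i x. pd l (?v i) x + (\<Sum>k\<in>UNIV. ?C i l k x * ?v k x)"
  have u2: "Ck_on 2 S u" using Ck_on_le[OF u] by simp
  have v2: "Ck_on 2 S (?v i)" for i using gradient_Ck[of 2 u] u by (simp add: numeral_3_eq_3 numeral_2_eq_2)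
  have DD: "D l i y = ?D l i y" if "y \<in> S" for l i y
    unfolding D_def by (rule covariant_derivative_gradient[OF u2 that, symmetric])
  have dv: "?v i differentiable (at y)" "pd l (?v i) differentiable (at y)" if "y \<in> S" for y i l
    using v2[of i] that by (auto simp: numeral_2_eq_2)
  have dC: "?C i j k differentiable (at y)" if "y \<in> S" for y i j k
    using Ck_on_differentiable[OF christoffel_Ck[of 1] _ that] by simp
  have "Ck_on 1 S (D l i)" for l i
    unfolding D_def using u
    by (intro Ck_on_sum Ck_on_mult open_S gi_Ck hessian_Ck) (simp add: numeral_3_eq_3)
  then have dD: "D l i differentiable (at x)" for l i
    using Ck_on_differentiable[of 1 S "D l i" x] x by simp
  have pdD: "pd m (D l i) x = pd m (pd l (?v i)) x + (\<Sum>k\<in>UNIV. pd m (?C i l k) x * ?v k x + ?C i l k x * pd m (?v k) x)" for m l i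
  proof -
    have "pd m (D l i) x = pd m (?D l i) x" by (rule pd_cong[OF open_S x DD])
    also have "\<dots> = pd m (pd l (?v i)) x + pd m (\<lambda>x. \<Sum>k\<in>UNIV. ?C i l k x * ?v k x) x"
      by (rule pd_add) (auto intro!: dv dC x differentiable_mult differentiable_sum)
    also have "pd m (\<lambda>x. \<Sum>k\<in>UNIV. ?C i l k x * ?v k x) x = (\<Sum>k\<in>UNIV. pd m (?C i l k) x * ?v k x + ?C i l k x * pd m (?v k) x)"
      by (subst pd_sum) (auto intro!: differentiable_mult dv dC x simp: pd_mult dv dC x)
    finally show ?thesis .
  qed
  let ?w = "grad_ip G u u"
  have w2: "Ck_on 2 S ?w" using grad_ip_Ck[of 2 u u] u by (simp add: numeral_3_eq_3 numeral_2_eq_2)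
  have gw: "gradient G ?w y $ i = 2 * (\<Sum>l\<in>UNIV. ?v l y * D l i y)" if "y \<in> S" for y i
  proof -
    have "gradient G ?w y $ i = (\<Sum>j\<in>UNIV. gi y i j * (2 * (\<Sum>l\<in>UNIV. hessian G u y $ j $ l * ?v l y)))"
      unfolding gradient_nth[of ?w] by (simp add: pd_grad_ip[OF u2 u2 that])
    also have "\<dots> = 2 * (\<Sum>j\<in>UNIV. \<Sum>l\<in>UNIV. gi y i j * hessian G u y $ l $ j * ?v l y)"
      by (simp add: sum_distrib_left hessian_sym[OF u2 that, of _ "_::'n"] mult_ac cong: sum.cong)
    also have "(\<Sum>j\<in>UNIV. \<Sum>l\<in>UNIV. gi y i j * hessian G u y $ l $ j * ?v l y) = (\<Sum>l\<in>UNIV. ?v l y * D l i y)"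
      by (subst sum.swap) (simp add: D_def sum_distrib_left mult_ac)
    finally show ?thesis .
  qed
  have "pd i (\<lambda>x. gradient G ?w x $ i) x = 2 * (\<Sum>l\<in>UNIV. pd i (?v l) x * D l i x + ?v l x * pd i (D l i) x)" for i
  proof -
    have "pd i (\<lambda>x. gradient G ?w x $ i) x = pd i (\<lambda>x. 2 * (\<Sum>l\<in>UNIV. ?v l x * D l i x)) x"
      by (rule pd_cong[OF open_S x gw])
    also have "\<dots> = 2 * pd i (\<lambda>x. \<Sum>l\<in>UNIV. ?v l x * D l i x) x"
      by (rule pd_cmult) (auto intro!: dv dD x differentiable_mult differentiable_sum)
    also have "pd i (\<lambda>x. \<Sum>l\<in>UNIV. ?v l x * D l i x) x = (\<Sum>l\<in>UNIV. pd i (?v l) x * D l i x + ?v l x * pd i (D l i) x)"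
      by (subst pd_sum) (auto intro!: differentiable_mult dv dD x simp: pd_mult dv dD x)
    finally show ?thesis .
  qed
  then have "lap G ?w x = 2 * (\<Sum>i\<in>UNIV. (\<Sum>l\<in>UNIV. pd i (?v l) x * D l i x + ?v l x * pd i (D l i) x)
      + (\<Sum>k\<in>UNIV. ?C i i k x * (\<Sum>l\<in>UNIV. ?v l x * D l k x)))"
    unfolding lap_divergence[OF w2 x] by (simp add: gw[OF x] sum_distrib_left distrib_left mult_ac)
  also have "\<dots> = 2 * ((\<Sum>i\<in>UNIV. \<Sum>l\<in>UNIV. pd i (?v l) x * ?D l i x)
      + (\<Sum>i\<in>UNIV. \<Sum>l\<in>UNIV. ?v l x * (pd i (pd l (?v i)) x + (\<Sum>k\<in>UNIV. pd i (?C i l k) x * ?v k x + ?C i l k x * pd i (?v k) x)))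
      + (\<Sum>i\<in>UNIV. \<Sum>k\<in>UNIV. ?C i i k x * (\<Sum>l\<in>UNIV. ?v l x * ?D l k x)))"
    unfolding pdD by (simp add: DD[OF x] sum.distrib)
  also have "\<dots> = 2 * ((\<Sum>i\<in>UNIV. \<Sum>l\<in>UNIV. ?D i l x * ?D l i x)
      + (\<Sum>j\<in>UNIV. \<Sum>k\<in>UNIV. ?v j x * (\<Sum>l\<in>UNIV. pd l (?C l j k) x - pd j (?C l l k) x + (\<Sum>m\<in>UNIV. ?C l l m x * ?C m j k x - ?C l j m x * ?C m l k x)) * ?v k x)
      + (\<Sum>l\<in>UNIV. ?v l x * (\<Sum>i\<in>UNIV. pd l (pd i (?v i)) x + (\<Sum>k\<in>UNIV. pd l (?C i i k) x * ?v k x + ?C i i k x * pd l (?v k) x))))"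
    by (subst bochner_algebra[of "\<lambda>i l j. pd i (pd l (?v j)) x" "\<lambda>j i k. ?C j i k x"])
       (rule pd_commute[OF v2 open_S x], rule christoffel_sym[OF x], rule refl)
  also have "(\<Sum>j\<in>UNIV. \<Sum>k\<in>UNIV. ?v j x * (\<Sum>l\<in>UNIV. pd l (?C l j k) x - pd j (?C l l k) x + (\<Sum>m\<in>UNIV. ?C l l m x * ?C m j k x - ?C l j m x * ?C m l k x)) * ?v k x)
     = gradient G u x \<bullet> (ricci G x *v gradient G u x)"
    unfolding inner_matrix_sum
    by (intro sum.cong refl)
       (simp add: ricci_def riemann_def christoffel_sym[OF x] )
  also have "(\<Sum>l\<in>UNIV. ?v l x * (\<Sum>i\<in>UNIV. pd l (pd i (?v i)) x + (\<Sum>k\<in>UNIV. pd l (?C i i k) x * ?v k x + ?C i i k x * pd l (?v k) x)))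
     = grad_ip G u (lap G u) x"
  proof -
    have "pd l (lap G u) x = (\<Sum>i\<in>UNIV. pd l (D i i) x)" for l
    proof -
      have "pd l (lap G u) x = pd l (\<lambda>x. \<Sum>i\<in>UNIV. D i i x) x"
        by (rule pd_cong[OF open_S x]) (simp add: lap_divergence[OF u2] DD)
      also have "\<dots> = (\<Sum>i\<in>UNIV. pd l (D i i) x)" by (rule pd_sum) (auto simp: dD)
      finally show ?thesis .
    qed
    then show ?thesis unfolding grad_ip_def pdD by simp
  qed
  finally show ?thesis by (simp add: DD[OF x])
qed

lemma lap_square_le:
  assumes u: "Ck_on 2 S u" and x: "x \<in> S"
  defines "D \<equiv> \<lambda>l i x. \<Sum>j\<in>UNIV. gi x i j * hessian G u x $ l $ j"
  shows "(lap G u x)\<^sup>2 \<le> real CARD('n) * (\<Sum>i\<in>UNIV. \<Sum>l\<in>UNIV. D i l x * D l i x)"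
proof -
  let ?K = "hessian G u x"
  have "transpose ?K = ?K" by (simp add: vec_eq_iff transpose_def hessian_sym[OF u x])
  then have "(lap G u x)\<^sup>2 \<le> real CARD('n) * trace (matrix_inv (G x) ** ?K ** (matrix_inv (G x) ** ?K))"
    unfolding lap_def by (rule trace_square_ge[OF G_posdef[OF x]])
  also have "trace (matrix_inv (G x) ** ?K ** (matrix_inv (G x) ** ?K)) = (\<Sum>i\<in>UNIV. \<Sum>l\<in>UNIV. D l i x * D i l x)"
  proof -
    have "(matrix_inv (G x) ** ?K) $ i $ l = D l i x" for i l
      by (simp add: matrix_matrix_mult_def D_def hessian_sym[OF u x, of l])
    then show ?thesis by (simp add: trace_def matrix_matrix_mult_def[of "_ ** _"])
  qed
  finally show ?thesis by (simp add: mult.commute)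
qed

end

section \<open>Change of coordinates\<close>

lemma grad_ip_cong:
  assumes "open T" "x \<in> T" "\<And>y. y \<in> T \<Longrightarrow> a y = a' y" "\<And>y. y \<in> T \<Longrightarrow> b y = b' y"
  shows "grad_ip G a b x = grad_ip G a' b' x"
  unfolding grad_ip_def gradient_def
  using pd_cong[OF assms(1,2,3)] pd_cong[OF assms(1,2,4)] by simp

lemma hessian_cong:
  assumes "open T" "x \<in> T" "\<And>y. y \<in> T \<Longrightarrow> a y = a' y"
  shows "hessian G a x = hessian G a' x"
proof -
  have 1: "pd i a y = pd i a' y" if "y \<in> T" for i y by (rule pd_cong[OF assms(1) that assms(3)])
  have 2: "pd j (pd i a) x = pd j (pd i a') x" for i j by (rule pd_cong[OF assms(1,2) 1])
  show ?thesis by (simp add: hessian_def 2 1[OF assms(2)])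
qed

lemma lap_cong:
  assumes "open T" "x \<in> T" "\<And>y. y \<in> T \<Longrightarrow> a y = a' y"
  shows "lap G a x = lap G a' x"
  by (simp only: lap_def hessian_cong[of T x a a', OF assms])

context local_metric
begin

text \<open>A Koszul-type formula: by \<open>pd_grad_ip\<close> each iterated product is a sum of
  two Hessian terms, and by symmetry four of the six cancel. Since the right side involves only
  inner products of gradients, chart invariance of the Hessian follows without a transformation law
  for Christoffel symbols.\<close>

lemma hessian_polarization:
  assumes a: "Ck_on 2 S a" and b: "Ck_on 2 S b" and c: "Ck_on 2 S c" and x: "x \<in> S"
  shows "2 * (gradient G b x \<bullet> (hessian G a x *v gradient G c x))
    = grad_ip G b (grad_ip G a c) x + grad_ip G c (grad_ip G a b) x - grad_ip G a (grad_ip G b c) x"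
proof -
  have e: "grad_ip G p (grad_ip G q r) x = gradient G p x \<bullet> (hessian G q x *v gradient G r x)
      + gradient G p x \<bullet> (hessian G r x *v gradient G q x)"
    if "Ck_on 2 S q" "Ck_on 2 S r" for p q r
    by (simp add: grad_ip_def[of G p] pd_grad_ip[OF that x] inner_vec_def matrix_vector_mult_def
        distrib_left sum.distrib)
  have s: "v \<bullet> (hessian G q x *v w) = w \<bullet> (hessian G q x *v v)" if "Ck_on 2 S q" for q v w
  proof -
    have "transpose (hessian G q x) = hessian G q x"
      by (simp add: vec_eq_iff transpose_def hessian_sym[OF that x])
    then show ?thesis by (subst inner_matrix_transpose) (simp add: inner_commute)
  qed
  show ?thesis
    using e[OF a b, of c] e[OF a c, of b] e[OF b c, of a] s[OF a, of "gradient G b x" "gradient G c x"]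
      s[OF b, of "gradient G a x" "gradient G c x"] s[OF c, of "gradient G a x" "gradient G b x"] by simp
qed

text \<open>Linear test functions realize every vector as a gradient at a given point, so the
  polarization formula determines the whole Hessian there.\<close>

lemma gradient_linear:
  assumes "x \<in> S"
  shows "gradient G (\<lambda>y. (G x *v v) \<bullet> y) x = v"
proof -
  have "pd j (\<lambda>y. (G x *v v) \<bullet> y) x = (G x *v v) $ j" for j
    by (subst pd_eqI[OF bounded_linear_imp_has_derivative[OF bounded_linear_inner_right]])
       (simp add: inner_axis)
  then show ?thesis by (simp add: gradient_def posdef_inv_cancel[OF G_posdef[OF assms]])
qed

end

lemma grad_ip_inner: "grad_ip G a b x = gradient G a x \<bullet> (\<chi> i. pd i b x)"
  by (simp add: grad_ip_def inner_vec_def)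

locale chart_change = src: local_metric S G + dst: local_metric S' G'
  for S :: "(real^'n::finite) set" and G and S' :: "(real^'n) set" and G' +
  fixes \<phi> :: "real^'n \<Rightarrow> real^'n"
  assumes \<phi>_smooth: "\<And>k. Ck_on k S \<phi>" and \<phi>_in: "\<And>x. x \<in> S \<Longrightarrow> \<phi> x \<in> S'"
    and G_pullback: "\<And>x i j. x \<in> S \<Longrightarrow> G x $ i $ j = pd i \<phi> x \<bullet> (G' (\<phi> x) *v pd j \<phi> x)"
begin

definition jac :: "real^'n \<Rightarrow> real^'n^'n" where "jac x = (\<chi> a i. pd i \<phi> x $ a)"

lemma \<phi>_differentiable: "x \<in> S \<Longrightarrow> \<phi> differentiable (at x)"
  using Ck_on_differentiable[OF \<phi>_smooth[of 1]] by simp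

lemma \<phi>_has_derivative:
  assumes "x \<in> S" shows "(\<phi> has_derivative ((*v) (jac x))) (at x)"
proof -
  have "(\<lambda>v. \<Sum>i\<in>UNIV. v $ i *\<^sub>R pd i \<phi> x) = (*v) (jac x)"
    by (auto simp: jac_def vec_eq_iff matrix_vector_mult_def mult.commute)
  then show ?thesis using has_derivative_pd[OF \<phi>_differentiable[OF assms]] by simp
qed

lemma G_jac: "x \<in> S \<Longrightarrow> G x = transpose (jac x) ** G' (\<phi> x) ** jac x"
  by (simp add: vec_eq_iff gram_entry G_pullback jac_def column_def)

lemma jac_inner: "x \<in> S \<Longrightarrow> v \<bullet> (G x *v w) = (jac x *v v) \<bullet> (G' (\<phi> x) *v (jac x *v w))"
  unfolding G_jac
  by (simp add: matrix_vector_mul_assoc[symmetric] inner_matrix_transpose[of v "transpose (jac x)"] del: transpose_matrix_vector)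

text \<open>A kernel vector of the Jacobian would have length zero in the pulled-back metric, which
  is positive definite.\<close>

lemma jac_invertible:
  assumes "x \<in> S" shows "invertible (jac x)"
proof -
  have "v = 0" if "jac x *v v = 0" for v
    using jac_inner[OF assms, of v v] src.G_posdef[OF assms] that by (cases "v = 0") (auto simp: posdef_def)
  then show ?thesis by (simp add: invertible_left_inverse matrix_left_invertible_ker)
qed

lemma jac_inj: "x \<in> S \<Longrightarrow> jac x *v v = jac x *v w \<Longrightarrow> v = w"
  using jac_invertible[of x] by (auto simp: invertible_left_inverse matrix_left_invertible_injective inj_eq)

lemma pd_pullback:
  assumes "x \<in> S" "b differentiable (at (\<phi> x))"
  shows "(\<chi> i. pd i (\<lambda>x. b (\<phi> x)) x) = transpose (jac x) *v (\<chi> j. pd j b (\<phi> x))"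
  using pd_compose[OF assms(2) \<phi>_differentiable[OF assms(1)]]
  by (auto simp: vec_eq_iff matrix_vector_mult_def jac_def transpose_def)

text \<open>Comparing the transformation of differentials with that of the metric shows that the
  transposed Jacobian annihilates a difference, and this matrix is invertible.\<close>

lemma gradient_pullback:
  assumes x: "x \<in> S" and b: "b differentiable (at (\<phi> x))"
  shows "jac x *v gradient G (\<lambda>x. b (\<phi> x)) x = gradient G' b (\<phi> x)"
proof -
  let ?w = "gradient G (\<lambda>x. b (\<phi> x)) x"
  have "G x *v ?w = transpose (jac x) *v (\<chi> j. pd j b (\<phi> x))"
    by (simp add: gradient_def posdef_inv_cancel[OF src.G_posdef[OF x]] pd_pullback[OF assms] del: transpose_matrix_vector)
  then have "v \<bullet> (transpose (jac x) *v (G' (\<phi> x) *v (jac x *v ?w) - (\<chi> j. pd j b (\<phi> x)))) = 0" for v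
    by (simp add: G_jac[OF x] matrix_vector_mul_assoc[symmetric] matrix_vector_mult_diff_distrib del: transpose_matrix_vector)
  then have "transpose (jac x) *v (G' (\<phi> x) *v (jac x *v ?w) - (\<chi> j. pd j b (\<phi> x))) = 0"
    using inner_eq_zero_iff by blast
  moreover have "invertible (transpose (jac x))"
    using jac_invertible[OF x] by (rule transpose_invertible)
  ultimately have "G' (\<phi> x) *v (jac x *v ?w) - (\<chi> j. pd j b (\<phi> x)) = 0"
    unfolding invertible_left_inverse matrix_left_invertible_ker by blast
  then have "G' (\<phi> x) *v (jac x *v ?w) = (\<chi> j. pd j b (\<phi> x))" by simp
  then have "matrix_inv (G' (\<phi> x)) *v (G' (\<phi> x) *v (jac x *v ?w)) = gradient G' b (\<phi> x)"
    by (simp add: gradient_def)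
  then show ?thesis by (simp add: posdef_inv_cancel[OF dst.G_posdef[OF \<phi>_in[OF x]]])
qed

lemma grad_ip_pullback:
  assumes x: "x \<in> S" and a: "a differentiable (at (\<phi> x))" and b: "b differentiable (at (\<phi> x))"
  shows "grad_ip G (\<lambda>x. a (\<phi> x)) (\<lambda>x. b (\<phi> x)) x = grad_ip G' a b (\<phi> x)"
  unfolding grad_ip_inner pd_pullback[OF x b] gradient_pullback[OF x a, symmetric]
  by (subst inner_matrix_transpose) simp

lemma Ck_pullback: "Ck_on k S' b \<Longrightarrow> Ck_on k S (\<lambda>x. b (\<phi> x))"
  using Ck_on_compose[OF src.open_S _ _ \<phi>_smooth[of k], of S' b] \<phi>_in by blast

text \<open>Polarization is applied in both charts to linear functions on the target whose gradients
  at \<phi> x are the images of \<open>p\<close> and \<open>q\<close> under the Jacobian. Their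
  pullbacks have gradients \<open>p\<close> and \<open>q\<close>, because the Jacobian is
  injective.\<close>

lemma hessian_pullback:
  assumes a: "Ck_on 2 S' a" and x: "x \<in> S"
  shows "p \<bullet> (hessian G (\<lambda>x. a (\<phi> x)) x *v q) = (jac x *v p) \<bullet> (hessian G' a (\<phi> x) *v (jac x *v q))"
proof -
  let ?b = "\<lambda>v y. (G' (\<phi> x) *v v) \<bullet> y"
  let ?v = "jac x *v p" and ?w = "jac x *v q"
  have y: "\<phi> x \<in> S'" using \<phi>_in[OF x] .
  have b2: "Ck_on 2 S' (?b v)" for v
    by (rule Ck_on_bounded_linear[OF dst.open_S bounded_linear_inner_right Ck_on_id])
  have dif: "f differentiable (at (\<phi> z))" if "Ck_on 2 S' f" "z \<in> S" for f z
    using Ck_on_differentiable[OF that(1)] \<phi>_in that(2) by simp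
  \<comment> \<open>The inner product that is differentiated once more must be transformed on all of
    \<open>S\<close>, not only at \<open>x\<close>.\<close>
  have ip: "grad_ip G (\<lambda>x. f (\<phi> x)) (grad_ip G (\<lambda>x. h (\<phi> x)) (\<lambda>x. k (\<phi> x))) x = grad_ip G' f (grad_ip G' h k) (\<phi> x)"
    if "Ck_on 2 S' f" "Ck_on 2 S' h" "Ck_on 2 S' k" for f h k
  proof -
    have "grad_ip G (\<lambda>x. f (\<phi> x)) (grad_ip G (\<lambda>x. h (\<phi> x)) (\<lambda>x. k (\<phi> x))) x
       = grad_ip G (\<lambda>x. f (\<phi> x)) (\<lambda>x. grad_ip G' h k (\<phi> x)) x"
      by (rule grad_ip_cong[OF src.open_S x]) (auto intro: grad_ip_pullback dif that)
    also have "\<dots> = grad_ip G' f (grad_ip G' h k) (\<phi> x)"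
    proof (rule grad_ip_pullback[OF x])
      have "Ck_on 1 S' (grad_ip G' h k)" using dst.grad_ip_Ck[of 1 h k] that by (simp add: numeral_2_eq_2)
      then show "grad_ip G' h k differentiable (at (\<phi> x))" using y by simp
    qed (use that dif x in auto)
    finally show ?thesis .
  qed
  have g: "gradient G' (?b v) (\<phi> x) = v" for v by (rule dst.gradient_linear[OF y])
  have "gradient G (\<lambda>x. ?b ?v (\<phi> x)) x = p" "gradient G (\<lambda>x. ?b ?w (\<phi> x)) x = q"
    using gradient_pullback[OF x dif[OF b2 x]] g jac_inj[OF x] by metis+
  then have "2 * (p \<bullet> (hessian G (\<lambda>x. a (\<phi> x)) x *v q)) = 2 * (?v \<bullet> (hessian G' a (\<phi> x) *v ?w))"
    using src.hessian_polarization[OF Ck_pullback[OF a] Ck_pullback[OF b2] Ck_pullback[OF b2] x, of ?v ?w]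
      dst.hessian_polarization[OF a b2 b2 y, of ?v ?w]
    by (simp add: g ip a b2)
  then show ?thesis by simp
qed

lemma lap_pullback:
  assumes a: "Ck_on 2 S' a" and x: "x \<in> S"
  shows "lap G (\<lambda>x. a (\<phi> x)) x = lap G' a (\<phi> x)"
proof -
  have "hessian G (\<lambda>x. a (\<phi> x)) x = transpose (jac x) ** hessian G' a (\<phi> x) ** jac x"
    unfolding vec_eq_iff
  proof (intro allI)
    fix i j
    have *: "axis i 1 \<bullet> (M *v axis j 1) = M $ i $ j" for M :: "real^'n^'n"
      by (simp add: matrix_vector_mult_basis column_def inner_axis')
    show "hessian G (\<lambda>x. a (\<phi> x)) x $ i $ j = (transpose (jac x) ** hessian G' a (\<phi> x) ** jac x) $ i $ j"
      using hessian_pullback[OF assms, of "axis i 1" "axis j 1"]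
      unfolding * by (simp add: gram_entry matrix_vector_mult_basis)
  qed
  then show ?thesis
    unfolding lap_def G_jac[OF x]
    by (simp add: trace_congruence[OF dst.G_posdef[OF \<phi>_in[OF x]] jac_invertible[OF x]])
qed

end

section \<open>Scalar operators on a Riemannian manifold\<close>

locale riemannian_manifold =
  fixes A :: "('a::{t2_space,second_countable_topology}, 'n::finite) chart set"
    and g :: "('a, 'n) tensor2"
  assumes atlas: "smooth_atlas A" and metric: "riemannian_metric A g"
begin

lemma ex_chart: "\<exists>c\<in>A. p \<in> cdom c"
proof -
  have "p \<in> (\<Union>c\<in>A. cdom c)" using atlas by (simp add: smooth_atlas_def)
  then show ?thesis by blast
qed

lemma chart_at: "chart_at A p \<in> A" "p \<in> cdom (chart_at A p)"
  using someI_ex[OF ex_chart[of p, unfolded Bex_def]] by (simp_all add: chart_at_def)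

context
  fixes c assumes c: "c \<in> A"
begin

lemma is_chart: "is_chart c"
  using atlas c by (simp add: smooth_atlas_def)

lemma cdom_open: "open (cdom c)"
  and chart_homeo: "homeomorphism (cdom c) (cmap c ` cdom c) (cmap c) (cinv c)"
  and cimage_open: "open (cmap c ` cdom c)"
  using is_chart by (auto simp: is_chart_def)

lemma cinv_cmap [simp]: "p \<in> cdom c \<Longrightarrow> cinv c (cmap c p) = p"
  using chart_homeo by (auto simp: homeomorphism_def)

lemma cmap_cinv: "x \<in> cmap c ` cdom c \<Longrightarrow> cmap c (cinv c x) = x"
  by (auto simp: )

lemma cinv_in: "x \<in> cmap c ` U \<Longrightarrow> U \<subseteq> cdom c \<Longrightarrow> cinv c x \<in> U"
  by (auto simp: subset_iff)

lemma cmap_continuous: "continuous_on (cdom c) (cmap c)"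
  and cinv_continuous: "continuous_on (cmap c ` cdom c) (cinv c)"
  using chart_homeo by (auto simp: homeomorphism_def)

lemma cmap_image_eq: "U \<subseteq> cdom c \<Longrightarrow> cmap c ` U = cmap c ` cdom c \<inter> cinv c -` U"
  by (force simp: subset_iff image_iff)

lemma cmap_open: "open U \<Longrightarrow> U \<subseteq> cdom c \<Longrightarrow> open (cmap c ` U)"
  using cmap_image_eq cinv_continuous cimage_open continuous_on_open_vimage by (metis Int_commute)

lemma cinv_open:
  assumes "open V" "V \<subseteq> cmap c ` cdom c"
  shows "open (cinv c ` V)"
proof -
  have "cinv c ` V = cdom c \<inter> cmap c -` V"
  proof (intro set_eqI iffI)
    fix p assume "p \<in> cdom c \<inter> cmap c -` V"
    then show "p \<in> cinv c ` V" by (intro image_eqI[of _ _ "cmap c p"]) auto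
  qed (use assms(2) in auto)
  then show ?thesis
    using cmap_continuous cdom_open assms(1) continuous_on_open_vimage by (metis Int_commute)
qed

lemma local_metric: "local_metric (cmap c ` cdom c) (g c)"
proof
  show "posdef (g c x)" if "x \<in> cmap c ` cdom c" for x
    using metric c that unfolding riemannian_metric_def posdef_def by blast
  show "Ck_on k (cmap c ` cdom c) (g c)" for k
    using metric c unfolding riemannian_metric_def by blast
qed (rule cimage_open)

lemma local_metric_on: "open U \<Longrightarrow> U \<subseteq> cdom c \<Longrightarrow> local_metric (cmap c ` U) (g c)"
  by (rule local_metric.local_metric_subset[OF local_metric cmap_open]) auto

end

lemma transition_Ck:
  assumes "c \<in> A" "d \<in> A"
  shows "Ck_on k (cmap c ` (cdom c \<inter> cdom d)) (cmap d \<circ> cinv c)"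
  using atlas assms by (simp add: smooth_atlas_def)

lemma chart_change:
  assumes c: "c \<in> A" and d: "d \<in> A" and U: "open U" "U \<subseteq> cdom c" "U \<subseteq> cdom d"
  shows "chart_change (cmap c ` U) (g c) (cmap d ` U) (g d) (cmap d \<circ> cinv c)"
proof -
  interpret s: local_metric "cmap c ` U" "g c" using local_metric_on[OF c] U by simp
  interpret t: local_metric "cmap d ` U" "g d" using local_metric_on[OF d] U by simp
  let ?\<phi> = "cmap d \<circ> cinv c"
  have C: "Ck_on k (cmap c ` U) ?\<phi>" for k
    by (rule Ck_on_subset[OF transition_Ck[OF c d]]) (use U in auto)
  show ?thesis
  proof
    show "Ck_on k (cmap c ` U) ?\<phi>" for k by (rule C)
    show "?\<phi> x \<in> cmap d ` U" if "x \<in> cmap c ` U" for x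
      using cinv_in[OF c that] U by simp
    fix x i j assume "x \<in> cmap c ` U"
    then obtain p where p: "p \<in> U" "x = cmap c p" by auto
    have pp: "p \<in> cdom c \<inter> cdom d" using p U by auto
    have "axis i 1 \<bullet> (g c (cmap c p) *v axis j 1)
        = frechet_derivative ?\<phi> (at (cmap c p)) (axis i 1) \<bullet> (g d (cmap d p) *v frechet_derivative ?\<phi> (at (cmap c p)) (axis j 1))"
      using metric c d pp unfolding riemannian_metric_def Let_def by blast
    then show "g c x $ i $ j = pd i ?\<phi> x \<bullet> (g d (?\<phi> x) *v pd j ?\<phi> x)"
      using pp c by (simp add: p pd_def matrix_vector_mult_basis column_def inner_axis' o_def)
  qed
qed

lemma transition_eq:
  assumes "c \<in> A" "d \<in> A" "U \<subseteq> cdom c" "U \<subseteq> cdom d" "x \<in> cmap c ` U"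
  shows "(b \<circ> cinv d) ((cmap d \<circ> cinv c) x) = (b \<circ> cinv c) x"
  using cinv_in[OF assms(1,5,3)] assms by auto

text \<open>Frees \<open>laplacian\<close> from the chart selected by \<open>chart_at\<close>: for a
  function of class C^2 near \<open>p\<close> any chart around \<open>p\<close> may be used.\<close>

lemma lap_chart:
  assumes c: "c \<in> A" "p \<in> cdom c" and U: "open U" "p \<in> U" and b: "Ck_open 2 A U b"
  shows "laplacian A g b p = lap (g c) (b \<circ> cinv c) (cmap c p)"
proof -
  let ?d = "chart_at A p"
  let ?U = "U \<inter> cdom c \<inter> cdom ?d"
  note d = chart_at[of p]
  have oU: "open ?U" using U cdom_open[OF c(1)] cdom_open[OF d(1)] by auto
  interpret chart_change "cmap c ` ?U" "g c" "cmap ?d ` ?U" "g ?d" "cmap ?d \<circ> cinv c"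
    by (rule chart_change[OF c(1) d(1) oU]) auto
  have x: "cmap c p \<in> cmap c ` ?U" using c d U by auto
  have "Ck_on 2 (cmap ?d ` (cdom ?d \<inter> U)) (b \<circ> cinv ?d)" using b d by (simp add: Ck_open_def)
  then have "Ck_on 2 (cmap ?d ` ?U) (b \<circ> cinv ?d)" by (rule Ck_on_subset) auto
  from lap_pullback[OF this x]
  have "lap (g c) (\<lambda>x. (b \<circ> cinv ?d) ((cmap ?d \<circ> cinv c) x)) (cmap c p) = laplacian A g b p"
    using c d by (simp add: laplacian_def lap_def Let_def)
  moreover have "lap (g c) (\<lambda>x. (b \<circ> cinv ?d) ((cmap ?d \<circ> cinv c) x)) (cmap c p) = lap (g c) (b \<circ> cinv c) (cmap c p)"
    by (rule lap_cong[OF src.open_S x], rule transition_eq[OF c(1) d(1)]) auto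
  ultimately show ?thesis by simp
qed

text \<open>Polarized form of \<open>grad_norm_sq\<close>; mixed products arise when a partition of
  unity is differentiated.\<close>

definition gip :: "('a \<Rightarrow> real) \<Rightarrow> ('a \<Rightarrow> real) \<Rightarrow> 'a \<Rightarrow> real" where
  "gip a b p = (let c = chart_at A p in grad_ip (g c) (a \<circ> cinv c) (b \<circ> cinv c) (cmap c p))"

lemma gip_chart:
  assumes c: "c \<in> A" "p \<in> cdom c" and U: "open U" "p \<in> U" and ab: "Ck_open 1 A U a" "Ck_open 1 A U b"
  shows "gip a b p = grad_ip (g c) (a \<circ> cinv c) (b \<circ> cinv c) (cmap c p)"
proof -
  let ?d = "chart_at A p"
  let ?U = "U \<inter> cdom c \<inter> cdom ?d"
  note d = chart_at[of p]
  have oU: "open ?U" using U cdom_open[OF c(1)] cdom_open[OF d(1)] by auto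
  interpret chart_change "cmap c ` ?U" "g c" "cmap ?d ` ?U" "g ?d" "cmap ?d \<circ> cinv c"
    by (rule chart_change[OF c(1) d(1) oU]) auto
  have x: "cmap c p \<in> cmap c ` ?U" using c d U by auto
  have y: "(cmap ?d \<circ> cinv c) (cmap c p) = cmap ?d p" using c by simp
  have "(f \<circ> cinv ?d) differentiable (at (cmap ?d p))" if "Ck_open 1 A U f" for f
  proof -
    have "Ck_on 1 (cmap ?d ` (cdom ?d \<inter> U)) (f \<circ> cinv ?d)" using that d by (simp add: Ck_open_def)
    then show ?thesis by (rule Ck_on_differentiable) (use d U in auto)
  qed
  then have "grad_ip (g c) (\<lambda>x. (a \<circ> cinv ?d) ((cmap ?d \<circ> cinv c) x)) (\<lambda>x. (b \<circ> cinv ?d) ((cmap ?d \<circ> cinv c) x)) (cmap c p) = gip a b p"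
    using grad_ip_pullback[OF x, of "a \<circ> cinv ?d" "b \<circ> cinv ?d"] ab unfolding y gip_def Let_def by blast
  moreover have "grad_ip (g c) (\<lambda>x. (a \<circ> cinv ?d) ((cmap ?d \<circ> cinv c) x)) (\<lambda>x. (b \<circ> cinv ?d) ((cmap ?d \<circ> cinv c) x)) (cmap c p)
     = grad_ip (g c) (a \<circ> cinv c) (b \<circ> cinv c) (cmap c p)"
    by (rule grad_ip_cong[OF src.open_S x]; rule transition_eq[OF c(1) d(1)]) auto
  ultimately show ?thesis by simp
qed

lemma grad_norm_sq_gip: "grad_norm_sq A g u p = gip u u p"
proof -
  let ?c = "chart_at A p"
  let ?v = "gradient (g ?c) (u \<circ> cinv ?c) (cmap ?c p)"
  interpret local_metric "cmap ?c ` cdom ?c" "g ?c" by (rule local_metric[OF chart_at(1)])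
  have "cmap ?c p \<in> cmap ?c ` cdom ?c" using chart_at by blast
  then have "g ?c (cmap ?c p) *v ?v = (\<chi> i. pd i (u \<circ> cinv ?c) (cmap ?c p))"
    by (simp add: vec_eq_iff matrix_vector_mult_def G_gradient)
  then show ?thesis
    by (simp add: grad_norm_sq_def gip_def Let_def grad_ip_def inner_vec_def)
qed

end

section \<open>Change of variables over an arbitrary finite index type\<close>

text \<open>The library theorem needs a well-ordered index type; \<open>'a wo\<close> is a well-ordered copy of \<open>'a\<close>.\<close>

typedef ('a::finite) wo = "UNIV :: 'a set" by simp

instance wo :: (finite) finite
proof
  have "UNIV = range (Abs_wo :: 'a \<Rightarrow> 'a wo)" by (metis Rep_wo_inverse surjI)
  moreover have "finite (range (Abs_wo :: 'a \<Rightarrow> 'a wo))" by simp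
  ultimately show "finite (UNIV :: 'a wo set)" by metis
qed

instantiation wo :: (finite) wellorder
begin

definition less_eq_wo :: "'a wo \<Rightarrow> 'a wo \<Rightarrow> bool" where
  "less_eq_wo x y \<longleftrightarrow> to_nat_on (UNIV :: 'a set) (Rep_wo x) \<le> to_nat_on (UNIV :: 'a set) (Rep_wo y)"

definition less_wo :: "'a wo \<Rightarrow> 'a wo \<Rightarrow> bool" where
  "less_wo x y \<longleftrightarrow> to_nat_on (UNIV :: 'a set) (Rep_wo x) < to_nat_on (UNIV :: 'a set) (Rep_wo y)"

instance
proof
  fix x y :: "'a wo"
  show "x \<le> y \<Longrightarrow> y \<le> x \<Longrightarrow> x = y"
    using inj_on_to_nat_on[of "UNIV :: 'a set"]
    by (auto simp: less_eq_wo_def inj_on_def Rep_wo_inject countable_finite)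
next
  fix P :: "'a wo \<Rightarrow> bool" and a :: "'a wo"
  assume *: "\<And>x. (\<And>y. y < x \<Longrightarrow> P y) \<Longrightarrow> P x"
  show "P a"
    by (induction a rule: measure_induct_rule[of "\<lambda>x. to_nat_on (UNIV :: 'a set) (Rep_wo x)"])
       (rule *, simp add: less_wo_def)
qed (auto simp: less_eq_wo_def less_wo_def)

end

lemma Basis_real_vec: "(Basis :: (real^'n::finite) set) = range (\<lambda>i. axis i 1)"
  by (auto simp: Basis_vec_def)

lemma prod_Basis_real_vec: "(\<Prod>b\<in>(Basis :: (real^'n::finite) set). f b) = (\<Prod>i\<in>UNIV. f (axis i 1))"
  unfolding Basis_real_vec by (subst prod.reindex) (auto simp: inj_on_def axis_eq_axis)

definition from_wo :: "real^('m::finite) wo \<Rightarrow> real^'m" where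
  "from_wo w = (\<chi> i. w $ Abs_wo i)"

definition to_wo :: "real^'m::finite \<Rightarrow> real^'m wo" where
  "to_wo v = (\<chi> i. v $ Rep_wo i)"

lemma from_to_wo [simp]: "from_wo (to_wo v) = v" "to_wo (from_wo w) = w"
  by (auto simp: from_wo_def to_wo_def vec_eq_iff Abs_wo_inverse Rep_wo_inverse)

lemma linear_wo: "linear from_wo" "linear to_wo"
  by (auto intro!: linearI simp: from_wo_def to_wo_def vec_eq_iff)

lemma bounded_linear_wo: "bounded_linear from_wo" "bounded_linear to_wo"
  using linear_wo linear_conv_bounded_linear by auto

lemma borel_measurable_wo [measurable]: "from_wo \<in> borel_measurable borel" "to_wo \<in> borel_measurable borel"
  by (intro borel_measurable_continuous_onI linear_continuous_on bounded_linear_wo)+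

text \<open>Renaming coordinates maps boxes to boxes with the same side lengths, and boxes
  characterize Lebesgue measure.\<close>

lemma lborel_from_wo: "distr lborel borel (from_wo :: real^('m::finite) wo \<Rightarrow> real^'m) = lborel"
proof (rule lborel_eqI[symmetric])
  fix l u :: "real^'m" assume lu: "\<And>b. b \<in> Basis \<Longrightarrow> l \<bullet> b \<le> u \<bullet> b"
  have le: "l $ i \<le> u $ i" for i using lu[of "axis i 1"] by (simp add: inner_axis)
  have bij: "bij (Abs_wo :: 'm \<Rightarrow> 'm wo)"
    by (rule bijI') (auto simp: Abs_wo_inject intro: Rep_wo_inverse[symmetric])
  have sx: "(\<forall>i. P (Abs_wo i)) \<longleftrightarrow> (\<forall>j. P j)" for P :: "'m wo \<Rightarrow> bool" by (metis Rep_wo_inverse)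
  have "from_wo -` box l u = box (to_wo l) (to_wo u)"
  proof (intro set_eqI)
    fix w :: "real^'m wo"
    have "(\<forall>i. l $ i < w $ Abs_wo i \<and> w $ Abs_wo i < u $ i)
        \<longleftrightarrow> (\<forall>j. l $ Rep_wo j < w $ j \<and> w $ j < u $ Rep_wo j)"
      by (subst sx[symmetric]) (simp add: Abs_wo_inverse)
    then show "w \<in> from_wo -` box l u \<longleftrightarrow> w \<in> box (to_wo l) (to_wo u)"
      by (simp add: mem_box_cart from_wo_def to_wo_def)
  qed
  then have "emeasure (distr lborel borel from_wo) (box l u) = emeasure lborel (box (to_wo l) (to_wo u))"
    by (simp add: emeasure_distr)
  also have "\<dots> = (\<Prod>b\<in>Basis. (to_wo u - to_wo l) \<bullet> b)"
    by (rule emeasure_lborel_box) (auto simp: Basis_real_vec inner_axis to_wo_def le)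
  also have "(\<Prod>b\<in>Basis. (to_wo u - to_wo l) \<bullet> b) = (\<Prod>j\<in>UNIV. u $ Rep_wo j - l $ Rep_wo j)"
    by (simp add: prod_Basis_real_vec inner_axis to_wo_def)
  also have "\<dots> = (\<Prod>i\<in>UNIV. u $ i - l $ i)"
    using prod.reindex_bij_betw[OF bij, of "\<lambda>j. u $ Rep_wo j - l $ Rep_wo j"] by (simp add: Abs_wo_inverse)
  also have "\<dots> = (\<Prod>b\<in>Basis. (u - l) \<bullet> b)"
    by (simp add: prod_Basis_real_vec inner_axis)
  finally show "emeasure (distr lborel borel from_wo) (box l u) = (\<Prod>b\<in>Basis. (u - l) \<bullet> b)" .
qed simp

lemma borel_preimage:
  fixes \<psi> :: "'a::topological_space \<Rightarrow> 'b::topological_space"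
  assumes "S \<in> sets borel" "continuous_on S \<psi>" "B \<in> sets borel"
  shows "{x \<in> S. \<psi> x \<in> B} \<in> sets borel"
proof -
  have "\<psi> \<in> measurable (restrict_space borel S) borel"
    by (rule borel_measurable_continuous_on_restrict[OF assms(2)])
  from measurable_sets[OF this assms(3)] show ?thesis
    using assms(1) by (auto simp: space_restrict_space sets_restrict_space_iff Int_def vimage_def conj_commute)
qed

text \<open>Boundedness gives \<open>B\<close> finite measure, so that the Henstock-Kurzweil
  integral of the Jacobian can be converted into a nonnegative Lebesgue integral.\<close>

lemma emeasure_image_wo:
  fixes \<psi> :: "real^'m::{finite,wellorder} \<Rightarrow> real^'m::_"
  assumes "open U" and der: "\<And>x. x \<in> U \<Longrightarrow> (\<psi> has_derivative K x) (at x)" and "inj_on \<psi> U"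
    and B: "B \<in> sets borel" "bounded B" "B \<subseteq> \<psi> ` U"
  shows "emeasure lborel B = (\<integral>\<^sup>+x. ennreal \<bar>det (matrix (K x))\<bar> * indicator {x \<in> U. \<psi> x \<in> B} x \<partial>lborel)"
proof -
  let ?S = "{x \<in> U. \<psi> x \<in> B}"
  have im: "\<psi> ` ?S = B" using B by auto
  have "continuous_on U \<psi>"
    by (meson continuous_at_imp_continuous_on der has_derivative_continuous)
  then have "?S \<in> sets borel" using assms by (intro borel_preimage) auto
  then have S: "?S \<in> sets lebesgue" by simp
  have Bm: "B \<in> lmeasurable" using B by (intro bounded_set_imp_lmeasurable) auto
  have "((\<lambda>x. \<bar>det (matrix (K x))\<bar>) has_integral measure lebesgue B) ?S"
  proof (subst has_measure_differentiable_image[OF S, symmetric])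
    show "(\<psi> has_derivative K x) (at x within ?S)" if "x \<in> ?S" for x
      using der that has_derivative_at_withinI by blast
    show "inj_on \<psi> ?S" using assms(3) by (rule inj_on_subset) auto
  qed (simp add: im Bm)
  from nn_integral_has_integral_lebesgue'[OF _ this]
  have "(\<integral>\<^sup>+x. ennreal \<bar>det (matrix (K x))\<bar> * indicator ?S x \<partial>lborel) = ennreal (measure lebesgue B)"
    by simp
  also have "\<dots> = emeasure lborel B"
  proof -
    have "emeasure lborel B < \<infinity>" using B(2) by (rule emeasure_bounded_finite)
    then show ?thesis using B(1) by (simp add: emeasure_eq_ennreal_measure)
  qed
  finally show ?thesis by simp
qed

text \<open>Conjugation with \<open>from_wo\<close> and \<open>to_wo\<close> carries the situation
  to the well-ordered index type; the Jacobian determinant is unchanged because rows and columns are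
  renamed by the same bijection.\<close>

lemma emeasure_image:
  fixes \<psi> :: "real^'m::finite \<Rightarrow> real^'m"
  assumes U: "open U" and der: "\<And>x. x \<in> U \<Longrightarrow> (\<psi> has_derivative K x) (at x)" and inj: "inj_on \<psi> U"
    and B: "B \<in> sets borel" "bounded B" "B \<subseteq> \<psi> ` U"
    and meas: "(\<lambda>x. indicator U x * \<bar>det (matrix (K x))\<bar>) \<in> borel_measurable borel"
  shows "emeasure lborel B = (\<integral>\<^sup>+x. ennreal \<bar>det (matrix (K x))\<bar> * indicator {x \<in> U. \<psi> x \<in> B} x \<partial>lborel)"
proof -
  let ?\<psi> = "\<lambda>w. to_wo (\<psi> (from_wo w))" and ?K = "\<lambda>w v. to_wo (K (from_wo w) (from_wo v))"
  have "continuous_on U \<psi>"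
    by (meson continuous_at_imp_continuous_on der has_derivative_continuous)
  then have S: "{x \<in> U. \<psi> x \<in> B} \<in> sets borel" using U B by (intro borel_preimage) auto
  have img: "from_wo -` B = to_wo ` B" by (auto intro: image_eqI[of _ _ "from_wo _"])
  have detK: "det (matrix (?K w)) = det (matrix (K (from_wo w)))" if "from_wo w \<in> U" for w
  proof -
    have ax: "from_wo (axis j 1) = (axis (Rep_wo j) 1 :: real^'m)" for j :: "'m wo"
      by (auto simp: from_wo_def vec_eq_iff axis_def Abs_wo_inverse Rep_wo_inverse)
    have r: "range (Rep_wo :: 'm wo \<Rightarrow> 'm) = UNIV" by (metis Abs_wo_inverse UNIV_I surjI)
    have "det (matrix (K (from_wo w))) = (\<Prod>i\<in>- range (Rep_wo :: 'm wo \<Rightarrow> 'm). 1)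
        * det (\<chi> a b. matrix (K (from_wo w)) $ Rep_wo a $ Rep_wo b)"
      by (rule det_embed) (auto simp: inj_on_def Rep_wo_inject r)
    also have "(\<chi> a b. matrix (K (from_wo w)) $ Rep_wo a $ Rep_wo b) = matrix (?K w)"
      by (auto simp: matrix_def vec_eq_iff ax to_wo_def)
    finally show ?thesis by (simp add: r)
  qed
  have "emeasure lborel B = emeasure (distr lborel borel from_wo) B" by (simp add: lborel_from_wo)
  also have "\<dots> = emeasure lborel (from_wo -` B)" using B by (simp add: emeasure_distr)
  also have "\<dots> = (\<integral>\<^sup>+w. ennreal \<bar>det (matrix (?K w))\<bar> * indicator {w \<in> from_wo -` U. ?\<psi> w \<in> from_wo -` B} w \<partial>lborel)"
  proof (rule emeasure_image_wo)
    show "open (from_wo -` U)"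
      using U bounded_linear_wo(1) by (intro open_vimage linear_continuous_on)
    show "(?\<psi> has_derivative ?K w) (at w)" if "w \<in> from_wo -` U" for w
    proof -
      have "(from_wo has_derivative from_wo) (at w)" by (rule bounded_linear_imp_has_derivative[OF bounded_linear_wo(1)])
      from has_derivative_compose[OF this der] that
      have "((\<lambda>w. \<psi> (from_wo w)) has_derivative (\<lambda>v. K (from_wo w) (from_wo v))) (at w)" by simp
      then show ?thesis by (rule bounded_linear.has_derivative[OF bounded_linear_wo(2)])
    qed
    show "inj_on ?\<psi> (from_wo -` U)"
      by (rule inj_onI) (metis from_to_wo inj inj_onD vimageE)
    show "from_wo -` B \<in> sets borel" using measurable_sets[OF borel_measurable_wo(1) B(1)] by simp
    show "bounded (from_wo -` B)" unfolding img using B(2) bounded_linear_wo(2) by (rule bounded_linear_image)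
    show "from_wo -` B \<subseteq> ?\<psi> ` from_wo -` U"
    proof
      fix w assume "w \<in> from_wo -` B"
      then obtain x where "x \<in> U" "from_wo w = \<psi> x" using B by auto
      then show "w \<in> ?\<psi> ` from_wo -` U"
        by (intro image_eqI[of _ _ "to_wo x"]) (auto, metis from_to_wo(2))
    qed
  qed
  also have "\<dots> = (\<integral>\<^sup>+w. ennreal \<bar>det (matrix (K (from_wo w)))\<bar> * indicator {x \<in> U. \<psi> x \<in> B} (from_wo w) \<partial>lborel)"
    by (rule nn_integral_cong) (auto simp: indicator_def detK)
  also have "\<dots> = (\<integral>\<^sup>+w. ennreal (indicator U (from_wo w) * \<bar>det (matrix (K (from_wo w)))\<bar>) * indicator {x \<in> U. \<psi> x \<in> B} (from_wo w) \<partial>lborel)"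
    by (rule nn_integral_cong) (auto simp: indicator_def)
  also have "\<dots> = (\<integral>\<^sup>+x. ennreal (indicator U x * \<bar>det (matrix (K x))\<bar>) * indicator {x \<in> U. \<psi> x \<in> B} x \<partial>distr lborel borel from_wo)"
    using meas S by (subst nn_integral_distr) auto
  also have "\<dots> = (\<integral>\<^sup>+x. ennreal \<bar>det (matrix (K x))\<bar> * indicator {x \<in> U. \<psi> x \<in> B} x \<partial>lborel)"
    unfolding lborel_from_wo by (rule nn_integral_cong) (auto simp: indicator_def)
  finally show ?thesis .
qed

text \<open>As an equality of measures the change of variables also covers sets of infinite measure
  and both kinds of integrals. Outside \<open>U\<close> the map takes the value 0; the density
  vanishes there, so this value carries no mass.\<close>

lemma distr_image:
  fixes \<psi> :: "real^'m::finite \<Rightarrow> real^'m"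
  assumes U: "open U" and der: "\<And>x. x \<in> U \<Longrightarrow> (\<psi> has_derivative K x) (at x)" and inj: "inj_on \<psi> U"
    and im: "open (\<psi> ` U)" and cont: "continuous_on U (\<lambda>x. \<bar>det (matrix (K x))\<bar>)"
  shows "density lborel (indicator (\<psi> ` U))
    = distr (density lborel (\<lambda>x. ennreal (indicator U x * \<bar>det (matrix (K x))\<bar>))) borel (\<lambda>x. indicator U x *\<^sub>R \<psi> x)"
proof (rule measure_eqI)
  have meas: "(\<lambda>x. indicator U x * \<bar>det (matrix (K x))\<bar>) \<in> borel_measurable borel"
    using borel_measurable_continuous_on_indicator[of U "\<lambda>x. \<bar>det (matrix (K x))\<bar>"] U cont
    by simp
  have c: "continuous_on U \<psi>"
    by (meson continuous_at_imp_continuous_on der has_derivative_continuous)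
  have \<psi>m: "(\<lambda>x. indicator U x *\<^sub>R \<psi> x) \<in> borel_measurable borel"
    using borel_measurable_continuous_on_indicator[of U \<psi>] U c by simp
  let ?R = "distr (density lborel (\<lambda>x. ennreal (indicator U x * \<bar>det (matrix (K x))\<bar>))) borel (\<lambda>x. indicator U x *\<^sub>R \<psi> x)"
  fix B assume "B \<in> sets (density lborel (indicator (\<psi> ` U)))"
  then have B: "B \<in> sets borel" by simp
  \<comment> \<open>Bounded pieces to which \<open>emeasure_image\<close> applies; they exhaust the
    part of \<open>B\<close> inside the image of \<open>U\<close>.\<close>
  define C where "C n = B \<inter> \<psi> ` U \<inter> cball 0 (real n)" for n
  have C: "C n \<in> sets borel" "bounded (C n)" "C n \<subseteq> \<psi> ` U" for n
    using B im by (auto simp: C_def bounded_Int)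
  have eR: "emeasure ?R X = (\<integral>\<^sup>+x. ennreal \<bar>det (matrix (K x))\<bar> * indicator {x \<in> U. \<psi> x \<in> X} x \<partial>lborel)"
    if "X \<in> sets borel" for X
  proof -
    have "emeasure ?R X = (\<integral>\<^sup>+x. ennreal (indicator U x * \<bar>det (matrix (K x))\<bar>) * indicator ((\<lambda>x. indicator U x *\<^sub>R \<psi> x) -` X) x \<partial>lborel)"
      using that meas \<psi>m measurable_sets[OF \<psi>m that] by (simp add: emeasure_distr emeasure_density)
    also have "\<dots> = (\<integral>\<^sup>+x. ennreal \<bar>det (matrix (K x))\<bar> * indicator {x \<in> U. \<psi> x \<in> X} x \<partial>lborel)"
      by (rule nn_integral_cong) (auto simp: indicator_def)
    finally show ?thesis .
  qed
  have eqC: "emeasure lborel (C n) = emeasure ?R (C n)" for n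
    unfolding eR[OF C(1)] by (rule emeasure_image[OF U der inj C meas])
  have inc: "incseq C" by (auto simp: C_def incseq_def subset_iff)
  have un: "(\<Union>n. C n) = B \<inter> \<psi> ` U"
    using real_arch_simple by (auto simp: C_def)
  have "emeasure (density lborel (indicator (\<psi> ` U))) B = emeasure lborel (B \<inter> \<psi> ` U)"
    using B im by (simp add: emeasure_density nn_integral_indicator flip: indicator_inter_arith Int_commute)
  also have "\<dots> = (SUP n. emeasure lborel (C n))"
    unfolding un[symmetric] by (rule SUP_emeasure_incseq[symmetric]) (use C inc in auto)
  also have "\<dots> = (SUP n. emeasure ?R (C n))" by (simp add: eqC)
  also have "\<dots> = emeasure ?R (B \<inter> \<psi> ` U)"
    unfolding un[symmetric] by (rule SUP_emeasure_incseq) (use C inc in auto)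
  also have "\<dots> = emeasure ?R B"
    using B im by (subst (1 2) eR) (auto intro!: nn_integral_cong simp: indicator_def)
  finally show "emeasure (density lborel (indicator (\<psi> ` U))) B = emeasure ?R B" .
qed simp

lemma integral_image:
  fixes \<psi> :: "real^'m::finite \<Rightarrow> real^'m" and f :: "real^'m \<Rightarrow> real"
  assumes U: "open U" and der: "\<And>x. x \<in> U \<Longrightarrow> (\<psi> has_derivative K x) (at x)" and inj: "inj_on \<psi> U"
    and im: "open (\<psi> ` U)" and cont: "continuous_on U (\<lambda>x. \<bar>det (matrix (K x))\<bar>)"
    and f: "(\<lambda>y. indicator (\<psi> ` U) y * f y) \<in> borel_measurable borel"
  shows "(LINT y:\<psi> ` U|lborel. f y) = (LINT x:U|lborel. \<bar>det (matrix (K x))\<bar> * f (\<psi> x))"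
proof -
  let ?f = "\<lambda>y. indicator (\<psi> ` U) y * f y"
  have meas: "(\<lambda>x. indicator U x * \<bar>det (matrix (K x))\<bar>) \<in> borel_measurable borel"
    using borel_measurable_continuous_on_indicator[of U "\<lambda>x. \<bar>det (matrix (K x))\<bar>"] U cont
    by simp
  have c: "continuous_on U \<psi>"
    by (meson continuous_at_imp_continuous_on der has_derivative_continuous)
  have \<psi>m: "(\<lambda>x. indicator U x *\<^sub>R \<psi> x) \<in> borel_measurable borel"
    using borel_measurable_continuous_on_indicator[of U \<psi>] U c by simp
  have "(LINT y:\<psi> ` U|lborel. f y) = integral\<^sup>L (density lborel (indicator (\<psi> ` U))) ?f"
  proof -
    have "integral\<^sup>L (density lborel (\<lambda>x. ennreal (indicator (\<psi> ` U) x))) ?f = integral\<^sup>L lborel (\<lambda>y. indicator (\<psi> ` U) y *\<^sub>R ?f y)"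
      using f im by (intro integral_density) auto
    also have "\<dots> = (LINT y:\<psi> ` U|lborel. f y)"
      unfolding set_lebesgue_integral_def by (rule Bochner_Integration.integral_cong) (auto simp: indicator_def)
    finally show ?thesis by (simp add: ennreal_indicator)
  qed
  also have "\<dots> = integral\<^sup>L (density lborel (\<lambda>x. ennreal (indicator U x * \<bar>det (matrix (K x))\<bar>))) (\<lambda>x. ?f (indicator U x *\<^sub>R \<psi> x))"
  proof -
    have "integral\<^sup>L (density lborel (indicator (\<psi> ` U))) ?f
        = integral\<^sup>L (distr (density lborel (\<lambda>x. ennreal (indicator U x * \<bar>det (matrix (K x))\<bar>))) borel (\<lambda>x. indicator U x *\<^sub>R \<psi> x)) ?f"
      by (simp only: distr_image[OF U der inj im cont])
    also have "\<dots> = integral\<^sup>L (density lborel (\<lambda>x. ennreal (indicator U x * \<bar>det (matrix (K x))\<bar>))) (\<lambda>x. ?f (indicator U x *\<^sub>R \<psi> x))"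
      by (rule integral_distr) (use f \<psi>m in auto)
    finally show ?thesis .
  qed
  also have "\<dots> = integral\<^sup>L lborel (\<lambda>x. (indicator U x * \<bar>det (matrix (K x))\<bar>) *\<^sub>R ?f (indicator U x *\<^sub>R \<psi> x))"
    using f \<psi>m meas by (intro integral_density measurable_compose[OF \<psi>m f]) auto
  also have "\<dots> = (LINT x:U|lborel. \<bar>det (matrix (K x))\<bar> * f (\<psi> x))"
    unfolding set_lebesgue_integral_def by (rule Bochner_Integration.integral_cong) (auto simp: indicator_def)
  finally show ?thesis .
qed

text \<open>Here \<psi> is only known to be continuous at \<open>x\<close>. Near \<psi> x the
  increments of \<open>h\<close> almost equal those of its argument, so the increments of \<psi> are
  first bounded by a multiple of |z - x| and then compared with those of the composition. The
  intended \<psi> is the transition between two parametrizations.\<close>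

lemma has_derivative_factor:
  fixes \<psi> :: "'a::real_normed_vector \<Rightarrow> 'b::real_normed_vector"
  assumes h: "(h has_derivative (\<lambda>v. v)) (at (\<psi> x))" and \<psi>: "isCont \<psi> x"
    and c: "((\<lambda>z. h (\<psi> z)) has_derivative M) (at x)"
  shows "(\<psi> has_derivative M) (at x)"
  unfolding has_derivative_at_alt
proof (intro conjI allI impI)
  show M: "bounded_linear M" using c by (rule has_derivative_bounded_linear)
  fix e :: real assume e: "e > 0"
  obtain C where C: "C > 0" "\<And>v. norm (M v) \<le> norm v * C"
    using bounded_linear.pos_bounded[OF M] by blast
  \<comment> \<open>The bound 1/2 lets the error of \<open>h\<close> be absorbed into the increment
    of \<psi>, which is then at most 2 (C + 1) |z - x|. The second bound makes the error itself at
    most (e / 2) |z - x|.\<close>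
  define e1 where "e1 = min (1/2) (e / (4 * (C + 1)))"
  define e2 where "e2 = min 1 (e / 2)"
  have e12: "e1 > 0" "e2 > 0" "e1 \<le> 1/2" "e2 \<le> 1" "e2 \<le> e / 2"
    using e C(1) min.cobounded1[of "1/2" "e / (4 * (C + 1))"] unfolding e1_def e2_def by auto
  have e1': "e1 * (2 * (C + 1)) \<le> e / 2"
  proof -
    have "e1 * (2 * (C + 1)) \<le> (e / (4 * (C + 1))) * (2 * (C + 1))"
      using C by (intro mult_right_mono) (auto simp: e1_def)
    also have "\<dots> = e / 2" using C by (simp add: field_simps)
    finally show ?thesis .
  qed
  obtain d1 where d1: "d1 > 0" "\<And>y. norm (y - \<psi> x) < d1 \<Longrightarrow> norm (h y - h (\<psi> x) - (y - \<psi> x)) \<le> e1 * norm (y - \<psi> x)"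
    using h e12 unfolding has_derivative_at_alt by blast
  obtain d2 where d2: "d2 > 0" "\<And>z. norm (z - x) < d2 \<Longrightarrow> norm (\<psi> z - \<psi> x) < d1"
    using \<psi> d1(1) unfolding continuous_at_eps_delta dist_norm by blast
  obtain d3 where d3: "d3 > 0" "\<And>z. norm (z - x) < d3 \<Longrightarrow> norm (h (\<psi> z) - h (\<psi> x) - M (z - x)) \<le> e2 * norm (z - x)"
    using c e12 unfolding has_derivative_at_alt by blast
  show "\<exists>d>0. \<forall>y. norm (y - x) < d \<longrightarrow> norm (\<psi> y - \<psi> x - M (y - x)) \<le> e * norm (y - x)"
  proof (intro exI[of _ "min d2 d3"] conjI allI impI)
    fix z assume z: "norm (z - x) < min d2 d3"
    let ?a = "norm (\<psi> z - \<psi> x)" and ?r = "norm (z - x)"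
    let ?P = "h (\<psi> z) - h (\<psi> x)"
    have 1: "norm (?P - (\<psi> z - \<psi> x)) \<le> e1 * ?a" using d1 d2 z by auto
    have 2: "norm (?P - M (z - x)) \<le> e2 * ?r" using d3 z by auto
    have "norm ?P \<le> norm (M (z - x)) + e2 * ?r" using 2 norm_triangle_sub[of ?P "M (z - x)"] by simp
    also have "\<dots> \<le> (C + 1) * ?r"
      using C(2)[of "z - x"] mult_right_mono[OF e12(4), of ?r] by (simp add: algebra_simps)
    finally have P: "norm ?P \<le> (C + 1) * ?r" .
    have "?a \<le> norm ?P + e1 * ?a"
      using 1 norm_triangle_sub[of "\<psi> z - \<psi> x" ?P] by (simp add: norm_minus_commute)
    moreover have "e1 * ?a \<le> (1/2) * ?a" using e12 by (intro mult_right_mono) auto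
    ultimately have a: "?a \<le> 2 * (C + 1) * ?r" using P by (simp add: algebra_simps)
    have "\<psi> z - \<psi> x - M (z - x) = (?P - M (z - x)) - (?P - (\<psi> z - \<psi> x))" by simp
    then have "norm (\<psi> z - \<psi> x - M (z - x)) \<le> norm (?P - M (z - x)) + norm (?P - (\<psi> z - \<psi> x))"
      by (metis norm_triangle_ineq4)
    also have "\<dots> \<le> e2 * ?r + e1 * ?a" using 1 2 by simp
    also have "\<dots> \<le> (e / 2) * ?r + e1 * (2 * (C + 1) * ?r)"
      using e12 a by (intro add_mono mult_right_mono mult_left_mono) auto
    also have "\<dots> \<le> (e / 2) * ?r + (e / 2) * ?r"
      using mult_right_mono[OF e1', of ?r] by (simp add: mult.assoc)
    finally show "norm (\<psi> z - \<psi> x - M (z - x)) \<le> e * ?r" by simp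
  qed (use d2 d3 in auto)
qed

section \<open>The Riemannian measure of an embedded submanifold\<close>

definition param_density :: "('a, 'n::finite) tensor2 \<Rightarrow> ('a, 'n) chart \<Rightarrow> (real^'m::finite \<Rightarrow> 'a) \<Rightarrow> real^'m \<Rightarrow> real" where
  "param_density g c F x = sqrt (det (induced_metric g c F x))"

text \<open>Outside \<open>W\<close> the map is \<open>undefined\<close>; the density contains the
  indicator of \<open>W\<close>, so this value receives no mass.\<close>

definition param_measure :: "('a::topological_space, 'n::finite) tensor2 \<Rightarrow> ('a, 'n) chart \<Rightarrow> (real^'m::finite) set
    \<Rightarrow> (real^'m \<Rightarrow> 'a) \<Rightarrow> 'a measure" where
  "param_measure g c W F = distr (density lborel (\<lambda>x. ennreal (indicator W x * param_density g c F x))) borel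
     (\<lambda>x. if x \<in> W then F x else undefined)"

lemma homeomorphism_preimage_open:
  assumes "open W" "homeomorphism W (F ` W) F G" "F ` W \<subseteq> S" "openin (top_of_set S) T"
  shows "open {x \<in> W. F x \<in> T}"
proof -
  obtain T' where T': "open T'" "T = S \<inter> T'" using assms(4) by (auto simp: openin_open)
  have "{x \<in> W. F x \<in> T} = F -` T' \<inter> W" using assms(3) T' by auto
  moreover have "continuous_on W F" using assms(2) by (simp add: homeomorphism_def)
  ultimately show ?thesis using T' assms(1) by (simp add: continuous_on_open_vimage)
qed

context riemannian_manifold
begin

context
  fixes S c W and F :: "real^'m::finite \<Rightarrow> 'a"
  assumes param: "local_parametrization A S c W F"
begin

lemma param_chart: "c \<in> A"
  and param_open: "open W"
  and param_Ck: "Ck_on 1 W (cmap c \<circ> F)"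
  and param_homeo: "homeomorphism W (F ` W) F (inv_into W F)"
  and param_openin: "openin (top_of_set S) (F ` W)"
  and param_in: "x \<in> W \<Longrightarrow> F x \<in> S" "x \<in> W \<Longrightarrow> F x \<in> cdom c"
  using param by (auto simp: local_parametrization_def)

lemma param_inj: "inj_on F W"
  using param_homeo by (metis homeomorphism_apply1 inj_on_inverseI)

lemma param_continuous: "continuous_on W F"
  using param_homeo by (simp add: homeomorphism_def)

lemma param_differentiable: "x \<in> W \<Longrightarrow> (cmap c \<circ> F) differentiable (at x)"
  using Ck_on_differentiable[OF param_Ck] by simp

abbreviation (input) "pmat x \<equiv> (\<chi> i a. pd a (cmap c \<circ> F) x $ i) :: real^'m^'n"

lemma param_derivative: "x \<in> W \<Longrightarrow> frechet_derivative (cmap c \<circ> F) (at x) v = pmat x *v v"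
  by (simp add: frechet_derivative_eq_pd param_differentiable vec_eq_iff matrix_vector_mult_def mult.commute)

lemma param_gram: "induced_metric g c F x = transpose (pmat x) ** g c (cmap c (F x)) ** pmat x"
  by (simp add: vec_eq_iff gram_entry induced_metric_def column_def)

lemma param_posdef:
  assumes "x \<in> W" shows "posdef (induced_metric g c F x)"
  unfolding param_gram
proof (rule posdef_gram)
  show "posdef (g c (cmap c (F x)))"
    using local_metric.G_posdef[OF local_metric[OF param_chart]] param_in(2)[OF assms] by simp
  have "inj (frechet_derivative (cmap c \<circ> F) (at x))"
    using param assms by (simp add: local_parametrization_def)
  moreover have "frechet_derivative (cmap c \<circ> F) (at x) = (*v) (pmat x)"
    by (rule ext) (rule param_derivative[OF assms])
  ultimately show "inj ((*v) (pmat x))" by simp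
qed

lemma param_density_pos: "x \<in> W \<Longrightarrow> param_density g c F x > 0"
  using posdef_det_pos[OF param_posdef] by (simp add: param_density_def)

lemma param_density_continuous: "continuous_on W (param_density g c F)"
proof -
  have f: "continuous_on W (\<lambda>x. cmap c (F x))" using Ck_on_continuous[OF param_Ck] by (simp add: o_def)
  have p: "continuous_on W (\<lambda>x. pd a (cmap c \<circ> F) x)" for a
    using param_Ck by simp
  have "continuous_on (cmap c ` cdom c) (\<lambda>x. g c x $ i $ j)" for i j
    by (rule Ck_on_continuous[OF local_metric.G_entry_Ck[OF local_metric[OF param_chart]]])
  from continuous_on_compose2[OF this f]
  have gg: "continuous_on W (\<lambda>x. g c (cmap c (F x)) $ i $ j)" for i j
    using param_in(2) by blast
  have "continuous_on W (\<lambda>x. det (induced_metric g c F x))"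
    unfolding det_def induced_metric_def inner_matrix_sum
    by simp (intro continuous_intros p gg)
  then show ?thesis unfolding param_density_def[abs_def] by (rule continuous_on_real_sqrt)
qed

lemma param_density_measurable: "(\<lambda>x. indicator W x * param_density g c F x) \<in> borel_measurable borel"
  using borel_measurable_continuous_on_indicator[OF _ param_density_continuous] param_open by simp

lemma param_map_measurable: "(\<lambda>x. if x \<in> W then F x else undefined) \<in> borel_measurable borel"
  using param_open param_continuous by (intro borel_measurable_continuous_on_if) auto

lemma param_preimage: "B \<in> sets borel \<Longrightarrow> {x \<in> W. F x \<in> B} \<in> sets borel"
  using param_open param_continuous by (intro borel_preimage) auto

lemma emeasure_param_measure:
  assumes "B \<in> sets borel"
  shows "emeasure (param_measure g c W F) B = (\<integral>\<^sup>+x\<in>{x \<in> W. F x \<in> B}. ennreal (param_density g c F x) \<partial>lborel)"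
proof -
  note m = param_density_measurable param_map_measurable
  have "emeasure (param_measure g c W F) B
    = (\<integral>\<^sup>+x. ennreal (indicator W x * param_density g c F x) * indicator ((\<lambda>x. if x \<in> W then F x else undefined) -` B) x \<partial>lborel)"
    unfolding param_measure_def using m measurable_sets[OF m(2) assms] assms
    by (simp add: emeasure_distr emeasure_density)
  also have "\<dots> = (\<integral>\<^sup>+x\<in>{x \<in> W. F x \<in> B}. ennreal (param_density g c F x) \<partial>lborel)"
    by (rule nn_integral_cong) (auto simp: indicator_def)
  finally show ?thesis .
qed

end

text \<open>A left inverse \<open>L\<close> of the derivative of the second parametrization composes
  with it to a map whose derivative is the identity, so \<open>has_derivative_factor\<close> applies
  to \<psi>. The induced metrics are then congruent through the matrix of \<open>K\<close>, and
  square roots of determinants give the factor |det K|.\<close>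

lemma param_transition:
  fixes F1 F2 :: "real^'m::finite \<Rightarrow> 'a"
  assumes p1: "local_parametrization A S c1 W1 F1" and p2: "local_parametrization A S c2 W2 F2"
    and x: "x \<in> W1" "F1 x \<in> F2 ` W2"
  defines "\<psi> \<equiv> \<lambda>x. inv_into W2 F2 (F1 x)"
  shows "\<exists>K. (\<psi> has_derivative K) (at x)
    \<and> param_density g c1 F1 x = \<bar>det (matrix K)\<bar> * param_density g c2 F2 (\<psi> x)"
proof -
  let ?f1 = "cmap c1 \<circ> F1" and ?f2 = "cmap c2 \<circ> F2" and ?\<theta> = "cmap c2 \<circ> cinv c1"
  define O1 where "O1 = {x \<in> W1. F1 x \<in> F2 ` W2}"
  have O1: "open O1" "x \<in> O1"
    unfolding O1_def using x param_in(1)[OF p1]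
    by (auto intro: homeomorphism_preimage_open[OF param_open[OF p1] param_homeo[OF p1] _ param_openin[OF p2]])
  have \<psi>: "\<psi> z \<in> W2" "F2 (\<psi> z) = F1 z" if "z \<in> O1" for z
    using that by (auto simp: O1_def \<psi>_def f_inv_into_f inv_into_into)
  have cont: "continuous_on O1 \<psi>"
    unfolding \<psi>_def
    by (rule continuous_on_compose2[of "F2 ` W2" "inv_into W2 F2"])
       (use param_homeo[OF p2] continuous_on_subset[OF param_continuous[OF p1]] in \<open>auto simp: O1_def homeomorphism_def\<close>)
  note cA = param_chart[OF p1] param_chart[OF p2]
  let ?U = "cdom c1 \<inter> cdom c2"
  have oU: "open ?U" using cdom_open[OF cA(1)] cdom_open[OF cA(2)] by (rule open_Int)
  interpret chart_change "cmap c1 ` ?U" "g c1" "cmap c2 ` ?U" "g c2" ?\<theta>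
    by (rule chart_change[OF cA oU]) auto
  have F1U: "F1 z \<in> ?U" if "z \<in> O1" for z
    using \<psi>[OF that] param_in(2)[OF p2] param_in(2)[OF p1] that by (metis (lifting) IntI O1_def mem_Collect_eq)
  then have f1in: "?f1 z \<in> cmap c1 ` ?U" if "z \<in> O1" for z using that by auto
  have eq: "?f2 (\<psi> z) = ?\<theta> (?f1 z)" if "z \<in> O1" for z
    using \<psi>[OF that] F1U[OF that] cA by simp
  define D1 where "D1 = frechet_derivative ?f1 (at x)"
  define D2 where "D2 = frechet_derivative ?f2 (at (\<psi> x))"
  define J where "J = jac (?f1 x)"
  have D1: "(?f1 has_derivative D1) (at x)"
    using param_differentiable[OF p1 x(1)] by (simp add: D1_def frechet_derivative_works)
  have D2: "(?f2 has_derivative D2) (at (\<psi> x))"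
    using param_differentiable[OF p2 \<psi>(1)[OF O1(2)]] by (simp add: D2_def frechet_derivative_works)
  have D\<theta>: "(?\<theta> has_derivative (*v) J) (at (?f1 x))"
    unfolding J_def by (rule \<phi>_has_derivative[OF f1in[OF O1(2)]])
  have comp: "((\<lambda>z. ?\<theta> (?f1 z)) has_derivative (\<lambda>v. J *v D1 v)) (at x)"
    by (rule has_derivative_compose[OF D1 D\<theta>])
  have "inj D2" using p2 \<psi>(1)[OF O1(2)] by (simp add: D2_def local_parametrization_def)
  then obtain L where L: "linear L" "L \<circ> D2 = id"
    using linear_injective_left_inverse[OF has_derivative_linear[OF D2]] by blast
  have bL: "bounded_linear L" using L linear_conv_bounded_linear by blast
  have "((\<lambda>y. L (?f2 y)) has_derivative (\<lambda>v. L (D2 v))) (at (\<psi> x))"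
    by (rule bounded_linear.has_derivative[OF bL D2])
  moreover have "(\<lambda>v. L (D2 v)) = (\<lambda>v. v)" using L(2) by (auto simp: fun_eq_iff)
  ultimately have h: "((\<lambda>y. L (?f2 y)) has_derivative (\<lambda>v. v)) (at (\<psi> x))" by simp
  have "((\<lambda>z. L (?\<theta> (?f1 z))) has_derivative (\<lambda>v. L (J *v D1 v))) (at x)"
    by (rule bounded_linear.has_derivative[OF bL comp])
  then have hc: "((\<lambda>z. L (?f2 (\<psi> z))) has_derivative (\<lambda>v. L (J *v D1 v))) (at x)"
    by (rule has_derivative_transform_within_open[OF _ O1]) (simp add: eq del: o_apply)
  define K where "K = (\<lambda>v. L (J *v D1 v))"
  have isC: "isCont \<psi> x" using cont O1 by (simp add: continuous_on_eq_continuous_at)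
  have K: "(\<psi> has_derivative K) (at x)"
    unfolding K_def by (rule has_derivative_factor[OF h isC hc])
  have "((\<lambda>z. ?f2 (\<psi> z)) has_derivative (\<lambda>v. D2 (K v))) (at x)"
    by (rule has_derivative_compose[OF K D2])
  moreover have "((\<lambda>z. ?f2 (\<psi> z)) has_derivative (\<lambda>v. J *v D1 v)) (at x)"
    by (rule has_derivative_transform_within_open[OF comp O1]) (simp add: eq del: o_apply)
  ultimately have "(\<lambda>v. D2 (K v)) = (\<lambda>v. J *v D1 v)" by (rule has_derivative_unique)
  then have DK: "D2 (K v) = J *v D1 v" for v by meson
  let ?h1 = "induced_metric g c1 F1 x" and ?h2 = "induced_metric g c2 F2 (\<psi> x)" and ?M = "matrix K"
  let ?P = "(\<chi> i a. pd a ?f2 (\<psi> x) $ i)"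
  have D2v: "D2 v = ?P *v v" for v
    unfolding D2_def by (rule param_derivative[OF p2 \<psi>(1)[OF O1(2)]])
  have fx: "cmap c2 (F2 (\<psi> x)) = ?\<theta> (?f1 x)" using eq[OF O1(2)] by simp
  have colM: "column a ?M = K (axis a 1)" for a by (simp add: column_def matrix_def)
  have "?h1 $ a $ b = (transpose ?M ** ?h2 ** ?M) $ a $ b" for a b
  proof -
    have "?h1 $ a $ b = D1 (axis a 1) \<bullet> (g c1 (?f1 x) *v D1 (axis b 1))"
      by (simp add: induced_metric_def D1_def pd_def)
    also have "\<dots> = D2 (K (axis a 1)) \<bullet> (g c2 (cmap c2 (F2 (\<psi> x))) *v D2 (K (axis b 1)))"
      unfolding DK fx J_def by (rule jac_inner[OF f1in[OF O1(2)]])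
    also have "\<dots> = K (axis a 1) \<bullet> (?h2 *v K (axis b 1))"
      unfolding param_gram[OF p2] D2v
      by (simp add: matrix_vector_mul_assoc[symmetric] inner_matrix_transpose[of "K _" "transpose ?P"] del: transpose_matrix_vector)
    finally show ?thesis by (simp add: gram_entry colM)
  qed
  then have "?h1 = transpose ?M ** ?h2 ** ?M" by (simp add: vec_eq_iff)
  then have "det ?h1 = (det ?M)\<^sup>2 * det ?h2" by (simp add: det_mul det_transpose power2_eq_square)
  then have "param_density g c1 F1 x = \<bar>det ?M\<bar> * param_density g c2 F2 (\<psi> x)"
    by (simp add: param_density_def real_sqrt_mult)
  then show ?thesis using K by blast
qed

text \<open>Both measures are written as integrals over the overlap in the two parameter domains.
  The transition map changes variables, and the density rule of \<open>param_transition\<close>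
  absorbs its Jacobian.\<close>

lemma param_measure_consistent:
  fixes F1 F2 :: "real^'m::finite \<Rightarrow> 'a"
  assumes p1: "local_parametrization A S c1 W1 F1" and p2: "local_parametrization A S c2 W2 F2"
    and B: "B \<in> sets borel" "B \<subseteq> F1 ` W1" "B \<subseteq> F2 ` W2"
  shows "emeasure (param_measure g c1 W1 F1) B = emeasure (param_measure g c2 W2 F2) B"
proof -
  let ?\<rho>1 = "param_density g c1 F1" and ?\<rho>2 = "param_density g c2 F2"
  let ?\<psi> = "\<lambda>x. inv_into W2 F2 (F1 x)"
  define O1 where "O1 = {x \<in> W1. F1 x \<in> F2 ` W2}"
  have O1: "open O1"
    unfolding O1_def using param_in(1)[OF p1]
    by (auto intro: homeomorphism_preimage_open[OF param_open[OF p1] param_homeo[OF p1] _ param_openin[OF p2]])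
  have "open {y \<in> W2. F2 y \<in> F1 ` W1}"
    using param_in(1)[OF p2]
    by (auto intro: homeomorphism_preimage_open[OF param_open[OF p2] param_homeo[OF p2] _ param_openin[OF p1]])
  moreover have im: "?\<psi> ` O1 = {y \<in> W2. F2 y \<in> F1 ` W1}"
  proof (intro set_eqI iffI)
    fix y assume "y \<in> {y \<in> W2. F2 y \<in> F1 ` W1}"
    then obtain x where x: "y \<in> W2" "F2 y = F1 x" "x \<in> W1" by auto
    have "y = ?\<psi> x" using inv_into_f_f[OF param_inj[OF p2] x(1)] x(2) by simp
    moreover have "F1 x \<in> F2 ` W2" unfolding x(2)[symmetric] using x(1) by (rule imageI)
    ultimately show "y \<in> ?\<psi> ` O1" unfolding O1_def using x(3) by blast
  next
    fix y assume "y \<in> ?\<psi> ` O1"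
    then obtain x where x: "x \<in> W1" "F1 x \<in> F2 ` W2" "y = ?\<psi> x" by (auto simp: O1_def)
    have "y \<in> W2" "F2 y = F1 x" unfolding x(3) using x(2) by (rule inv_into_into, rule f_inv_into_f)
    moreover have "F1 x \<in> F1 ` W1" using x(1) by blast
    ultimately show "y \<in> {y \<in> W2. F2 y \<in> F1 ` W1}" by (metis (mono_tags) mem_Collect_eq)
  qed
  ultimately have O2: "open (?\<psi> ` O1)" by simp
  have "\<forall>x\<in>O1. \<exists>K. (?\<psi> has_derivative K) (at x) \<and> ?\<rho>1 x = \<bar>det (matrix K)\<bar> * ?\<rho>2 (?\<psi> x)"
    using param_transition[OF p1 p2] by (auto simp: O1_def)
  then obtain K where K: "\<And>x. x \<in> O1 \<Longrightarrow> (?\<psi> has_derivative K x) (at x)"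
      "\<And>x. x \<in> O1 \<Longrightarrow> ?\<rho>1 x = \<bar>det (matrix (K x))\<bar> * ?\<rho>2 (?\<psi> x)" by metis
  have \<psi>W: "?\<psi> x \<in> W2" "F2 (?\<psi> x) = F1 x" if "x \<in> O1" for x
    using that by (auto simp: O1_def f_inv_into_f inv_into_into)
  have cont: "continuous_on O1 ?\<psi>"
    by (intro continuous_at_imp_continuous_on ballI has_derivative_continuous[OF K(1)])
  \<comment> \<open>The derivatives \<open>K x\<close> were chosen pointwise; continuity of |det K|
    is recovered from the quotient of the two continuous densities.\<close>
  have "continuous_on O1 (\<lambda>x. ?\<rho>1 x / ?\<rho>2 (?\<psi> x))"
  proof (intro continuous_on_divide)
    show "continuous_on O1 ?\<rho>1"
      using param_density_continuous[OF p1] by (rule continuous_on_subset) (auto simp: O1_def)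
    show "continuous_on O1 (\<lambda>x. ?\<rho>2 (?\<psi> x))"
      using \<psi>W by (intro continuous_on_compose2[OF param_density_continuous[OF p2] cont]) auto
    show "\<forall>x\<in>O1. ?\<rho>2 (?\<psi> x) \<noteq> 0" using param_density_pos[OF p2] \<psi>W by (auto simp: less_le)
  qed
  then have cdet: "continuous_on O1 (\<lambda>x. \<bar>det (matrix (K x))\<bar>)"
    by (rule continuous_on_eq) (use K(2) \<psi>W param_density_pos[OF p2] in \<open>auto simp: less_le\<close>)
  have inj: "inj_on ?\<psi> O1"
    by (rule inj_onI) (metis (lifting) O1_def \<psi>W(2) inj_onD mem_Collect_eq param_inj[OF p1])
  let ?q = "\<lambda>y. ennreal (indicator W2 y * ?\<rho>2 y) * indicator {y \<in> W2. F2 y \<in> B} y"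
  have qm: "?q \<in> borel_measurable borel"
    using param_density_measurable[OF p2] param_preimage[OF p2 B(1)] by simp
  have dm: "(\<lambda>x. indicator O1 x * \<bar>det (matrix (K x))\<bar>) \<in> borel_measurable borel"
    using borel_measurable_continuous_on_indicator[OF _ cdet] O1 by simp
  have \<psi>m: "(\<lambda>x. indicator O1 x *\<^sub>R ?\<psi> x) \<in> borel_measurable borel"
    using borel_measurable_continuous_on_indicator[OF _ cont] O1 by simp
  have "emeasure (param_measure g c2 W2 F2) B = (\<integral>\<^sup>+y. indicator (?\<psi> ` O1) y * ?q y \<partial>lborel)"
    unfolding emeasure_param_measure[OF p2 B(1)] im
    by (rule nn_integral_cong) (use B in \<open>auto simp: indicator_def\<close>)
  also have "\<dots> = integral\<^sup>N (density lborel (indicator (?\<psi> ` O1))) ?q"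
    using O2 qm by (intro nn_integral_density[symmetric]) auto
  also have "\<dots> = integral\<^sup>N (distr (density lborel (\<lambda>x. ennreal (indicator O1 x * \<bar>det (matrix (K x))\<bar>))) borel (\<lambda>x. indicator O1 x *\<^sub>R ?\<psi> x)) ?q"
    by (simp only: distr_image[OF O1 K(1) inj O2 cdet])
  also have "\<dots> = integral\<^sup>N (density lborel (\<lambda>x. ennreal (indicator O1 x * \<bar>det (matrix (K x))\<bar>))) (\<lambda>x. ?q (indicator O1 x *\<^sub>R ?\<psi> x))"
    by (rule nn_integral_distr) (use \<psi>m qm in auto)
  also have "\<dots> = (\<integral>\<^sup>+x. ennreal (indicator O1 x * \<bar>det (matrix (K x))\<bar>) * ?q (indicator O1 x *\<^sub>R ?\<psi> x) \<partial>lborel)"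
    by (rule nn_integral_density) (use dm measurable_compose[OF \<psi>m qm] in auto)
  also have "\<dots> = (\<integral>\<^sup>+x\<in>{x \<in> W1. F1 x \<in> B}. ennreal (?\<rho>1 x) \<partial>lborel)"
  proof (rule nn_integral_cong)
    fix x
    show "ennreal (indicator O1 x * \<bar>det (matrix (K x))\<bar>) * ?q (indicator O1 x *\<^sub>R ?\<psi> x)
        = ennreal (?\<rho>1 x) * indicator {x \<in> W1. F1 x \<in> B} x"
    proof (cases "x \<in> O1")
      case True
      then show ?thesis using K(2) \<psi>W[OF True] param_density_pos[OF p2 \<psi>W(1)[OF True]]
        by (auto simp: indicator_def ennreal_mult O1_def)
    qed (use B in \<open>auto simp: indicator_def O1_def\<close>)
  qed
  finally show ?thesis by (simp add: emeasure_param_measure[OF p1 B(1)])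
qed

lemma param_image_borel:
  assumes "local_parametrization A S c W F" "S \<in> sets borel"
  shows "F ` W \<in> sets borel"
  using param_openin[OF assms(1)] assms(2) by (auto simp: openin_open)

text \<open>Second countability enters here: by Lindelof countably many parametrized pieces cover
  \<open>S\<close>. The empty piece is adjoined so that a sequence exists even when the countable
  subcover is empty.\<close>

lemma param_sequence:
  assumes ex: "\<And>p. p \<in> S \<Longrightarrow> \<exists>c W (F :: real^'m::finite \<Rightarrow> 'a). local_parametrization A S c W F \<and> p \<in> F ` W"
  obtains c W and F :: "nat \<Rightarrow> real^'m \<Rightarrow> 'a"
  where "\<And>i. local_parametrization A S (c i) (W i) (F i)" "(\<Union>i. F i ` W i) = S"
proof -
  obtain c0 where c0: "c0 \<in> A" using ex_chart by blast
  have triv: "local_parametrization A S c0 {} (F :: real^'m \<Rightarrow> 'a)" for F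
    using c0 by (auto simp: local_parametrization_def homeomorphism_def)
  define \<F> where "\<F> = {T. open T \<and> (\<exists>c W (F :: real^'m \<Rightarrow> 'a). local_parametrization A S c W F \<and> F ` W = S \<inter> T)}"
  obtain \<G> where \<G>: "\<G> \<subseteq> \<F>" "countable \<G>" "\<Union>\<G> = \<Union>\<F>"
    by (rule Lindelof[of \<F>]) (auto simp: \<F>_def)
  have "{} \<in> \<F>" unfolding \<F>_def using triv[of undefined] by blast
  with \<G> have \<G>': "insert {} \<G> \<subseteq> \<F>" "countable (insert {} \<G>)" "insert {} \<G> \<noteq> {}" by auto
  define T where "T = from_nat_into (insert {} \<G>)"
  have rT: "range T = insert {} \<G>" unfolding T_def using \<G>' by (intro range_from_nat_into) auto
  have "\<forall>i. \<exists>t. local_parametrization A S (fst t) (fst (snd t)) (snd (snd t) :: real^'m \<Rightarrow> 'a) \<and> snd (snd t) ` fst (snd t) = S \<inter> T i"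
  proof
    fix i
    have "T i \<in> insert {} \<G>" using rT by blast
    then have "T i \<in> \<F>" using \<G>'(1) by blast
    then obtain c W and F :: "real^'m \<Rightarrow> 'a" where "local_parametrization A S c W F" "F ` W = S \<inter> T i" by (auto simp: \<F>_def)
    then show "\<exists>t. local_parametrization A S (fst t) (fst (snd t)) (snd (snd t) :: real^'m \<Rightarrow> 'a) \<and> snd (snd t) ` fst (snd t) = S \<inter> T i"
      by (intro exI[of _ "(c, W, F)"]) simp
  qed
  then obtain t where t: "\<And>i. local_parametrization A S (fst (t i)) (fst (snd (t i))) (snd (snd (t i)) :: real^'m \<Rightarrow> 'a)"
      "\<And>i. snd (snd (t i)) ` fst (snd (t i)) = S \<inter> T i" by metis
  have "S \<subseteq> \<Union>\<F>"
  proof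
    fix p assume "p \<in> S"
    then obtain c W and F :: "real^'m \<Rightarrow> 'a" where F: "local_parametrization A S c W F" "p \<in> F ` W" using ex by blast
    then obtain T where "open T" "F ` W = S \<inter> T" using param_openin[OF F(1)] by (auto simp: openin_open)
    then have "T \<in> \<F>" "p \<in> T" using F unfolding \<F>_def by blast+
    then show "p \<in> \<Union>\<F>" by blast
  qed
  then have "(\<Union>i. S \<inter> T i) = S" using rT \<G>(3) by (metis Int_UN_distrib Int_absorb2 Union_insert sup_bot_left)
  then show ?thesis using that[of "\<lambda>i. fst (t i)" "\<lambda>i. fst (snd (t i))" "\<lambda>i. snd (snd (t i))"] t by simp
qed

text \<open>The property that describes \<open>riemannian_measure\<close>, with the local integrals
  expressed by \<open>param_measure\<close>.\<close>

definition volume_on :: "'m::finite itself \<Rightarrow> 'a set \<Rightarrow> 'a measure \<Rightarrow> bool" where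
  "volume_on _ S \<mu> \<longleftrightarrow> sets \<mu> = sets borel \<and> emeasure \<mu> (- S) = 0
     \<and> (\<forall>c W (F :: real^'m \<Rightarrow> 'a). local_parametrization A S c W F \<longrightarrow>
          (\<forall>B\<in>sets borel. B \<subseteq> F ` W \<longrightarrow> emeasure \<mu> B = emeasure (param_measure g c W F) B))"

text \<open>A countable cover by parametrized pieces is made disjoint, and the local measures of the
  parts are added. By \<open>param_measure_consistent\<close> every other parametrization measures
  its subsets in the same way.\<close>

lemma volume_on_exists:
  assumes ex: "\<And>p. p \<in> S \<Longrightarrow> \<exists>c W (F :: real^'m::finite \<Rightarrow> 'a). local_parametrization A S c W F \<and> p \<in> F ` W"
    and S: "S \<in> sets borel"
  shows "\<exists>\<mu>. volume_on TYPE('m) S \<mu>"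
proof -
  obtain c W and F :: "nat \<Rightarrow> real^'m \<Rightarrow> 'a"
    where p: "\<And>i. local_parametrization A S (c i) (W i) (F i)" and un: "(\<Union>i. F i ` W i) = S"
    using param_sequence[OF ex] by blast
  define D where "D = disjointed (\<lambda>i. F i ` W i)"
  have FW: "F i ` W i \<in> sets borel" for i by (rule param_image_borel[OF p S])
  have D: "D i \<in> sets borel" "D i \<subseteq> F i ` W i" for i
    using sets.range_disjointed_sets[of "\<lambda>i. F i ` W i" borel] FW disjointed_subset[of "\<lambda>i. F i ` W i"]
    by (auto simp: D_def)
  have dD: "disjoint_family D" "(\<Union>i. D i) = S"
    using disjoint_family_disjointed un by (auto simp: D_def UN_disjointed_eq)
  let ?p = "\<lambda>i. param_measure g (c i) (W i) (F i)"
  \<comment> \<open>The series over the pieces is an integral for counting measure, so that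
    countable additivity becomes an interchange of a sum with an integral.\<close>
  define m where "m B = (\<integral>\<^sup>+i. emeasure (?p i) (B \<inter> D i) \<partial>count_space UNIV)" for B
  define \<mu> where "\<mu> = measure_of UNIV (sets borel) m"
  have sp: "sets (?p i) = sets borel" for i by (simp add: param_measure_def)
  have ca: "countably_additive (sets borel) m"
    unfolding countably_additive_def
  proof (intro allI impI)
    fix X :: "nat \<Rightarrow> 'a set" assume X: "range X \<subseteq> sets borel" "disjoint_family X" "\<Union>(range X) \<in> sets borel"
    have "emeasure (?p i) (\<Union>(range X) \<inter> D i) = (\<Sum>j. emeasure (?p i) (X j \<inter> D i))" for i
    proof -
      have "(\<Sum>j. emeasure (?p i) (X j \<inter> D i)) = emeasure (?p i) (\<Union>j. X j \<inter> D i)"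
        using X D sp by (intro suminf_emeasure) (auto simp: disjoint_family_on_def)
      then show ?thesis by simp
    qed
    then show "(\<Sum>j. m (X j)) = m (\<Union>(range X))"
      unfolding m_def by (simp add: nn_integral_suminf)
  qed
  have em: "emeasure \<mu> B = m B" if "B \<in> sets borel" for B
    unfolding \<mu>_def
    by (rule emeasure_measure_of_sigma)
       (use that ca sets.sigma_algebra_axioms[of "borel :: 'a measure"] in \<open>auto simp: positive_def m_def\<close>)
  have sets\<mu>: "sets \<mu> = sets borel"
    unfolding \<mu>_def using sets.sigma_sets_eq[of "borel :: 'a measure"] by (simp add: sets_measure_of_conv)
  have "volume_on TYPE('m) S \<mu>"
    unfolding volume_on_def
  proof (intro conjI allI impI ballI)
    have "- S \<inter> D i = {}" for i using dD(2) by blast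
    then show "emeasure \<mu> (- S) = 0" using S by (simp add: em m_def)
  next
    fix c' W' B and F' :: "real^'m \<Rightarrow> 'a"
    assume p': "local_parametrization A S c' W' F'" and B: "B \<in> sets borel" "B \<subseteq> F' ` W'"
    have BS: "B \<subseteq> S" using B param_in(1)[OF p'] by auto
    have "emeasure \<mu> B = (\<Sum>i. emeasure (?p i) (B \<inter> D i))"
      using B by (simp add: em m_def nn_integral_count_space_nat)
    also have "\<dots> = (\<Sum>i. emeasure (param_measure g c' W' F') (B \<inter> D i))"
    proof (rule suminf_cong)
      show "emeasure (?p i) (B \<inter> D i) = emeasure (param_measure g c' W' F') (B \<inter> D i)" for i
        using B D by (intro param_measure_consistent[OF p p']) blast+
    qed
    also have "\<dots> = emeasure (param_measure g c' W' F') (\<Union>i. B \<inter> D i)"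
    proof (rule suminf_emeasure)
      show "disjoint_family (\<lambda>i. B \<inter> D i)" using dD(1) unfolding disjoint_family_on_def by blast
    qed (use B D in \<open>auto simp: param_measure_def\<close>)
    also have "(\<Union>i. B \<inter> D i) = B" using BS dD(2) by blast
    finally show "emeasure \<mu> B = emeasure (param_measure g c' W' F') B" .
  qed (rule sets\<mu>)
  then show ?thesis by blast
qed

text \<open>The complement of \<open>S\<close> is a null set for both, and \<open>S\<close> is a
  countable disjoint union of Borel parts of parametrized pieces, on which the values are
  prescribed.\<close>

lemma volume_on_unique:
  assumes ex: "\<And>p. p \<in> S \<Longrightarrow> \<exists>c W (F :: real^'m::finite \<Rightarrow> 'a). local_parametrization A S c W F \<and> p \<in> F ` W"
    and S: "S \<in> sets borel" and \<mu>: "volume_on TYPE('m) S \<mu>" and \<nu>: "volume_on TYPE('m) S \<nu>"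
  shows "\<mu> = \<nu>"
proof (rule measure_eqI)
  show "sets \<mu> = sets \<nu>" using \<mu> \<nu> by (simp add: volume_on_def)
  fix B assume "B \<in> sets \<mu>"
  then have B: "B \<in> sets borel" using \<mu> by (simp add: volume_on_def)
  obtain c W and F :: "nat \<Rightarrow> real^'m \<Rightarrow> 'a"
    where p: "\<And>i. local_parametrization A S (c i) (W i) (F i)" and un: "(\<Union>i. F i ` W i) = S"
    using param_sequence[OF ex] by blast
  define D where "D = disjointed (\<lambda>i. F i ` W i)"
  have FW: "F i ` W i \<in> sets borel" for i by (rule param_image_borel[OF p S])
  have D: "D i \<in> sets borel" "D i \<subseteq> F i ` W i" for i
    using sets.range_disjointed_sets[of "\<lambda>i. F i ` W i" borel] FW disjointed_subset[of "\<lambda>i. F i ` W i"]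
    by (auto simp: D_def)
  have dD: "disjoint_family D" "(\<Union>i. D i) = S"
    using disjoint_family_disjointed un by (auto simp: D_def UN_disjointed_eq)
  have "emeasure \<kappa> B = (\<Sum>i. emeasure (param_measure g (c i) (W i) (F i)) (B \<inter> D i))" if "volume_on TYPE('m) S \<kappa>" for \<kappa>
  proof -
    have sets: "sets \<kappa> = sets borel" and z: "emeasure \<kappa> (- S) = 0" using that by (auto simp: volume_on_def)
    have "emeasure \<kappa> B = emeasure \<kappa> (B \<inter> S) + emeasure \<kappa> (B \<inter> - S)"
      using B S sets by (subst plus_emeasure) (auto simp flip: Int_Un_distrib)
    also have "emeasure \<kappa> (B \<inter> - S) = 0"
      using emeasure_mono[of "B \<inter> - S" "- S" \<kappa>] z S sets by auto
    also have "B \<inter> S = (\<Union>i. B \<inter> D i)" using dD by blast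
    also have "emeasure \<kappa> (\<Union>i. B \<inter> D i) = (\<Sum>i. emeasure \<kappa> (B \<inter> D i))"
    proof (rule suminf_emeasure[symmetric])
      show "disjoint_family (\<lambda>i. B \<inter> D i)" using dD(1) unfolding disjoint_family_on_def by blast
    qed (use B D sets in auto)
    also have "\<dots> = (\<Sum>i. emeasure (param_measure g (c i) (W i) (F i)) (B \<inter> D i))"
    proof (rule suminf_cong)
      fix i
      have "B \<inter> D i \<in> sets borel" "B \<inter> D i \<subseteq> F i ` W i" using B D by auto
      then show "emeasure \<kappa> (B \<inter> D i) = emeasure (param_measure g (c i) (W i) (F i)) (B \<inter> D i)"
        using that p[of i] unfolding volume_on_def by blast
    qed
    finally show ?thesis by simp
  qed
  from this[OF \<mu>] this[OF \<nu>] show "emeasure \<mu> B = emeasure \<nu> B" by simp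
qed

text \<open>Makes the definite description usable: existence and uniqueness guarantee that
  \<open>riemannian_measure\<close> has its describing property.\<close>

lemma volume_on_riemannian_measure:
  assumes ex: "\<And>p. p \<in> S \<Longrightarrow> \<exists>c W (F :: real^'m::finite \<Rightarrow> 'a). local_parametrization A S c W F \<and> p \<in> F ` W"
    and S: "S \<in> sets borel"
  shows "volume_on TYPE('m) S (riemannian_measure TYPE('m) A g S)"
proof -
  have eq: "riemannian_measure TYPE('m) A g S = (THE \<mu>. volume_on TYPE('m) S \<mu>)"
    unfolding riemannian_measure_def volume_on_def
    by (rule arg_cong[of _ _ The], rule ext)
       (simp add: emeasure_param_measure param_density_def cong: conj_cong imp_cong ball_cong)
  show ?thesis unfolding eq
    by (rule theI') (use volume_on_exists[OF assms] volume_on_unique[OF assms] in blast)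
qed

lemma density_volume_on:
  fixes F :: "real^'m::finite \<Rightarrow> 'a"
  assumes v: "volume_on TYPE('m) S \<mu>" and p: "local_parametrization A S c W F" and S: "S \<in> sets borel"
  shows "density \<mu> (indicator (F ` W)) = param_measure g c W F"
proof (rule measure_eqI)
  have FW: "F ` W \<in> sets borel" by (rule param_image_borel[OF p S])
  have sets: "sets \<mu> = sets borel" using v by (simp add: volume_on_def)
  then show "sets (density \<mu> (indicator (F ` W))) = sets (param_measure g c W F)"
    by (simp add: param_measure_def)
  fix B assume "B \<in> sets (density \<mu> (indicator (F ` W)))"
  then have B: "B \<in> sets borel" by (simp add: sets)
  have ms: "F ` W \<in> sets \<mu>" "B \<in> sets \<mu>" using FW B sets by auto
  have "emeasure (density \<mu> (indicator (F ` W))) B = emeasure \<mu> (F ` W \<inter> B)"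
    using ms by (simp add: emeasure_density nn_integral_indicator flip: indicator_inter_arith)
  also have "\<dots> = emeasure (param_measure g c W F) (F ` W \<inter> B)"
    using v p B FW unfolding volume_on_def by (meson Int_lower1 sets.Int)
  also have "\<dots> = emeasure (param_measure g c W F) B"
    using B FW by (subst (1 2) emeasure_param_measure[OF p]) (auto intro!: nn_integral_cong simp: indicator_def)
  finally show "emeasure (density \<mu> (indicator (F ` W))) B = emeasure (param_measure g c W F) B" .
qed

lemma volume_on_integral:
  fixes F :: "real^'m::finite \<Rightarrow> 'a" and f :: "'a \<Rightarrow> real"
  assumes v: "volume_on TYPE('m) S \<mu>" and p: "local_parametrization A S c W F" and S: "S \<in> sets borel"
    and f: "continuous_on W (\<lambda>x. f (F x))"
  shows "(LINT q:F ` W|\<mu>. f q) = (LINT x:W|lborel. param_density g c F x * f (F x))"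
    and "set_integrable \<mu> (F ` W) f \<longleftrightarrow> set_integrable lborel W (\<lambda>x. param_density g c F x * f (F x))"
proof -
  let ?h = "\<lambda>q. indicator (F ` W) q * f q" and ?F = "\<lambda>x. if x \<in> W then F x else undefined"
  let ?d = "\<lambda>x. indicator W x * param_density g c F x"
  have FW: "F ` W \<in> sets borel" by (rule param_image_borel[OF p S])
  have sets: "sets \<mu> = sets borel" using v by (simp add: volume_on_def)
  have FWm: "F ` W \<in> sets \<mu>" using FW sets by simp
  have "continuous_on (F ` W) (\<lambda>q. f (F (inv_into W F q)))"
    by (rule continuous_on_compose2[OF f]) (use param_homeo[OF p] in \<open>auto simp: homeomorphism_def\<close>)
  then have "continuous_on (F ` W) f"
    by (rule continuous_on_eq) (simp add: f_inv_into_f)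
  from borel_measurable_continuous_on_indicator[OF FW this]
  have hb: "?h \<in> borel_measurable borel" by simp
  then have hm: "?h \<in> borel_measurable \<mu>" by (simp add: measurable_cong_sets[OF sets refl])
  have dm: "?d \<in> borel_measurable borel" and Fm: "?F \<in> borel_measurable borel"
    by (rule param_density_measurable[OF p], rule param_map_measurable[OF p])
  have d0: "0 \<le> ?d x" for x using param_density_pos[OF p] by (auto simp: indicator_def less_imp_le)
  have hF: "(\<lambda>x. ?h (?F x)) \<in> borel_measurable borel" by (rule measurable_compose[OF Fm hb])
  have dens: "density \<mu> (\<lambda>x. ennreal (indicator (F ` W) x)) = param_measure g c W F"
    using density_volume_on[OF v p S] by (simp add: ennreal_indicator)
  have e1: "?d x *\<^sub>R ?h (?F x) = indicator W x *\<^sub>R (param_density g c F x * f (F x))" for x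
    by (auto simp: indicator_def)
  have e2: "indicator (F ` W) q *\<^sub>R ?h q = indicator (F ` W) q *\<^sub>R f q" for q by (auto simp: indicator_def)
  have "(LINT q:F ` W|\<mu>. f q) = integral\<^sup>L (density \<mu> (\<lambda>x. ennreal (indicator (F ` W) x))) ?h"
  proof -
    have "integral\<^sup>L (density \<mu> (\<lambda>x. ennreal (indicator (F ` W) x))) ?h = integral\<^sup>L \<mu> (\<lambda>q. indicator (F ` W) q *\<^sub>R ?h q)"
      using hm FWm by (intro integral_density) auto
    then show ?thesis unfolding e2 set_lebesgue_integral_def by (rule sym)
  qed
  also have "\<dots> = integral\<^sup>L (density lborel (\<lambda>x. ennreal (?d x))) (\<lambda>x. ?h (?F x))"
    unfolding dens param_measure_def using Fm hb by (intro integral_distr) auto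
  also have "\<dots> = integral\<^sup>L lborel (\<lambda>x. ?d x *\<^sub>R ?h (?F x))"
    using hF dm d0 by (intro integral_density) auto
  finally show "(LINT q:F ` W|\<mu>. f q) = (LINT x:W|lborel. param_density g c F x * f (F x))"
    by (simp only: e1 set_lebesgue_integral_def)
  have "set_integrable \<mu> (F ` W) f \<longleftrightarrow> integrable (density \<mu> (\<lambda>x. ennreal (indicator (F ` W) x))) ?h"
  proof -
    have "integrable (density \<mu> (\<lambda>x. ennreal (indicator (F ` W) x))) ?h \<longleftrightarrow> integrable \<mu> (\<lambda>q. indicator (F ` W) q *\<^sub>R ?h q)"
      using hm FWm by (intro integrable_density) auto
    then show ?thesis unfolding e2 set_integrable_def by (rule sym)
  qed
  also have "\<dots> \<longleftrightarrow> integrable (density lborel (\<lambda>x. ennreal (?d x))) (\<lambda>x. ?h (?F x))"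
    unfolding dens param_measure_def using Fm hb by (intro integrable_distr_eq) auto
  also have "\<dots> \<longleftrightarrow> integrable lborel (\<lambda>x. ?d x *\<^sub>R ?h (?F x))"
    using hF dm d0 by (intro integrable_density) auto
  finally show "set_integrable \<mu> (F ` W) f \<longleftrightarrow> set_integrable lborel W (\<lambda>x. param_density g c F x * f (F x))"
    by (simp only: e1 set_integrable_def)
qed

text \<open>Each point has a neighbourhood in \<open>S\<close> that is the image of a ball whose
  closure lies in the parameter domain, where the density is bounded. Compactness leaves finitely
  many of them.\<close>

lemma volume_on_compact_finite:
  assumes ex: "\<And>p. p \<in> S \<Longrightarrow> \<exists>c W (F :: real^'m::finite \<Rightarrow> 'a). local_parametrization A S c W F \<and> p \<in> F ` W"
    and S: "S \<in> sets borel" and v: "volume_on TYPE('m) S \<mu>" and K: "compact K" "K \<subseteq> S"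
  shows "emeasure \<mu> K < \<infinity>"
proof -
  have sets: "sets \<mu> = sets borel" using v by (simp add: volume_on_def)
  have "\<exists>U. open U \<and> p \<in> U \<and> emeasure \<mu> (S \<inter> U) < \<infinity>" if "p \<in> S" for p
  proof -
    obtain c W and F :: "real^'m \<Rightarrow> 'a" where F: "local_parametrization A S c W F" "p \<in> F ` W" using ex[OF \<open>p \<in> S\<close>] by blast
    obtain x where x: "x \<in> W" "p = F x" using F by blast
    obtain e where e: "e > 0" "cball x e \<subseteq> W" using param_open[OF F(1)] x open_contains_cball by blast
    have "openin (top_of_set (F ` W)) (F ` ball x e)"
      by (rule homeomorphism_imp_open_map[OF param_homeo[OF F(1)]])
         (use e ball_subset_cball[of x e] in \<open>auto simp: openin_open intro!: exI[of _ "ball x e"]\<close>)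
    then have "openin (top_of_set S) (F ` ball x e)" using param_openin[OF F(1)] openin_trans by blast
    then obtain U where U: "open U" "F ` ball x e = S \<inter> U" by (auto simp: openin_open)
    have cont: "continuous_on (cball x e) (param_density g c F)"
      using param_density_continuous[OF F(1)] e(2) by (rule continuous_on_subset)
    then have "bounded (param_density g c F ` cball x e)"
      by (simp add: compact_continuous_image compact_imp_bounded)
    then obtain b where b: "\<And>y. y \<in> cball x e \<Longrightarrow> \<bar>param_density g c F y\<bar> \<le> b" unfolding bounded_iff real_norm_def by blast
    have SU: "S \<inter> U \<in> sets borel" "S \<inter> U \<subseteq> F ` W"
      using S U e ball_subset_cball[of x e] by (auto, blast)
    have "emeasure \<mu> (S \<inter> U) = emeasure (param_measure g c W F) (S \<inter> U)"
      using v F(1) SU unfolding volume_on_def by blast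
    also have "\<dots> \<le> (\<integral>\<^sup>+y. ennreal b * indicator (cball x e) y \<partial>lborel)"
      unfolding emeasure_param_measure[OF F(1) SU(1)]
    proof (rule nn_integral_mono)
      fix y
      have "y \<in> ball x e" if "y \<in> W" "F y \<in> S \<inter> U"
        using that param_inj[OF F(1)] e ball_subset_cball[of x e] unfolding U(2)[symmetric] by (metis image_iff inj_onD subsetD)
      then show "ennreal (param_density g c F y) * indicator {x \<in> W. F x \<in> S \<inter> U} y \<le> ennreal b * indicator (cball x e) y"
        using b[of y] by (auto simp: indicator_def intro!: ennreal_leI)
    qed
    also have "\<dots> < \<infinity>"
      using emeasure_bounded_finite[of "cball x e"] by (simp add: nn_integral_cmult_indicator ennreal_mult_less_top)
    finally show ?thesis using U x e by (intro exI[of _ U]) auto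
  qed
  then obtain U where U: "\<And>p. p \<in> K \<Longrightarrow> open (U p)" "\<And>p. p \<in> K \<Longrightarrow> p \<in> U p" "\<And>p. p \<in> K \<Longrightarrow> emeasure \<mu> (S \<inter> U p) < \<infinity>"
    using K by (metis subsetD)
  obtain T where T: "T \<subseteq> K" "finite T" "K \<subseteq> (\<Union>p\<in>T. U p)"
    using compactE_image[OF K(1), of K U] U by blast
  have "emeasure \<mu> K \<le> emeasure \<mu> (\<Union>p\<in>T. S \<inter> U p)"
  proof (rule emeasure_mono)
    have "open (\<Union>p\<in>T. U p)" using U(1) T(1) by blast
    then have "S \<inter> (\<Union>p\<in>T. U p) \<in> sets borel" using S by simp
    then show "(\<Union>p\<in>T. S \<inter> U p) \<in> sets \<mu>" by (simp add: sets)
  qed (use T K in blast)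
  also have "\<dots> \<le> (\<Sum>p\<in>T. emeasure \<mu> (S \<inter> U p))"
    using T(1,2) U(1) S sets by (intro emeasure_subadditive_finite) (auto simp: subset_iff)
  also have "\<dots> < \<infinity>" using T U(3) by (simp add: subset_iff)
  finally show ?thesis .
qed

end

section \<open>The divergence theorem in Euclidean coordinates\<close>

lemma Ck_on_Un:
  assumes "open S" "open T"
  shows "Ck_on k S f \<Longrightarrow> Ck_on k T f \<Longrightarrow> Ck_on k (S \<union> T) f"
  by (induction k arbitrary: f) (auto intro: continuous_on_open_Un[OF assms])

lemma Ck_on_zero_ext:
  assumes "open D" "compact K" "K \<subseteq> D" "Ck_on k D f" "\<And>x. x \<in> D - K \<Longrightarrow> f x = 0"
  shows "Ck_on k UNIV (\<lambda>x. if x \<in> D then f x else 0)"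
proof -
  have oK: "open (- K)" using assms(2) by (simp add: open_Compl compact_imp_closed)
  have "Ck_on k D (\<lambda>x. if x \<in> D then f x else 0)"
    by (rule Ck_on_cong[OF assms(1) _ assms(4)]) simp
  moreover have "Ck_on k (- K) (\<lambda>x. if x \<in> D then f x else 0)"
    by (rule Ck_on_cong[OF oK _ Ck_on_const[of k _ 0]]) (use assms(5) in auto)
  ultimately have "Ck_on k (D \<union> - K) (\<lambda>x. if x \<in> D then f x else 0)"
    by (rule Ck_on_Un[OF assms(1) oK])
  moreover have "D \<union> - K = UNIV" using assms(3) by auto
  ultimately show ?thesis by simp
qed

lemma set_integrable_compact_support:
  fixes f :: "'a::euclidean_space \<Rightarrow> real"
  assumes "continuous_on K f" "compact K" "K \<subseteq> D" "\<And>x. x \<in> D - K \<Longrightarrow> f x = 0"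
  shows "set_integrable lborel D f"
proof -
  have "set_integrable lborel K f"
    unfolding set_integrable_def by (rule borel_integrable_compact[OF assms(2,1)])
  moreover have "(\<lambda>x. indicator D x *\<^sub>R f x) = (\<lambda>x. indicator K x *\<^sub>R f x)"
    using assms(3,4) by (auto simp: indicator_def fun_eq_iff)
  ultimately show ?thesis by (simp add: set_integrable_def)
qed

lemma pd_zero_outside:
  assumes "closed K" "\<And>x. x \<notin> K \<Longrightarrow> h x = 0" "x \<notin> K"
  shows "pd i h x = 0"
proof -
  have "pd i h x = pd i (\<lambda>x. 0) x"
    by (rule pd_cong[of "- K"]) (use assms in auto)
  then show ?thesis by (simp add: pd_eqI[OF has_derivative_const])
qed

text \<open>By translation invariance every difference quotient of \<open>h\<close> has integral
  zero, and dominated convergence passes to the derivative. The mean value theorem gives the bound,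
  on a ball enlarged by 1 because the increments are at most 1.\<close>

lemma integral_pd_zero:
  fixes h :: "real^'n::finite \<Rightarrow> real"
  assumes h: "Ck_on 1 UNIV h" and K: "compact K" "\<And>x. x \<notin> K \<Longrightarrow> h x = 0"
  shows "integral\<^sup>L lborel (pd i h) = 0"
proof -
  have dh: "h differentiable (at x)" for x using h by simp
  have ch: "continuous_on UNIV h" by (rule Ck_on_continuous[OF h])
  have cp: "continuous_on UNIV (pd i h)" using h by simp
  have pz: "pd i h x = 0" if "x \<notin> K" for x
    by (rule pd_zero_outside[OF compact_imp_closed[OF K(1)] K(2) that])
  have "bounded (pd i h ` K)"
    using K(1) cp by (meson compact_continuous_image compact_imp_bounded continuous_on_subset top_greatest)
  then obtain M0 where M0: "\<And>x. x \<in> K \<Longrightarrow> \<bar>pd i h x\<bar> \<le> M0" unfolding bounded_iff real_norm_def by blast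
  define M where "M = max M0 0"
  have M: "\<bar>pd i h x\<bar> \<le> M" for x using M0[of x] pz[of x] by (cases "x \<in> K") (auto simp: M_def)
  obtain R where R: "R > 0" "\<And>x. x \<in> K \<Longrightarrow> norm x \<le> R" using K(1) compact_imp_bounded bounded_pos by metis
  let ?s = "\<lambda>n. 1 / real (Suc n)" and ?e = "axis i 1 :: real^'n"
  let ?q = "\<lambda>n x. (h (x + ?s n *\<^sub>R ?e) - h x) / ?s n"
  have hi: "integrable lborel h"
    using set_integrable_compact_support[of K h UNIV] K continuous_on_subset[OF ch] by (simp add: set_integrable_def)
  have hi': "integrable lborel (\<lambda>x. h (x + v))" "integral\<^sup>L lborel (\<lambda>x. h (x + v)) = integral\<^sup>L lborel h" for v
  proof -
    have d: "distr lborel borel ((+) v) = lborel" by (rule lborel_distr_plus)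
    have "integrable (distr lborel borel ((+) v)) h" using hi by (simp add: d)
    then show "integrable lborel (\<lambda>x. h (x + v))"
      by (subst (asm) integrable_distr_eq) (use borel_measurable_continuous_onI[OF ch] in \<open>auto simp: add.commute\<close>)
    have "integral\<^sup>L (distr lborel borel ((+) v)) h = integral\<^sup>L lborel (\<lambda>x. h (v + x))"
      by (rule integral_distr) (use borel_measurable_continuous_onI[OF ch] in auto)
    then show "integral\<^sup>L lborel (\<lambda>x. h (x + v)) = integral\<^sup>L lborel h" by (simp add: d add.commute)
  qed
  have z: "integral\<^sup>L lborel (?q n) = 0" for n
    using hi hi' by simp
  have "(\<lambda>n. integral\<^sup>L lborel (?q n)) \<longlonglongrightarrow> integral\<^sup>L lborel (pd i h)"
  proof (rule integral_dominated_convergence[where w = "\<lambda>x. indicator (cball 0 (R + 1)) x * M"])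
    show "pd i h \<in> borel_measurable lborel" using borel_measurable_continuous_onI[OF cp] by simp
    show "?q n \<in> borel_measurable lborel" for n
    proof -
      have "?q n \<in> borel_measurable borel"
        by (intro borel_measurable_continuous_onI continuous_intros continuous_on_compose2[OF ch]) auto
      then show ?thesis by simp
    qed
    show "integrable lborel (\<lambda>x. indicator (cball 0 (R + 1)) x * M)"
      by (intro integrable_mult_left integrable_real_indicator emeasure_bounded_finite) auto
    show "AE x in lborel. (\<lambda>n. ?q n x) \<longlonglongrightarrow> pd i h x"
    proof (rule AE_I2)
      fix x
      have "((\<lambda>t. h (x + t *\<^sub>R ?e)) has_real_derivative pd i h (x + 0 *\<^sub>R ?e)) (at 0)"
        by (rule line_has_derivative) (simp add: dh)
      then have "((\<lambda>t. (h (x + t *\<^sub>R ?e) - h x) / t) \<longlongrightarrow> pd i h x) (at 0)"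
        by (simp add: has_field_derivative_iff)
      moreover have "filterlim ?s (at 0) sequentially"
        unfolding filterlim_at using LIMSEQ_Suc[OF lim_1_over_n] by (auto simp del: of_nat_Suc)
      ultimately show "(\<lambda>n. ?q n x) \<longlonglongrightarrow> pd i h x" by (rule filterlim_compose)
    qed
    show "AE x in lborel. norm (?q n x) \<le> indicator (cball 0 (R + 1)) x * M" for n
    proof (rule AE_I2)
      fix x
      have s: "0 < ?s n" "?s n \<le> 1" by auto
      show "norm (?q n x) \<le> indicator (cball 0 (R + 1)) x * M"
      proof (cases "x \<in> cball 0 (R + 1)")
        case True
        have "\<exists>\<xi>>0. \<xi> < ?s n \<and> h (x + ?s n *\<^sub>R ?e) - h (x + 0 *\<^sub>R ?e) = (?s n - 0) * pd i h (x + \<xi> *\<^sub>R ?e)"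
          by (rule MVT2[OF s(1)]) (rule line_has_derivative, rule dh)
        then obtain \<xi> where "h (x + ?s n *\<^sub>R ?e) - h x = ?s n * pd i h (x + \<xi> *\<^sub>R ?e)" by auto
        then have "?q n x = pd i h (x + \<xi> *\<^sub>R ?e)" using s by simp
        then show ?thesis using True M by simp
      next
        case False
        then have n: "norm x > R + 1" by simp
        have "norm x \<le> norm (x + ?s n *\<^sub>R ?e) + norm (?s n *\<^sub>R ?e)"
          using norm_triangle_ineq4[of "x + ?s n *\<^sub>R ?e" "?s n *\<^sub>R ?e"] by simp
        also have "norm (?s n *\<^sub>R ?e) \<le> 1" using s by (simp add: norm_axis_1)
        finally have "x \<notin> K" "x + ?s n *\<^sub>R ?e \<notin> K" using n R by force+
        then show ?thesis using K(2) False by simp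
      qed
    qed
  qed
  then show ?thesis unfolding z by (simp add: LIMSEQ_const_iff)
qed

section \<open>Cutoff functions of class C^1\<close>

lemma DERIV_max0_sq: "((\<lambda>x. (max 0 x)\<^sup>2) has_real_derivative 2 * max 0 x) (at (x::real))"
proof -
  consider "x > 0" | "x < 0" | "x = 0" by linarith
  then show ?thesis
  proof cases
    case 1
    have "((\<lambda>x. x\<^sup>2) has_real_derivative 2 * x) (at x)" by (auto intro!: derivative_eq_intros)
    then show ?thesis
      using 1 by (auto intro: has_field_derivative_transform_within_open[of _ _ _ "{0<..}"])
  next
    case 2
    have "((\<lambda>x. 0) has_real_derivative 0) (at x)" by simp
    then have "((\<lambda>x. (max 0 x)\<^sup>2) has_real_derivative 0) (at x)"
      by (rule has_field_derivative_transform_within_open[of _ _ _ "{..<0}"]) (use 2 in auto)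
    then show ?thesis using 2 by simp
  next
    case 3
    have "((\<lambda>h::real. (max 0 h)\<^sup>2 / h) \<longlongrightarrow> 0) (at 0)"
    proof (rule Lim_null_comparison[where g = "\<lambda>h. \<bar>h\<bar>"])
      have "norm ((max 0 h)\<^sup>2 / h) \<le> \<bar>h\<bar>" for h :: real
        by (auto simp: max_def power2_eq_square)
      then show "\<forall>\<^sub>F h in at (0::real). norm ((max 0 h)\<^sup>2 / h) \<le> \<bar>h\<bar>" by simp
      show "((\<lambda>h. \<bar>h\<bar>) \<longlongrightarrow> 0) (at (0::real))" by (intro tendsto_eq_intros) auto
    qed
    then show ?thesis using 3 by (simp add: has_field_derivative_iff)
  qed
qed

text \<open>A \<open>C\<^sup>1\<close> transition from \<open>0\<close> to \<open>1\<close> on the interval \<open>[1,2]\<close>.\<close>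

definition cutoff :: "real \<Rightarrow> real" where
  "cutoff t = (max 0 (t - 1))\<^sup>2 / ((max 0 (t - 1))\<^sup>2 + (max 0 (2 - t))\<^sup>2)"

definition cutoff' :: "real \<Rightarrow> real" where
  "cutoff' t = (2 * max 0 (t - 1) * (max 0 (2 - t))\<^sup>2 + (max 0 (t - 1))\<^sup>2 * (2 * max 0 (2 - t)))
     / ((max 0 (t - 1))\<^sup>2 + (max 0 (2 - t))\<^sup>2)\<^sup>2"

lemma cutoff_denominator: "(max 0 (t - 1))\<^sup>2 + (max 0 (2 - t))\<^sup>2 > (0::real)"
  by (cases "t > 1") (auto intro: add_pos_nonneg add_nonneg_pos simp: max_def)

lemma DERIV_cutoff: "(cutoff has_real_derivative cutoff' t) (at t)"
proof -
  have a: "((\<lambda>t. (max 0 (t - 1))\<^sup>2) has_real_derivative 2 * max 0 (t - 1) * 1) (at t)"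
    by (rule DERIV_chain2[OF DERIV_max0_sq]) (auto intro!: derivative_eq_intros)
  have b: "((\<lambda>t. (max 0 (2 - t))\<^sup>2) has_real_derivative 2 * max 0 (2 - t) * (-1)) (at t)"
    by (rule DERIV_chain2[OF DERIV_max0_sq]) (auto intro!: derivative_eq_intros)
  have "(max 0 (t - 1))\<^sup>2 + (max 0 (2 - t))\<^sup>2 \<noteq> 0" using cutoff_denominator[of t] by linarith
  from DERIV_divide[OF a DERIV_add[OF a b] this]
  have "(cutoff has_real_derivative
     (2 * max 0 (t - 1) * 1 * ((max 0 (t - 1))\<^sup>2 + (max 0 (2 - t))\<^sup>2) - (max 0 (t - 1))\<^sup>2 * (2 * max 0 (t - 1) * 1 + 2 * max 0 (2 - t) * - 1))
     / (((max 0 (t - 1))\<^sup>2 + (max 0 (2 - t))\<^sup>2) * ((max 0 (t - 1))\<^sup>2 + (max 0 (2 - t))\<^sup>2))) (at t)"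
    unfolding cutoff_def[abs_def] .
  then show ?thesis by (rule DERIV_cong) (simp add: cutoff'_def power2_eq_square algebra_simps)
qed

lemma cutoff_eq: "t \<le> 1 \<Longrightarrow> cutoff t = 0" "t \<ge> 2 \<Longrightarrow> cutoff t = 1"
  by (auto simp: cutoff_def max_def)

lemma cutoff_bounds: "0 \<le> cutoff t" "cutoff t \<le> 1"
  unfolding cutoff_def using divide_le_eq_1_pos[OF cutoff_denominator[of t]] by auto

lemma cutoff'_eq_0: "t \<le> 1 \<or> t \<ge> 2 \<Longrightarrow> cutoff' t = 0"
  by (auto simp: cutoff'_def max_def)

lemma cutoff'_continuous: "continuous_on X cutoff'"
  unfolding cutoff'_def
proof (intro continuous_intros ballI)
  show "((max 0 (t - 1))\<^sup>2 + (max 0 (2 - t))\<^sup>2)\<^sup>2 \<noteq> 0" for t :: real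
    using cutoff_denominator[of t] by (simp only: power_eq_0_iff) linarith
qed

lemma cutoff_continuous: "continuous_on X cutoff"
  by (intro continuous_at_imp_continuous_on ballI DERIV_isCont[OF DERIV_cutoff])

lemma cutoff'_bounded: "\<exists>C\<ge>0. \<forall>t. \<bar>cutoff' t\<bar> \<le> C"
proof -
  have "bounded (cutoff' ` {1..2})"
    by (simp add: compact_continuous_image compact_imp_bounded cutoff'_continuous)
  then obtain C where "\<And>t. t \<in> {1..2} \<Longrightarrow> \<bar>cutoff' t\<bar> \<le> C" unfolding bounded_iff real_norm_def by blast
  then have "\<bar>cutoff' t\<bar> \<le> max C 0" for t using cutoff'_eq_0[of t] by (cases "t \<in> {1..2}") (auto simp: le_max_iff_disj)
  then show ?thesis by (intro exI[of _ "max C 0"]) auto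
qed

text \<open>Total mass 1 is what makes the boundary layer converge to the boundary flux with
  coefficient 1.\<close>

lemma integral_cutoff': "integrable lborel cutoff'" "integral\<^sup>L lborel cutoff' = 1"
proof -
  have "has_bochner_integral lborel (\<lambda>x. indicator {1..2} x *\<^sub>R cutoff' x) (cutoff 2 - cutoff 1)"
    using DERIV_cutoff
    by (intro has_bochner_integral_FTC_Icc cutoff'_continuous)
       (auto simp: has_real_derivative_iff_has_vector_derivative[symmetric] intro: has_field_derivative_at_within)
  moreover have "(\<lambda>x. indicator {1..2} x *\<^sub>R cutoff' x) = cutoff'"
  proof
    fix x show "indicator {1..2} x *\<^sub>R cutoff' x = cutoff' x"
      using cutoff'_eq_0[of x] by (cases "x \<in> {1..2}") auto
  qed
  ultimately have "has_bochner_integral lborel cutoff' 1" by (simp add: cutoff_eq)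
  then show "integrable lborel cutoff'" "integral\<^sup>L lborel cutoff' = 1"
    by (auto simp: has_bochner_integral_iff)
qed

text \<open>Straightening of the hypersurface \<open>r = 0\<close>: the coordinate \<open>z\<close> is replaced by \<open>r\<close>.\<close>

locale straightening =
  fixes N :: "(real^'n::finite) set" and r :: "real^'n \<Rightarrow> real" and z :: 'n
    and Q :: "(real^'n) set" and \<Theta> :: "real^'n \<Rightarrow> real^'n"
  assumes open_N: "open N" and open_Q: "open Q" and r_C2: "Ck_on 2 N r"
    and rz: "\<And>x. x \<in> N \<Longrightarrow> pd z r x \<noteq> 0"
    and homeo: "homeomorphism N Q (\<lambda>x. x + (r x - x $ z) *\<^sub>R axis z 1) \<Theta>"
    and \<Theta>_deriv: "\<And>y. y \<in> Q \<Longrightarrow> (\<Theta> has_derivative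
      (\<lambda>w. w + ((w $ z - (\<Sum>i\<in>UNIV. w $ i * pd i r (\<Theta> y))) / pd z r (\<Theta> y)) *\<^sub>R axis z 1)) (at y)"

text \<open>Inverse function theorem for the map that replaces the coordinate \<open>z\<close> by
  \<open>r\<close>. Its derivative differs from the identity only in the component \<open>z\<close>,
  where it is dr; so it is invertible where \<open>pd z r\<close> is nonzero, with the explicit
  inverse \<open>?E\<close> that the locale records.\<close>

lemma straightening_exists:
  fixes r :: "real^'n::finite \<Rightarrow> real"
  assumes V: "open V" "x0 \<in> V" and r: "Ck_on 2 V r" and z: "pd z r x0 \<noteq> 0"
  shows "\<exists>N Q \<Theta>. straightening N r z Q \<Theta> \<and> x0 \<in> N \<and> N \<subseteq> V"
proof -
  let ?\<Psi> = "\<lambda>x. x + (r x - x $ z) *\<^sub>R axis z 1"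
  let ?D = "\<lambda>x v. v + ((\<Sum>i\<in>UNIV. v $ i * pd i r x) - v $ z) *\<^sub>R axis z 1"
  let ?E = "\<lambda>x w. w + ((w $ z - (\<Sum>i\<in>UNIV. w $ i * pd i r x)) / pd z r x) *\<^sub>R axis z 1"
  have cr: "continuous_on V (pd i r)" for i using Ck_on_continuous[OF Ck_on_pd[OF r, of 1]] by simp
  define U where "U = {x \<in> V. pd z r x \<noteq> 0}"
  have U: "open U" "x0 \<in> U" "U \<subseteq> V"
    using continuous_on_open_vimage[OF V(1), THEN iffD1, OF cr[of z], rule_format, of "- {0}"] V z
    by (auto simp: U_def vimage_def Int_def conj_commute)
  have DE: "?D x (?E x w) = w" "?E x (?D x w) = w" if "x \<in> U" for x w
  proof -
    have s: "(\<Sum>i\<in>UNIV. (w + c *\<^sub>R axis z 1) $ i * pd i r x) = (\<Sum>i\<in>UNIV. w $ i * pd i r x) + c * pd z r x" for c w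
      by (simp add: distrib_right sum.distrib axis_def if_distrib[of "\<lambda>t. t * _"] if_distrib[of "\<lambda>t. _ * t"] cong: if_cong)
    show "?D x (?E x w) = w" "?E x (?D x w) = w"
      unfolding s using that by (auto simp: U_def vec_eq_iff axis_def field_simps)
  qed
  have lD: "linear (?D x)" for x
    by (rule linearI) (auto simp: algebra_simps sum.distrib scaleR_add_left sum_distrib_left)
  define f' where "f' x = Blinfun (?D x)" for x
  have f': "blinfun_apply (f' x) = ?D x" for x
    unfolding f'_def using lD linear_conv_bounded_linear bounded_linear_Blinfun_apply by blast
  have der: "(?\<Psi> has_derivative blinfun_apply (f' x)) (at x)" if "x \<in> U" for x
  proof -
    have "(r has_derivative (\<lambda>v. \<Sum>i\<in>UNIV. v $ i *\<^sub>R pd i r x)) (at x)"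
      by (rule has_derivative_pd) (use Ck_on_differentiable[OF r] that U in auto)
    then show ?thesis unfolding f'
      by (auto intro!: derivative_eq_intros bounded_linear_imp_has_derivative bounded_linear_vec_nth)
  qed
  have contf': "continuous_on U f'"
  proof (rule continuous_on_blinfun_componentwise)
    fix b :: "real^'n" assume "b \<in> Basis"
    show "continuous_on U (\<lambda>x. blinfun_apply (f' x) b)" unfolding f'
      by (intro continuous_intros continuous_on_subset[OF cr U(3)])
  qed
  let ?invf = "Blinfun (?E x0)"
  have lE: "linear (?E x)" for x
    by (rule linearI)
       (auto simp: algebra_simps sum.distrib scaleR_add_left sum_distrib_left add_divide_distrib diff_divide_distrib)
  have inv: "?invf o\<^sub>L f' x0 = id_blinfun"
  proof (rule blinfun_eqI)
    fix v
    have "blinfun_apply ?invf = ?E x0"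
      using lE linear_conv_bounded_linear bounded_linear_Blinfun_apply by blast
    then show "blinfun_apply (?invf o\<^sub>L f' x0) v = blinfun_apply id_blinfun v"
      by (simp only: blinfun_apply_blinfun_compose f' DE[OF U(2)] blinfun_apply_id_blinfun id_apply)
  qed
  obtain N Q \<Theta> \<Theta>' where *: "open N" "N \<subseteq> U" "x0 \<in> N" "open Q" "?\<Psi> x0 \<in> Q" "homeomorphism N Q ?\<Psi> \<Theta>"
    "\<And>y. y \<in> Q \<Longrightarrow> (\<Theta> has_derivative \<Theta>' y) (at y)"
    "\<And>y. y \<in> Q \<Longrightarrow> \<Theta>' y = Hilbert_Choice.inv (blinfun_apply (f' (\<Theta> y)))"
    "\<And>y. y \<in> Q \<Longrightarrow> bij (blinfun_apply (f' (\<Theta> y)))"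
    by (rule inverse_function_theorem[OF U(1) der contf' U(2) inv]) blast+
  have "straightening N r z Q \<Theta>"
  proof
    show "Ck_on 2 N r" using r by (rule Ck_on_subset) (use * U in auto)
    show "pd z r x \<noteq> 0" if "x \<in> N" for x using that * by (auto simp: U_def)
    fix y assume y: "y \<in> Q"
    have "\<Theta> y \<in> U" using y *(2,6) by (auto simp: homeomorphism_def)
    then have "Hilbert_Choice.inv (blinfun_apply (f' (\<Theta> y))) w = ?E (\<Theta> y) w" for w
      unfolding f' by (intro inv_f_eq bij_is_inj[OF *(9)[OF y, unfolded f']] DE(1))
    then have "Hilbert_Choice.inv (blinfun_apply (f' (\<Theta> y))) = ?E (\<Theta> y)" by (rule ext)
    then show "(\<Theta> has_derivative ?E (\<Theta> y)) (at y)" using *(7,8)[OF y] by simp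
  qed (use * in auto)
  then show ?thesis using * U by blast
qed

section \<open>Lebesgue measure split along one coordinate\<close>

definition slice_embed :: "'n \<Rightarrow> ('m \<Rightarrow> 'n) \<Rightarrow> real^'m::finite \<Rightarrow> real^'n::finite" where
  "slice_embed z \<sigma> y = (\<chi> i. if i = z then 0 else y $ inv \<sigma> i)"

context
  fixes z :: "'n::finite" and \<sigma> :: "'m::finite \<Rightarrow> 'n"
  assumes \<sigma>: "inj \<sigma>" "range \<sigma> = - {z}"
begin

lemma slice_embed_nth: "slice_embed z \<sigma> y $ z = 0" "slice_embed z \<sigma> y $ \<sigma> a = y $ a"
  using \<sigma> by (auto simp: slice_embed_def)

lemma slice_cases: "i = z \<or> (\<exists>a. i = \<sigma> a)"
  using \<sigma>(2) by auto

lemma linear_slice_embed: "linear (slice_embed z \<sigma> :: real^'m \<Rightarrow> real^'n)"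
  by (rule linearI) (auto simp: slice_embed_def vec_eq_iff)

lemma slice_embed_continuous: "continuous_on X (slice_embed z \<sigma> :: real^'m \<Rightarrow> real^'n)"
  using linear_slice_embed linear_conv_bounded_linear linear_continuous_on by blast

lemma slice_prod: "(\<Prod>i\<in>UNIV. f i) = f z * (\<Prod>a\<in>UNIV. f (\<sigma> a))"
proof -
  have "UNIV = insert z (range \<sigma>)" using \<sigma> by auto
  then have "(\<Prod>i\<in>UNIV. f i) = (\<Prod>i\<in>insert z (range \<sigma>). f i)" by simp
  also have "\<dots> = f z * (\<Prod>i\<in>range \<sigma>. f i)" using \<sigma> by (subst prod.insert) auto
  also have "(\<Prod>i\<in>range \<sigma>. f i) = (\<Prod>a\<in>UNIV. f (\<sigma> a))" by (rule prod.reindex[OF \<sigma>(1), unfolded o_def])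
  finally show ?thesis .
qed

text \<open>A box is the product of a box in the remaining coordinates and an interval in the
  coordinate \<open>z\<close>, so both measures agree on boxes.\<close>

lemma lborel_slice:
  "distr (lborel \<Otimes>\<^sub>M lborel) borel (\<lambda>p :: (real^'m) \<times> real. slice_embed z \<sigma> (fst p) + snd p *\<^sub>R axis z 1) = (lborel :: (real^'n) measure)"
proof (rule lborel_eqI[symmetric])
  let ?T = "\<lambda>p :: (real^'m) \<times> real. slice_embed z \<sigma> (fst p) + snd p *\<^sub>R axis z 1 :: real^'n"
  have nth: "?T p $ z = snd p" "?T p $ \<sigma> a = fst p $ a" for p a
    using slice_embed_nth \<sigma> by (auto simp: axis_def)
  have "continuous_on UNIV ?T"
    by (intro continuous_intros continuous_on_compose2[OF slice_embed_continuous]) auto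
  then have m: "?T \<in> measurable (lborel \<Otimes>\<^sub>M lborel) borel"
    by (simp add: lborel_prod borel_measurable_continuous_onI)
  fix l u :: "real^'n" assume lu: "\<And>b. b \<in> Basis \<Longrightarrow> l \<bullet> b \<le> u \<bullet> b"
  have le: "l $ i \<le> u $ i" for i using lu[of "axis i 1"] by (simp add: inner_axis)
  let ?l = "\<chi> a. l $ \<sigma> a :: real^'m" and ?u = "\<chi> a. u $ \<sigma> a :: real^'m"
  have all: "(\<forall>i. P i) \<longleftrightarrow> P z \<and> (\<forall>a. P (\<sigma> a))" for P using slice_cases by metis
  have "?T -` box l u = box ?l ?u \<times> {l $ z<..<u $ z}"
  proof (rule set_eqI)
    fix p show "p \<in> ?T -` box l u \<longleftrightarrow> p \<in> box ?l ?u \<times> {l $ z<..<u $ z}"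
      unfolding vimage_eq mem_box_cart all nth by (auto simp: mem_Times_iff mem_box_cart)
  qed
  then have "emeasure (distr (lborel \<Otimes>\<^sub>M lborel) borel ?T) (box l u) = emeasure (lborel \<Otimes>\<^sub>M lborel) (box ?l ?u \<times> {l $ z<..<u $ z})"
    by (subst emeasure_distr[OF m]) (auto simp: space_pair_measure)
  also have "\<dots> = emeasure lborel (box ?l ?u) * emeasure lborel {l $ z<..<u $ z}"
    by (rule lborel.emeasure_pair_measure_Times) auto
  also have "\<dots> = ennreal (\<Prod>b\<in>Basis. (?u - ?l) \<bullet> b) * ennreal (u $ z - l $ z)"
    using le by (subst emeasure_lborel_box) (auto simp: Basis_real_vec inner_axis)
  also have "\<dots> = ennreal ((\<Prod>b\<in>Basis. (?u - ?l) \<bullet> b) * (u $ z - l $ z))"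
    using le by (intro ennreal_mult[symmetric] prod_nonneg) (auto simp: Basis_real_vec inner_axis)
  also have "(\<Prod>b\<in>Basis. (?u - ?l) \<bullet> b) * (u $ z - l $ z) = (\<Prod>b\<in>Basis. (u - l) \<bullet> b)"
    by (simp add: prod_Basis_real_vec inner_axis slice_prod mult.commute)
  finally show "emeasure (distr (lborel \<Otimes>\<^sub>M lborel) borel ?T) (box l u) = (\<Prod>b\<in>Basis. (u - l) \<bullet> b)" .
qed simp

end

context straightening
begin

definition "\<Psi> x = x + (r x - x $ z) *\<^sub>R axis z 1"

lemma \<Psi>_nth: "\<Psi> x $ i = (if i = z then r x else x $ i)"
  by (simp add: \<Psi>_def axis_def)

lemma \<Theta>_in: "y \<in> Q \<Longrightarrow> \<Theta> y \<in> N"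
  and \<Psi>_\<Theta>: "y \<in> Q \<Longrightarrow> \<Psi> (\<Theta> y) = y"
  and \<Psi>_in: "x \<in> N \<Longrightarrow> \<Psi> x \<in> Q"
  and \<Theta>_\<Psi>: "x \<in> N \<Longrightarrow> \<Theta> (\<Psi> x) = x"
  using homeo by (auto simp: homeomorphism_def \<Psi>_def)

lemma r_\<Theta>: "y \<in> Q \<Longrightarrow> r (\<Theta> y) = y $ z"
  using \<Psi>_\<Theta>[of y] \<Psi>_nth[of "\<Theta> y" z] by simp

lemma \<Theta>_cont: "continuous_on Q \<Theta>" and \<Psi>_cont: "continuous_on N \<Psi>"
  using homeo by (auto simp: homeomorphism_def \<Psi>_def)

lemma r_cont: "continuous_on N r" and pdr_cont: "continuous_on N (pd i r)"
  using Ck_on_continuous[OF r_C2] Ck_on_continuous[OF Ck_on_pd[OF r_C2, of 1]] by auto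

lemma open_neg: "open {x \<in> N. r x < 0}"
proof -
  have "{x \<in> N. r x < 0} = r -` {..<0} \<inter> N" by auto
  then show ?thesis using r_cont open_N by (simp add: continuous_on_open_vimage)
qed

text \<open>The constant \<open>c\<close> rescales the direction \<open>z\<close> before the
  derivative of \<Theta> is applied. The matrix is the identity except in row \<open>z\<close>,
  whose diagonal entry is \<open>c\<close> divided by \<open>pd z r\<close>.\<close>

lemma det_\<Theta>_deriv:
  fixes \<sigma> :: "'m::finite \<Rightarrow> 'n"
  assumes \<sigma>: "inj \<sigma>" "range \<sigma> = - {z}" and y: "y \<in> Q"
  shows "det (matrix (\<lambda>v. (\<lambda>w. w + ((w $ z - (\<Sum>i\<in>UNIV. w $ i * pd i r (\<Theta> y))) / pd z r (\<Theta> y)) *\<^sub>R axis z 1)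
    (\<chi> i. if i = z then c * v $ z else v $ i))) = c / pd z r (\<Theta> y)"
    (is "det (matrix ?f) = _")
proof -
  have rz0: "pd z r (\<Theta> y) \<noteq> 0" using rz[OF \<Theta>_in[OF y]] .
  have cz: "- range \<sigma> = {z}" using \<sigma> by auto
  have S: "(\<chi> i. if i = z then c * axis j 1 $ z else axis j 1 $ i) = (if j = z then c else 1) *\<^sub>R (axis j 1 :: real^'n)" for j
    by (auto simp: vec_eq_iff axis_def)
  have sm: "(\<Sum>i\<in>UNIV. (a *\<^sub>R axis j (1::real)) $ i * pd i r (\<Theta> y)) = a * pd j r (\<Theta> y)" for a and j :: 'n
    by (simp add: axis_def if_distrib[of "\<lambda>t. t * _"] if_distrib[of "\<lambda>t. _ * t"] cong: if_cong)
  define F where "F = ?f"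
  have f: "F (axis j 1) $ i = (if j = z then c else 1) * (if i = j then 1 else 0)
     + (if i = z then ((if j = z then c else 0) - (if j = z then c else 1) * pd j r (\<Theta> y)) / pd z r (\<Theta> y) else 0)" for i j
    unfolding F_def S sm by (auto simp: axis_def)
  have "det (transpose (matrix F)) = (\<Prod>i\<in>- range \<sigma>. c / pd z r (\<Theta> y)) * det (\<chi> a b. transpose (matrix F) $ \<sigma> a $ \<sigma> b)"
  proof (rule det_embed[OF \<sigma>(1)])
    fix i j assume "i \<notin> range \<sigma>"
    then have "i = z" using cz by auto
    then show "transpose (matrix F) $ i $ j = (if i = j then c / pd z r (\<Theta> y) else 0)"
      unfolding transpose_def matrix_def vec_lambda_beta f using rz0 by (auto simp: field_simps)
  qed
  also have "(\<chi> a b. transpose (matrix F) $ \<sigma> a $ \<sigma> b) = mat 1"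
  proof -
    have "\<sigma> a \<noteq> z" for a using \<sigma>(2) by auto
    then show ?thesis
      unfolding vec_eq_iff transpose_def matrix_def vec_lambda_beta f using \<sigma>(1) by (auto simp: mat_def inj_eq)
  qed
  finally show ?thesis by (simp add: det_transpose cz F_def)
qed

section \<open>The divergence theorem in one straightened neighbourhood of the boundary\<close>

context
  fixes \<sigma> :: "'m::finite \<Rightarrow> 'n" and X :: "real^'n \<Rightarrow> real^'n" and K M
  assumes \<sigma>: "inj \<sigma>" "range \<sigma> = - {z}"
    and K: "compact K" "K \<subseteq> N"
    and X_cont: "continuous_on {x \<in> N. r x \<le> 0} X"
    and X_C1: "\<And>i. Ck_on 1 {x \<in> N. r x < 0} (\<lambda>x. X x $ i)"
    and X_zero: "\<And>x. x \<in> N \<Longrightarrow> r x \<le> 0 \<Longrightarrow> x \<notin> K \<Longrightarrow> X x = 0"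
    and dX_bdd: "\<And>x. x \<in> N \<Longrightarrow> r x < 0 \<Longrightarrow> \<bar>\<Sum>i\<in>UNIV. pd i (\<lambda>x. X x $ i) x\<bar> \<le> M"
begin

abbreviation "neg \<equiv> {x \<in> N. r x < 0}"
definition "dvX x = (\<Sum>i\<in>UNIV. pd i (\<lambda>x. X x $ i) x)"
definition "flux x = (\<Sum>i\<in>UNIV. pd i r x * X x $ i)"
text \<open>Flux through the level sets of \<open>r\<close> per unit of hyperplane measure: dr
  divided by |\<open>pd z r\<close>| is the Euclidean unit conormal times the area factor of a graph
  over the hyperplane.\<close>

definition "dens w = flux (\<Theta> w) / \<bar>pd z r (\<Theta> w)\<bar>"
text \<open>Extension by zero. Since \<open>X\<close> vanishes off the compact set \<open>K\<close>,
  the result is continuous on the closed half-space up to the hyperplane and vanishes there outside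
  a compact set.\<close>

definition "dens0 w = (if w \<in> Q \<and> w $ z \<le> 0 then dens w else 0)"

lemma dvX_cont: "continuous_on neg dvX"
  unfolding dvX_def[abs_def] using X_C1 by (intro continuous_on_sum) auto

lemma dvX_zero: "x \<in> neg \<Longrightarrow> x \<notin> K \<Longrightarrow> dvX x = 0"
proof -
  assume x: "x \<in> neg" "x \<notin> K"
  have "open (neg - K)" using open_neg compact_imp_closed[OF K(1)] by (rule open_Diff)
  then have "pd i (\<lambda>x. X x $ i) x = pd i (\<lambda>x. 0) x" for i
    by (rule pd_cong) (use x X_zero in auto)
  then show ?thesis by (simp add: dvX_def pd_eqI[OF has_derivative_const])
qed

lemma flux_cont: "continuous_on {x \<in> N. r x \<le> 0} flux"
  unfolding flux_def[abs_def] using pdr_cont X_cont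
  by (intro continuous_intros continuous_on_subset[OF pdr_cont]) auto

lemma flux_zero: "x \<in> N \<Longrightarrow> r x \<le> 0 \<Longrightarrow> x \<notin> K \<Longrightarrow> flux x = 0"
  using X_zero by (simp add: flux_def)

text \<open>The cutoff factor vanishes where r > -e, so the truncated field is supported in a
  compact set \<open>L\<close> inside the open region where \<open>X\<close> is C^1. It extends by
  zero to a C^1 field on the whole space, to which \<open>integral_pd_zero\<close> applies
  componentwise.\<close>

lemma cutoff_flux:
  assumes e: "e > 0"
  shows "(LINT x:neg|lborel. cutoff (- r x / e) * dvX x) = (LINT x:neg|lborel. (1 / e) * cutoff' (- r x / e) * flux x)"
proof -
  let ?k = "\<lambda>x. cutoff (- r x / e)" and ?k' = "\<lambda>x. cutoff' (- r x / e)"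
  define L where "L = {x \<in> K. r x \<le> - e}"
  have rK: "continuous_on K r" using r_cont K(2) by (rule continuous_on_subset)
  have L: "compact L" "L \<subseteq> neg"
  proof -
    have "closedin (top_of_set K) (K \<inter> r -` {..- e})" by (rule continuous_closedin_preimage[OF rK]) simp
    moreover have "K \<inter> r -` {..- e} = L" by (auto simp: L_def)
    ultimately show "compact L" using K(1) closedin_compact by metis
    show "L \<subseteq> neg" using K e by (auto simp: L_def)
  qed
  have z: "?k x = 0" "?k' x = 0" if "x \<in> neg" "r x > - e" for x
  proof -
    have "- r x \<le> 1 * e" using that by simp
    then have "- r x / e \<le> 1" by (subst pos_divide_le_eq[OF e])
    then show "?k x = 0" "?k' x = 0" using cutoff_eq(1) cutoff'_eq_0 by blast+
  qed
  have rneg: "Ck_on 2 neg r" using r_C2 by (rule Ck_on_subset) auto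
  have r1: "Ck_on 1 neg (\<lambda>x. - r x / e)"
    unfolding divide_inverse using Ck_on_le[OF rneg, of 1]
    by (intro Ck_on_mult Ck_on_uminus Ck_on_const open_neg) auto
  have c': "continuous_on neg ?k'"
    by (rule continuous_on_compose2[OF cutoff'_continuous[of UNIV] Ck_on_continuous[OF r1]]) auto
  have k1: "Ck_on 1 neg ?k"
    using Ck_on_chain[of neg cutoff cutoff' "\<lambda>x. - r x / e" 0] open_neg DERIV_cutoff r1 c' by simp
  have dk: "pd i ?k x = - (1 / e) * ?k' x * pd i r x" if "x \<in> neg" for i x
  proof -
    have dr: "r differentiable (at x)" using Ck_on_differentiable[OF rneg _ that] by simp
    have "pd i (\<lambda>x. - r x / e) x = - (1 / e) * pd i r x"
      using pd_cmult[OF dr, of i "- (1 / e)"] by simp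
    moreover have "(\<lambda>x. - r x / e) differentiable (at x)" using Ck_on_differentiable[OF r1 _ that] by simp
    ultimately show ?thesis
      using pd_chain(1)[of cutoff _ "\<lambda>x. - r x / e" x i, OF DERIV_cutoff] by simp
  qed
  have kX: "Ck_on 1 neg (\<lambda>x. ?k x * X x $ i)" for i
    by (intro Ck_on_mult open_neg k1 X_C1)
  have kX0: "?k x * X x $ i = 0" if "x \<in> neg - L" for i x
    using that z(1)[of x] X_zero[of x] by (cases "x \<in> K") (auto simp: L_def not_le)
  let ?h = "\<lambda>i x. if x \<in> neg then ?k x * X x $ i else 0"
  have h1: "Ck_on 1 UNIV (?h i)" for i by (rule Ck_on_zero_ext[OF open_neg L kX kX0])
  have h0: "?h i x = 0" if "x \<notin> L" for i x using kX0[of x i] that by auto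
  have pdh: "pd i (?h i) x = indicator neg x * pd i (\<lambda>x. ?k x * X x $ i) x" for i x
  proof (cases "x \<in> neg")
    case True
    then show ?thesis using pd_cong[OF open_neg True, of "?h i" "\<lambda>x. ?k x * X x $ i" i] by simp
  next
    case False
    then have "x \<notin> L" using L by auto
    then show ?thesis using pd_zero_outside[OF compact_imp_closed[OF L(1)] h0] False by simp
  qed
  have "integral\<^sup>L lborel (pd i (?h i)) = 0" for i by (rule integral_pd_zero[OF h1 L(1) h0])
  moreover have "integrable lborel (pd i (?h i))" for i
  proof -
    have "continuous_on UNIV (pd i (?h i))" using h1[of i] by simp
    then have "set_integrable lborel UNIV (pd i (?h i))"
      by (intro set_integrable_compact_support[OF _ L(1)])
         (use pd_zero_outside[OF compact_imp_closed[OF L(1)] h0] in \<open>auto intro: continuous_on_subset\<close>)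
    then show ?thesis by (simp add: set_integrable_def)
  qed
  ultimately have "integral\<^sup>L lborel (\<lambda>x. \<Sum>i\<in>UNIV. pd i (?h i) x) = 0"
    by (subst Bochner_Integration.integral_sum) auto
  moreover have "(\<Sum>i\<in>UNIV. pd i (?h i) x) = indicator neg x *\<^sub>R (?k x * dvX x - (1 / e) * ?k' x * flux x)" for x
  proof (cases "x \<in> neg")
    case True
    have "pd i (\<lambda>x. ?k x * X x $ i) x = - (1 / e) * ?k' x * pd i r x * X x $ i + ?k x * pd i (\<lambda>x. X x $ i) x" for i
      using pd_mult[OF Ck_on_differentiable[OF k1 _ True] Ck_on_differentiable[OF X_C1 _ True], of i i] dk[OF True] by simp
    then show ?thesis unfolding pdh using True
      by (simp add: dvX_def flux_def sum.distrib sum_subtractf sum_distrib_left sum_negf mult.assoc sum_divide_distrib)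
  next
    case False
    then show ?thesis unfolding pdh by simp
  qed
  ultimately have "(LINT x:neg|lborel. ?k x * dvX x - (1 / e) * ?k' x * flux x) = 0"
    by (simp add: set_lebesgue_integral_def)
  moreover have "set_integrable lborel neg (\<lambda>x. ?k x * dvX x)"
  proof (rule set_integrable_compact_support[OF _ L])
    show "continuous_on L (\<lambda>x. ?k x * dvX x)"
      by (rule continuous_on_subset[OF continuous_on_mult[OF Ck_on_continuous[OF k1] dvX_cont] L(2)])
    show "?k x * dvX x = 0" if "x \<in> neg - L" for x
      using that z(1)[of x] dvX_zero[of x] by (cases "x \<in> K") (auto simp: L_def not_le)
  qed
  moreover have "set_integrable lborel neg (\<lambda>x. (1 / e) * ?k' x * flux x)"
  proof (rule set_integrable_compact_support[OF _ L])
    have "continuous_on neg flux" using flux_cont by (rule continuous_on_subset) auto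
    then have "continuous_on neg (\<lambda>x. (1 / e) * ?k' x * flux x)" using c' by (intro continuous_intros)
    then show "continuous_on L (\<lambda>x. (1 / e) * ?k' x * flux x)" using L(2) by (rule continuous_on_subset)
    show "(1 / e) * ?k' x * flux x = 0" if "x \<in> neg - L" for x
      using that z(2)[of x] flux_zero[of x] by (cases "x \<in> K") (auto simp: L_def not_le)
  qed
  ultimately show ?thesis by (simp add: set_integral_diff)
qed

text \<open>With w_z = -r/e the shrinking layer e \<le> -r \<le> 2e becomes the fixed slab 1 \<le>
  w_z \<le> 2.\<close>

definition zscale :: "real \<Rightarrow> real^'n \<Rightarrow> real^'n" where "zscale e w = (\<chi> i. if i = z then - e * w $ z else w $ i)"

lemma zscale_nth: "zscale e w $ i = (if i = z then - e * w $ z else w $ i)"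
  by (simp add: zscale_def)

lemma zscale_linear: "linear (zscale e)"
  by (rule linearI) (auto simp: zscale_def vec_eq_iff algebra_simps)

lemma zscale_cont: "continuous_on Y (zscale e)"
  using zscale_linear linear_conv_bounded_linear linear_continuous_on by blast

text \<open>The Jacobian of \<Theta> after \<open>zscale e\<close> has absolute value e divided by
  |\<open>pd z r\<close>|: the factor e cancels 1/e, and the rest turns \<open>flux\<close> into
  \<open>dens\<close>.\<close>

lemma flux_change_of_variables:
  assumes e: "e > 0"
  shows "(LINT x:neg|lborel. (1 / e) * cutoff' (- r x / e) * flux x)
    = integral\<^sup>L lborel (\<lambda>w. cutoff' (w $ z) * dens0 (zscale e w))"
proof -
  let ?f = "\<lambda>x. (1 / e) * cutoff' (- r x / e) * flux x"
  let ?\<psi> = "\<lambda>w. \<Theta> (zscale e w)"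
  let ?E = "\<lambda>y w. w + ((w $ z - (\<Sum>i\<in>UNIV. w $ i * pd i r (\<Theta> y))) / pd z r (\<Theta> y)) *\<^sub>R axis z 1"
  let ?K = "\<lambda>w v. ?E (zscale e w) (zscale e v)"
  define U where "U = {w. zscale e w \<in> Q \<and> w $ z > 0}"
  have "open (zscale e -` Q \<inter> {w. w $ z > 0})"
  proof (rule open_Int)
    show "open (zscale e -` Q)" using zscale_cont[of UNIV e] open_Q by (simp add: open_vimage)
    show "open {w :: real^'n. w $ z > 0}" by (rule open_halfspace_component_gt_cart)
  qed
  then have U: "open U" by (simp add: U_def vimage_def Int_def)
  have im: "?\<psi> ` U = neg"
  proof (intro set_eqI iffI)
    fix x assume "x \<in> neg"
    then have x: "x \<in> N" "r x < 0" by auto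
    define w where "w = (\<chi> i. if i = z then - r x / e else x $ i)"
    have "zscale e w = \<Psi> x" using e by (simp add: vec_eq_iff zscale_nth w_def \<Psi>_nth)
    then have "w \<in> U" "?\<psi> w = x"
      using x e \<Psi>_in \<Theta>_\<Psi> by (auto simp: U_def w_def divide_less_0_iff)
    then show "x \<in> ?\<psi> ` U" by force
  qed (use e in \<open>auto simp: U_def \<Theta>_in r_\<Theta> zscale_nth\<close>)
  have der: "(?\<psi> has_derivative ?K w) (at w)" if "w \<in> U" for w
  proof -
    have "(zscale e has_derivative zscale e) (at w)"
      using zscale_linear linear_conv_bounded_linear bounded_linear_imp_has_derivative by blast
    from has_derivative_compose[OF this \<Theta>_deriv] that show ?thesis by (simp add: U_def)
  qed
  have det: "det (matrix (?K w)) = - e / pd z r (?\<psi> w)" if "w \<in> U" for w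
    using det_\<Theta>_deriv[OF \<sigma>, of "zscale e w" "- e"] that by (simp add: U_def zscale_def)
  have inj: "inj_on ?\<psi> U"
  proof (rule inj_onI)
    fix v w assume vw: "v \<in> U" "w \<in> U" "?\<psi> v = ?\<psi> w"
    then have "zscale e v = zscale e w" using \<Psi>_\<Theta> unfolding U_def by (metis (mono_tags, lifting) mem_Collect_eq)
    then show "v = w" using e by (auto simp: vec_eq_iff zscale_nth split: if_splits)
  qed
  have \<psi>c: "continuous_on U ?\<psi>"
    by (rule continuous_on_compose2[OF \<Theta>_cont zscale_cont]) (auto simp: U_def)
  have \<psi>N: "?\<psi> w \<in> N" if "w \<in> U" for w using that \<Theta>_in by (simp add: U_def)
  have "continuous_on U (\<lambda>w. \<bar>- e / pd z r (?\<psi> w)\<bar>)"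
    by (intro continuous_intros continuous_on_compose2[OF pdr_cont \<psi>c]) (use \<psi>N rz in auto)
  then have cdet: "continuous_on U (\<lambda>w. \<bar>det (matrix (?K w))\<bar>)"
    by (rule continuous_on_eq) (simp add: det)
  have "continuous_on neg ?f"
  proof -
    have "continuous_on neg (\<lambda>x. - r x / e)"
      by (intro continuous_on_divide continuous_on_minus continuous_on_subset[OF r_cont] continuous_on_const) (use e in auto)
    then have "continuous_on neg (\<lambda>x. cutoff' (- r x / e))"
      by (rule continuous_on_compose2[OF cutoff'_continuous[of UNIV]]) auto
    then show ?thesis
      by (intro continuous_on_mult continuous_on_const continuous_on_subset[OF flux_cont]) auto
  qed
  from borel_measurable_continuous_on_indicator[OF _ this]
  have fm: "(\<lambda>x. indicator (?\<psi> ` U) x * ?f x) \<in> borel_measurable borel"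
    using open_neg unfolding im by simp
  have "(LINT x:neg|lborel. ?f x) = (LINT x:?\<psi> ` U|lborel. ?f x)" by (simp only: im)
  also have "\<dots> = (LINT w:U|lborel. \<bar>det (matrix (?K w))\<bar> * ?f (?\<psi> w))"
    using open_neg by (intro integral_image U der inj cdet fm) (simp_all only: im)
  also have "\<dots> = integral\<^sup>L lborel (\<lambda>w. cutoff' (w $ z) * dens0 (zscale e w))"
    unfolding set_lebesgue_integral_def
  proof (rule Bochner_Integration.integral_cong[OF refl])
    fix w
    show "indicator U w *\<^sub>R (\<bar>det (matrix (?K w))\<bar> * ?f (?\<psi> w)) = cutoff' (w $ z) * dens0 (zscale e w)"
    proof (cases "w \<in> U")
      case True
      then have *: "zscale e w \<in> Q" "w $ z > 0" by (auto simp: U_def)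
      have r: "r (?\<psi> w) = - e * w $ z" using r_\<Theta>[OF *(1)] by (simp add: zscale_nth)
      have "dens0 (zscale e w) = dens (zscale e w)" using * e by (simp add: dens0_def zscale_nth)
      then show ?thesis using True e by (simp only: det) (simp add: r dens_def abs_divide)
    next
      case False
      then show ?thesis using cutoff'_eq_0[of "w $ z"] by (auto simp: U_def dens0_def)
    qed
  qed
  finally show ?thesis .
qed

text \<open>The half-space is covered by two relatively open sets: the part in \<open>Q\<close>,
  where \<open>dens\<close> is continuous, and the complement of the closed image of
  \<open>K\<close>, where \<open>dens0\<close> vanishes.\<close>

lemma dens0_cont: "continuous_on {w. w $ z \<le> 0} dens0"
proof -
  let ?H = "{w :: real^'n. w $ z \<le> 0}"
  have cK: "closed (\<Psi> ` K)"
    using K \<Psi>_cont by (meson compact_continuous_image compact_imp_closed continuous_on_subset)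
  have H: "?H = (?H \<inter> Q) \<union> (?H - \<Psi> ` K)" using K \<Psi>_in by auto
  have "continuous_on ((?H \<inter> Q) \<union> (?H - \<Psi> ` K)) dens0"
  proof (rule continuous_on_Un_local_open)
    show "openin (top_of_set (?H \<inter> Q \<union> (?H - \<Psi> ` K))) (?H \<inter> Q)"
      unfolding H[symmetric] using open_Q by (auto simp: openin_open)
    show "openin (top_of_set (?H \<inter> Q \<union> (?H - \<Psi> ` K))) (?H - \<Psi> ` K)"
      unfolding H[symmetric] openin_open using cK by (intro exI[of _ "- (\<Psi> ` K)"]) auto
    have "continuous_on (?H \<inter> Q) dens"
      unfolding dens_def[abs_def]
    proof (intro continuous_intros)
      have t: "continuous_on (?H \<inter> Q) \<Theta>" using \<Theta>_cont by (rule continuous_on_subset) auto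
      show "continuous_on (?H \<inter> Q) (\<lambda>w. flux (\<Theta> w))"
        by (rule continuous_on_compose2[OF flux_cont t]) (auto simp: \<Theta>_in r_\<Theta>)
      show "continuous_on (?H \<inter> Q) (\<lambda>w. pd z r (\<Theta> w))"
        by (rule continuous_on_compose2[OF pdr_cont t]) (auto simp: \<Theta>_in)
      show "\<forall>w\<in>?H \<inter> Q. \<bar>pd z r (\<Theta> w)\<bar> \<noteq> 0" using rz \<Theta>_in by auto
    qed
    then show "continuous_on (?H \<inter> Q) dens0"
      by (rule continuous_on_eq) (auto simp: dens0_def)
    have "dens0 w = 0" if "w \<in> ?H - \<Psi> ` K" for w
    proof (cases "w \<in> Q")
      case True
      then have "\<Theta> w \<notin> K" using that \<Psi>_\<Theta>[OF True] by (metis DiffD2 imageI)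
      then have "flux (\<Theta> w) = 0" using flux_zero[OF \<Theta>_in[OF True]] that True by (simp add: r_\<Theta>)
      then show ?thesis by (simp add: dens0_def dens_def)
    qed (simp add: dens0_def)
    then show "continuous_on (?H - \<Psi> ` K) dens0"
      by (subst continuous_on_cong[OF refl, of _ _ "\<lambda>_. 0"]) auto
  qed
  then show ?thesis using H by simp
qed

lemma dens0_zero: "w $ z \<le> 0 \<Longrightarrow> w \<notin> \<Psi> ` K \<Longrightarrow> dens0 w = 0"
proof (cases "w \<in> Q")
  case True
  assume *: "w $ z \<le> 0" "w \<notin> \<Psi> ` K"
  then have "\<Theta> w \<notin> K" using \<Psi>_\<Theta>[OF True] by (metis imageI)
  then have "flux (\<Theta> w) = 0" using flux_zero[OF \<Theta>_in[OF True]] * True by (simp add: r_\<Theta>)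
  then show ?thesis by (simp add: dens0_def dens_def)
qed (simp add: dens0_def)

lemma dens0_bounded: "\<exists>C\<ge>0. \<forall>w. \<bar>dens0 w\<bar> \<le> C"
proof -
  have cK: "compact (\<Psi> ` K \<inter> {w. w $ z \<le> 0})"
    using K \<Psi>_cont closed_halfspace_component_le_cart[of z 0]
    by (meson compact_Int_closed compact_continuous_image continuous_on_subset)
  have "bounded (dens0 ` (\<Psi> ` K \<inter> {w. w $ z \<le> 0}))"
    by (intro compact_imp_bounded compact_continuous_image cK continuous_on_subset[OF dens0_cont]) auto
  then obtain C where C: "\<And>w. w \<in> \<Psi> ` K \<inter> {w. w $ z \<le> 0} \<Longrightarrow> \<bar>dens0 w\<bar> \<le> C"
    unfolding bounded_iff real_norm_def by blast
  have "\<bar>dens0 w\<bar> \<le> max C 0" for w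
    using C[of w] dens0_zero[of w] by (cases "w \<in> \<Psi> ` K \<inter> {w. w $ z \<le> 0}") (auto simp: dens0_def le_max_iff_disj)
  then show ?thesis by (intro exI[of _ "max C 0"]) auto
qed

lemma flux_limit:
  defines "e \<equiv> \<lambda>n. 1 / real (Suc n)"
  shows "(\<lambda>n. integral\<^sup>L lborel (\<lambda>w. cutoff' (w $ z) * dens0 (zscale (e n) w)))
     \<longlonglongrightarrow> integral\<^sup>L lborel (\<lambda>w. cutoff' (w $ z) * dens0 (zscale 0 w))"
    and "integrable lborel (\<lambda>w. cutoff' (w $ z) * dens0 (zscale 0 w))"
proof -
  obtain C where C: "C \<ge> 0" "\<And>w. \<bar>dens0 w\<bar> \<le> C" using dens0_bounded by blast
  obtain C' where C': "C' \<ge> 0" "\<And>t. \<bar>cutoff' t\<bar> \<le> C'" using cutoff'_bounded by blast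
  have "bounded (\<Psi> ` K)"
    using K \<Psi>_cont by (meson compact_continuous_image compact_imp_bounded continuous_on_subset)
  then obtain R where R: "R > 0" "\<And>w. w \<in> \<Psi> ` K \<Longrightarrow> norm w \<le> R" unfolding bounded_pos by blast
  \<comment> \<open>Scaling leaves all coordinates but \<open>z\<close> unchanged, so they are
    bounded by \<open>R\<close> where the integrand is nonzero, while \<open>cutoff'\<close>
    confines the coordinate \<open>z\<close> to the interval from 1 to 2. The number R + 2 covers
    both.\<close>
  let ?b = "(\<chi> i. R + 2) :: real^'n"
  have e0: "e n > 0" for n by (simp add: e_def)
  have meas: "(\<lambda>w. cutoff' (w $ z) * dens0 (zscale d w)) \<in> borel_measurable lborel" if "d \<ge> 0" for d
  proof -
    have "closed {w :: real^'n. 0 \<le> w $ z}" by (rule closed_halfspace_component_ge_cart)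
    moreover have "continuous_on {w :: real^'n. 0 \<le> w $ z} (\<lambda>w. cutoff' (w $ z) * dens0 (zscale d w))"
      using that
      by (intro continuous_intros continuous_on_compose2[OF cutoff'_continuous[of UNIV]] continuous_on_compose2[OF dens0_cont zscale_cont])
         (auto simp: zscale_nth)
    ultimately have "(\<lambda>w. indicator {w :: real^'n. 0 \<le> w $ z} w *\<^sub>R (cutoff' (w $ z) * dens0 (zscale d w))) \<in> borel_measurable borel"
      by (intro borel_measurable_continuous_on_indicator) auto
    moreover have "(\<lambda>w. indicator {w :: real^'n. 0 \<le> w $ z} w *\<^sub>R (cutoff' (w $ z) * dens0 (zscale d w))) = (\<lambda>w. cutoff' (w $ z) * dens0 (zscale d w))"
    proof
      fix w :: "real^'n"
      show "indicator {w :: real^'n. 0 \<le> w $ z} w *\<^sub>R (cutoff' (w $ z) * dens0 (zscale d w)) = cutoff' (w $ z) * dens0 (zscale d w)"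
        using cutoff'_eq_0[of "w $ z"] by (auto simp: indicator_def)
    qed
    ultimately show ?thesis by simp
  qed
  have lim: "(\<lambda>n. cutoff' (w $ z) * dens0 (zscale (e n) w)) \<longlonglongrightarrow> cutoff' (w $ z) * dens0 (zscale 0 w)" for w
  proof (cases "w $ z \<ge> 0")
    case True
    have en: "e \<longlonglongrightarrow> 0" unfolding e_def by (rule LIMSEQ_Suc[OF lim_1_over_n])
    have "(\<lambda>n. zscale (e n) w) \<longlonglongrightarrow> zscale 0 w"
      by (rule vec_tendstoI) (use en in \<open>auto simp: zscale_nth intro!: tendsto_eq_intros\<close>)
    moreover have "zscale 0 w \<in> {w. w $ z \<le> 0}" "\<forall>\<^sub>F n in sequentially. zscale (e n) w \<in> {w. w $ z \<le> 0}"
      using True e0 by (auto simp: zscale_nth less_imp_le)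
    ultimately have "(\<lambda>n. dens0 (zscale (e n) w)) \<longlonglongrightarrow> dens0 (zscale 0 w)"
      using dens0_cont by (rule continuous_on_tendsto_compose[rotated])
    then show ?thesis by (rule tendsto_mult_left)
  next
    case False
    then show ?thesis using cutoff'_eq_0[of "w $ z"] by simp
  qed
  have bd: "norm (cutoff' (w $ z) * dens0 (zscale (e n) w)) \<le> indicator (cbox (- ?b) ?b) w * (C' * C)" for w n
  proof (cases "cutoff' (w $ z) * dens0 (zscale (e n) w) = 0")
    case False
    then have wz: "1 < w $ z" "w $ z < 2" using cutoff'_eq_0[of "w $ z"] by (auto simp: not_le[symmetric])
    have "zscale (e n) w $ z \<le> 0" using wz e0[of n] by (simp add: zscale_nth)
    then have "zscale (e n) w \<in> \<Psi> ` K" using dens0_zero[of "zscale (e n) w"] False by auto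
    then have R': "norm (zscale (e n) w) \<le> R" by (rule R(2))
    have "\<bar>w $ i\<bar> \<le> R + 2" for i
      using component_le_norm_cart[of "zscale (e n) w" i] R' wz R(1) by (cases "i = z") (auto simp: zscale_nth)
    then have "- (R + 2) \<le> w $ i \<and> w $ i \<le> R + 2" for i by (simp only: abs_le_iff minus_le_iff)
    then have "w \<in> cbox (- ?b) ?b" by (simp add: mem_box_cart)
    then show ?thesis using C' C by (simp add: abs_mult mult_mono)
  qed (use C C' in auto)
  have wi: "integrable lborel (\<lambda>w. indicator (cbox (- ?b) ?b) w * (C' * C))"
    by (intro integrable_mult_left integrable_real_indicator emeasure_bounded_finite) auto
  show "(\<lambda>n. integral\<^sup>L lborel (\<lambda>w. cutoff' (w $ z) * dens0 (zscale (e n) w)))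
     \<longlonglongrightarrow> integral\<^sup>L lborel (\<lambda>w. cutoff' (w $ z) * dens0 (zscale 0 w))"
    by (rule integral_dominated_convergence[OF _ _ wi])
       (use meas[OF order_refl] meas[OF less_imp_le[OF e0]] lim bd in auto)
  show "integrable lborel (\<lambda>w. cutoff' (w $ z) * dens0 (zscale 0 w))"
    by (rule integrable_dominated_convergence[OF _ _ wi, where s = "\<lambda>n w. cutoff' (w $ z) * dens0 (zscale (e n) w)"])
       (use meas[OF order_refl] meas[OF less_imp_le[OF e0]] lim bd in auto)
qed

text \<open>At scale 0 the second factor no longer depends on the coordinate \<open>z\<close>, so
  Fubini separates the integral of \<open>cutoff'\<close>, which is 1.\<close>

lemma flux_slice:
  "integral\<^sup>L lborel (\<lambda>w. cutoff' (w $ z) * dens0 (zscale 0 w)) = integral\<^sup>L lborel (\<lambda>y. dens0 (slice_embed z \<sigma> y))"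
proof -
  let ?T = "\<lambda>p :: (real^'m) \<times> real. slice_embed z \<sigma> (fst p) + snd p *\<^sub>R axis z 1 :: real^'n"
  let ?f = "\<lambda>w. cutoff' (w $ z) * dens0 (zscale 0 w)"
  have Tm: "?T \<in> measurable (lborel \<Otimes>\<^sub>M lborel) borel"
  proof -
    have "continuous_on UNIV ?T"
      by (intro continuous_intros continuous_on_compose2[OF slice_embed_continuous[OF \<sigma>]]) auto
    then show ?thesis by (simp add: lborel_prod borel_measurable_continuous_onI)
  qed
  have fT: "?f (?T p) = cutoff' (snd p) * dens0 (slice_embed z \<sigma> (fst p))" for p
  proof -
    have "zscale 0 (?T p) = slice_embed z \<sigma> (fst p)"
      by (simp add: vec_eq_iff zscale_nth slice_embed_nth[OF \<sigma>] axis_def)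
    moreover have "?T p $ z = snd p" by (simp add: slice_embed_nth[OF \<sigma>])
    ultimately show ?thesis by simp
  qed
  have int: "integrable (distr (lborel \<Otimes>\<^sub>M lborel) borel ?T) ?f"
    unfolding lborel_slice[OF \<sigma>] by (rule flux_limit(2))
  have fm: "?f \<in> borel_measurable borel"
    using borel_measurable_integrable[OF flux_limit(2)] by simp
  have int2: "integrable (lborel \<Otimes>\<^sub>M lborel) (\<lambda>p. ?f (?T p))"
    using int integrable_distr_eq[OF Tm fm] by simp
  have "integral\<^sup>L lborel ?f = integral\<^sup>L (distr (lborel \<Otimes>\<^sub>M lborel) borel ?T) ?f"
    unfolding lborel_slice[OF \<sigma>] ..
  also have "\<dots> = integral\<^sup>L (lborel \<Otimes>\<^sub>M lborel) (\<lambda>p. ?f (?T p))" by (rule integral_distr[OF Tm fm])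
  also have "\<dots> = (\<integral>y. (\<integral>s. ?f (?T (y, s)) \<partial>lborel) \<partial>lborel)"
    by (rule lborel_pair.integral_fst'[OF int2, symmetric])
  also have "\<dots> = (\<integral>y. dens0 (slice_embed z \<sigma> y) \<partial>lborel)"
    unfolding fT by (simp add: integral_cutoff'(2))
  finally show ?thesis .
qed

text \<open>Continuity of the divergence holds only inside, so integrability rests on the bound
  \<open>M\<close> and on the compact support.\<close>

lemma dvX_integrable: "set_integrable lborel neg dvX"
  unfolding set_integrable_def
proof (rule Bochner_Integration.integrable_bound)
  show "integrable lborel (\<lambda>x. M * indicator K x)"
    using K(1) by (intro integrable_mult_right integrable_real_indicator emeasure_bounded_finite compact_imp_bounded) (auto simp: compact_imp_closed)
  show "(\<lambda>x. indicator neg x *\<^sub>R dvX x) \<in> borel_measurable lborel"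
    using borel_measurable_continuous_on_indicator[OF _ dvX_cont] open_neg by simp
  show "AE x in lborel. norm (indicator neg x *\<^sub>R dvX x) \<le> norm (M * indicator K x)"
  proof (intro AE_I2)
    fix x
    show "norm (indicator neg x *\<^sub>R dvX x) \<le> norm (M * indicator K x)"
      using dvX_zero[of x] dX_bdd[of x] by (cases "x \<in> neg"; cases "x \<in> K") (auto simp: dvX_def)
  qed
qed

text \<open>The integral of the divergence of \<open>cutoff (- r / e) X\<close> vanishes. After the change of variables
  \<open>x = \<Theta> (zscale e w)\<close> the term with the derivative of the cutoff tends to the boundary flux as \<open>e \<rightarrow> 0\<close>, so
  \<open>X\<close> need not be differentiable at the boundary.\<close>

theorem flat_divergence:
  "(LINT x:neg|lborel. dvX x) = (LINT y:{y. slice_embed z \<sigma> y \<in> Q}|lborel. dens (slice_embed z \<sigma> y))"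
proof -
  define e where "e = (\<lambda>n. 1 / real (Suc n))"
  have e0: "e n > 0" for n by (simp add: e_def)
  let ?k = "\<lambda>n x. cutoff (- r x / e n)"
  have "(\<lambda>n. LINT x:neg|lborel. ?k n x * dvX x) \<longlonglongrightarrow> (LINT x:neg|lborel. dvX x)"
    unfolding set_lebesgue_integral_def
  proof (rule integral_dominated_convergence[where w = "\<lambda>x. norm (indicator neg x *\<^sub>R dvX x)"])
    have i: "integrable lborel (\<lambda>x. indicator neg x *\<^sub>R dvX x)" using dvX_integrable by (simp add: set_integrable_def)
    then show "integrable lborel (\<lambda>x. norm (indicator neg x *\<^sub>R dvX x))" by (rule integrable_norm)
    show "(\<lambda>x. indicator neg x *\<^sub>R dvX x) \<in> borel_measurable lborel" using i by (rule borel_measurable_integrable)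
    show "(\<lambda>x. indicator neg x *\<^sub>R (?k n x * dvX x)) \<in> borel_measurable lborel" for n
    proof -
      have "continuous_on neg (\<lambda>x. - r x / e n)"
        by (intro continuous_on_divide continuous_on_minus continuous_on_subset[OF r_cont] continuous_on_const)
           (use e0[of n] in auto)
      then have "continuous_on neg (\<lambda>x. ?k n x * dvX x)"
        by (intro continuous_on_mult dvX_cont continuous_on_compose2[OF cutoff_continuous[of UNIV]]) auto
      from borel_measurable_continuous_on_indicator[OF _ this] show ?thesis using open_neg by simp
    qed
    show "AE x in lborel. (\<lambda>n. indicator neg x *\<^sub>R (?k n x * dvX x)) \<longlonglongrightarrow> indicator neg x *\<^sub>R dvX x"
    proof (rule AE_I2)
      fix x
      show "(\<lambda>n. indicator neg x *\<^sub>R (?k n x * dvX x)) \<longlonglongrightarrow> indicator neg x *\<^sub>R dvX x"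
      proof (cases "x \<in> neg")
        case True
        then have rx: "- r x > 0" by simp
        \<comment> \<open>From this index on -r x / e n is at least 2, where the cutoff equals
          1.\<close>
        obtain m where m: "2 / (- r x) < real m" using reals_Archimedean2 by blast
        have "?k n x = 1" if "n \<ge> m" for n
        proof -
          have "2 < real m * (- r x)" using m rx pos_divide_less_eq by blast
          also have "\<dots> \<le> real (Suc n) * (- r x)" using that rx by (intro mult_right_mono) auto
          finally have "- r x / e n \<ge> 2" by (simp add: e_def mult.commute)
          then show ?thesis by (rule cutoff_eq(2))
        qed
        then have "\<forall>\<^sub>F n in sequentially. indicator neg x *\<^sub>R dvX x = indicator neg x *\<^sub>R (?k n x * dvX x)"
          by (intro eventually_sequentiallyI[of m]) simp
        then show ?thesis by (rule Lim_transform_eventually[OF tendsto_const])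
      qed simp
    qed
    show "AE x in lborel. norm (indicator neg x *\<^sub>R (?k n x * dvX x)) \<le> norm (indicator neg x *\<^sub>R dvX x)" for n
      using cutoff_bounds by (intro AE_I2) (auto simp: abs_mult indicator_def intro: mult_left_le_one_le)
  qed
  moreover have "(\<lambda>n. LINT x:neg|lborel. ?k n x * dvX x) \<longlonglongrightarrow> integral\<^sup>L lborel (\<lambda>w. cutoff' (w $ z) * dens0 (zscale 0 w))"
    unfolding cutoff_flux[OF e0] flux_change_of_variables[OF e0] unfolding e_def by (rule flux_limit(1))
  ultimately have "(LINT x:neg|lborel. dvX x) = integral\<^sup>L lborel (\<lambda>w. cutoff' (w $ z) * dens0 (zscale 0 w))"
    by (rule LIMSEQ_unique)
  also have "\<dots> = (LINT y:{y. slice_embed z \<sigma> y \<in> Q}|lborel. dens (slice_embed z \<sigma> y))"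
    unfolding flux_slice set_lebesgue_integral_def
    by (rule Bochner_Integration.integral_cong) (auto simp: dens0_def slice_embed_nth[OF \<sigma>] indicator_def)
  finally show ?thesis .
qed

lemma dens_integrable: "set_integrable lborel {y. slice_embed z \<sigma> y \<in> Q} (\<lambda>y. dens (slice_embed z \<sigma> y))"
proof -
  let ?L = "slice_embed z \<sigma> -` (\<Psi> ` K) :: (real^'m) set"
  have cK: "compact (\<Psi> ` K)" using K \<Psi>_cont by (meson compact_continuous_image continuous_on_subset)
  have cont: "continuous_on UNIV (\<lambda>y. dens0 (slice_embed z \<sigma> y))"
    by (rule continuous_on_compose2[OF dens0_cont slice_embed_continuous[OF \<sigma>]]) (auto simp: slice_embed_nth[OF \<sigma>])
  obtain R where R: "\<And>w. w \<in> \<Psi> ` K \<Longrightarrow> norm w \<le> R"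
    using compact_imp_bounded[OF cK] unfolding bounded_iff by blast
  have "compact ?L"
    unfolding compact_eq_bounded_closed
  proof
    show "closed ?L"
      using slice_embed_continuous[OF \<sigma>, of UNIV] compact_imp_closed[OF cK] by (simp add: closed_vimage)
    have "norm y \<le> (\<Sum>a\<in>(UNIV :: 'm set). R)" if "y \<in> ?L" for y
    proof (rule order_trans[OF norm_le_l1_cart], rule sum_mono)
      fix a
      have "\<bar>y $ a\<bar> = \<bar>slice_embed z \<sigma> y $ \<sigma> a\<bar>" by (simp add: slice_embed_nth[OF \<sigma>])
      also have "\<dots> \<le> norm (slice_embed z \<sigma> y)" by (rule component_le_norm_cart)
      also have "\<dots> \<le> R" using that R by blast
      finally show "\<bar>y $ a\<bar> \<le> R" .
    qed
    then show "bounded ?L" unfolding bounded_iff by blast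
  qed
  then have "set_integrable lborel UNIV (\<lambda>y. dens0 (slice_embed z \<sigma> y))"
    by (intro set_integrable_compact_support[of ?L] continuous_on_subset[OF cont])
       (auto intro!: dens0_zero simp: slice_embed_nth[OF \<sigma>])
  moreover have "indicator {y. slice_embed z \<sigma> y \<in> Q} y *\<^sub>R dens (slice_embed z \<sigma> y) = dens0 (slice_embed z \<sigma> y)" for y
    by (auto simp: dens0_def slice_embed_nth[OF \<sigma>] indicator_def)
  ultimately show ?thesis by (simp add: set_integrable_def)
qed

end

end

section \<open>Domains with \<open>C\<^sup>2\<close> boundary: normal and mean curvature\<close>

lemma dir_derivative:
  fixes f :: "real^'n::finite \<Rightarrow> real"
  assumes "f differentiable (at x)"
  shows "((\<lambda>t. f (x + t *\<^sub>R v)) has_real_derivative (\<Sum>i\<in>UNIV. v $ i * pd i f x)) (at 0)"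
proof -
  have 1: "((\<lambda>t. x + t *\<^sub>R v) has_derivative (\<lambda>h. h *\<^sub>R v)) (at 0)"
    by (auto intro!: derivative_eq_intros)
  have 2: "(f has_derivative (\<lambda>v. \<Sum>i\<in>UNIV. v $ i *\<^sub>R pd i f x)) (at (x + 0 *\<^sub>R v))"
    using has_derivative_pd[OF assms] by simp
  have "((\<lambda>t. f (x + t *\<^sub>R v)) has_derivative (\<lambda>h. \<Sum>i\<in>UNIV. (h *\<^sub>R v) $ i *\<^sub>R pd i f x)) (at 0)"
    by (rule has_derivative_compose[OF 1 2])
  moreover have "(\<lambda>h. \<Sum>i\<in>UNIV. (h *\<^sub>R v) $ i *\<^sub>R pd i f x) = (*) (\<Sum>i\<in>UNIV. v $ i * pd i f x)"
    by (auto simp: fun_eq_iff sum_distrib_left mult_ac)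
  ultimately show ?thesis by (simp add: has_field_derivative_def)
qed

text \<open>If the component \<open>b\<close> of \<open>a'\<close> orthogonal to \<open>a\<close>
  were nonzero, subtracting a large multiple of it from \<open>a\<close> would keep a \<bullet> v
  positive and make a' \<bullet> v negative. The intended covectors are the differentials of two
  defining functions of the same domain.\<close>

lemma parallel_covector:
  fixes a a' :: "real^'n::finite"
  assumes "\<And>v. a \<bullet> v > 0 \<Longrightarrow> a' \<bullet> v \<ge> 0" "a \<noteq> 0" "a' \<noteq> 0"
  shows "\<exists>l>0. a' = l *\<^sub>R a"
proof -
  define l where "l = (a' \<bullet> a) / (a \<bullet> a)"
  define b where "b = a' - l *\<^sub>R a"
  have aa: "a \<bullet> a > 0" using assms(2) by simp
  have ba: "b \<bullet> a = 0" "a \<bullet> b = 0" using aa by (simp_all add: b_def l_def inner_diff_left inner_diff_right inner_commute)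
  have "b = 0"
  proof (rule ccontr)
    assume "b \<noteq> 0"
    then have bb: "b \<bullet> b > 0" by simp
    \<comment> \<open>Chosen so that \<open>a'\<close> takes the value -1 on the test
      vector.\<close>
    define K where "K = (l * (a \<bullet> a) + 1) / (b \<bullet> b)"
    have "a' \<bullet> (a - K *\<^sub>R b) = l * (a \<bullet> a) - K * (b \<bullet> b)"
    proof -
      have "a' = l *\<^sub>R a + b" by (simp add: b_def)
      then show ?thesis by (simp add: inner_add_left inner_diff_right ba)
    qed
    also have "\<dots> = - 1" using bb by (simp add: K_def)
    finally have "a' \<bullet> (a - K *\<^sub>R b) < 0" by simp
    moreover have "a \<bullet> (a - K *\<^sub>R b) > 0" using aa by (simp add: inner_diff_right ba)
    ultimately show False using assms(1) by force
  qed
  then have a': "a' = l *\<^sub>R a" by (simp add: b_def)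
  moreover have "l \<ge> 0" using assms(1)[OF aa] aa by (simp add: l_def)
  ultimately show ?thesis using assms(3) by (intro exI[of _ l]) (auto simp: less_le)
qed

text \<open>The divergence of \<nabla>r/|\<nabla>r|, that is, the mean curvature of the level sets
  of \<open>r\<close>: the trace of the Hessian without its normal part, divided by
  |\<nabla>r|.\<close>

definition curv :: "(real^'n \<Rightarrow> real^'n^'n) \<Rightarrow> (real^'n \<Rightarrow> real) \<Rightarrow> real^'n::finite \<Rightarrow> real" where
  "curv G r x = (lap G r x - (gradient G r x \<bullet> (hessian G r x *v gradient G r x)) / grad_ip G r r x)
     / sqrt (grad_ip G r r x)"

text \<open>A derivative within a hypersurface is determined only on velocities of curves in it. On
  such a velocity the chain rule identifies it with the derivative of a map that is differentiable
  in the surrounding space and agrees with \<open>f\<close> along the curve.\<close>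

lemma has_derivative_agree_along_curve:
  fixes f :: "'a::real_normed_vector \<Rightarrow> 'b::real_normed_vector" and \<gamma> :: "real \<Rightarrow> 'a"
  assumes f: "(f has_derivative D) (at x within S)" and h: "(h has_derivative E) (at x)"
    and \<gamma>: "(\<gamma> has_vector_derivative e) (at 0)" "\<gamma> 0 = x"
    and d: "d > 0" "\<And>t. \<bar>t\<bar> < d \<Longrightarrow> \<gamma> t \<in> S" "\<And>t. \<bar>t\<bar> < d \<Longrightarrow> f (\<gamma> t) = h (\<gamma> t)"
  shows "D e = E e"
proof -
  let ?T = "{t. \<bar>t\<bar> < d}"
  have T: "open ?T" "0 \<in> ?T" using d(1) by (auto intro!: open_Collect_less continuous_intros)
  have g: "(\<gamma> has_derivative (\<lambda>t. t *\<^sub>R e)) (at 0 within ?T)"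
    using \<gamma>(1) by (auto simp: has_vector_derivative_def intro: has_derivative_at_withinI)
  have "(f has_derivative D) (at (\<gamma> 0) within \<gamma> ` ?T)"
    using f \<gamma>(2) d(2) by (auto intro: has_derivative_subset)
  from has_derivative_in_compose[OF g this]
  have "((\<lambda>t. f (\<gamma> t)) has_derivative (\<lambda>t. D (t *\<^sub>R e))) (at 0)"
    unfolding at_within_open[OF T(2,1)] .
  then have 1: "((\<lambda>t. h (\<gamma> t)) has_derivative (\<lambda>t. D (t *\<^sub>R e))) (at 0)"
    by (rule has_derivative_transform_within_open[OF _ T]) (use d(3) in auto)
  have "(h has_derivative E) (at (\<gamma> 0))" using h \<gamma>(2) by simp
  from has_derivative_compose[of \<gamma> "\<lambda>t. t *\<^sub>R e" 0 UNIV, OF _ this] \<gamma>(1)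
  have "((\<lambda>t. h (\<gamma> t)) has_derivative (\<lambda>t. E (t *\<^sub>R e))) (at 0)"
    by (simp add: has_vector_derivative_def)
  with 1 have "(\<lambda>t. D (t *\<^sub>R e)) = (\<lambda>t. E (t *\<^sub>R e))" by (rule has_derivative_unique)
  from fun_cong[OF this, of 1] show ?thesis by simp
qed

context straightening
begin

text \<open>In straightened coordinates the curve is a line in the hyperplane, whose direction is
  \<open>e\<close> with the component \<open>z\<close> dropped. Tangency of \<open>e\<close> is what
  makes the derivative of \<Theta> restore this component.\<close>

lemma boundary_curve:
  assumes x: "x \<in> N" "r x = 0" and e: "(\<Sum>i\<in>UNIV. e $ i * pd i r x) = 0"
  defines "\<gamma> \<equiv> \<lambda>t. \<Theta> (\<Psi> x + t *\<^sub>R (e - (e $ z) *\<^sub>R axis z 1))"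
  shows "(\<gamma> has_vector_derivative e) (at 0)" "\<gamma> 0 = x"
    "\<exists>d>0. \<forall>t. \<bar>t\<bar> < d \<longrightarrow> \<gamma> t \<in> N \<and> r (\<gamma> t) = 0"
proof -
  let ?a = "e - (e $ z) *\<^sub>R axis z 1"
  note y = \<Psi>_in[OF x(1)]
  show "\<gamma> 0 = x" by (simp add: \<gamma>_def \<Theta>_\<Psi> x)
  have 1: "((\<lambda>t. \<Psi> x + t *\<^sub>R ?a) has_derivative (\<lambda>h. h *\<^sub>R ?a)) (at 0)"
    by (auto intro!: derivative_eq_intros)
  have 2: "(\<Theta> has_derivative
      (\<lambda>w. w + ((w $ z - (\<Sum>i\<in>UNIV. w $ i * pd i r x)) / pd z r x) *\<^sub>R axis z 1)) (at (\<Psi> x + 0 *\<^sub>R ?a))"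
    using \<Theta>_deriv[OF y] by (simp add: \<Theta>_\<Psi> x)
  have s: "(\<Sum>i\<in>UNIV. ?a $ i * pd i r x) = - (e $ z) * pd z r x"
    by (simp add: left_diff_distrib sum_subtractf e axis_def if_distrib[of "\<lambda>t. t * _"] if_distrib[of "\<lambda>t. _ * t"] cong: if_cong)
  have "(h *\<^sub>R ?a) + (((h *\<^sub>R ?a) $ z - (\<Sum>i\<in>UNIV. (h *\<^sub>R ?a) $ i * pd i r x)) / pd z r x) *\<^sub>R axis z 1 = h *\<^sub>R e" for h
  proof -
    have "(\<Sum>i\<in>UNIV. (h *\<^sub>R ?a) $ i * pd i r x) = h * (\<Sum>i\<in>UNIV. ?a $ i * pd i r x)"
      by (simp add: sum_distrib_left mult.assoc)
    then show ?thesis using rz[OF x(1)] unfolding s by (simp add: vec_eq_iff axis_def)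
  qed
  then show "(\<gamma> has_vector_derivative e) (at 0)"
    unfolding has_vector_derivative_def \<gamma>_def using has_derivative_compose[OF 1 2] by simp
  obtain d where d: "d > 0" "ball (\<Psi> x) d \<subseteq> Q" using open_Q y open_contains_ball by blast
  define d' where "d' = d / (norm ?a + 1)"
  have "\<gamma> t \<in> N \<and> r (\<gamma> t) = 0" if "\<bar>t\<bar> < d'" for t
  proof -
    have "\<bar>t\<bar> * (norm ?a + 1) < d"
      using that by (simp add: d'_def pos_less_divide_eq add_nonneg_pos)
    moreover have "\<bar>t\<bar> * norm ?a \<le> \<bar>t\<bar> * (norm ?a + 1)" by (intro mult_left_mono) auto
    ultimately have "\<Psi> x + t *\<^sub>R ?a \<in> ball (\<Psi> x) d" by (simp add: dist_norm)
    then have q: "\<Psi> x + t *\<^sub>R ?a \<in> Q" using d by blast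
    have "(\<Psi> x + t *\<^sub>R ?a) $ z = 0" by (simp add: \<Psi>_nth x)
    then show ?thesis using \<Theta>_in[OF q] r_\<Theta>[OF q] by (simp add: \<gamma>_def)
  qed
  moreover have "d' > 0" using d by (simp add: d'_def add_nonneg_pos)
  ultimately show "\<exists>d>0. \<forall>t. \<bar>t\<bar> < d \<longrightarrow> \<gamma> t \<in> N \<and> r (\<gamma> t) = 0" by blast
qed

end

locale riemannian_domain = riemannian_manifold A g
  for A :: "('a::{t2_space,second_countable_topology}, 'n::finite) chart set" and g :: "('a, 'n) tensor2" +
  fixes \<Omega> :: "'a set"
  assumes open_\<Omega>: "open \<Omega>" and compact_closure: "compact (closure \<Omega>)" and C2: "C2_boundary A \<Omega>"
begin

text \<open>\<open>local_defining_fun\<close> without a base point and without nondegeneracy, so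
  that one function serves all points of \<open>V\<close>, including a neighbourhood that does not
  meet the boundary.\<close>

definition defining :: "('a, 'n) chart \<Rightarrow> (real^'n) set \<Rightarrow> (real^'n \<Rightarrow> real) \<Rightarrow> bool" where
  "defining c V r \<longleftrightarrow> open V \<and> V \<subseteq> cmap c ` cdom c \<and> Ck_on 2 V r
     \<and> (\<forall>x\<in>V. (cinv c x \<in> \<Omega> \<longleftrightarrow> r x < 0) \<and> (cinv c x \<in> frontier \<Omega> \<longleftrightarrow> r x = 0))"

abbreviation dcov :: "(real^'n \<Rightarrow> real) \<Rightarrow> real^'n \<Rightarrow> real^'n" where
  "dcov r x \<equiv> (\<chi> i. pd i r x)"

lemma defining_differentiable: "defining c V r \<Longrightarrow> x \<in> V \<Longrightarrow> r differentiable (at x)"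
  unfolding defining_def using Ck_on_differentiable[of 2] by auto

lemma frechet_dcov: "r differentiable (at x) \<Longrightarrow> frechet_derivative r (at x) v = dcov r x \<bullet> v"
  for r :: "real^'n \<Rightarrow> real"
  by (simp add: frechet_derivative_eq_pd inner_vec_def mult.commute)

lemma local_defining_iff:
  "local_defining_fun c \<Omega> p r \<longleftrightarrow> p \<in> cdom c \<inter> frontier \<Omega> \<and> (\<exists>V. defining c V r \<and> cmap c p \<in> V \<and> dcov r (cmap c p) \<noteq> 0)"
proof -
  have "(\<exists>v. frechet_derivative r (at (cmap c p)) v \<noteq> 0) \<longleftrightarrow> dcov r (cmap c p) \<noteq> 0"
    if "defining c V r" "cmap c p \<in> V" for V
    using frechet_dcov[OF defining_differentiable[OF that]]
    by (metis inner_eq_zero_iff inner_zero_left)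
  note * = this
  show ?thesis
  proof
    assume "local_defining_fun c \<Omega> p r"
    then obtain V where V: "p \<in> cdom c \<inter> frontier \<Omega>" "open V" "cmap c p \<in> V" "V \<subseteq> cmap c ` cdom c" "Ck_on 2 V r"
      "\<exists>v. frechet_derivative r (at (cmap c p)) v \<noteq> 0"
      "\<forall>x\<in>V. (cinv c x \<in> \<Omega> \<longleftrightarrow> r x < 0) \<and> (cinv c x \<in> frontier \<Omega> \<longleftrightarrow> r x = 0)"
      unfolding local_defining_fun_def by blast
    then have d: "defining c V r" unfolding defining_def by blast
    show "p \<in> cdom c \<inter> frontier \<Omega> \<and> (\<exists>V. defining c V r \<and> cmap c p \<in> V \<and> dcov r (cmap c p) \<noteq> 0)"
      using V(1,3,6) d *[OF d V(3)] by blast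
  next
    assume "p \<in> cdom c \<inter> frontier \<Omega> \<and> (\<exists>V. defining c V r \<and> cmap c p \<in> V \<and> dcov r (cmap c p) \<noteq> 0)"
    then obtain V where V: "p \<in> cdom c \<inter> frontier \<Omega>" "defining c V r" "cmap c p \<in> V" "dcov r (cmap c p) \<noteq> 0" by blast
    have ex: "\<exists>v. frechet_derivative r (at (cmap c p)) v \<noteq> 0" using *[OF V(2,3)] V(4) by blast
    show "local_defining_fun c \<Omega> p r"
      unfolding local_defining_fun_def
      by (rule conjI[OF V(1)], rule exI[of _ V]) (use V(2,3) ex in \<open>simp add: defining_def\<close>)
  qed
qed

text \<open>Otherwise a short step along \<open>v\<close> would lead to a point with r > 0 and r' <
  0, that is, both outside and inside the domain.\<close>

lemma defining_positive:
  assumes r: "defining c V r" "x \<in> V" "r x = 0" and r': "defining c V' r'" "x \<in> V'" "r' x = 0"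
    and v: "dcov r x \<bullet> v > 0"
  shows "dcov r' x \<bullet> v \<ge> 0"
proof (rule ccontr)
  assume "\<not> dcov r' x \<bullet> v \<ge> 0"
  then have neg: "(\<Sum>i\<in>UNIV. v $ i * pd i r' x) < 0" by (simp add: inner_vec_def mult.commute)
  have pos: "(\<Sum>i\<in>UNIV. v $ i * pd i r x) > 0" using v by (simp add: inner_vec_def mult.commute)
  obtain d1 where d1: "d1 > 0" "\<And>t. 0 < t \<Longrightarrow> t < d1 \<Longrightarrow> r (x + t *\<^sub>R v) > 0"
    using DERIV_pos_inc_right[OF dir_derivative[OF defining_differentiable[OF r(1,2)]] pos] r(3) by auto
  obtain d2 where d2: "d2 > 0" "\<And>t. 0 < t \<Longrightarrow> t < d2 \<Longrightarrow> r' (x + t *\<^sub>R v) < 0"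
    using DERIV_neg_dec_right[OF dir_derivative[OF defining_differentiable[OF r'(1,2)]] neg] r'(3) by auto
  have "((\<lambda>t. x + t *\<^sub>R v) \<longlongrightarrow> x + 0 *\<^sub>R v) (at_right 0)" by (intro tendsto_intros)
  moreover have "open (V \<inter> V')" "x + 0 *\<^sub>R v \<in> V \<inter> V'" using r r' by (auto simp: defining_def)
  ultimately have "\<forall>\<^sub>F t in at_right 0. x + t *\<^sub>R v \<in> V \<inter> V'" by (rule topological_tendstoD)
  then obtain b where b: "b > 0" "\<And>t. 0 < t \<Longrightarrow> t < b \<Longrightarrow> x + t *\<^sub>R v \<in> V \<inter> V'"
    unfolding eventually_at_right_field by auto
  define t where "t = min b (min d1 d2) / 2"
  have t: "0 < t" "t < b" "t < d1" "t < d2" using b d1 d2 by (auto simp: t_def)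
  then show False using b(2)[OF t(1,2)] d1(2)[OF t(1,3)] d2(2)[OF t(1,4)] r(1) r'(1) by (auto simp: defining_def)
qed

lemma grad_ip_posdef:
  assumes "posdef (G x)" "dcov r x \<noteq> 0"
  shows "grad_ip G r r x > 0"
proof -
  have "dcov r x \<bullet> (matrix_inv (G x) *v dcov r x) > 0"
    using posdef_inv[OF assms(1)] assms(2) by (simp add: posdef_def)
  then show ?thesis by (simp add: grad_ip_inner gradient_def inner_commute)
qed

lemma defining_grad_pos:
  assumes "c \<in> A" "local_defining_fun c \<Omega> p r"
  shows "grad_ip (g c) r r (cmap c p) > 0"
proof -
  have "p \<in> cdom c" "dcov r (cmap c p) \<noteq> 0" using assms(2) by (auto simp: local_defining_iff)
  then show ?thesis using grad_ip_posdef[of "g c", OF local_metric.G_posdef[OF local_metric[OF assms(1)]]] by blast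
qed

text \<open>Justifies the definite description: the differentials of two defining functions at
  \<open>p\<close> are positive multiples of each other, so the normalized gradient is the same for
  all of them, and the three conditions leave no other vector.\<close>

lemma outward_normal_eq:
  assumes c: "c \<in> A" and ld: "local_defining_fun c \<Omega> p r"
  shows "outward_normal g \<Omega> c p = (1 / sqrt (grad_ip (g c) r r (cmap c p))) *\<^sub>R gradient (g c) r (cmap c p)"
proof -
  let ?x = "cmap c p" and ?G = "g c (cmap c p)"
  let ?n = "\<lambda>r. (1 / sqrt (grad_ip (g c) r r ?x)) *\<^sub>R gradient (g c) r ?x"
  let ?P = "\<lambda>r \<nu>. \<nu> \<bullet> (?G *v \<nu>) = 1 \<and> frechet_derivative r (at ?x) \<nu> > 0 \<and> (\<forall>v. frechet_derivative r (at ?x) v = 0 \<longrightarrow> v \<bullet> (?G *v \<nu>) = 0)"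
  have p: "p \<in> cdom c" "p \<in> frontier \<Omega>" using ld by (auto simp: local_defining_iff)
  have G: "posdef ?G" using local_metric.G_posdef[OF local_metric[OF c]] p by simp
  have fr: "frechet_derivative r (at ?x) v = dcov r ?x \<bullet> v" "dcov r ?x \<noteq> 0"
    if "local_defining_fun c \<Omega> p r" for r v
    using that frechet_dcov defining_differentiable unfolding local_defining_iff by blast+
  have ip: "grad_ip (g c) r r ?x = dcov r ?x \<bullet> gradient (g c) r ?x" for r
    by (simp add: grad_ip_inner inner_commute)
  have Gg: "?G *v gradient (g c) r ?x = dcov r ?x" for r
    by (simp add: gradient_def posdef_inv_cancel[OF G])
  have P: "?P r (?n r)" if "local_defining_fun c \<Omega> p r" for r
  proof -
    have q: "grad_ip (g c) r r ?x > 0" by (rule defining_grad_pos[OF c that])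
    then show ?thesis
      by (auto simp: fr[OF that] matrix_vector_mult_scaleR Gg ip[symmetric] inner_commute[of "gradient _ _ _"]
          inner_commute[of _ "dcov r ?x"] real_div_sqrt)
  qed
  have par: "?n r' = ?n r" if r': "local_defining_fun c \<Omega> p r'" for r'
  proof -
    obtain V V' where V: "defining c V r" "?x \<in> V" and V': "defining c V' r'" "?x \<in> V'"
      using ld r' unfolding local_defining_iff by blast
    have 0: "r ?x = 0" "r' ?x = 0" using V V' p c unfolding defining_def by auto
    obtain l where l: "l > 0" "dcov r' ?x = l *\<^sub>R dcov r ?x"
      using parallel_covector[of "dcov r ?x" "dcov r' ?x"] defining_positive[OF V 0(1) V' 0(2)] fr(2)[OF ld] fr(2)[OF r'] by blast
    then have g: "gradient (g c) r' ?x = l *\<^sub>R gradient (g c) r ?x"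
      by (simp add: gradient_def matrix_vector_mult_scaleR)
    have "grad_ip (g c) r' r' ?x = l\<^sup>2 * grad_ip (g c) r r ?x"
      unfolding ip g l(2) by (simp add: power2_eq_square)
    then show ?thesis using l by (simp add: g real_sqrt_mult)
  qed
  \<comment> \<open>Orthogonality to the kernel of the differential makes the lowered vector
    \<open>?w\<close> a multiple \<open>m\<close> of that differential; the sign and the unit length
    then fix \<open>m\<close>.\<close>
  have uniq: "\<nu> = ?n r'" if r': "local_defining_fun c \<Omega> p r'" and P': "?P r' \<nu>" for r' \<nu>
  proof -
    let ?a = "dcov r' ?x" and ?w = "?G *v \<nu>"
    define m where "m = (?w \<bullet> ?a) / (?a \<bullet> ?a)"
    have a0: "?a \<bullet> ?a > 0" using fr(2)[OF r'] by simp
    have "?a \<bullet> (?w - m *\<^sub>R ?a) = 0" using a0 by (simp add: inner_diff_right m_def inner_commute)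
    moreover from this have "(?w - m *\<^sub>R ?a) \<bullet> ?w = 0" using P' unfolding fr(1)[OF r'] by blast
    ultimately have "(?w - m *\<^sub>R ?a) \<bullet> ?w = 0" "(?w - m *\<^sub>R ?a) \<bullet> ?a = 0" by (simp_all only: inner_commute)
    then have "(?w - m *\<^sub>R ?a) \<bullet> (?w - m *\<^sub>R ?a) = 0" by (simp add: inner_diff_right)
    then have w: "?w = m *\<^sub>R ?a" by simp
    have "\<nu> = matrix_inv ?G *v ?w" by (simp add: posdef_inv_cancel[OF G])
    then have \<nu>: "\<nu> = m *\<^sub>R gradient (g c) r' ?x" by (simp add: w matrix_vector_mult_scaleR gradient_def)
    have q: "grad_ip (g c) r' r' ?x > 0" by (rule defining_grad_pos[OF c r'])
    have "?a \<bullet> \<nu> > 0" using P' fr[OF r'] by simp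
    then have "m * grad_ip (g c) r' r' ?x > 0" unfolding \<nu> by (simp add: ip)
    then have m: "m > 0" using q by (simp add: zero_less_mult_iff)
    have "\<nu> \<bullet> ?w = 1" using P' by simp
    then have "m * (m * grad_ip (g c) r' r' ?x) = 1" unfolding w by (simp add: \<nu> ip inner_commute)
    then have sq: "(m * sqrt (grad_ip (g c) r' r' ?x))\<^sup>2 = 1\<^sup>2" using q by (simp add: power2_eq_square mult_ac)
    have "m * sqrt (grad_ip (g c) r' r' ?x) = 1"
      by (rule power2_eq_imp_eq[OF sq]) (simp_all add: less_imp_le[OF m] less_imp_le[OF q])
    then have "m = 1 / sqrt (grad_ip (g c) r' r' ?x)" using q by (simp add: field_simps)
    then show ?thesis using \<nu> by simp
  qed
  show ?thesis
    unfolding outward_normal_def Let_def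
  proof (rule the_equality)
    show "\<exists>r'. local_defining_fun c \<Omega> p r' \<and> ?P r' (?n r)"
      using P[OF ld] ld by blast
    fix \<nu> assume "\<exists>r. local_defining_fun c \<Omega> p r \<and> ?P r \<nu>"
    then obtain r' where r': "local_defining_fun c \<Omega> p r'" "?P r' \<nu>" by blast
    show "\<nu> = ?n r" using uniq[OF r'] par[OF r'(1)] by (rule trans)
  qed
qed

text \<open>Lets a defining function given in some chart be used in every chart around the point, in
  particular in the one selected by \<open>chart_at\<close>.\<close>

lemma transport_defining:
  assumes c: "c \<in> A" "d \<in> A" and p: "p \<in> cdom d" and ld: "local_defining_fun c \<Omega> p r"
  shows "local_defining_fun d \<Omega> p (\<lambda>x. r ((cmap c \<circ> cinv d) x))"
proof -
  obtain V where V: "defining c V r" "cmap c p \<in> V" and pc: "p \<in> cdom c" "p \<in> frontier \<Omega>" and nz: "dcov r (cmap c p) \<noteq> 0"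
    using ld unfolding local_defining_iff by blast
  have VV: "open V" "V \<subseteq> cmap c ` cdom c" using V by (auto simp: defining_def)
  define U where "U = cdom d \<inter> cinv c ` V"
  have U: "open U" "U \<subseteq> cdom d" "U \<subseteq> cdom c" "p \<in> U" "cmap c ` U \<subseteq> V"
    using cdom_open[OF c(2)] cinv_open[OF c(1) VV] p pc V(2) VV(2) c
    by (auto simp: U_def image_iff subset_iff intro!: bexI[of _ "cmap c p"])
  interpret chart_change "cmap d ` U" "g d" "cmap c ` U" "g c" "cmap c \<circ> cinv d"
    by (rule chart_change[OF c(2,1) U(1-3)])
  have x: "cmap d p \<in> cmap d ` U" using U by simp
  have \<phi>p: "(cmap c \<circ> cinv d) (cmap d p) = cmap c p" using p c by simp
  have "Ck_on 2 (cmap c ` U) r" using V(1) U(5) unfolding defining_def by (blast intro: Ck_on_subset)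
  then have C: "Ck_on 2 (cmap d ` U) (\<lambda>x. r ((cmap c \<circ> cinv d) x))" by (rule Ck_pullback)
  have "defining d (cmap d ` U) (\<lambda>x. r ((cmap c \<circ> cinv d) x))"
    unfolding defining_def
  proof (intro conjI ballI)
    show "open (cmap d ` U)" by (rule cmap_open[OF c(2) U(1,2)])
    show "cmap d ` U \<subseteq> cmap d ` cdom d" using U by blast
    fix x assume "x \<in> cmap d ` U"
    then obtain q where q: "q \<in> U" "x = cmap d q" by blast
    have qc: "q \<in> cdom c" "q \<in> cdom d" "cmap c q \<in> V" using q U by auto
    then have "cinv d x = q" "cinv c ((cmap c \<circ> cinv d) x) = q" "(cmap c \<circ> cinv d) x \<in> V"
      using c by (simp_all add: q)
    then show "(cinv d x \<in> \<Omega>) = (r ((cmap c \<circ> cinv d) x) < 0)" "(cinv d x \<in> frontier \<Omega>) = (r ((cmap c \<circ> cinv d) x) = 0)"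
      using V(1) unfolding defining_def by metis+
  qed (rule C)
  moreover have "dcov (\<lambda>x. r ((cmap c \<circ> cinv d) x)) (cmap d p) \<noteq> 0"
  proof
    assume "dcov (\<lambda>x. r ((cmap c \<circ> cinv d) x)) (cmap d p) = 0"
    then have "transpose (jac (cmap d p)) *v dcov r (cmap c p) = 0"
      using pd_pullback[OF x, of r] defining_differentiable[OF V] \<phi>p by simp
    moreover have "invertible (transpose (jac (cmap d p)))" by (rule transpose_invertible[OF jac_invertible[OF x]])
    ultimately show False using nz by (auto simp: invertible_left_inverse matrix_left_invertible_ker)
  qed
  ultimately show ?thesis unfolding local_defining_iff using p pc x by blast
qed

lemma ex_defining: "c \<in> A \<Longrightarrow> p \<in> cdom c \<Longrightarrow> p \<in> frontier \<Omega> \<Longrightarrow> \<exists>r. local_defining_fun c \<Omega> p r"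
proof -
  assume c: "c \<in> A" "p \<in> cdom c" "p \<in> frontier \<Omega>"
  obtain d r where "d \<in> A" "local_defining_fun d \<Omega> p r"
    using C2 c(3) unfolding C2_boundary_def by blast
  from transport_defining[OF this(1) c(1,2) this(2)] show ?thesis by blast
qed

lemma defining_straightening:
  assumes c: "c \<in> A" and ld: "local_defining_fun c \<Omega> p r"
  obtains V N z Q \<Theta> where "defining c V r" "straightening N r z Q \<Theta>" "cmap c p \<in> N" "N \<subseteq> V"
proof -
  obtain V where V: "defining c V r" "cmap c p \<in> V" and nz: "dcov r (cmap c p) \<noteq> 0"
    using ld unfolding local_defining_iff by blast
  obtain z where z: "pd z r (cmap c p) \<noteq> 0" using nz by (auto simp: vec_eq_iff)
  have "open V" "Ck_on 2 V r" using V(1) by (auto simp: defining_def)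
  from straightening_exists[OF this(1) V(2) this(2) z] show ?thesis using that V by blast
qed

lemma defining_at:
  assumes c: "c \<in> A" and V: "defining c V r" and st: "straightening N r z Q \<Theta>" "N \<subseteq> V" and x: "x \<in> N" "r x = 0"
  shows "local_defining_fun c \<Omega> (cinv c x) r" "cmap c (cinv c x) = x"
proof -
  have xV: "x \<in> V" "x \<in> cmap c ` cdom c" using x st(2) V by (auto simp: defining_def)
  show e: "cmap c (cinv c x) = x" using cmap_cinv[OF c xV(2)] .
  have "pd z r x \<noteq> 0" using straightening.rz[OF st(1) x(1)] .
  then have "dcov r x \<noteq> 0" by (auto simp: vec_eq_iff)
  moreover have "cinv c x \<in> frontier \<Omega>" using V xV x unfolding defining_def by blast
  moreover have "cinv c x \<in> cdom c" using cinv_in[OF c xV(2)] by blast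
  ultimately show "local_defining_fun c \<Omega> (cinv c x) r"
    unfolding local_defining_iff e using V xV by blast
qed

text \<open>Along the boundary near \<open>p\<close> the normal is the restriction of
  \<nabla>r/|\<nabla>r|. Differentiating the factor 1/|\<nabla>r| gives a multiple of \<nabla>r,
  which is orthogonal to the tangent vector \<open>e\<close>; what remains is the Hessian of
  \<open>r\<close>.\<close>

lemma normal_covariant_trace:
  assumes c: "c \<in> A" and ld: "local_defining_fun c \<Omega> p r"
    and e: "dcov r (cmap c p) \<bullet> e = 0"
  shows "normal_covariant_derivative g \<Omega> c p e \<bullet> (g c (cmap c p) *v e)
    = (e \<bullet> (hessian (g c) r (cmap c p) *v e)) / sqrt (grad_ip (g c) r r (cmap c p))"
proof -
  let ?x = "cmap c p"
  obtain V N z Q \<Theta> where V: "defining c V r" and st: "straightening N r z Q \<Theta>" and xN: "?x \<in> N" and NV: "N \<subseteq> V"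
    using defining_straightening[OF c ld] .
  interpret straightening N r z Q \<Theta> by (rule st)
  have pc: "p \<in> cdom c" "p \<in> frontier \<Omega>" using ld by (auto simp: local_defining_iff)
  have NS: "N \<subseteq> cmap c ` cdom c" using NV V by (auto simp: defining_def)
  have rx: "r ?x = 0" using V xN NV pc c unfolding defining_def by auto
  interpret lm: local_metric N "g c"
    by (rule local_metric.local_metric_subset[OF local_metric[OF c] open_N NS])
  let ?q = "grad_ip (g c) r r" and ?v = "gradient (g c) r"
  have q: "?q y > 0" if "y \<in> N" for y
    using rz[OF that] by (intro grad_ip_posdef lm.G_posdef that) (auto simp: vec_eq_iff)
  define n where "n y = (1 / sqrt (?q y)) *\<^sub>R ?v y" for y
  have vC: "Ck_on 1 N (\<lambda>y. ?v y $ i)" for i using lm.gradient_Ck[of 1 r] r_C2 by (simp add: numeral_2_eq_2)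
  have sC: "Ck_on 1 N (\<lambda>y. 1 / sqrt (?q y))"
    using lm.grad_ip_Ck[of 1 r r] r_C2 q
    by (intro Ck_on_divide Ck_on_const Ck_on_sqrt open_N) (auto simp: numeral_2_eq_2 less_imp_neq[symmetric] dest: q)
  have nC: "Ck_on 1 N (\<lambda>y. n y $ i)" for i
    unfolding n_def using Ck_on_mult[OF open_N sC vC] by simp
  have "Ck_on 1 N n" by (rule Ck_on_vec[OF open_N nC])
  then have nd: "n differentiable (at ?x)" using Ck_on_differentiable xN by simp
  let ?f = "\<lambda>y. outward_normal g \<Omega> c (cinv c y)" and ?S = "cmap c ` (cdom c \<inter> frontier \<Omega>)"
  have fn: "?f y = n y" if "y \<in> N" "r y = 0" for y
    using outward_normal_eq[OF c defining_at(1)[OF c V st NV that]] defining_at(2)[OF c V st NV that] by (simp add: n_def)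
  have NS0: "y \<in> ?S \<longleftrightarrow> r y = 0" if "y \<in> N" for y
  proof -
    have y: "y \<in> V" "y \<in> cmap c ` cdom c" using that NV NS by auto
    have "y \<in> ?S \<longleftrightarrow> cinv c y \<in> frontier \<Omega>"
    proof
      assume "cinv c y \<in> frontier \<Omega>"
      then show "y \<in> ?S"
        using y(2) cmap_cinv[OF c y(2)] cinv_in[OF c y(2)] by (intro image_eqI[of _ _ "cinv c y"]) auto
    next
      assume "y \<in> ?S"
      then show "cinv c y \<in> frontier \<Omega>" using c by auto
    qed
    then show ?thesis using V y(1) unfolding defining_def by blast
  qed
  define E where "E = frechet_derivative n (at ?x)"
  have E: "(n has_derivative E) (at ?x)" using nd by (simp add: E_def frechet_derivative_works)
  have "(?f has_derivative E) (at ?x within ?S)"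
  proof -
    have "(n has_derivative E) (at ?x within ?S)" using E by (rule has_derivative_at_withinI)
    moreover obtain d where d: "d > 0" "ball ?x d \<subseteq> N" using open_N xN open_contains_ball by blast
    ultimately show ?thesis
      by (elim has_derivative_transform_within[OF _ d(1)])
         (use fn NS0 d(2) pc in \<open>auto simp: subset_iff dist_commute\<close>)
  qed
  then have D: "(?f has_derivative frechet_derivative ?f (at ?x within ?S)) (at ?x within ?S)"
    using frechet_derivative_works differentiable_def by blast
  have e0: "(\<Sum>i\<in>UNIV. e $ i * pd i r ?x) = 0" using e by (simp add: inner_vec_def mult.commute)
  note bc = boundary_curve[OF xN rx e0]
  obtain d where d: "d > 0" "\<And>t. \<bar>t\<bar> < d \<Longrightarrow> \<Theta> (\<Psi> ?x + t *\<^sub>R (e - (e $ z) *\<^sub>R axis z 1)) \<in> N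
      \<and> r (\<Theta> (\<Psi> ?x + t *\<^sub>R (e - (e $ z) *\<^sub>R axis z 1))) = 0" using bc(3) by blast
  \<comment> \<open>The derivative within the boundary is a chosen linear map; on the tangent vector
    \<open>e\<close> it must agree with the derivative of the extension \<open>n\<close>.\<close>
  have DE: "frechet_derivative ?f (at ?x within ?S) e = E e"
    by (rule has_derivative_agree_along_curve[OF D E bc(1,2) d(1)]) (use d(2) fn NS0 in blast)+
  let ?s = "\<lambda>y. 1 / sqrt (?q y)"
  have Ee: "E e $ k = (\<Sum>i\<in>UNIV. e $ i * pd i ?s ?x) * ?v ?x $ k + ?s ?x * (\<Sum>i\<in>UNIV. e $ i * pd i (\<lambda>y. ?v y $ k) ?x)" for k
  proof -
    have "pd i n ?x $ k = pd i (\<lambda>y. ?s y * ?v y $ k) ?x" for i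
      using pd_bounded_linear[OF bounded_linear_vec_nth[of k] nd, of i] by (simp add: n_def)
    also have "\<dots> i = pd i ?s ?x * ?v ?x $ k + ?s ?x * pd i (\<lambda>y. ?v y $ k) ?x" for i
      by (rule pd_mult[OF Ck_on_differentiable[OF sC _ xN] Ck_on_differentiable[OF vC _ xN]]) auto
    finally show ?thesis
      by (simp add: E_def frechet_derivative_eq_pd[OF nd] distrib_left sum.distrib sum_distrib_left sum_distrib_right mult_ac)
  qed
  let ?C = "christoffel (g c)" and ?H = "hessian (g c) r ?x"
  have ncd: "normal_covariant_derivative g \<Omega> c p e $ k
     = (\<Sum>i\<in>UNIV. e $ i * pd i ?s ?x) * ?v ?x $ k + ?s ?x * (matrix_inv (g c ?x) *v (?H *v e)) $ k" for k
  proof -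
    have "normal_covariant_derivative g \<Omega> c p e $ k = E e $ k + (\<Sum>i\<in>UNIV. \<Sum>j\<in>UNIV. ?C k i j ?x * e $ i * n ?x $ j)"
      using fn[OF xN rx] pc c by (simp add: normal_covariant_derivative_def Let_def DE)
    also have "\<dots> = (\<Sum>i\<in>UNIV. e $ i * pd i ?s ?x) * ?v ?x $ k
       + ?s ?x * (\<Sum>i\<in>UNIV. e $ i * (pd i (\<lambda>y. ?v y $ k) ?x + (\<Sum>j\<in>UNIV. ?C k i j ?x * ?v ?x $ j)))"
      unfolding Ee n_def by (simp add: distrib_left sum.distrib sum_distrib_left mult_ac)
    also have "(\<Sum>i\<in>UNIV. e $ i * (pd i (\<lambda>y. ?v y $ k) ?x + (\<Sum>j\<in>UNIV. ?C k i j ?x * ?v ?x $ j)))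
       = (\<Sum>i\<in>UNIV. \<Sum>l\<in>UNIV. e $ i * (lm.gi ?x k l * ?H $ i $ l))"
      unfolding lm.covariant_derivative_gradient[OF r_C2 xN] by (simp add: sum_distrib_left)
    also have "\<dots> = (matrix_inv (g c ?x) *v (?H *v e)) $ k"
      by (subst sum.swap) (simp add: matrix_vector_mult_def sum_distrib_left lm.hessian_sym[OF r_C2 xN, of _ "_::'n"] mult_ac cong: sum.cong)
    finally show ?thesis .
  qed
  have "normal_covariant_derivative g \<Omega> c p e = (\<Sum>i\<in>UNIV. e $ i * pd i ?s ?x) *\<^sub>R ?v ?x + ?s ?x *\<^sub>R (matrix_inv (g c ?x) *v (?H *v e))"
    by (simp add: vec_eq_iff ncd)
  moreover have "?v ?x \<bullet> (g c ?x *v e) = 0"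
  proof -
    have "?v ?x \<bullet> (g c ?x *v e) = e \<bullet> (g c ?x *v ?v ?x)" by (rule posdef_sym[OF lm.G_posdef[OF xN]])
    also have "g c ?x *v ?v ?x = dcov r ?x" by (simp add: gradient_def posdef_inv_cancel[OF lm.G_posdef[OF xN]])
    finally show ?thesis using e by (simp add: inner_commute)
  qed
  moreover have "(matrix_inv (g c ?x) *v (?H *v e)) \<bullet> (g c ?x *v e) = e \<bullet> (?H *v e)"
    using posdef_sym[OF lm.G_posdef[OF xN], of "matrix_inv (g c ?x) *v (?H *v e)" e]
    by (simp add: posdef_inv_cancel[OF lm.G_posdef[OF xN]])
  ultimately show ?thesis by (simp add: inner_add_left)
qed

lemma curv_orthonormal:
  assumes c: "c \<in> A" and ld: "local_defining_fun c \<Omega> p r"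
    and B: "orthonormal_basis_of (g c (cmap c p)) (boundary_tangent_space g \<Omega> c p) B"
  shows "orthonormal_basis_of (g c (cmap c p)) UNIV (insert (outward_normal g \<Omega> c p) B)" "outward_normal g \<Omega> c p \<notin> B"
    "\<And>e. e \<in> B \<Longrightarrow> dcov r (cmap c p) \<bullet> e = 0"
proof -
  let ?x = "cmap c p" and ?n = "outward_normal g \<Omega> c p"
  have p: "p \<in> cdom c" and nz: "dcov r ?x \<noteq> 0" using ld by (auto simp: local_defining_iff)
  have G: "posdef (g c ?x)" using local_metric.G_posdef[OF local_metric[OF c]] p by simp
  have q: "grad_ip (g c) r r ?x > 0" by (rule defining_grad_pos[OF c ld])
  have Gn: "g c ?x *v ?n = (1 / sqrt (grad_ip (g c) r r ?x)) *\<^sub>R dcov r ?x"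
    unfolding outward_normal_eq[OF c ld] by (simp add: matrix_vector_mult_scaleR gradient_def posdef_inv_cancel[OF G])
  have n1: "?n \<bullet> (g c ?x *v ?n) = 1"
    unfolding Gn unfolding outward_normal_eq[OF c ld] using q by (simp flip: grad_ip_inner)
  from orthonormal_basis_insert_normal[OF G n1 B[unfolded boundary_tangent_space_def]]
  show "orthonormal_basis_of (g c ?x) UNIV (insert ?n B)" "?n \<notin> B" .
  fix e assume "e \<in> B"
  then have "e \<in> boundary_tangent_space g \<Omega> c p" using B span_base unfolding orthonormal_basis_of_def by blast
  then have "e \<bullet> (g c ?x *v ?n) = 0" by (simp add: boundary_tangent_space_def)
  then show "dcov r ?x \<bullet> e = 0" using q by (simp add: Gn inner_commute)
qed

lemma tangent_basis_exists:
  assumes c: "c \<in> A" and p: "p \<in> cdom c"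
  shows "\<exists>B. orthonormal_basis_of (g c (cmap c p)) (boundary_tangent_space g \<Omega> c p) B"
proof (rule ex_orthonormal_basis)
  show "posdef (g c (cmap c p))" using local_metric.G_posdef[OF local_metric[OF c]] p by simp
  show "subspace (boundary_tangent_space g \<Omega> c p)"
    by (auto simp: subspace_def boundary_tangent_space_def inner_add_left)
qed

text \<open>A tangential orthonormal basis together with the unit normal is an orthonormal basis of
  the whole space, so the tangential trace is the full trace without its normal term.\<close>

lemma tangent_trace:
  assumes c: "c \<in> A" and ld: "local_defining_fun c \<Omega> p r"
    and B: "orthonormal_basis_of (g c (cmap c p)) (boundary_tangent_space g \<Omega> c p) B"
  shows "(\<Sum>e\<in>B. e \<bullet> (K *v e)) = trace (matrix_inv (g c (cmap c p)) ** K) - outward_normal g \<Omega> c p \<bullet> (K *v outward_normal g \<Omega> c p)"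
proof -
  have p: "p \<in> cdom c" using ld by (auto simp: local_defining_iff)
  have G: "posdef (g c (cmap c p))" using local_metric.G_posdef[OF local_metric[OF c]] p by simp
  show ?thesis
    using trace_orthonormal_basis[OF G curv_orthonormal(1)[OF c ld B], of K] curv_orthonormal(2)[OF c ld B]
      orthonormal_basis_independent(2)[OF B] by simp
qed

lemma curv_tangent_trace:
  assumes c: "c \<in> A" and ld: "local_defining_fun c \<Omega> p r"
    and B: "orthonormal_basis_of (g c (cmap c p)) (boundary_tangent_space g \<Omega> c p) B"
  shows "curv (g c) r (cmap c p) = (\<Sum>e\<in>B. e \<bullet> (hessian (g c) r (cmap c p) *v e)) / sqrt (grad_ip (g c) r r (cmap c p))"
proof -
  let ?x = "cmap c p"
  have q: "grad_ip (g c) r r ?x > 0" by (rule defining_grad_pos[OF c ld])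
  have "(1 / sqrt (grad_ip (g c) r r ?x)) * (1 / sqrt (grad_ip (g c) r r ?x)) = 1 / grad_ip (g c) r r ?x"
    using q by simp
  then show ?thesis
    unfolding tangent_trace[OF c ld B] outward_normal_eq[OF c ld] curv_def lap_def
    by (simp add: matrix_vector_mult_scaleR)
qed

text \<open>\<open>mean_curvature\<close> is computed in the selected chart and in an arbitrary
  orthonormal basis, whereas \<open>curv\<close> refers to no basis and is invariant under a change
  of charts.\<close>

lemma mean_curvature_eq:
  assumes c: "c \<in> A" and ld: "local_defining_fun c \<Omega> p r"
  shows "mean_curvature A g \<Omega> p = curv (g c) r (cmap c p)"
proof -
  let ?d = "chart_at A p"
  let ?r = "\<lambda>x. r ((cmap c \<circ> cinv ?d) x)"
  note d = chart_at[of p]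
  have ld': "local_defining_fun ?d \<Omega> p ?r" by (rule transport_defining[OF c d ld])
  let ?B = "SOME B. orthonormal_basis_of (g ?d (cmap ?d p)) (boundary_tangent_space g \<Omega> ?d p) B"
  have B: "orthonormal_basis_of (g ?d (cmap ?d p)) (boundary_tangent_space g \<Omega> ?d p) ?B"
    using someI_ex[OF tangent_basis_exists[OF d]] .
  have "mean_curvature A g \<Omega> p = (\<Sum>e\<in>?B. normal_covariant_derivative g \<Omega> ?d p e \<bullet> (g ?d (cmap ?d p) *v e))"
    by (simp add: mean_curvature_def Let_def)
  also have "\<dots> = (\<Sum>e\<in>?B. (e \<bullet> (hessian (g ?d) ?r (cmap ?d p) *v e)) / sqrt (grad_ip (g ?d) ?r ?r (cmap ?d p)))"
    by (intro sum.cong refl normal_covariant_trace[OF d(1) ld'] curv_orthonormal(3)[OF d(1) ld' B])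
  also have "\<dots> = curv (g ?d) ?r (cmap ?d p)"
    unfolding curv_tangent_trace[OF d(1) ld' B] by (rule sum_divide_distrib[symmetric])
  also have "\<dots> = curv (g c) r (cmap c p)"
  proof -
    obtain V where V: "defining c V r" "cmap c p \<in> V" and pc: "p \<in> cdom c"
      using ld unfolding local_defining_iff by blast
    have VV: "open V" "V \<subseteq> cmap c ` cdom c" "Ck_on 2 V r" using V by (auto simp: defining_def)
    define U where "U = cdom ?d \<inter> cinv c ` V"
    have U: "open U" "U \<subseteq> cdom ?d" "U \<subseteq> cdom c" "p \<in> U" "cmap c ` U \<subseteq> V"
      using cdom_open[OF d(1)] cinv_open[OF c VV(1,2)] d pc V(2) VV(2) c
      by (auto simp: U_def image_iff subset_iff intro!: bexI[of _ "cmap c p"])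
    interpret chart_change "cmap ?d ` U" "g ?d" "cmap c ` U" "g c" "cmap c \<circ> cinv ?d"
      by (rule chart_change[OF d(1) c U(1-3)])
    have x: "cmap ?d p \<in> cmap ?d ` U" using U by simp
    have \<phi>p: "(cmap c \<circ> cinv ?d) (cmap ?d p) = cmap c p" using d c by simp
    have r2: "Ck_on 2 (cmap c ` U) r" using VV(3) U(5) by (rule Ck_on_subset)
    have dr: "r differentiable (at ((cmap c \<circ> cinv ?d) (cmap ?d p)))" using defining_differentiable[OF V] \<phi>p by simp
    show ?thesis
      unfolding curv_def lap_pullback[OF r2 x] hessian_pullback[OF r2 x] gradient_pullback[OF x dr]
        grad_ip_pullback[OF x dr dr] \<phi>p ..
  qed
  finally show ?thesis .
qed

end

section \<open>Boundary parametrizations and boundary derivatives\<close>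

lemma curve_derivative:
  fixes f :: "real^'n::finite \<Rightarrow> real"
  assumes "(\<gamma> has_vector_derivative e) (at t)" "f differentiable (at (\<gamma> t))"
  shows "((\<lambda>t. f (\<gamma> t)) has_real_derivative (\<Sum>i\<in>UNIV. e $ i * pd i f (\<gamma> t))) (at t)"
proof -
  have "((\<lambda>t. f (\<gamma> t)) has_derivative (\<lambda>s. \<Sum>i\<in>UNIV. (s *\<^sub>R e) $ i *\<^sub>R pd i f (\<gamma> t))) (at t)"
    by (rule has_derivative_compose[OF assms(1)[unfolded has_vector_derivative_def] has_derivative_pd[OF assms(2)]])
  moreover have "(\<lambda>s. \<Sum>i\<in>UNIV. (s *\<^sub>R e) $ i *\<^sub>R pd i f (\<gamma> t)) = (*) (\<Sum>i\<in>UNIV. e $ i * pd i f (\<gamma> t))"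
    by (auto simp: fun_eq_iff sum_distrib_left mult_ac)
  ultimately show ?thesis by (simp add: has_field_derivative_def)
qed

lemma continuous_on_near:
  assumes "continuous_on S f" "y \<in> S" "\<epsilon> > 0"
  shows "\<exists>d>0. \<forall>w\<in>S. dist w y < d \<longrightarrow> dist (f w) (f y) < \<epsilon>"
  using assms unfolding continuous_on_iff by blast

context straightening
begin

lemma \<Theta>_direction:
  assumes "w + t *\<^sub>R b \<in> Q"
  shows "((\<lambda>t. \<Theta> (w + t *\<^sub>R b)) has_vector_derivative
     (b + ((b $ z - (\<Sum>i\<in>UNIV. b $ i * pd i r (\<Theta> (w + t *\<^sub>R b)))) / pd z r (\<Theta> (w + t *\<^sub>R b))) *\<^sub>R axis z 1)) (at t)"
proof -
  have 1: "((\<lambda>t. w + t *\<^sub>R b) has_derivative (\<lambda>h. h *\<^sub>R b)) (at t)"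
    by (auto intro!: derivative_eq_intros)
  have l: "linear (\<lambda>v. v + ((v $ z - (\<Sum>i\<in>UNIV. v $ i * pd i r (\<Theta> (w + t *\<^sub>R b)))) / pd z r (\<Theta> (w + t *\<^sub>R b))) *\<^sub>R axis z 1 :: real^'n)"
    using has_derivative_linear[OF \<Theta>_deriv[OF assms]] .
  show ?thesis
    unfolding has_vector_derivative_def
    using has_derivative_compose[OF 1 \<Theta>_deriv[OF assms]] linear_cmul[OF l, of _ b] by simp
qed

context
  fixes a0 :: "real^'n \<Rightarrow> real" and ai :: "'n \<Rightarrow> real^'n \<Rightarrow> real"
  assumes a0: "continuous_on {x \<in> N. r x \<le> 0} a0"
    and da: "\<And>x. x \<in> N \<Longrightarrow> r x < 0 \<Longrightarrow> a0 differentiable (at x)"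
    and ai: "\<And>j. continuous_on {x \<in> N. r x \<le> 0} (ai j)"
    and pda: "\<And>x j. x \<in> N \<Longrightarrow> r x < 0 \<Longrightarrow> pd j a0 x = ai j x"
begin

text \<open>Inside, this sum is the derivative of a0 \<circ> \<Theta> in the constant direction
  \<open>b\<close>. It is expressed by extended derivatives only and therefore makes sense on the
  hyperplane as well.\<close>

lemma trace_slope_continuous:
  "continuous_on (Q \<inter> {w. w $ z \<le> 0}) (\<lambda>w. \<Sum>j\<in>UNIV. (b + ((b $ z - (\<Sum>i\<in>UNIV. b $ i * pd i r (\<Theta> w))) / pd z r (\<Theta> w)) *\<^sub>R axis z 1) $ j * ai j (\<Theta> w))"
proof -
  have t: "continuous_on (Q \<inter> {w. w $ z \<le> 0}) \<Theta>" using \<Theta>_cont by (rule continuous_on_subset) auto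
  have p: "continuous_on (Q \<inter> {w. w $ z \<le> 0}) (\<lambda>w. pd i r (\<Theta> w))" for i
    by (rule continuous_on_compose2[OF pdr_cont t]) (auto simp: \<Theta>_in)
  have q: "continuous_on (Q \<inter> {w. w $ z \<le> 0}) (\<lambda>w. ai j (\<Theta> w))" for j
    by (rule continuous_on_compose2[OF ai t]) (auto simp: \<Theta>_in r_\<Theta>)
  show ?thesis by (intro continuous_intros p q) (use rz \<Theta>_in in auto)
qed

text \<open>The derivative along a boundary curve is the limit of the derivatives along the curves pushed into
  the domain, where the chain rule applies.\<close>

lemma trace_derivative:
  assumes x: "x \<in> N" "r x = 0" and e: "(\<Sum>i\<in>UNIV. e $ i * pd i r x) = 0"
  shows "((\<lambda>t. a0 (\<Theta> (\<Psi> x + t *\<^sub>R (e - (e $ z) *\<^sub>R axis z 1)))) has_real_derivative (\<Sum>j\<in>UNIV. e $ j * ai j x)) (at 0)"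
proof -
  define b where "b = e - (e $ z) *\<^sub>R axis z 1"
  let ?D = "\<lambda>w. b + ((b $ z - (\<Sum>i\<in>UNIV. b $ i * pd i r (\<Theta> w))) / pd z r (\<Theta> w)) *\<^sub>R axis z 1"
  let ?\<psi> = "\<lambda>w. \<Sum>j\<in>UNIV. ?D w $ j * ai j (\<Theta> w)"
  let ?y = "\<Psi> x"
  have y: "?y \<in> Q" "?y $ z = 0" using \<Psi>_in[OF x(1)] by (simp_all add: \<Psi>_nth x)
  have bz: "b $ z = 0" by (simp add: b_def)
  have De: "?D ?y = e"
  proof -
    have "(\<Sum>i\<in>UNIV. b $ i * pd i r x) = - (e $ z) * pd z r x"
      by (simp add: b_def left_diff_distrib sum_subtractf e axis_def if_distrib[of "\<lambda>t. t * _"] if_distrib[of "\<lambda>t. _ * t"] cong: if_cong)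
    then show ?thesis using rz[OF x(1)] by (simp add: \<Theta>_\<Psi> x vec_eq_iff axis_def b_def)
  qed
  have \<psi>y: "?\<psi> ?y = (\<Sum>j\<in>UNIV. e $ j * ai j x)" unfolding De by (simp add: \<Theta>_\<Psi> x)
  have "((\<lambda>t. a0 (\<Theta> (?y + t *\<^sub>R b))) has_derivative (*) (?\<psi> ?y)) (at 0)"
    unfolding has_derivative_at_alt
  proof (intro conjI allI impI)
    show "bounded_linear ((*) (?\<psi> ?y))" by (rule bounded_linear_mult_right)
    fix \<epsilon> :: real assume \<epsilon>: "\<epsilon> > 0"
    obtain d1 where d1: "d1 > 0" "\<And>w. w \<in> Q \<inter> {w. w $ z \<le> 0} \<Longrightarrow> dist w ?y < d1 \<Longrightarrow> dist (?\<psi> w) (?\<psi> ?y) < \<epsilon>"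
      using continuous_on_near[OF trace_slope_continuous[of b] _ \<epsilon>, of ?y] y by auto
    obtain d2 where d2: "d2 > 0" "ball ?y d2 \<subseteq> Q" using open_Q y(1) open_contains_ball by blast
    \<comment> \<open>A depth \<open>s\<close> and a parameter \<open>t\<close> below \<delta>
      together move the point by less than \<delta> (norm b + 2).\<close>
    define \<delta> where "\<delta> = min d1 d2 / (norm b + 2)"
    have nb: "norm b + 2 > 0" by (simp add: add_nonneg_pos)
    have \<delta>: "\<delta> > 0" using d1 d2 nb by (simp add: \<delta>_def)
    let ?c = "\<lambda>s t. (?y - s *\<^sub>R axis z 1) + t *\<^sub>R b"
    have c: "?c s t \<in> Q" "dist (?c s t) ?y < d1" "?c s t $ z = - s" "?c s t \<in> Q \<inter> {w. w $ z \<le> 0}" if "0 \<le> s" "s < \<delta>" "\<bar>t\<bar> < \<delta>" for s t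
    proof -
      have "norm (t *\<^sub>R b - s *\<^sub>R axis z 1) \<le> \<bar>t\<bar> * norm b + \<bar>s\<bar>"
        using norm_triangle_ineq4[of "t *\<^sub>R b" "s *\<^sub>R axis z 1"] by (simp add: norm_axis_1)
      also have "\<dots> \<le> \<delta> * norm b + \<delta>" using that by (intro add_mono mult_right_mono) auto
      also have "\<dots> < \<delta> * (norm b + 2)" using \<delta> by (simp add: algebra_simps)
      also have "\<dots> = min d1 d2" using nb by (simp add: \<delta>_def)
      finally have n: "norm (t *\<^sub>R b - s *\<^sub>R axis z 1) < min d1 d2" .
      have "?c s t - ?y = t *\<^sub>R b - s *\<^sub>R axis z 1" by simp
      then have d: "dist (?c s t) ?y < min d1 d2" using n by (simp add: dist_norm)
      then show "dist (?c s t) ?y < d1" by simp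
      have "?c s t \<in> ball ?y d2" using d by (simp add: dist_commute)
      then show "?c s t \<in> Q" using d2(2) by blast
      then show "?c s t \<in> Q \<inter> {w. w $ z \<le> 0}" using y bz that by simp
      show "?c s t $ z = - s" using y bz by simp
    qed
    \<comment> \<open>The bound does not depend on the depth \<open>s\<close>, so it survives the
      limit s \<rightarrow> 0, in which the curve reaches the boundary.\<close>
    have est: "\<bar>a0 (\<Theta> (?c s t)) - a0 (\<Theta> (?c s 0)) - ?\<psi> ?y * t\<bar> \<le> \<epsilon> * \<bar>t\<bar>"
      if s: "0 < s" "s < \<delta>" and t: "\<bar>t\<bar> < \<delta>" for s t
    proof -
      let ?G = "\<lambda>t. a0 (\<Theta> (?c s t)) - ?\<psi> ?y * t"
      have "norm (?G t - ?G 0) \<le> \<epsilon> * norm (t - 0)"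
      proof (rule field_differentiable_bound[where S = "{- \<delta><..<\<delta>}" and f' = "\<lambda>t. ?\<psi> (?c s t) - ?\<psi> ?y"])
        fix \<tau> assume \<tau>: "\<tau> \<in> {- \<delta><..<\<delta>}"
        then have c': "?c s \<tau> \<in> Q" "dist (?c s \<tau>) ?y < d1" "?c s \<tau> $ z = - s" using c[of s \<tau>] s by auto
        have in': "\<Theta> (?c s \<tau>) \<in> N" "r (\<Theta> (?c s \<tau>)) < 0" using \<Theta>_in[OF c'(1)] r_\<Theta>[OF c'(1)] c'(3) s by auto
        have "((\<lambda>t. a0 (\<Theta> (?c s t))) has_real_derivative ?\<psi> (?c s \<tau>)) (at \<tau>)"
          using curve_derivative[OF \<Theta>_direction[OF c'(1)] da[OF in']] pda[OF in'] by simp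
        then have "(?G has_real_derivative ?\<psi> (?c s \<tau>) - ?\<psi> ?y) (at \<tau>)"
          by (rule DERIV_diff) (auto intro!: derivative_eq_intros)
        then show "(?G has_real_derivative ?\<psi> (?c s \<tau>) - ?\<psi> ?y) (at \<tau> within {- \<delta><..<\<delta>})"
          by (rule has_field_derivative_at_within)
        have "?c s \<tau> \<in> Q \<inter> {w. w $ z \<le> 0}" using c' s by simp
        then show "norm (?\<psi> (?c s \<tau>) - ?\<psi> ?y) \<le> \<epsilon>"
          using d1(2) c'(2) unfolding dist_norm by (meson less_imp_le)
      qed (use t \<delta> in auto)
      then show ?thesis by simp
    qed
    show "\<exists>d>0. \<forall>t. norm (t - 0) < d \<longrightarrow> norm (a0 (\<Theta> (?y + t *\<^sub>R b)) - a0 (\<Theta> (?y + 0 *\<^sub>R b)) - ?\<psi> ?y * (t - 0)) \<le> \<epsilon> * norm (t - 0)"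
    proof (intro exI[of _ \<delta>] conjI allI impI \<delta>)
      fix t :: real assume "norm (t - 0) < \<delta>"
      then have t: "\<bar>t\<bar> < \<delta>" by simp
      have lim: "((\<lambda>s. a0 (\<Theta> (?c s t))) \<longlongrightarrow> a0 (\<Theta> (?y + t *\<^sub>R b))) (at_right 0)" if t: "\<bar>t\<bar> < \<delta>" for t
      proof -
        have "((\<lambda>s. ?c s t) \<longlongrightarrow> ?c 0 t) (at_right 0)" by (intro tendsto_intros)
        moreover have "continuous_on (Q \<inter> {w. w $ z \<le> 0}) (\<lambda>w. a0 (\<Theta> w))"
          by (rule continuous_on_compose2[OF a0 continuous_on_subset[OF \<Theta>_cont]]) (auto simp: \<Theta>_in r_\<Theta>)
        moreover have "?c 0 t \<in> Q \<inter> {w. w $ z \<le> 0}" using c[of 0 t] t \<delta> by simp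
        moreover have "\<forall>\<^sub>F s in at_right 0. ?c s t \<in> Q \<inter> {w. w $ z \<le> 0}"
          unfolding eventually_at_right_field using c(4)[of _ t] t \<delta> less_imp_le by (intro exI[of _ \<delta>]) blast
        ultimately have "((\<lambda>s. a0 (\<Theta> (?c s t))) \<longlongrightarrow> a0 (\<Theta> (?c 0 t))) (at_right 0)"
          by (intro continuous_on_tendsto_compose[of _ "\<lambda>w. a0 (\<Theta> w)"])
        then show ?thesis by simp
      qed
      have "((\<lambda>s. \<bar>a0 (\<Theta> (?c s t)) - a0 (\<Theta> (?c s 0)) - ?\<psi> ?y * t\<bar>) \<longlongrightarrow>
          \<bar>a0 (\<Theta> (?y + t *\<^sub>R b)) - a0 (\<Theta> (?y + 0 *\<^sub>R b)) - ?\<psi> ?y * t\<bar>) (at_right 0)"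
        by (intro tendsto_intros lim t) (simp add: \<delta>)
      moreover have "\<forall>\<^sub>F s in at_right 0. \<bar>a0 (\<Theta> (?c s t)) - a0 (\<Theta> (?c s 0)) - ?\<psi> ?y * t\<bar> \<le> \<epsilon> * \<bar>t\<bar>"
        unfolding eventually_at_right_field using est t \<delta> by (intro exI[of _ \<delta>]) auto
      ultimately have "\<bar>a0 (\<Theta> (?y + t *\<^sub>R b)) - a0 (\<Theta> (?y + 0 *\<^sub>R b)) - ?\<psi> ?y * t\<bar> \<le> \<epsilon> * \<bar>t\<bar>"
        by (rule tendsto_upperbound) simp
      then show "norm (a0 (\<Theta> (?y + t *\<^sub>R b)) - a0 (\<Theta> (?y + 0 *\<^sub>R b)) - ?\<psi> ?y * (t - 0)) \<le> \<epsilon> * norm (t - 0)" by simp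
    qed
  qed
  then show ?thesis unfolding \<psi>y unfolding has_field_derivative_def b_def .
qed

text \<open>The quotient is the slope of \<open>a0\<close> in the coordinate \<open>r\<close>, which
  increases outwards. If it were positive, \<open>a0\<close> would fall below its boundary value 0
  along a short segment into the domain, against positivity there. This gives the normal derivative
  of \<open>u\<close> its sign.\<close>

lemma normal_slope_nonpos:
  assumes pos: "\<And>x. x \<in> N \<Longrightarrow> r x < 0 \<Longrightarrow> a0 x > 0" and zero: "a0 x = 0" and x: "x \<in> N" "r x = 0"
  shows "ai z x / pd z r x \<le> 0"
proof (rule ccontr)
  assume "\<not> ai z x / pd z r x \<le> 0"
  let ?y = "\<Psi> x" and ?b = "- axis z 1 :: real^'n"
  let ?\<psi> = "\<lambda>w. \<Sum>j\<in>UNIV. (?b + ((?b $ z - (\<Sum>i\<in>UNIV. ?b $ i * pd i r (\<Theta> w))) / pd z r (\<Theta> w)) *\<^sub>R axis z 1) $ j * ai j (\<Theta> w)"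
  have y: "?y \<in> Q" "?y $ z = 0" using \<Psi>_in[OF x(1)] by (simp_all add: \<Psi>_nth x)
  have \<psi>: "?\<psi> w = - (ai z (\<Theta> w) / pd z r (\<Theta> w))" if "w \<in> Q" for w
  proof -
    have s: "(\<Sum>i\<in>UNIV. ?b $ i * pd i r (\<Theta> w)) = - pd z r (\<Theta> w)"
      by (simp add: axis_def if_distrib[of "\<lambda>t. t * _"] sum_negf cong: if_cong)
    have "?b + ((?b $ z - (\<Sum>i\<in>UNIV. ?b $ i * pd i r (\<Theta> w))) / pd z r (\<Theta> w)) *\<^sub>R axis z 1 = (- 1 / pd z r (\<Theta> w)) *\<^sub>R axis z 1"
      unfolding s using rz[OF \<Theta>_in[OF that]] by (simp add: vec_eq_iff axis_def field_simps)
    then show ?thesis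
      by (simp add: axis_def if_distrib[of "\<lambda>t. t * _"] if_distrib[of "\<lambda>t. _ * t"] sum_negf cong: if_cong)
  qed
  have "?\<psi> ?y = - (ai z (\<Theta> ?y) / pd z r (\<Theta> ?y))" by (rule \<psi>[OF y(1)])
  also have "\<dots> = - (ai z x / pd z r x)" by (simp only: \<Theta>_\<Psi>[OF x(1)])
  also have "\<dots> < 0" using \<open>\<not> ai z x / pd z r x \<le> 0\<close> by simp
  finally have "?\<psi> ?y < 0" .
  then obtain d1 where d1: "d1 > 0" "\<And>w. w \<in> Q \<inter> {w. w $ z \<le> 0} \<Longrightarrow> dist w ?y < d1 \<Longrightarrow> ?\<psi> w < 0"
  proof -
    assume neg: "?\<psi> ?y < 0" and *: "\<And>d1. 0 < d1 \<Longrightarrow> (\<And>w. w \<in> Q \<inter> {w. w $ z \<le> 0} \<Longrightarrow> dist w ?y < d1 \<Longrightarrow> ?\<psi> w < 0) \<Longrightarrow> thesis"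
    obtain d where d: "d > 0" "\<And>w. w \<in> Q \<inter> {w. w $ z \<le> 0} \<Longrightarrow> dist w ?y < d \<Longrightarrow> dist (?\<psi> w) (?\<psi> ?y) < - ?\<psi> ?y"
      using continuous_on_near[OF trace_slope_continuous[of ?b], of ?y "- ?\<psi> ?y"] y neg by auto
    show thesis
    proof (rule *[OF d(1)])
      fix w assume "w \<in> Q \<inter> {w. w $ z \<le> 0}" "dist w ?y < d"
      from d(2)[OF this] show "?\<psi> w < 0" unfolding dist_real_def by linarith
    qed
  qed
  obtain d2 where d2: "d2 > 0" "ball ?y d2 \<subseteq> Q" using open_Q y(1) open_contains_ball by blast
  define s where "s = min d1 d2 / 2"
  have s: "0 < s" "s < d1" "s < d2" using d1 d2 by (auto simp: s_def)
  have c: "?y + t *\<^sub>R ?b \<in> Q" "dist (?y + t *\<^sub>R ?b) ?y < d1" "(?y + t *\<^sub>R ?b) $ z = - t" if "0 \<le> t" "t \<le> s" for t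
  proof -
    have d: "dist (?y + t *\<^sub>R ?b) ?y = t" using that by (simp add: dist_norm norm_axis_1)
    then show "dist (?y + t *\<^sub>R ?b) ?y < d1" using that s by simp
    have "?y + t *\<^sub>R ?b \<in> ball ?y d2" using d that s by (simp add: dist_commute)
    then show "?y + t *\<^sub>R ?b \<in> Q" using d2 by blast
    show "(?y + t *\<^sub>R ?b) $ z = - t" using y by simp
  qed
  let ?\<phi> = "\<lambda>t. a0 (\<Theta> (?y + t *\<^sub>R ?b))"
  have "continuous_on {0..s} ?\<phi>"
  proof (rule continuous_on_compose2[OF a0])
    show "continuous_on {0..s} (\<lambda>t. \<Theta> (?y + t *\<^sub>R ?b))"
      by (rule continuous_on_compose2[OF \<Theta>_cont]) (use c in \<open>auto intro!: continuous_intros\<close>)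
    show "(\<lambda>t. \<Theta> (?y + t *\<^sub>R ?b)) ` {0..s} \<subseteq> {x \<in> N. r x \<le> 0}"
    proof (rule image_subsetI)
      fix t assume "t \<in> {0..s}"
      then have "?y + t *\<^sub>R ?b \<in> Q" "(?y + t *\<^sub>R ?b) $ z \<le> 0" using c[of t] by simp_all
      then show "\<Theta> (?y + t *\<^sub>R ?b) \<in> {x \<in> N. r x \<le> 0}" using \<Theta>_in r_\<Theta> by simp
    qed
  qed
  moreover have der: "(?\<phi> has_real_derivative ?\<psi> (?y + t *\<^sub>R ?b)) (at t)" if "0 < t" "t \<le> s" for t
  proof -
    have q: "?y + t *\<^sub>R ?b \<in> Q" "(?y + t *\<^sub>R ?b) $ z = - t" using c[of t] that by auto
    have in': "\<Theta> (?y + t *\<^sub>R ?b) \<in> N" "r (\<Theta> (?y + t *\<^sub>R ?b)) < 0" using \<Theta>_in[OF q(1)] r_\<Theta>[OF q(1)] q(2) that by simp_all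
    show ?thesis using curve_derivative[OF \<Theta>_direction[OF q(1)] da[OF in']] pda[OF in'] by simp
  qed
  ultimately obtain t where t: "0 < t" "t < s" "?\<phi> s - ?\<phi> 0 = (s - 0) * ?\<psi> (?y + t *\<^sub>R ?b)"
    using MVT[OF s(1), of ?\<phi>] DERIV_unique[OF _ der]
    by (metis (no_types, lifting) less_imp_le real_differentiable_def)
  have "?\<psi> (?y + t *\<^sub>R ?b) < 0" by (rule d1(2)) (use c[of t] t in auto)
  then have "?\<phi> s - ?\<phi> 0 < 0" unfolding t(3) by (intro mult_pos_neg) (use s in auto)
  then have "?\<phi> s < ?\<phi> 0" by (rule iffD2[OF less_iff_diff_less_0])
  moreover have "?\<phi> 0 = 0" by (simp add: \<Theta>_\<Psi> x zero)
  moreover have "?\<phi> s > 0"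
  proof -
    have q: "?y + s *\<^sub>R ?b \<in> Q" "(?y + s *\<^sub>R ?b) $ z = - s" using c[of s] s by auto
    show ?thesis using pos \<Theta>_in[OF q(1)] r_\<Theta>[OF q(1)] q(2) s by simp
  qed
  ultimately show False by simp
qed

end

text \<open>\<open>a0\<close> vanishes along boundary curves, so its extended differential kills
  tangent vectors. Evaluating it on the tangent vector e_j - (\<partial>_j r / \<partial>_z r) e_z
  yields proportionality to dr.\<close>

lemma dirichlet_gradient:
  assumes "continuous_on {x \<in> N. r x \<le> 0} a0" "\<And>x. x \<in> N \<Longrightarrow> r x < 0 \<Longrightarrow> a0 differentiable (at x)"
    "\<And>j. continuous_on {x \<in> N. r x \<le> 0} (ai j)" "\<And>x j. x \<in> N \<Longrightarrow> r x < 0 \<Longrightarrow> pd j a0 x = ai j x"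
    and zero: "\<And>x. x \<in> N \<Longrightarrow> r x = 0 \<Longrightarrow> a0 x = 0" and x: "x \<in> N" "r x = 0"
  shows "ai j x = ai z x / pd z r x * pd j r x"
proof -
  define e :: "real^'n" where "e = axis j 1 - (pd j r x / pd z r x) *\<^sub>R axis z 1"
  have sm: "(\<Sum>i\<in>UNIV. e $ i * h i) = h j - pd j r x / pd z r x * h z" for h
    by (simp add: e_def left_diff_distrib sum_subtractf axis_def if_distrib[of "\<lambda>t. t * _"] if_distrib[of "\<lambda>t. _ * t"] cong: if_cong)
  have e: "(\<Sum>i\<in>UNIV. e $ i * pd i r x) = 0" using rz[OF x(1)] by (simp add: sm)
  let ?\<gamma> = "\<lambda>t. \<Theta> (\<Psi> x + t *\<^sub>R (e - (e $ z) *\<^sub>R axis z 1))"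
  have "((\<lambda>t. a0 (?\<gamma> t)) has_real_derivative (\<Sum>j\<in>UNIV. e $ j * ai j x)) (at 0)"
    by (rule trace_derivative[OF assms(1-4) x e])
  moreover obtain d where d: "d > 0" "\<And>t. \<bar>t\<bar> < d \<Longrightarrow> ?\<gamma> t \<in> N \<and> r (?\<gamma> t) = 0"
    using boundary_curve(3)[OF x e] by blast
  have "((\<lambda>t. 0) has_real_derivative 0) (at 0)" by simp
  then have "((\<lambda>t. a0 (?\<gamma> t)) has_real_derivative 0) (at 0)"
    by (rule has_field_derivative_transform_within_open[of _ _ _ "{-d<..<d}"]) (use d zero in \<open>auto simp: abs_less_iff\<close>)
  ultimately have "(\<Sum>j\<in>UNIV. e $ j * ai j x) = 0" by (rule DERIV_unique)
  then show ?thesis by (simp add: sm)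
qed

text \<open>The proportionality of the differentials of \<open>a0\<close> and \<open>r\<close> is
  differentiated along a boundary curve with velocity \<open>e\<close>. The derivative of the
  multiplier is accompanied by dr(e) = 0 once the result is contracted with
  \<open>e\<close>.\<close>

lemma dirichlet_hessian:
  assumes a0: "continuous_on {x \<in> N. r x \<le> 0} a0" "\<And>x. x \<in> N \<Longrightarrow> r x < 0 \<Longrightarrow> a0 differentiable (at x)"
    and ai: "\<And>j. continuous_on {x \<in> N. r x \<le> 0} (ai j)" "\<And>x j. x \<in> N \<Longrightarrow> r x < 0 \<Longrightarrow> pd j a0 x = ai j x"
    and dai: "\<And>x j. x \<in> N \<Longrightarrow> r x < 0 \<Longrightarrow> ai j differentiable (at x)"
    and aij: "\<And>i j. continuous_on {x \<in> N. r x \<le> 0} (aij i j)" "\<And>x i j. x \<in> N \<Longrightarrow> r x < 0 \<Longrightarrow> pd i (ai j) x = aij i j x"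
    and zero: "\<And>x. x \<in> N \<Longrightarrow> r x = 0 \<Longrightarrow> a0 x = 0" and x: "x \<in> N" "r x = 0"
    and e: "(\<Sum>i\<in>UNIV. e $ i * pd i r x) = 0"
  shows "(\<Sum>i\<in>UNIV. \<Sum>j\<in>UNIV. e $ i * aij i j x * e $ j)
    = ai z x / pd z r x * (\<Sum>i\<in>UNIV. \<Sum>j\<in>UNIV. e $ i * pd i (pd j r) x * e $ j)"
proof -
  let ?\<gamma> = "\<lambda>t. \<Theta> (\<Psi> x + t *\<^sub>R (e - (e $ z) *\<^sub>R axis z 1))"
  note bc = boundary_curve[OF x e]
  obtain d where d: "d > 0" "\<And>t. \<bar>t\<bar> < d \<Longrightarrow> ?\<gamma> t \<in> N \<and> r (?\<gamma> t) = 0" using bc(3) by blast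
  have da: "((\<lambda>t. ai j (?\<gamma> t)) has_real_derivative (\<Sum>i\<in>UNIV. e $ i * aij i j x)) (at 0)" for j
    by (rule trace_derivative[OF ai(1) dai aij x e])
  have dr: "((\<lambda>t. pd j r (?\<gamma> t)) has_real_derivative (\<Sum>i\<in>UNIV. e $ i * pd i (pd j r) x)) (at 0)" for j
  proof -
    have "pd j r differentiable (at (?\<gamma> 0))"
      using r_C2 x by (simp only: bc(2)) (simp add: numeral_2_eq_2)
    from curve_derivative[OF bc(1) this] show ?thesis by (simp only: bc(2))
  qed
  let ?l = "ai z x / pd z r x"
  define l where "l = ?l"
  define l' where "l' = ((\<Sum>i\<in>UNIV. e $ i * aij i z x) * pd z r (?\<gamma> 0) - ai z (?\<gamma> 0) * (\<Sum>i\<in>UNIV. e $ i * pd i (pd z r) x)) / (pd z r (?\<gamma> 0) * pd z r (?\<gamma> 0))"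
  have "pd z r (?\<gamma> 0) \<noteq> 0" using rz[OF x(1)] by (simp only: bc(2)) simp
  from DERIV_divide[OF da[of z] dr[of z] this]
  have dl: "((\<lambda>t. ai z (?\<gamma> t) / pd z r (?\<gamma> t)) has_real_derivative l') (at 0)" unfolding l'_def .
  have "(\<Sum>i\<in>UNIV. e $ i * aij i j x) = l' * pd j r x + (\<Sum>i\<in>UNIV. e $ i * pd i (pd j r) x) * ?l" for j
  proof -
    have "((\<lambda>t. ai z (?\<gamma> t) / pd z r (?\<gamma> t) * pd j r (?\<gamma> t)) has_real_derivative
        l' * pd j r (?\<gamma> 0) + (\<Sum>i\<in>UNIV. e $ i * pd i (pd j r) x) * (ai z (?\<gamma> 0) / pd z r (?\<gamma> 0))) (at 0)"
      by (rule DERIV_mult[OF dl dr])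
    then have "((\<lambda>t. ai j (?\<gamma> t)) has_real_derivative
        l' * pd j r (?\<gamma> 0) + (\<Sum>i\<in>UNIV. e $ i * pd i (pd j r) x) * (ai z (?\<gamma> 0) / pd z r (?\<gamma> 0))) (at 0)"
    proof (rule has_field_derivative_transform_within_open[of _ _ _ "{-d<..<d}"])
      fix t assume "t \<in> {-d<..<d}"
      then have "?\<gamma> t \<in> N" "r (?\<gamma> t) = 0" using d(2)[of t] by (auto simp: abs_less_iff)
      from dirichlet_gradient[OF a0 ai zero this, of j]
      show "ai z (?\<gamma> t) / pd z r (?\<gamma> t) * pd j r (?\<gamma> t) = ai j (?\<gamma> t)" by (rule sym)
    qed (use d in auto)
    from DERIV_unique[OF da this] show ?thesis by (simp only: bc(2))
  qed
  note slope = this[folded l_def]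
  from slope have "(\<Sum>j\<in>UNIV. (\<Sum>i\<in>UNIV. e $ i * aij i j x) * e $ j)
     = l' * (\<Sum>j\<in>UNIV. e $ j * pd j r x) + l * (\<Sum>j\<in>UNIV. (\<Sum>i\<in>UNIV. e $ i * pd i (pd j r) x) * e $ j)"
    by (simp add: distrib_left distrib_right sum.distrib sum_distrib_left mult_ac)
  then have "(\<Sum>j\<in>UNIV. \<Sum>i\<in>UNIV. e $ i * aij i j x * e $ j) = l * (\<Sum>j\<in>UNIV. \<Sum>i\<in>UNIV. e $ i * pd i (pd j r) x * e $ j)"
    by (simp add: e sum_distrib_right)
  then show ?thesis unfolding l_def by (subst (1 2) sum.swap)
qed

end

lemma ex_slice_index:
  assumes "CARD('m::finite) = CARD('n::finite) - 1"
  shows "\<exists>\<sigma> :: 'm \<Rightarrow> 'n. inj \<sigma> \<and> range \<sigma> = - {z}"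
proof -
  have "card (UNIV :: 'm set) = card (- {z})" using assms by (simp add: card_Diff_singleton Compl_eq_Diff_UNIV)
  then obtain \<sigma> where "bij_betw \<sigma> (UNIV :: 'm set) (- {z})"
    using finite_same_card_bij[of "UNIV :: 'm set" "- {z}"] by auto
  then show ?thesis by (auto simp: bij_betw_def)
qed

section \<open>Parametrization of the boundary in straightened coordinates\<close>

context riemannian_domain
begin

context
  fixes c V r N z Q \<Theta> and \<sigma> :: "'m::finite \<Rightarrow> 'n"
  assumes c: "c \<in> A" and V: "defining c V r" and st: "straightening N r z Q \<Theta>" and NV: "N \<subseteq> V"
    and \<sigma>: "inj \<sigma>" "range \<sigma> = - {z}"
begin

interpretation straightening N r z Q \<Theta> by (rule st)

abbreviation (input) "bpar y \<equiv> cinv c (\<Theta> (slice_embed z \<sigma> y))"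
abbreviation (input) "bdom \<equiv> {y :: real^'m. slice_embed z \<sigma> y \<in> Q}"

lemma N_chart: "N \<subseteq> cmap c ` cdom c"
  using NV V by (auto simp: defining_def)

lemma bpar_chart: "y \<in> bdom \<Longrightarrow> cmap c (bpar y) = \<Theta> (slice_embed z \<sigma> y)"
  using cmap_cinv[OF c] N_chart \<Theta>_in by blast

lemma bdom_open: "open bdom"
  using slice_embed_continuous[OF \<sigma>, of UNIV] open_Q by (simp add: open_vimage flip: vimage_def)

lemma bpar_image: "(\<lambda>y. bpar y) ` bdom = frontier \<Omega> \<inter> cinv c ` N"
proof (intro set_eqI iffI)
  fix p assume "p \<in> (\<lambda>y. bpar y) ` bdom"
  then obtain y where y: "slice_embed z \<sigma> y \<in> Q" "p = bpar y" by auto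
  have "\<Theta> (slice_embed z \<sigma> y) \<in> N" "r (\<Theta> (slice_embed z \<sigma> y)) = 0"
    using \<Theta>_in[OF y(1)] r_\<Theta>[OF y(1)] by (simp_all add: slice_embed_nth[OF \<sigma>])
  then show "p \<in> frontier \<Omega> \<inter> cinv c ` N" using y(2) NV V unfolding defining_def by blast
next
  fix p assume "p \<in> frontier \<Omega> \<inter> cinv c ` N"
  then obtain x where x: "x \<in> N" "p = cinv c x" "p \<in> frontier \<Omega>" by auto
  have rx: "r x = 0" using x NV V unfolding defining_def by blast
  define y where "y = (\<chi> a. \<Psi> x $ \<sigma> a)"
  have "slice_embed z \<sigma> y $ i = \<Psi> x $ i" for i
    using slice_cases[OF \<sigma>, of i] by (auto simp: slice_embed_nth[OF \<sigma>] y_def \<Psi>_nth rx)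
  then have "slice_embed z \<sigma> y = \<Psi> x" by (simp add: vec_eq_iff)
  then show "p \<in> (\<lambda>y. bpar y) ` bdom" using x \<Psi>_in \<Theta>_\<Psi> by (intro image_eqI[of _ _ y]) auto
qed

lemma bpar_derivative:
  assumes y: "y \<in> bdom"
  shows "((cmap c \<circ> (\<lambda>y. bpar y)) has_derivative
     (\<lambda>v. slice_embed z \<sigma> v + ((slice_embed z \<sigma> v $ z - (\<Sum>i\<in>UNIV. slice_embed z \<sigma> v $ i * pd i r (\<Theta> (slice_embed z \<sigma> y)))) / pd z r (\<Theta> (slice_embed z \<sigma> y))) *\<^sub>R axis z 1)) (at y)"
proof -
  have "(slice_embed z \<sigma> has_derivative slice_embed z \<sigma>) (at y)"
    using linear_slice_embed[OF \<sigma>] linear_conv_bounded_linear bounded_linear_imp_has_derivative by blast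
  from has_derivative_compose[OF this \<Theta>_deriv] y
  have "((\<lambda>y. \<Theta> (slice_embed z \<sigma> y)) has_derivative
     (\<lambda>v. slice_embed z \<sigma> v + ((slice_embed z \<sigma> v $ z - (\<Sum>i\<in>UNIV. slice_embed z \<sigma> v $ i * pd i r (\<Theta> (slice_embed z \<sigma> y)))) / pd z r (\<Theta> (slice_embed z \<sigma> y))) *\<^sub>R axis z 1)) (at y)"
    by simp
  then show ?thesis
    by (rule has_derivative_transform_within_open[OF _ bdom_open y]) (simp add: bpar_chart)
qed

lemma bpar_pd:
  assumes y: "y \<in> bdom"
  shows "pd a (cmap c \<circ> (\<lambda>y. bpar y)) y
    = axis (\<sigma> a) 1 + (- pd (\<sigma> a) r (\<Theta> (slice_embed z \<sigma> y)) / pd z r (\<Theta> (slice_embed z \<sigma> y))) *\<^sub>R axis z 1"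
proof -
  have "slice_embed z \<sigma> (axis a 1) $ i = axis (\<sigma> a) 1 $ i" for i
    using slice_cases[OF \<sigma>, of i] \<sigma> by (auto simp: slice_embed_nth[OF \<sigma>] axis_def inj_eq)
  then have s: "slice_embed z \<sigma> (axis a 1) = axis (\<sigma> a) 1" by (simp add: vec_eq_iff)
  have "\<sigma> a \<noteq> z" using \<sigma>(2) by auto
  then show ?thesis
    unfolding pd_eqI[OF bpar_derivative[OF y]] s
    by (simp add: axis_def if_distrib[of "\<lambda>t. t * _"] cong: if_cong)
qed

text \<open>The explicit continuous inverse straightens a point and forgets its coordinate
  \<open>z\<close>. The derivative is injective because its components other than \<open>z\<close>
  reproduce the argument.\<close>

lemma boundary_parametrization: "local_parametrization A (frontier \<Omega>) c bdom (\<lambda>y. bpar y)"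
proof -
  let ?f = "cmap c \<circ> (\<lambda>y. bpar y)"
  have sc: "continuous_on bdom (slice_embed z \<sigma> :: real^'m \<Rightarrow> real^'n)" by (rule slice_embed_continuous[OF \<sigma>])
  have tc: "continuous_on bdom (\<lambda>y. \<Theta> (slice_embed z \<sigma> y))"
    by (rule continuous_on_compose2[OF \<Theta>_cont sc]) auto
  have pc: "continuous_on bdom (\<lambda>y. pd i r (\<Theta> (slice_embed z \<sigma> y)))" for i
    by (rule continuous_on_compose2[OF pdr_cont tc]) (auto simp: \<Theta>_in)
  have inv: "(\<chi> a. \<Psi> (cmap c (bpar y)) $ \<sigma> a) = y" if "y \<in> bdom" for y
    using that by (simp add: bpar_chart \<Psi>_\<Theta> slice_embed_nth[OF \<sigma>] vec_eq_iff)
  have inj: "inj_on (\<lambda>y. bpar y) bdom" by (rule inj_on_inverseI[where g = "\<lambda>p. \<chi> a. \<Psi> (cmap c p) $ \<sigma> a"]) (rule inv)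
  have sub: "(\<lambda>y. bpar y) ` bdom \<subseteq> frontier \<Omega> \<inter> cdom c"
    unfolding bpar_image using N_chart cinv_in[OF c] by blast
  have oN: "open (cinv c ` N)" by (rule cinv_open[OF c open_N N_chart])
  have fc: "continuous_on bdom (\<lambda>y. bpar y)"
    by (rule continuous_on_compose2[OF cinv_continuous[OF c] tc]) (use \<Theta>_in N_chart in auto)
  have gc: "continuous_on ((\<lambda>y. bpar y) ` bdom) (\<lambda>p. \<chi> a. \<Psi> (cmap c p) $ \<sigma> a)"
  proof -
    have "continuous_on ((\<lambda>y. bpar y) ` bdom) (cmap c)"
      using cmap_continuous[OF c] by (rule continuous_on_subset) (use sub in blast)
    then have "continuous_on ((\<lambda>y. bpar y) ` bdom) (\<lambda>p. \<Psi> (cmap c p))"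
      by (rule continuous_on_compose2[OF \<Psi>_cont]) (use bpar_chart \<Theta>_in in auto)
    then show ?thesis by (intro continuous_intros)
  qed
  have "inv_into bdom (\<lambda>y. bpar y) p = (\<chi> a. \<Psi> (cmap c p) $ \<sigma> a)" if "p \<in> (\<lambda>y. bpar y) ` bdom" for p
    using that inv inv_into_f_f[OF inj] by auto
  then have ic: "continuous_on ((\<lambda>y. bpar y) ` bdom) (inv_into bdom (\<lambda>y. bpar y))"
    using gc by (simp cong: continuous_on_cong)
  have hom: "homeomorphism bdom ((\<lambda>y. bpar y) ` bdom) (\<lambda>y. bpar y) (inv_into bdom (\<lambda>y. bpar y))"
    using fc ic inj by (auto simp: homeomorphism_def inv_into_f_f[OF inj] f_inv_into_f image_iff inv_into_into intro!: bexI)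
  have "continuous_on bdom (pd a ?f)" for a
  proof (rule continuous_on_eq)
    show "continuous_on bdom (\<lambda>y. axis (\<sigma> a) 1 + (- pd (\<sigma> a) r (\<Theta> (slice_embed z \<sigma> y)) / pd z r (\<Theta> (slice_embed z \<sigma> y))) *\<^sub>R axis z 1 :: real^'n)"
      by (rule continuous_on_add[OF continuous_on_const continuous_on_scaleR[OF continuous_on_divide[OF continuous_on_minus[OF pc] pc] continuous_on_const]])
         (use rz \<Theta>_in in auto)
  qed (simp add: bpar_pd)
  then have C1: "Ck_on 1 bdom ?f" using bpar_derivative by (auto simp: differentiable_def)
  have "inj (frechet_derivative ?f (at y))" if y: "y \<in> bdom" for y
  proof (rule injI)
    fix v w assume "frechet_derivative ?f (at y) v = frechet_derivative ?f (at y) w"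
    then have "frechet_derivative ?f (at y) v $ \<sigma> a = frechet_derivative ?f (at y) w $ \<sigma> a" for a by simp
    moreover have "frechet_derivative ?f (at y) u $ \<sigma> a = u $ a" for u a
    proof -
      have "\<sigma> a \<noteq> z" using \<sigma>(2) by auto
      then show ?thesis
        unfolding frechet_derivative_at[OF bpar_derivative[OF y], symmetric]
        by (simp add: slice_embed_nth[OF \<sigma>] axis_def)
    qed
    ultimately show "v = w" by (simp add: vec_eq_iff)
  qed
  moreover have "openin (top_of_set (frontier \<Omega>)) ((\<lambda>y. bpar y) ` bdom)"
    unfolding bpar_image openin_open using oN by blast
  ultimately show ?thesis
    unfolding local_parametrization_def using c bdom_open sub hom C1 by blast
qed

text \<open>\<open>graph_gram_det\<close> with the conormal dr divided by \<open>pd z r\<close>. The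
  same factor 1/|\<open>pd z r\<close>| occurs in \<open>dens\<close>, so that Euclidean and
  Riemannian flux densities will match.\<close>

lemma boundary_density:
  assumes y: "y \<in> bdom"
  shows "param_density g c (\<lambda>y. bpar y) y = sqrt (det (g c (\<Theta> (slice_embed z \<sigma> y))))
     * sqrt (grad_ip (g c) r r (\<Theta> (slice_embed z \<sigma> y))) / \<bar>pd z r (\<Theta> (slice_embed z \<sigma> y))\<bar>"
proof -
  let ?x = "\<Theta> (slice_embed z \<sigma> y)"
  let ?M = "g c ?x" and ?J = "\<lambda>a. pd a (cmap c \<circ> (\<lambda>y. bpar y)) y" and ?\<nu> = "(1 / pd z r ?x) *\<^sub>R dcov r ?x"
  have x: "?x \<in> N" using y \<Theta>_in by simp
  have rz: "pd z r ?x \<noteq> 0" by (rule rz[OF x])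
  have M: "posdef ?M" using local_metric.G_posdef[OF local_metric[OF c]] x N_chart by blast
  have \<sigma>z: "\<sigma> a \<noteq> z" for a using \<sigma>(2) by auto
  have "det (\<chi> a b. ?J a \<bullet> (?M *v ?J b)) = det ?M * (?\<nu> \<bullet> (matrix_inv ?M *v ?\<nu>))"
  proof (rule graph_gram_det[OF M \<sigma>])
    show "?J a $ \<sigma> b = (if a = b then 1 else 0)" for a b
      using \<sigma>z[of b] \<sigma>(1) by (auto simp: bpar_pd[OF y] axis_def inj_eq)
    show "?\<nu> $ z = 1" using rz by simp
    show "?\<nu> \<bullet> ?J a = 0" for a
      using rz by (simp add: bpar_pd[OF y] inner_add_right inner_diff_right inner_axis field_simps)
  qed
  also have "?\<nu> \<bullet> (matrix_inv ?M *v ?\<nu>) = grad_ip (g c) r r ?x / (pd z r ?x)\<^sup>2"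
    by (simp add: grad_ip_inner gradient_def matrix_vector_mult_scaleR power2_eq_square inner_commute)
  finally have D: "det (\<chi> a b. ?J a \<bullet> (?M *v ?J b)) = det ?M * (grad_ip (g c) r r ?x / (pd z r ?x)\<^sup>2)" .
  have "induced_metric g c (\<lambda>y. bpar y) y = (\<chi> a b. ?J a \<bullet> (?M *v ?J b))"
    by (simp only: induced_metric_def bpar_chart[OF y])
  then have "param_density g c (\<lambda>y. bpar y) y = sqrt (det ?M * (grad_ip (g c) r r ?x / (pd z r ?x)\<^sup>2))"
    by (simp only: param_density_def D)
  then show ?thesis by (simp add: real_sqrt_mult real_sqrt_divide)
qed

end

end

section \<open>The divergence theorem on a Riemannian domain\<close>

lemma indicator_restrict:
  fixes f :: "'x \<Rightarrow> real"
  assumes "T \<subseteq> S" "\<And>p. p \<in> S - T \<Longrightarrow> f p = 0"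
  shows "(\<lambda>p. indicator S p *\<^sub>R f p) = (\<lambda>p. indicator T p *\<^sub>R f p)"
  using assms by (auto simp: fun_eq_iff indicator_def)

lemma Ck_open_subset:
  assumes "Ck_open k A T b" "S \<subseteq> T"
  shows "Ck_open k A S b"
  unfolding Ck_open_def
proof
  fix c assume "c \<in> A"
  then have "Ck_on k (cmap c ` (cdom c \<inter> T)) (b \<circ> cinv c)" using assms(1) by (simp add: Ck_open_def)
  then show "Ck_on k (cmap c ` (cdom c \<inter> S)) (b \<circ> cinv c)" by (rule Ck_on_subset) (use assms(2) in blast)
qed

lemma Ck_open_le: "Ck_open k A T b \<Longrightarrow> l \<le> k \<Longrightarrow> Ck_open l A T b"
  unfolding Ck_open_def by (meson Ck_on_le)

context riemannian_manifold
begin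

text \<open>The inverse of a chart parametrizes the manifold itself, so the volume is the
  codimension zero case of the submanifold measure.\<close>

lemma chart_parametrization:
  assumes c: "c \<in> A" and U: "open U" "U \<subseteq> cdom c"
  shows "local_parametrization A UNIV c (cmap c ` U) (cinv c)"
    and "cinv c ` cmap c ` U = U"
    and "x \<in> cmap c ` U \<Longrightarrow> param_density g c (cinv c) x = sqrt (det (g c x))"
proof -
  let ?W = "cmap c ` U"
  have oW: "open ?W" by (rule cmap_open[OF c U])
  show img: "cinv c ` ?W = U" using U(2) cinv_cmap[OF c] by (force simp: image_iff)
  have inj: "inj_on (cinv c) ?W" by (rule inj_on_inverseI[of _ "cmap c"]) (use cmap_cinv[OF c] U in blast)
  have inv: "inv_into ?W (cinv c) p = cmap c p" if "p \<in> U" for p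
    using inv_into_f_f[OF inj, of "cmap c p"] that U cinv_cmap[OF c] by force
  have hom: "homeomorphism ?W (cinv c ` ?W) (cinv c) (inv_into ?W (cinv c))"
  proof -
    have "continuous_on U (inv_into ?W (cinv c))"
      using continuous_on_subset[OF cmap_continuous[OF c] U(2)] inv by (simp cong: continuous_on_cong)
    moreover have "continuous_on ?W (cinv c)"
      by (rule continuous_on_subset[OF cinv_continuous[OF c]]) (use U in blast)
    ultimately show ?thesis
      unfolding homeomorphism_def img using inv U(2) cinv_cmap[OF c] cmap_cinv[OF c] img by (auto simp: subset_iff)
  qed
  have id: "(cmap c \<circ> cinv c) y = y" if "y \<in> ?W" for y using cmap_cinv[OF c] that U by auto
  have C1: "Ck_on k ?W (cmap c \<circ> cinv c)" for k
    by (rule Ck_on_cong[OF oW _ Ck_on_id]) (simp only: id)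
  have D: "((cmap c \<circ> cinv c) has_derivative (\<lambda>v. v)) (at y)" if "y \<in> ?W" for y
    by (subst has_derivative_cong_open[OF oW that, where g = "\<lambda>y. y"]) (use id in auto)
  have "inj (frechet_derivative (cmap c \<circ> cinv c) (at y))" if "y \<in> ?W" for y
    using frechet_derivative_at[OF D[OF that], symmetric] by (simp add: inj_def)
  moreover have "cinv c ` ?W \<subseteq> UNIV \<inter> cdom c" unfolding img using U by blast
  moreover have "openin (top_of_set UNIV) (cinv c ` ?W)" unfolding img using U by simp
  ultimately show "local_parametrization A UNIV c ?W (cinv c)"
    unfolding local_parametrization_def using c oW hom C1 by blast
  assume x: "x \<in> ?W"
  have "pd a (cmap c \<circ> cinv c) x = axis a 1" for a by (rule pd_eqI[OF D[OF x]])
  moreover have "cmap c (cinv c x) = x" using id[OF x] by simp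
  ultimately have "induced_metric g c (cinv c) x = (\<chi> a b. axis a 1 \<bullet> (g c x *v axis b 1))"
    by (simp only: induced_metric_def)
  then have "induced_metric g c (cinv c) x = g c x"
    by (simp add: vec_eq_iff inner_axis' matrix_vector_mult_basis column_def)
  then show "param_density g c (cinv c) x = sqrt (det (g c x))" by (simp add: param_density_def)
qed

lemma volume_on_volume_measure: "volume_on TYPE('n) UNIV (volume_measure A g)"
  unfolding volume_measure_def
proof (rule volume_on_riemannian_measure)
  fix p :: 'a
  obtain c where c: "c \<in> A" "p \<in> cdom c" using ex_chart by blast
  show "\<exists>c W (F :: real^'n \<Rightarrow> 'a). local_parametrization A UNIV c W F \<and> p \<in> F ` W"
    using chart_parametrization(1,2)[OF c(1) cdom_open[OF c(1)] order_refl] c(2) by blast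
qed simp

lemma volume_integral_chart:
  assumes c: "c \<in> A" and U: "open U" "U \<subseteq> cdom c" and f: "continuous_on (cmap c ` U) (\<lambda>x. f (cinv c x))"
  shows "(LINT q:U|volume_measure A g. f q) = (LINT x:cmap c ` U|lborel. sqrt (det (g c x)) * f (cinv c x))"
    and "set_integrable (volume_measure A g) U f \<longleftrightarrow> set_integrable lborel (cmap c ` U) (\<lambda>x. sqrt (det (g c x)) * f (cinv c x))"
proof -
  note P = chart_parametrization[OF c U]
  have S: "(UNIV :: 'a set) \<in> sets borel" by simp
  note I = volume_on_integral[OF volume_on_volume_measure P(1) S f, unfolded P(2)]
  have "open (cmap c ` U)" by (rule cmap_open[OF c U])
  then have s: "cmap c ` U \<in> sets lborel" by simp
  show "(LINT q:U|volume_measure A g. f q) = (LINT x:cmap c ` U|lborel. sqrt (det (g c x)) * f (cinv c x))"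
    unfolding I(1) by (rule set_lebesgue_integral_cong[OF s]) (simp add: P(3))
  show "set_integrable (volume_measure A g) U f \<longleftrightarrow> set_integrable lborel (cmap c ` U) (\<lambda>x. sqrt (det (g c x)) * f (cinv c x))"
    unfolding I(2) by (rule set_integrable_cong) (simp_all add: P(3))
qed

text \<open>In a chart the function is the square of the positive part of \<rho>^2 - |x - x0|^2,
  with x0 the coordinates of \<open>p\<close>. Squaring the positive part makes it C^1, and it is
  positive exactly on a coordinate ball.\<close>

lemma bump_exists:
  assumes U: "open U" "p \<in> U"
  shows "\<exists>\<beta> K. compact K \<and> K \<subseteq> U \<and> (\<forall>q. \<beta> q \<ge> 0) \<and> \<beta> p > (0::real) \<and> (\<forall>q. q \<notin> K \<longrightarrow> \<beta> q = 0)
     \<and> open {q. \<beta> q > 0} \<and> Ck_open 1 A UNIV \<beta>"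
proof -
  obtain c where c: "c \<in> A" "p \<in> cdom c" using ex_chart by blast
  let ?x = "cmap c p"
  have oU: "open (cmap c ` (cdom c \<inter> U))" by (rule cmap_open[OF c(1)]) (use cdom_open[OF c(1)] U in auto)
  then obtain \<rho> where \<rho>: "\<rho> > 0" "cball ?x \<rho> \<subseteq> cmap c ` (cdom c \<inter> U)"
    using oU c U unfolding open_contains_cball by blast
  have sub: "cball ?x \<rho> \<subseteq> cmap c ` cdom c" using \<rho>(2) by blast
  define K where "K = cinv c ` cball ?x \<rho>"
  have cK: "compact K" unfolding K_def
    by (rule compact_continuous_image[OF continuous_on_subset[OF cinv_continuous[OF c(1)] sub] compact_cball])
  have KU: "K \<subseteq> U" and Kd: "K \<subseteq> cdom c" using \<rho>(2) cinv_cmap[OF c(1)] unfolding K_def by force+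
  define s where "s x = \<rho>\<^sup>2 - (x - ?x) \<bullet> (x - ?x)" for x
  define \<beta> where "\<beta> q = (if q \<in> cdom c then (max 0 (s (cmap c q)))\<^sup>2 else 0)" for q
  have spos: "s x > 0 \<longleftrightarrow> x \<in> ball ?x \<rho>" for x
  proof -
    have "s x > 0 \<longleftrightarrow> (norm (x - ?x))\<^sup>2 < \<rho>\<^sup>2" by (simp add: s_def power2_norm_eq_inner)
    also have "\<dots> \<longleftrightarrow> norm (x - ?x) < \<rho>" using \<rho>(1) by (auto intro: power2_less_imp_less power_strict_mono)
    finally show ?thesis by (simp add: dist_norm norm_minus_commute)
  qed
  have inK: "q \<in> K" if "\<beta> q \<noteq> 0" for q
  proof -
    have q: "q \<in> cdom c" "s (cmap c q) > 0" using that by (auto simp: \<beta>_def max_def split: if_splits)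
    then have "cmap c q \<in> cball ?x \<rho>" using spos[of "cmap c q"] by auto
    then show ?thesis unfolding K_def using cinv_cmap[OF c(1) q(1)] by force
  qed
  have "{q. \<beta> q > 0} = cinv c ` ball ?x \<rho>"
  proof (intro set_eqI iffI)
    fix q assume "q \<in> {q. \<beta> q > 0}"
    then have q: "q \<in> cdom c" "s (cmap c q) > 0" by (auto simp: \<beta>_def max_def split: if_splits)
    then have "cmap c q \<in> ball ?x \<rho>" using spos by blast
    then show "q \<in> cinv c ` ball ?x \<rho>" using cinv_cmap[OF c(1) q(1)] by force
  next
    fix q assume "q \<in> cinv c ` ball ?x \<rho>"
    then obtain x where x: "x \<in> ball ?x \<rho>" "q = cinv c x" by blast
    have xi: "x \<in> cmap c ` cdom c" using x sub ball_subset_cball by blast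
    have "cmap c q = x" "q \<in> cdom c" using cmap_cinv[OF c(1) xi] cinv_in[OF c(1) xi] x by simp_all
    then show "q \<in> {q. \<beta> q > 0}" using spos[of x] x(1) by (simp add: \<beta>_def)
  qed
  moreover have "open (cinv c ` ball ?x \<rho>)"
    by (rule cinv_open[OF c(1) open_ball]) (use sub ball_subset_cball in blast)
  ultimately have ob: "open {q. \<beta> q > 0}" by simp
  have sD: "(s has_derivative (\<lambda>v. - 2 * (v \<bullet> (x - ?x)))) (at x)" for x
    unfolding s_def by (auto intro!: derivative_eq_intros simp: inner_commute)
  have sdiff: "s differentiable (at x)" for x using sD by (auto simp: differentiable_def)
  have spd: "pd i s = (\<lambda>x. - 2 * (x - ?x) $ i)" for i
  proof
    fix x show "pd i s x = - 2 * (x - ?x) $ i" using pd_eqI[OF sD[of x], of i] by (simp add: inner_axis')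
  qed
  have s1: "Ck_on (Suc 0) UNIV s" using sdiff by (auto simp: spd intro!: continuous_intros)
  have B: "Ck_on (Suc 0) UNIV (\<lambda>x. (max 0 (s x))\<^sup>2)"
  proof (rule Ck_on_chain[OF open_UNIV DERIV_max0_sq s1])
    have "continuous_on UNIV s" by (rule Ck_on_continuous[OF s1])
    then show "Ck_on 0 UNIV (\<lambda>x. 2 * max 0 (s x))" by (auto intro!: continuous_intros)
  qed
  have "Ck_open 1 A UNIV \<beta>"
    unfolding Ck_open_def
  proof
    fix d assume d: "d \<in> A"
    let ?S1 = "cmap d ` (cdom d \<inter> cdom c)" and ?S2 = "cmap d ` (cdom d - K)"
    have o1: "open ?S1" by (rule cmap_open[OF d]) (use cdom_open[OF d] cdom_open[OF c(1)] in auto)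
    have o2: "open ?S2" by (rule cmap_open[OF d]) (use cdom_open[OF d] compact_imp_closed[OF cK] in auto)
    have "Ck_on 1 ?S1 (\<lambda>x. (max 0 (s ((cmap c \<circ> cinv d) x)))\<^sup>2)"
      using Ck_on_compose[OF o1 subset_UNIV B transition_Ck[OF d c(1), of "Suc 0"]] by (simp only: One_nat_def)
    then have "Ck_on 1 ?S1 (\<beta> \<circ> cinv d)"
      by (rule Ck_on_cong[OF o1, rotated]) (use cinv_cmap[OF d] in \<open>auto simp: \<beta>_def\<close>)
    moreover have "Ck_on 1 ?S2 (\<beta> \<circ> cinv d)"
      by (rule Ck_on_cong[OF o2 _ Ck_on_const[of 1 _ 0]]) (use cinv_cmap[OF d] inK in force)
    moreover have "?S1 \<union> ?S2 = cmap d ` (cdom d \<inter> UNIV)" using Kd by blast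
    ultimately show "Ck_on 1 (cmap d ` (cdom d \<inter> UNIV)) (\<beta> \<circ> cinv d)"
      using Ck_on_Un[OF o1 o2, of 1 "\<beta> \<circ> cinv d"] by simp
  qed
  moreover have "\<beta> q \<ge> 0" for q by (simp add: \<beta>_def)
  moreover have "\<beta> p > 0" using c(2) spos[of ?x] \<rho>(1) by (simp add: \<beta>_def)
  ultimately show ?thesis using cK KU inK ob by blast
qed

end

context riemannian_domain
begin

abbreviation (input) "vol \<equiv> volume_measure A g"

lemma closure_eq: "closure \<Omega> = \<Omega> \<union> frontier \<Omega>"
  using open_\<Omega> closure_subset by (auto simp: frontier_def interior_open)

definition straightened where
  "straightened c V r N z Q \<Theta> \<longleftrightarrow> c \<in> A \<and> defining c V r \<and> straightening N r z Q \<Theta> \<and> N \<subseteq> V"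

text \<open>Near an interior point a coordinate plane outside the neighbourhood plays the role of the boundary.\<close>

lemma straightened_exists:
  assumes p: "p \<in> closure \<Omega>"
  shows "\<exists>c V r N z Q \<Theta>. straightened c V r N z Q \<Theta> \<and> p \<in> cinv c ` N"
proof -
  obtain c where c: "c \<in> A" "p \<in> cdom c" using ex_chart by blast
  have pc: "p = cinv c (cmap c p)" using cinv_cmap[OF c] by simp
  show ?thesis
  proof (cases "p \<in> \<Omega>")
    case True
    fix z :: 'n
    \<comment> \<open>One more than the coordinate of \<open>p\<close>, so that \<open>p\<close> has
      coordinates in \<open>V\<close> while \<open>r\<close> is negative on all of
      \<open>V\<close>.\<close>
    define a where "a = cmap c p $ z + 1"
    define V where "V = cmap c ` (cdom c \<inter> \<Omega>) \<inter> {x. x $ z < a}"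
    define r :: "real^'n \<Rightarrow> real" where "r x = x $ z - a" for x
    have oV: "open V" unfolding V_def
      by (intro open_Int cmap_open[OF c(1)] open_halfspace_component_lt_cart) (use cdom_open[OF c(1)] open_\<Omega> in auto)
    have rC: "Ck_on 2 X r" for X
      by (rule Ck_on_subset[OF _ subset_UNIV], unfold r_def, intro Ck_on_diff Ck_on_nth Ck_on_id Ck_on_const open_UNIV)
    have "(r has_derivative (\<lambda>v. v $ z)) (at x)" for x
      unfolding r_def
      using has_derivative_diff[OF bounded_linear_imp_has_derivative[OF bounded_linear_vec_nth[of z]] has_derivative_const[of a]] by simp
    from pd_eqI[OF this, of z "cmap c p"] have "pd z r (cmap c p) \<noteq> 0" by simp
    moreover have "cmap c p \<in> V" using c True by (auto simp: V_def a_def)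
    ultimately obtain N Q \<Theta> where N: "straightening N r z Q \<Theta>" "cmap c p \<in> N" "N \<subseteq> V"
      using straightening_exists[OF oV _ rC] by blast
    have "cinv c x \<in> \<Omega> \<and> cinv c x \<notin> frontier \<Omega> \<and> r x < 0" if "x \<in> V" for x
    proof -
      have "cinv c x \<in> \<Omega>" using that cinv_in[OF c(1), of x "cdom c \<inter> \<Omega>"] unfolding V_def by blast
      then show ?thesis using that open_\<Omega> by (auto simp: frontier_def interior_open r_def V_def)
    qed
    then have "\<forall>x\<in>V. (cinv c x \<in> \<Omega> \<longleftrightarrow> r x < 0) \<and> (cinv c x \<in> frontier \<Omega> \<longleftrightarrow> r x = 0)" by fastforce
    moreover have "V \<subseteq> cmap c ` cdom c" unfolding V_def by blast
    ultimately have "defining c V r" unfolding defining_def using oV rC by blast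
    then show ?thesis unfolding straightened_def using c(1) N pc by blast
  next
    case False
    then obtain r where r: "local_defining_fun c \<Omega> p r" using ex_defining[OF c] p closure_eq by blast
    obtain V N z Q \<Theta> where "defining c V r" "straightening N r z Q \<Theta>" "cmap c p \<in> N" "N \<subseteq> V"
      by (rule defining_straightening[OF c(1) r])
    then show ?thesis unfolding straightened_def using c(1) pc by blast
  qed
qed

text \<open>\<open>h\<close> extends the differential of \<open>b\<close> continuously to the
  boundary in the chart \<open>c\<close>, and \<nu> is the normal derivative formed with it: paired
  with \<nabla>r it gives \<nu> |\<nabla>r|, for every defining function.\<close>

definition normal_extension :: "('a \<Rightarrow> real) \<Rightarrow> ('a \<Rightarrow> real) \<Rightarrow> ('a, 'n) chart \<Rightarrow> ('n \<Rightarrow> real^'n \<Rightarrow> real) \<Rightarrow> bool" where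
  "normal_extension b \<nu> c h \<longleftrightarrow> (\<forall>j. continuous_on (cmap c ` (cdom c \<inter> closure \<Omega>)) (h j))
     \<and> (\<forall>j. \<forall>x\<in>cmap c ` (cdom c \<inter> \<Omega>). pd j (b \<circ> cinv c) x = h j x)
     \<and> (\<forall>p r. local_defining_fun c \<Omega> p r \<longrightarrow>
          \<nu> p * sqrt (grad_ip (g c) r r (cmap c p)) = (\<Sum>j\<in>UNIV. gradient (g c) r (cmap c p) $ j * h j (cmap c p)))"

definition normal_data :: "('a \<Rightarrow> real) \<Rightarrow> ('a \<Rightarrow> real) \<Rightarrow> bool" where
  "normal_data b \<nu> \<longleftrightarrow> (\<forall>c\<in>A. \<exists>h. normal_extension b \<nu> c h)"

lemma frontier_borel: "frontier \<Omega> \<in> sets borel"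
  by (simp add: borel_closed frontier_closed)

lemma frontier_compact: "compact (frontier \<Omega>)"
  using compact_Int_closed[OF compact_closure, of "frontier \<Omega>"] frontier_closed closure_eq by (simp add: Int_absorb1)

lemma closure_finite: "emeasure vol (closure \<Omega>) < \<infinity>"
proof (rule volume_on_compact_finite[OF _ _ volume_on_volume_measure compact_closure])
  show "\<exists>c W (F :: real^'n \<Rightarrow> 'a). local_parametrization A UNIV c W F \<and> p \<in> F ` W" for p
  proof -
    obtain c where c: "c \<in> A" "p \<in> cdom c" using ex_chart by blast
    show ?thesis using chart_parametrization(1,2)[OF c(1) cdom_open[OF c(1)] order_refl] c(2) by blast
  qed
qed auto


section \<open>The divergence theorem for functions with bounded Laplacian\<close>

context
  fixes \<mu> :: "'a measure" and \<sigma>0 :: "'m::finite itself"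
  assumes dimm: "CARD('m) = CARD('n) - 1"
  defines "\<mu> \<equiv> riemannian_measure TYPE('m) A g (frontier \<Omega>)"
begin

lemma frontier_parametrized:
  assumes p: "p \<in> frontier \<Omega>"
  shows "\<exists>c W (F :: real^'m \<Rightarrow> 'a). local_parametrization A (frontier \<Omega>) c W F \<and> p \<in> F ` W"
proof -
  have "p \<in> closure \<Omega>" using p by (simp add: frontier_def)
  then obtain c V r N z Q \<Theta> where st: "straightened c V r N z Q \<Theta>" "p \<in> cinv c ` N"
    using straightened_exists by blast
  obtain \<sigma> :: "'m \<Rightarrow> 'n" where \<sigma>: "inj \<sigma>" "range \<sigma> = - {z}" using ex_slice_index[OF dimm] by blast
  note s = st(1)[unfolded straightened_def]
  have "c \<in> A" "defining c V r" "straightening N r z Q \<Theta>" "N \<subseteq> V" using s by simp_all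
  from boundary_parametrization[OF this \<sigma>] bpar_image[OF this \<sigma>] st(2) p show ?thesis by blast
qed

lemma volume_on_frontier: "volume_on TYPE('m) (frontier \<Omega>) \<mu>"
  unfolding \<mu>_def
proof (rule volume_on_riemannian_measure)
  show "\<exists>c W (F :: real^'m \<Rightarrow> 'a). local_parametrization A (frontier \<Omega>) c W F \<and> p \<in> F ` W" if "p \<in> frontier \<Omega>" for p
    by (rule frontier_parametrized[OF that])
qed (rule frontier_borel)

lemma frontier_finite: "emeasure \<mu> (frontier \<Omega>) < \<infinity>"
proof (rule volume_on_compact_finite[OF _ frontier_borel volume_on_frontier])
  show "\<exists>c W (F :: real^'m \<Rightarrow> 'a). local_parametrization A (frontier \<Omega>) c W F \<and> p \<in> F ` W" if "p \<in> frontier \<Omega>" for p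
    by (rule frontier_parametrized[OF that])
qed (auto simp: frontier_compact)

context
  fixes b \<nu> :: "'a \<Rightarrow> real" and M
  assumes b2: "Ck_open 2 A \<Omega> b" and bM: "\<And>p. p \<in> \<Omega> \<Longrightarrow> \<bar>laplacian A g b p\<bar> \<le> M" and nd: "normal_data b \<nu>"
begin

text \<open>The flat theorem is applied to X = \<zeta> sqrt(det g) g^{-1} h, which is continuous up
  to the boundary; the bound on the Laplacian of \<open>b\<close> bounds its divergence. On the
  boundary \<open>dens\<close> becomes the Riemannian density times \<zeta> \<nu>, by
  \<open>boundary_density\<close>.\<close>

lemma local_divergence:
  assumes s: "straightened c V r N z Q \<Theta>"
    and \<zeta>: "open T" "closure \<Omega> \<subseteq> T" "Ck_open 1 A T \<zeta>"
    and K: "compact K" "K \<subseteq> cinv c ` N" "\<And>p. p \<in> closure \<Omega> \<Longrightarrow> p \<notin> K \<Longrightarrow> \<zeta> p = 0"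
  defines "F \<equiv> \<lambda>p. \<zeta> p * laplacian A g b p + gip b \<zeta> p"
  shows "set_integrable vol \<Omega> F" "set_integrable \<mu> (frontier \<Omega>) (\<lambda>p. \<zeta> p * \<nu> p)"
    "(LINT p:\<Omega>|vol. F p) = (LINT p:frontier \<Omega>|\<mu>. \<zeta> p * \<nu> p)"
proof -
  have c: "c \<in> A" and V: "defining c V r" and st: "straightening N r z Q \<Theta>" and NV: "N \<subseteq> V"
    using s by (simp_all add: straightened_def)
  obtain \<sigma> :: "'m \<Rightarrow> 'n" where \<sigma>: "inj \<sigma>" "range \<sigma> = - {z}" using ex_slice_index[OF dimm] by blast
  interpret straightening N r z Q \<Theta> by (rule st)
  let ?neg = "{x \<in> N. r x < 0}" and ?np = "{x \<in> N. r x \<le> 0}"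
  have Nc: "N \<subseteq> cmap c ` cdom c" by (rule N_chart[OF c V st NV \<sigma>])
  have cc: "cmap c (cinv c x) = x" "cinv c x \<in> cdom c" if "x \<in> N" for x
    using that Nc cmap_cinv[OF c] cinv_in[OF c] by blast+
  have sgn: "cinv c x \<in> \<Omega> \<longleftrightarrow> r x < 0" "cinv c x \<in> frontier \<Omega> \<longleftrightarrow> r x = 0" if "x \<in> N" for x
    using that V NV unfolding defining_def by blast+
  have clos: "cinv c x \<in> closure \<Omega> \<longleftrightarrow> r x \<le> 0" if "x \<in> N" for x
    using sgn[OF that] closure_eq by auto
  interpret L: local_metric "cmap c ` cdom c" "g c" by (rule local_metric[OF c])
  interpret Ln: local_metric ?neg "g c" by (rule L.local_metric_subset[OF open_neg]) (use Nc in blast)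
  let ?\<zeta> = "\<zeta> \<circ> cinv c" and ?b = "b \<circ> cinv c"
  have negsub: "?neg \<subseteq> cmap c ` (cdom c \<inter> \<Omega>)" and npsub: "?np \<subseteq> cmap c ` (cdom c \<inter> closure \<Omega>)"
    using cc sgn clos by (force intro!: image_eqI)+
  have npT: "?np \<subseteq> cmap c ` (cdom c \<inter> T)" using npsub \<zeta>(2) by blast
  have \<zeta>C: "Ck_on (Suc 0) (cmap c ` (cdom c \<inter> T)) ?\<zeta>" using \<zeta>(3) c by (simp add: Ck_open_def)
  have \<zeta>n: "Ck_on (Suc 0) ?neg ?\<zeta>" by (rule Ck_on_subset[OF \<zeta>C]) (use npT in auto)
  have bC: "Ck_on 2 ?neg ?b" by (rule Ck_on_subset[OF _ negsub]) (use b2 c in \<open>simp add: Ck_open_def\<close>)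
  have bC': "Ck_on (Suc (Suc 0)) ?neg ?b" using bC by (simp only: numeral_2_eq_2)
  obtain h where hh: "normal_extension b \<nu> c h" using nd c unfolding normal_data_def by blast
  have h: "\<And>j. continuous_on (cmap c ` (cdom c \<inter> closure \<Omega>)) (h j)"
     "\<And>j x. x \<in> cmap c ` (cdom c \<inter> \<Omega>) \<Longrightarrow> pd j ?b x = h j x"
     "\<And>p r. local_defining_fun c \<Omega> p r \<Longrightarrow>
          \<nu> p * sqrt (grad_ip (g c) r r (cmap c p)) = (\<Sum>j\<in>UNIV. gradient (g c) r (cmap c p) $ j * h j (cmap c p))"
    using hh unfolding normal_extension_def by auto
  define X where "X x = (\<chi> i. ?\<zeta> x * (sqrt (det (g c x)) * (\<Sum>j\<in>UNIV. L.gi x i j * h j x)))" for x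
  have grad: "(\<Sum>j\<in>UNIV. L.gi x i j * h j x) = gradient (g c) ?b x $ i" if "x \<in> ?neg" for x i
    using h(2) negsub that by (simp add: L.gradient_nth subset_iff)
  have Xn: "?\<zeta> x * (sqrt (det (g c x)) * gradient (g c) ?b x $ i) = X x $ i" if "x \<in> ?neg" for x i
    by (simp only: X_def grad[OF that] vec_lambda_beta)
  have np_img: "?np \<subseteq> cmap c ` cdom c" using Nc by auto
  have con\<zeta>: "continuous_on ?np ?\<zeta>" by (rule continuous_on_subset[OF Ck_on_continuous[OF \<zeta>C] npT])
  have cond: "continuous_on ?np (\<lambda>x. sqrt (det (g c x)))"
    by (rule continuous_on_subset[OF Ck_on_continuous[OF L.sqrt_det_Ck[of 0]] np_img])
  have congi: "continuous_on ?np (\<lambda>x. L.gi x i j)" for i j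
    by (rule continuous_on_subset[OF Ck_on_continuous[OF L.gi_Ck[of 0]] np_img])
  have conh: "continuous_on ?np (h j)" for j by (rule continuous_on_subset[OF h(1) npsub])
  have conv: "continuous_on ?np (\<lambda>x. \<Sum>j\<in>UNIV. L.gi x i j * h j x)" for i
    by (intro continuous_on_sum continuous_on_mult congi conh)
  have X_cont: "continuous_on ?np X"
    unfolding X_def by (intro continuous_on_vec_lambda continuous_on_mult con\<zeta> cond conv)
  have X_C1: "Ck_on 1 ?neg (\<lambda>x. X x $ i)" for i
  proof (rule Ck_on_cong[OF open_neg Xn])
    show "Ck_on 1 ?neg (\<lambda>x. ?\<zeta> x * (sqrt (det (g c x)) * gradient (g c) ?b x $ i))"
      unfolding One_nat_def by (intro Ck_on_mult open_neg \<zeta>n Ln.sqrt_det_Ck Ln.gradient_Ck bC')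
  qed
  have div: "(\<Sum>i\<in>UNIV. pd i (\<lambda>x. X x $ i) x) = sqrt (det (g c x)) * (?\<zeta> x * lap (g c) ?b x + grad_ip (g c) ?b ?\<zeta> x)"
    if x: "x \<in> ?neg" for x
  proof -
    have "(\<Sum>i\<in>UNIV. pd i (\<lambda>x. X x $ i) x) = (\<Sum>i\<in>UNIV. pd i (\<lambda>x. ?\<zeta> x * (sqrt (det (g c x)) * gradient (g c) ?b x $ i)) x)"
      by (rule sum.cong[OF refl], rule pd_cong[OF open_neg x], rule Xn[symmetric])
    also have "\<dots> = sqrt (det (g c x)) * (?\<zeta> x * lap (g c) ?b x + grad_ip (g c) ?b ?\<zeta> x)"
      by (rule Ln.weighted_divergence[OF bC \<zeta>n[folded One_nat_def] x])
    finally show ?thesis .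
  qed
  have b1: "Ck_open 1 A \<Omega> b" by (rule Ck_open_le[OF b2]) simp
  have \<zeta>1: "Ck_open 1 A \<Omega> \<zeta>" by (rule Ck_open_subset[OF \<zeta>(3) order_trans[OF closure_subset \<zeta>(2)]])
  have Fc: "F (cinv c x) = ?\<zeta> x * lap (g c) ?b x + grad_ip (g c) ?b ?\<zeta> x"
    and lapM: "\<bar>lap (g c) ?b x\<bar> \<le> M" if x: "x \<in> ?neg" for x
  proof -
    have p: "cinv c x \<in> cdom c" "cinv c x \<in> \<Omega>" "cmap c (cinv c x) = x" using x cc sgn by auto
    have l: "laplacian A g b (cinv c x) = lap (g c) ?b x" using lap_chart[OF c p(1) open_\<Omega> p(2) b2] p(3) by simp
    then show "\<bar>lap (g c) ?b x\<bar> \<le> M" using bM[OF p(2)] by simp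
    show "F (cinv c x) = ?\<zeta> x * lap (g c) ?b x + grad_ip (g c) ?b ?\<zeta> x"
      using gip_chart[OF c p(1) open_\<Omega> p(2) b1 \<zeta>1] p(3) l by (simp add: F_def)
  qed
  define K' where "K' = cmap c ` (K \<inter> closure \<Omega>)"
  have Kd: "K \<subseteq> cdom c" using K(2) cc by blast
  have "compact (K \<inter> closure \<Omega>)" using K(1) by (simp add: compact_Int_closed)
  then have cK': "compact K'" unfolding K'_def
    by (rule compact_continuous_image[rotated]) (rule continuous_on_subset[OF cmap_continuous[OF c]], use Kd in blast)
  have K'np: "K' \<subseteq> ?np"
  proof
    fix x assume "x \<in> K'"
    then obtain p where p: "p \<in> K" "p \<in> closure \<Omega>" "x = cmap c p" unfolding K'_def by blast
    then obtain y where y: "y \<in> N" "p = cinv c y" using K(2) by blast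
    then show "x \<in> ?np" using cc clos p by simp
  qed
  have \<zeta>0: "?\<zeta> x = 0" if "x \<in> ?np" "x \<notin> K'" for x
  proof -
    have cl: "cinv c x \<in> closure \<Omega>" using that clos by auto
    moreover have "cinv c x \<notin> K"
    proof
      assume "cinv c x \<in> K"
      then have "cmap c (cinv c x) \<in> K'" unfolding K'_def using cl by blast
      then show False using that cc by auto
    qed
    ultimately show ?thesis using K(3) by simp
  qed
  have X_zero: "X x = 0" if "x \<in> N" "r x \<le> 0" "x \<notin> K'" for x
    using \<zeta>0[of x] that by (simp add: X_def vec_eq_iff)
  \<comment> \<open>Continuous extension to the boundary of the inner product of \<nabla>b and
    \<nabla>\<zeta>, used to bound it on the compact set \<open>K'\<close>.\<close>
  define \<Phi> where "\<Phi> x = (\<Sum>i\<in>UNIV. (\<Sum>j\<in>UNIV. L.gi x i j * h j x) * pd i ?\<zeta> x)" for x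
  have con\<Phi>: "continuous_on ?np \<Phi>"
  proof -
    have "continuous_on ?np (pd i ?\<zeta>)" for i
      by (rule continuous_on_subset[OF Ck_on_continuous[OF Ck_on_pd[OF \<zeta>C, of 0]] npT]) simp
    then show ?thesis unfolding \<Phi>_def by (intro continuous_on_sum continuous_on_mult conv)
  qed
  have bdd: "\<exists>B. \<forall>x\<in>K'. \<bar>f x\<bar> \<le> B" if "continuous_on ?np f" for f :: "real^'n \<Rightarrow> real"
    using compact_imp_bounded[OF compact_continuous_image[OF continuous_on_subset[OF that K'np] cK']]
    unfolding bounded_real by blast
  obtain B1 where B1: "\<And>x. x \<in> K' \<Longrightarrow> \<bar>sqrt (det (g c x)) * ?\<zeta> x\<bar> \<le> B1"
    using bdd[OF continuous_on_mult[OF cond con\<zeta>]] by blast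
  obtain B2 where B2: "\<And>x. x \<in> K' \<Longrightarrow> \<bar>sqrt (det (g c x)) * \<Phi> x\<bar> \<le> B2"
    using bdd[OF continuous_on_mult[OF cond con\<Phi>]] by blast
  have dX: "\<bar>\<Sum>i\<in>UNIV. pd i (\<lambda>x. X x $ i) x\<bar> \<le> \<bar>B1\<bar> * \<bar>M\<bar> + \<bar>B2\<bar>" if "x \<in> N" "r x < 0" for x
  proof -
    have x: "x \<in> ?neg" using that by simp
    have g\<Phi>: "grad_ip (g c) ?b ?\<zeta> x = \<Phi> x" unfolding grad_ip_def \<Phi>_def by (simp only: grad[OF x])
    show ?thesis
    proof (cases "x \<in> K'")
      case True
      have "\<bar>\<Sum>i\<in>UNIV. pd i (\<lambda>x. X x $ i) x\<bar> = \<bar>(sqrt (det (g c x)) * ?\<zeta> x) * lap (g c) ?b x + sqrt (det (g c x)) * \<Phi> x\<bar>"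
        unfolding div[OF x] g\<Phi> by (simp add: algebra_simps)
      also have "\<dots> \<le> \<bar>sqrt (det (g c x)) * ?\<zeta> x\<bar> * \<bar>lap (g c) ?b x\<bar> + \<bar>sqrt (det (g c x)) * \<Phi> x\<bar>"
        by (rule order_trans[OF abs_triangle_ineq]) (simp add: abs_mult)
      also have "\<dots> \<le> \<bar>B1\<bar> * \<bar>M\<bar> + \<bar>B2\<bar>"
        by (rule add_mono[OF mult_mono]) (use B1[OF True] B2[OF True] lapM[OF x] in auto)
      finally show ?thesis .
    next
      case False
      have "open (?neg - K')" using open_neg compact_imp_closed[OF cK'] by blast
      then have "pd i ?\<zeta> x = pd i (\<lambda>x. 0) x" for i
        by (rule pd_cong) (use x False \<zeta>0 in auto)
      moreover have "pd i (\<lambda>x. 0 :: real) x = 0" for i by (rule pd_eqI[OF has_derivative_const, THEN trans]) simp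
      ultimately have "\<Phi> x = 0" unfolding \<Phi>_def by simp
      moreover have "?\<zeta> x = 0" using \<zeta>0[of x] x False by auto
      ultimately show ?thesis unfolding div[OF x] g\<Phi> by simp
    qed
  qed
  have K'N: "K' \<subseteq> N" using K'np by blast
  have dvXd: "dvX X x = (\<Sum>i\<in>UNIV. pd i (\<lambda>x. X x $ i) x)" for x
    by (rule dvX_def[OF \<sigma> cK' K'N X_cont X_C1 X_zero dX])
  have fluxd: "flux X x = (\<Sum>i\<in>UNIV. pd i r x * X x $ i)" for x
    by (rule flux_def[OF \<sigma> cK' K'N X_cont X_C1 X_zero dX])
  have densd: "dens X w = flux X (\<Theta> w) / \<bar>pd z r (\<Theta> w)\<bar>" for w
    by (rule dens_def[OF \<sigma> cK' K'N X_cont X_C1 X_zero dX])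
  have FD: "(LINT x:?neg|lborel. dvX X x) = (LINT y:{y. slice_embed z \<sigma> y \<in> Q}|lborel. dens X (slice_embed z \<sigma> y))"
    by (rule flat_divergence[OF \<sigma> cK' K'N X_cont X_C1 X_zero dX])
  have dvI: "set_integrable lborel ?neg (dvX X)"
    by (rule dvX_integrable[OF \<sigma> cK' K'N X_cont X_C1 X_zero dX])
  have deI: "set_integrable lborel {y. slice_embed z \<sigma> y \<in> Q} (\<lambda>y. dens X (slice_embed z \<sigma> y))"
    by (rule dens_integrable[OF \<sigma> cK' K'N X_cont X_C1 X_zero dX])
  have dvX: "dvX X x = sqrt (det (g c x)) * F (cinv c x)" if "x \<in> ?neg" for x
    unfolding dvXd Fc[OF that] by (rule div[OF that])
  define U where "U = \<Omega> \<inter> cinv c ` N"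
  have oU: "open U" unfolding U_def using open_\<Omega> cinv_open[OF c open_N Nc] by blast
  have Ud: "U \<subseteq> cdom c" unfolding U_def using cc by blast
  have Uneg: "cmap c ` U = ?neg"
    unfolding U_def using cc(1) sgn(1) by (force intro!: image_eqI)
  have conF: "continuous_on (cmap c ` U) (\<lambda>x. F (cinv c x))"
    unfolding Uneg
  proof (rule continuous_on_eq)
    show "continuous_on ?neg (\<lambda>x. ?\<zeta> x * lap (g c) ?b x + grad_ip (g c) ?b ?\<zeta> x)"
      by (intro continuous_on_add continuous_on_mult Ck_on_continuous[OF \<zeta>n]
        Ck_on_continuous[OF Ln.lap_Ck[OF bC']] Ck_on_continuous[OF Ln.grad_ip_Ck[OF Ck_on_Suc_imp[OF bC'] \<zeta>n]])
  qed (rule Fc[symmetric])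
  have neg_s: "?neg \<in> sets lborel" using open_neg by simp
  \<comment> \<open>Off \<open>K\<close> the function \<zeta> vanishes on an open subset of the
    domain, so its gradient vanishes there too.\<close>
  have F0: "F p = 0" if "p \<in> \<Omega> - U" for p
  proof -
    have p: "p \<in> \<Omega> - K" using that K(2) unfolding U_def by blast
    have oK: "open (\<Omega> - K)" using open_\<Omega> compact_imp_closed[OF K(1)] by blast
    have "gip b \<zeta> p = 0"
    proof -
      let ?d = "chart_at A p"
      note d = chart_at[of p]
      have oD: "open (cmap ?d ` (cdom ?d \<inter> (\<Omega> - K)))" by (rule cmap_open[OF d(1)]) (use oK cdom_open[OF d(1)] in auto)
      have "grad_ip (g ?d) (b \<circ> cinv ?d) (\<zeta> \<circ> cinv ?d) (cmap ?d p) = grad_ip (g ?d) (b \<circ> cinv ?d) (\<lambda>x. 0) (cmap ?d p)"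
      proof (rule grad_ip_cong[OF oD])
        show "(\<zeta> \<circ> cinv ?d) y = 0" if "y \<in> cmap ?d ` (cdom ?d \<inter> (\<Omega> - K))" for y
          using cinv_in[OF d(1) that] K(3) closure_subset by auto
      qed (use p d in auto)
      also have "\<dots> = 0" by (simp add: grad_ip_def pd_eqI[OF has_derivative_const])
      finally show ?thesis by (simp add: gip_def Let_def)
    qed
    moreover have "\<zeta> p = 0" using p K(3) closure_subset by blast
    ultimately show ?thesis by (simp add: F_def)
  qed
  have indF: "(\<lambda>p. indicator \<Omega> p *\<^sub>R F p) = (\<lambda>p. indicator U p *\<^sub>R F p)"
    by (rule indicator_restrict[OF _ F0]) (auto simp: U_def)
  note VI = volume_integral_chart[OF c oU Ud conF, unfolded Uneg]
  have "set_integrable lborel ?neg (\<lambda>x. sqrt (det (g c x)) * F (cinv c x)) \<longleftrightarrow> set_integrable lborel ?neg (dvX X)"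
    by (rule set_integrable_cong) (simp_all add: dvX)
  then have "set_integrable vol U F" using VI(2) dvI by blast
  then show "set_integrable vol \<Omega> F" unfolding set_integrable_def indF .
  have "(LINT p:\<Omega>|vol. F p) = (LINT p:U|vol. F p)" unfolding set_lebesgue_integral_def indF ..
  also have "\<dots> = (LINT x:?neg|lborel. dvX X x)"
    unfolding VI(1) by (rule set_lebesgue_integral_cong[OF neg_s]) (simp add: dvX)
  finally have IF: "(LINT p:\<Omega>|vol. F p) = (LINT x:?neg|lborel. dvX X x)" .
  let ?W = "{y :: real^'m. slice_embed z \<sigma> y \<in> Q}" and ?F = "\<lambda>y. cinv c (\<Theta> (slice_embed z \<sigma> y))"
  note par = boundary_parametrization[OF c V st NV \<sigma>]
  have den: "dens X (slice_embed z \<sigma> y) = param_density g c ?F y * (\<zeta> (?F y) * \<nu> (?F y))" if y: "y \<in> ?W" for y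
  proof -
    let ?x = "\<Theta> (slice_embed z \<sigma> y)"
    have x: "?x \<in> N" "r ?x = 0" using y \<Theta>_in r_\<Theta> by (simp_all add: slice_embed_nth[OF \<sigma>])
    note ld = defining_at[OF c V st NV x]
    have xi: "?x \<in> cmap c ` cdom c" using x Nc by blast
    have "flux X ?x = (\<Sum>i\<in>UNIV. \<Sum>j\<in>UNIV. ?\<zeta> ?x * sqrt (det (g c ?x)) * (pd i r ?x * L.gi ?x i j * h j ?x))"
      by (simp add: fluxd X_def sum_distrib_left mult_ac)
    also have "\<dots> = ?\<zeta> ?x * sqrt (det (g c ?x)) * (\<Sum>i\<in>UNIV. \<Sum>j\<in>UNIV. pd i r ?x * L.gi ?x i j * h j ?x)"
      by (simp only: sum_distrib_left)
    also have "(\<Sum>i\<in>UNIV. \<Sum>j\<in>UNIV. pd i r ?x * L.gi ?x i j * h j ?x) = (\<Sum>j\<in>UNIV. \<Sum>i\<in>UNIV. pd i r ?x * L.gi ?x i j * h j ?x)"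
      by (rule sum.swap)
    also have "\<dots> = (\<Sum>j\<in>UNIV. gradient (g c) r ?x $ j * h j ?x)"
    proof (rule sum.cong[OF refl])
      fix j
      have "(\<Sum>i\<in>UNIV. pd i r ?x * L.gi ?x i j * h j ?x) = (\<Sum>i\<in>UNIV. L.gi ?x j i * pd i r ?x * h j ?x)"
        by (rule sum.cong[OF refl]) (simp only: L.gi_sym[OF xi, of _ j] mult_ac)
      then show "(\<Sum>i\<in>UNIV. pd i r ?x * L.gi ?x i j * h j ?x) = gradient (g c) r ?x $ j * h j ?x"
        by (simp only: L.gradient_nth sum_distrib_right)
    qed
    also have "\<dots> = \<nu> (?F y) * sqrt (grad_ip (g c) r r ?x)" using h(3)[OF ld(1)] by (simp only: ld(2))
    finally have "flux X ?x = \<zeta> (?F y) * sqrt (det (g c ?x)) * (\<nu> (?F y) * sqrt (grad_ip (g c) r r ?x))" by simp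
    then show ?thesis
      using boundary_density[OF c V st NV \<sigma>, of y] y unfolding densd by simp
  qed
  have tc: "continuous_on ?W (\<lambda>y. \<Theta> (slice_embed z \<sigma> y))"
    by (rule continuous_on_compose2[OF \<Theta>_cont slice_embed_continuous[OF \<sigma>]]) auto
  have td: "\<Theta> (slice_embed z \<sigma> y) \<in> ?np" if "y \<in> ?W" for y
    using that \<Theta>_in r_\<Theta> by (simp add: slice_embed_nth[OF \<sigma>])
  have flc: "continuous_on ?np (flux X)" by (rule flux_cont[OF \<sigma> cK' K'N X_cont X_C1 X_zero dX])
  have "continuous_on ?W (\<lambda>y. dens X (slice_embed z \<sigma> y))"
    unfolding densd
  proof (rule continuous_on_divide)
    show "continuous_on ?W (\<lambda>y. flux X (\<Theta> (slice_embed z \<sigma> y)))"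
      by (rule continuous_on_compose2[OF flc tc]) (use td in auto)
    show "continuous_on ?W (\<lambda>y. \<bar>pd z r (\<Theta> (slice_embed z \<sigma> y))\<bar>)"
      by (rule continuous_on_rabs, rule continuous_on_compose2[OF pdr_cont tc]) (use td in auto)
  qed (use td rz in auto)
  then have "continuous_on ?W (\<lambda>y. dens X (slice_embed z \<sigma> y) / param_density g c ?F y)"
    using param_density_continuous[OF par] param_density_pos[OF par] by (intro continuous_on_divide) fastforce+
  then have con: "continuous_on ?W (\<lambda>y. \<zeta> (?F y) * \<nu> (?F y))"
    by (rule continuous_on_eq) (use den param_density_pos[OF par] in fastforce)
  note BI = volume_on_integral[OF volume_on_frontier par frontier_borel con]
  have img: "?F ` ?W \<subseteq> frontier \<Omega>" using bpar_image[OF c V st NV \<sigma>] by blast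
  have off: "\<zeta> p * \<nu> p = 0" if "p \<in> frontier \<Omega> - ?F ` ?W" for p
  proof -
    have "p \<notin> K" using that K(2) bpar_image[OF c V st NV \<sigma>] by blast
    then show ?thesis using K(3)[of p] that closure_eq by auto
  qed
  have ind: "(\<lambda>p. indicator (frontier \<Omega>) p *\<^sub>R (\<zeta> p * \<nu> p)) = (\<lambda>p. indicator (?F ` ?W) p *\<^sub>R (\<zeta> p * \<nu> p))"
    by (rule indicator_restrict[OF img off])
  have W_s: "?W \<in> sets lborel" using param_open[OF par] by simp
  have "set_integrable lborel ?W (\<lambda>y. param_density g c ?F y * (\<zeta> (?F y) * \<nu> (?F y))) \<longleftrightarrow> set_integrable lborel ?W (\<lambda>y. dens X (slice_embed z \<sigma> y))"
    by (rule set_integrable_cong) (simp_all add: den)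
  then have "set_integrable \<mu> (?F ` ?W) (\<lambda>p. \<zeta> p * \<nu> p)" using BI(2) deI by blast
  then show "set_integrable \<mu> (frontier \<Omega>) (\<lambda>p. \<zeta> p * \<nu> p)" unfolding set_integrable_def ind .
  have "(LINT p:frontier \<Omega>|\<mu>. \<zeta> p * \<nu> p) = (LINT p:?F ` ?W|\<mu>. \<zeta> p * \<nu> p)" unfolding set_lebesgue_integral_def ind ..
  also have "\<dots> = (LINT y:?W|lborel. dens X (slice_embed z \<sigma> y))"
    unfolding BI(1) by (rule set_lebesgue_integral_cong[OF W_s]) (simp add: den)
  finally show "(LINT p:\<Omega>|vol. F p) = (LINT p:frontier \<Omega>|\<mu>. \<zeta> p * \<nu> p)" using IF FD by simp
qed

text \<open>Localization by a partition of unity on an open neighbourhood \<open>T\<close> of the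
  compact closure. The functions \<zeta> p add up to 1 on \<open>T\<close>, so their gradients add
  up to 0 and the mixed terms cancel in the sum.\<close>

theorem divergence_theorem:
  "set_integrable vol \<Omega> (laplacian A g b)" "set_integrable \<mu> (frontier \<Omega>) \<nu>"
  "(LINT p:\<Omega>|vol. laplacian A g b p) = (LINT p:frontier \<Omega>|\<mu>. \<nu> p)"
proof -
  define good where "good p \<beta> \<longleftrightarrow> (\<exists>K c V r N z Q \<Theta>. straightened c V r N z Q \<Theta> \<and> compact K \<and> K \<subseteq> cinv c ` N
     \<and> (\<forall>q. \<beta> q \<ge> (0::real)) \<and> \<beta> p > 0 \<and> (\<forall>q. q \<notin> K \<longrightarrow> \<beta> q = 0) \<and> open {q. \<beta> q > 0} \<and> Ck_open 1 A UNIV \<beta>)" for p \<beta>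
  have "\<exists>\<beta>. good p \<beta>" if p: "p \<in> closure \<Omega>" for p
  proof -
    obtain c V r N z Q \<Theta> where s: "straightened c V r N z Q \<Theta>" "p \<in> cinv c ` N"
      using straightened_exists[OF p] by blast
    have "N \<subseteq> cmap c ` cdom c" "c \<in> A" "open N"
      using s(1) straightening.open_N unfolding straightened_def defining_def by blast+
    then have "open (cinv c ` N)" using cinv_open by blast
    from bump_exists[OF this s(2)] s(1) show ?thesis unfolding good_def by blast
  qed
  then obtain \<beta> where \<beta>: "\<And>p. p \<in> closure \<Omega> \<Longrightarrow> good p (\<beta> p)" by metis
  have op: "open {q. \<beta> p q > 0}" and pos: "\<beta> p p > 0" and nn: "\<beta> p q \<ge> 0" and C1: "Ck_open 1 A UNIV (\<beta> p)"
    if "p \<in> closure \<Omega>" for p q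
    using \<beta>[OF that] unfolding good_def by blast+
  have cov: "closure \<Omega> \<subseteq> (\<Union>p\<in>closure \<Omega>. {q. \<beta> p q > 0})" using pos by blast
  obtain I where I: "I \<subseteq> closure \<Omega>" "finite I" "closure \<Omega> \<subseteq> (\<Union>p\<in>I. {q. \<beta> p q > 0})"
    by (rule compactE_image[OF compact_closure _ cov]) (rule op)
  define T where "T = (\<Union>p\<in>I. {q. \<beta> p q > 0})"
  have oT: "open T" unfolding T_def using op I(1) by blast
  have cT: "closure \<Omega> \<subseteq> T" using I(3) by (simp add: T_def)
  have Spos: "(\<Sum>p\<in>I. \<beta> p q) > 0" if q: "q \<in> T" for q
  proof -
    obtain p where "p \<in> I" "\<beta> p q > 0" using q unfolding T_def by blast
    then show ?thesis using sum_pos2[OF I(2), of p "\<lambda>p. \<beta> p q"] nn I(1) by blast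
  qed
  define \<zeta> where "\<zeta> p q = \<beta> p q / (\<Sum>p\<in>I. \<beta> p q)" for p q
  have sum\<zeta>: "(\<Sum>p\<in>I. \<zeta> p q) = 1" if "q \<in> T" for q
    using Spos[OF that] by (simp add: \<zeta>_def flip: sum_divide_distrib)
  have \<zeta>1: "Ck_open 1 A T (\<zeta> p)" if p: "p \<in> I" for p
    unfolding Ck_open_def
  proof
    fix c assume c: "c \<in> A"
    let ?S = "cmap c ` (cdom c \<inter> T)"
    have oS: "open ?S" by (rule cmap_open[OF c]) (use oT cdom_open[OF c] in auto)
    have b: "Ck_on 1 ?S (\<lambda>x. \<beta> p (cinv c x))" if "p \<in> I" for p
    proof -
      have "Ck_on 1 (cmap c ` (cdom c \<inter> UNIV)) (\<beta> p \<circ> cinv c)" using C1 that I(1) c unfolding Ck_open_def by blast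
      then have "Ck_on 1 ?S (\<beta> p \<circ> cinv c)" by (rule Ck_on_subset) auto
      then show ?thesis by (simp only: comp_def)
    qed
    have "(\<Sum>p\<in>I. \<beta> p (cinv c x)) \<noteq> 0" if "x \<in> ?S" for x
      using Spos[of "cinv c x"] cinv_in[OF c that] by auto
    from Ck_on_divide[OF oS this b[OF p] Ck_on_sum[OF oS b]]
    show "Ck_on 1 ?S (\<zeta> p \<circ> cinv c)" by (simp only: comp_def \<zeta>_def)
  qed
  define F where "F p q = \<zeta> p q * laplacian A g b q + gip b (\<zeta> p) q" for p q
  have loc: "set_integrable vol \<Omega> (F p) \<and> set_integrable \<mu> (frontier \<Omega>) (\<lambda>q. \<zeta> p q * \<nu> q)
     \<and> (LINT q:\<Omega>|vol. F p q) = (LINT q:frontier \<Omega>|\<mu>. \<zeta> p q * \<nu> q)" if p: "p \<in> I" for p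
  proof -
    have "good p (\<beta> p)" using \<beta> I(1) p by blast
    then obtain K c V r N z Q \<Theta> where s: "straightened c V r N z Q \<Theta>" "compact K" "K \<subseteq> cinv c ` N" "\<forall>q. q \<notin> K \<longrightarrow> \<beta> p q = 0"
      unfolding good_def by blast
    have z: "\<zeta> p q = 0" if "q \<in> closure \<Omega>" "q \<notin> K" for q using s(4) that by (simp add: \<zeta>_def)
    show ?thesis
      unfolding F_def using local_divergence[OF s(1) oT cT \<zeta>1[OF p] s(2,3) z] by blast
  qed
  have sumF: "(\<Sum>p\<in>I. F p q) = laplacian A g b q" if q: "q \<in> \<Omega>" for q
  proof -
    let ?c = "chart_at A q"
    note c = chart_at[of q]
    let ?x = "cmap ?c q" and ?S = "cmap ?c ` (cdom ?c \<inter> T)"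
    have qT: "q \<in> T" using q cT closure_subset by blast
    have oS: "open ?S" by (rule cmap_open[OF c(1)]) (use oT cdom_open[OF c(1)] in auto)
    have xS: "?x \<in> ?S" using c(2) qT by blast
    have dif: "(\<zeta> p \<circ> cinv ?c) differentiable (at ?x)" if "p \<in> I" for p
      by (rule Ck_on_differentiable[of 1 ?S]) (use \<zeta>1[OF that] c(1) xS in \<open>simp_all add: Ck_open_def\<close>)
    have "(\<Sum>p\<in>I. pd i (\<zeta> p \<circ> cinv ?c) ?x) = 0" for i
    proof -
      have "(\<Sum>p\<in>I. pd i (\<zeta> p \<circ> cinv ?c) ?x) = pd i (\<lambda>x. \<Sum>p\<in>I. (\<zeta> p \<circ> cinv ?c) x) ?x"
        by (rule pd_sum[OF I(2) dif, symmetric])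
      also have "\<dots> = pd i (\<lambda>x. 1) ?x"
      proof (rule pd_cong[OF oS xS])
        show "(\<Sum>p\<in>I. (\<zeta> p \<circ> cinv ?c) y) = 1" if "y \<in> ?S" for y
          using sum\<zeta>[of "cinv ?c y"] cinv_in[OF c(1) that] by auto
      qed
      also have "\<dots> = 0" by (simp add: pd_eqI[OF has_derivative_const])
      finally show ?thesis .
    qed
    then have "(\<Sum>p\<in>I. gip b (\<zeta> p) q) = 0"
      unfolding gip_def Let_def grad_ip_def by (subst sum.swap) (simp flip: sum_distrib_left)
    moreover have "(\<Sum>p\<in>I. \<zeta> p q * laplacian A g b q) = laplacian A g b q"
      using sum\<zeta>[OF qT] by (simp flip: sum_distrib_right)
    ultimately show ?thesis by (simp add: F_def sum.distrib)
  qed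
  have lapF: "(\<lambda>q. indicator \<Omega> q *\<^sub>R laplacian A g b q) = (\<lambda>q. \<Sum>p\<in>I. indicator \<Omega> q *\<^sub>R F p q)"
    using sumF by (auto simp: fun_eq_iff indicator_def)
  have \<nu>F: "(\<lambda>q. indicator (frontier \<Omega>) q *\<^sub>R \<nu> q) = (\<lambda>q. \<Sum>p\<in>I. indicator (frontier \<Omega>) q *\<^sub>R (\<zeta> p q * \<nu> q))"
  proof
    fix q
    have "(\<Sum>p\<in>I. \<zeta> p q * \<nu> q) = \<nu> q" if "q \<in> frontier \<Omega>"
      using sum\<zeta>[of q] that cT closure_eq by (simp add: subset_iff flip: sum_distrib_right)
    then show "indicator (frontier \<Omega>) q *\<^sub>R \<nu> q = (\<Sum>p\<in>I. indicator (frontier \<Omega>) q *\<^sub>R (\<zeta> p q * \<nu> q))"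
      by (cases "q \<in> frontier \<Omega>") simp_all
  qed
  have i1: "integrable vol (\<lambda>q. indicator \<Omega> q *\<^sub>R F p q)" "integrable \<mu> (\<lambda>q. indicator (frontier \<Omega>) q *\<^sub>R (\<zeta> p q * \<nu> q))"
    if "p \<in> I" for p
    using loc[OF that] unfolding set_integrable_def by blast+
  show "set_integrable vol \<Omega> (laplacian A g b)"
    unfolding set_integrable_def lapF by (rule Bochner_Integration.integrable_sum[OF i1(1)])
  show "set_integrable \<mu> (frontier \<Omega>) \<nu>"
    unfolding set_integrable_def \<nu>F by (rule Bochner_Integration.integrable_sum[OF i1(2)])
  have "(LINT p:\<Omega>|vol. laplacian A g b p) = (\<Sum>p\<in>I. LINT q:\<Omega>|vol. F p q)"
    unfolding set_lebesgue_integral_def lapF by (rule Bochner_Integration.integral_sum[OF i1(1)])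
  also have "\<dots> = (\<Sum>p\<in>I. LINT q:frontier \<Omega>|\<mu>. \<zeta> p q * \<nu> q)" using loc by simp
  also have "\<dots> = (LINT p:frontier \<Omega>|\<mu>. \<nu> p)"
    unfolding set_lebesgue_integral_def \<nu>F by (rule Bochner_Integration.integral_sum[OF i1(2), symmetric])
  finally show "(LINT p:\<Omega>|vol. laplacian A g b p) = (LINT p:frontier \<Omega>|\<mu>. \<nu> p)" .
qed

end

end

end



section \<open>The Dirichlet problem at the boundary\<close>

context riemannian_domain
begin

abbreviation Co :: "('a, 'n) chart \<Rightarrow> (real^'n) set" where "Co c \<equiv> cmap c ` (cdom c \<inter> \<Omega>)"
abbreviation Cc :: "('a, 'n) chart \<Rightarrow> (real^'n) set" where "Cc c \<equiv> cmap c ` (cdom c \<inter> closure \<Omega>)"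

lemma Co_open: "c \<in> A \<Longrightarrow> open (Co c)"
  by (rule cmap_open) (use cdom_open[of c] open_\<Omega> in auto)

lemma defining_sides:
  assumes c: "c \<in> A" and V: "defining c V r" and x: "x \<in> V"
  shows "r x < 0 \<Longrightarrow> x \<in> Co c" "r x \<le> 0 \<Longrightarrow> x \<in> Cc c"
proof -
  have xi: "x \<in> cmap c ` cdom c" using V x unfolding defining_def by blast
  have p: "x = cmap c (cinv c x)" "cinv c x \<in> cdom c" using cmap_cinv[OF c xi] cinv_in[OF c xi] by simp_all
  have s: "(cinv c x \<in> \<Omega> \<longleftrightarrow> r x < 0) \<and> (cinv c x \<in> frontier \<Omega> \<longleftrightarrow> r x = 0)" using V x unfolding defining_def by blast
  show "r x < 0 \<Longrightarrow> x \<in> Co c" by (rule image_eqI[of x "cmap c" "cinv c x", OF p(1)]) (use p(2) s in auto)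
  show "x \<in> Cc c" if "r x \<le> 0"
  proof (rule image_eqI[of x "cmap c" "cinv c x", OF p(1)])
    show "cinv c x \<in> cdom c \<inter> closure \<Omega>" unfolding closure_eq using p(2) s that by (cases "r x < 0") auto
  qed
qed

lemma frontier_nontrivial: "p \<in> frontier \<Omega> \<Longrightarrow> at p within \<Omega> \<noteq> bot"
proof -
  assume "p \<in> frontier \<Omega>"
  then have "p \<in> closure \<Omega>" "p \<notin> \<Omega>" using open_\<Omega> by (simp_all add: frontier_def interior_open)
  then have "p islimpt \<Omega>" unfolding closure_def by blast
  then show ?thesis by (simp add: trivial_limit_within)
qed

text \<open>A quantity extended continuously in a chart is a limit from inside the domain. Such
  limits do not refer to the chart, so boundary values obtained in different ways can be
  identified.\<close>

lemma boundary_limit: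
  assumes c: "c \<in> A" and p: "p \<in> cdom c" "p \<in> frontier \<Omega>" and \<phi>: "continuous_on (Cc c) \<phi>"
    and b: "\<And>q. q \<in> cdom c \<inter> \<Omega> \<Longrightarrow> b q = \<phi> (cmap c q)"
  shows "(b \<longlongrightarrow> \<phi> (cmap c p)) (at p within \<Omega>)"
proof -
  have "continuous_on (cdom c \<inter> closure \<Omega>) (\<lambda>q. \<phi> (cmap c q))"
    by (rule continuous_on_compose2[OF \<phi> continuous_on_subset[OF cmap_continuous[OF c]]]) auto
  moreover have "p \<in> cdom c \<inter> closure \<Omega>" using p by (auto simp: frontier_def)
  ultimately have "((\<lambda>q. \<phi> (cmap c q)) \<longlongrightarrow> \<phi> (cmap c p)) (at p within (cdom c \<inter> closure \<Omega>))"
    by (auto simp: continuous_on_def)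
  then have l: "((\<lambda>q. \<phi> (cmap c q)) \<longlongrightarrow> \<phi> (cmap c p)) (at p within (cdom c \<inter> \<Omega>))"
    by (rule tendsto_within_subset) (use closure_subset in blast)
  have "(b \<longlongrightarrow> \<phi> (cmap c p)) (at p within (cdom c \<inter> \<Omega>))"
    by (rule Lim_transform_eventually[OF l]) (auto simp: eventually_at_topological b)
  moreover have "at p within (cdom c \<inter> \<Omega>) = at p within \<Omega>"
    by (rule at_within_nhd[OF p(1) cdom_open[OF c]]) auto
  ultimately show ?thesis by simp
qed

text \<open>Locally the mean curvature is \<open>curv\<close> of a C^2 defining function, which
  involves derivatives of order at most two. On the compact boundary, continuity and positivity will
  bound 1/H.\<close>

lemma mean_curvature_continuous: "continuous_on (frontier \<Omega>) (mean_curvature A g \<Omega>)"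
proof -
  have "\<exists>U. open U \<and> p \<in> U \<and> continuous_on (frontier \<Omega> \<inter> U) (mean_curvature A g \<Omega>)" if p: "p \<in> frontier \<Omega>" for p
  proof -
    have "p \<in> closure \<Omega>" using p by (simp add: frontier_def)
    then obtain c V r N z Q \<Theta> where s: "straightened c V r N z Q \<Theta>" "p \<in> cinv c ` N"
      using straightened_exists by blast
    have c: "c \<in> A" and V: "defining c V r" and st: "straightening N r z Q \<Theta>" and NV: "N \<subseteq> V"
      using s(1) by (simp_all add: straightened_def)
    interpret straightening N r z Q \<Theta> by (rule st)
    have Nc: "N \<subseteq> cmap c ` cdom c" using V NV unfolding defining_def by blast
    interpret L: local_metric N "g c"
      by (rule local_metric.local_metric_subset[OF local_metric[OF c] open_N Nc])
    have r2: "Ck_on (Suc (Suc 0)) N r" using r_C2 by (simp only: numeral_2_eq_2)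
    note r1 = Ck_on_Suc_imp[OF r2]
    have q: "grad_ip (g c) r r x > 0" if "x \<in> N" for x
      by (rule grad_ip_posdef[of "g c", OF L.G_posdef[OF that]]) (use rz[OF that] in \<open>auto simp: vec_eq_iff\<close>)
    have gc: "continuous_on N (\<lambda>x. gradient (g c) r x $ i)" for i by (rule Ck_on_continuous[OF L.gradient_Ck[OF r1]])
    have hc: "continuous_on N (\<lambda>x. hessian (g c) r x $ i $ j)" for i j by (rule Ck_on_continuous[OF L.hessian_Ck[OF r2]])
    have qc: "continuous_on N (grad_ip (g c) r r)" by (rule Ck_on_continuous[OF L.grad_ip_Ck[OF r1 r1]])
    have "continuous_on N (\<lambda>x. gradient (g c) r x \<bullet> (hessian (g c) r x *v gradient (g c) r x))"
      unfolding inner_matrix_sum by (intro continuous_on_sum continuous_on_mult gc hc)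
    then have "continuous_on N (curv (g c) r)"
      unfolding curv_def
      by (intro continuous_on_divide continuous_on_diff continuous_on_real_sqrt qc Ck_on_continuous[OF L.lap_Ck[OF r2]])
         (use q in \<open>fastforce\<close>)+
    then have cc: "continuous_on (cinv c ` N) (\<lambda>q. curv (g c) r (cmap c q))"
      by (rule continuous_on_compose2[OF _ continuous_on_subset[OF cmap_continuous[OF c]]])
         (use Nc cmap_cinv[OF c] cinv_in[OF c] in \<open>auto simp: subset_iff\<close>)
    have "curv (g c) r (cmap c q) = mean_curvature A g \<Omega> q" if q: "q \<in> frontier \<Omega> \<inter> cinv c ` N" for q
    proof -
      obtain x where x: "x \<in> N" "q = cinv c x" using q by blast
      have "cinv c x \<in> frontier \<Omega>" "x \<in> V" using q x NV by auto
      then have "r x = 0" using V unfolding defining_def by blast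
      note ld = defining_at[OF c V st NV x(1) this]
      show ?thesis using mean_curvature_eq[OF c ld(1)] x(2) by simp
    qed
    moreover have "continuous_on (frontier \<Omega> \<inter> cinv c ` N) (\<lambda>q. curv (g c) r (cmap c q))"
      by (rule continuous_on_subset[OF cc]) blast
    ultimately have "continuous_on (frontier \<Omega> \<inter> cinv c ` N) (mean_curvature A g \<Omega>)"
      by (rule continuous_on_eq[rotated])
    then show ?thesis using s(2) cinv_open[OF c open_N Nc] by blast
  qed
  then obtain U where U: "\<And>p. p \<in> frontier \<Omega> \<Longrightarrow> open (U p) \<and> p \<in> U p \<and> continuous_on (frontier \<Omega> \<inter> U p) (mean_curvature A g \<Omega>)"
    by metis
  show ?thesis
    unfolding continuous_on_eq_continuous_within
  proof
    fix p assume p: "p \<in> frontier \<Omega>"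
    have "continuous (at p within (frontier \<Omega> \<inter> U p)) (mean_curvature A g \<Omega>)"
      using U[OF p] p by (simp add: continuous_on_eq_continuous_within)
    moreover have "at p within (frontier \<Omega> \<inter> U p) = at p within frontier \<Omega>"
      by (rule at_within_nhd[of _ "U p"]) (use U[OF p] in auto)
    ultimately show "continuous (at p within frontier \<Omega>) (mean_curvature A g \<Omega>)" by simp
  qed
qed

end

locale dirichlet_problem = riemannian_domain A g \<Omega>
  for A :: "('a::{t2_space,second_countable_topology}, 'n::finite) chart set" and g :: "('a, 'n) tensor2" and \<Omega> :: "'a set" +
  fixes u :: "'a \<Rightarrow> real" and f f' :: "real \<Rightarrow> real"
  assumes u3: "Ck_open 3 A \<Omega> u" and u2: "Ck_closure 2 A \<Omega> u" and pos: "\<And>p. p \<in> \<Omega> \<Longrightarrow> u p > 0"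
    and pde: "\<And>p. p \<in> \<Omega> \<Longrightarrow> laplacian A g u p = - f (u p)" and dirichlet: "\<And>p. p \<in> frontier \<Omega> \<Longrightarrow> u p = 0"
    and f': "\<And>t. (f has_real_derivative f' t) (at t)" and f'_cont: "continuous_on UNIV f'"
begin

abbreviation uc :: "('a, 'n) chart \<Rightarrow> real^'n \<Rightarrow> real" where "uc c \<equiv> u \<circ> cinv c"

text \<open>The continuous extensions to the boundary of the first and second derivatives of \<open>u\<close>, and below of its
  gradient and covariant Hessian, in the chart \<open>c\<close>.\<close>

definition jet :: "('a, 'n) chart \<Rightarrow> ('n \<Rightarrow> real^'n \<Rightarrow> real) \<Rightarrow> ('n \<Rightarrow> 'n \<Rightarrow> real^'n \<Rightarrow> real) \<Rightarrow> bool" where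
  "jet c h hh \<longleftrightarrow> (\<forall>j. continuous_on (Cc c) (h j)) \<and> (\<forall>j. \<forall>x\<in>Co c. pd j (uc c) x = h j x)
     \<and> (\<forall>i j. continuous_on (Cc c) (hh i j)) \<and> (\<forall>i j. \<forall>x\<in>Co c. pd i (pd j (uc c)) x = hh i j x)"

definition jV :: "('a, 'n) chart \<Rightarrow> ('n \<Rightarrow> real^'n \<Rightarrow> real) \<Rightarrow> real^'n \<Rightarrow> real^'n" where
  "jV c h x = matrix_inv (g c x) *v (\<chi> j. h j x)"

definition jK :: "('a, 'n) chart \<Rightarrow> ('n \<Rightarrow> real^'n \<Rightarrow> real) \<Rightarrow> ('n \<Rightarrow> 'n \<Rightarrow> real^'n \<Rightarrow> real) \<Rightarrow> real^'n \<Rightarrow> real^'n^'n" where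
  "jK c h hh x = (\<chi> i j. hh i j x - (\<Sum>k\<in>UNIV. christoffel (g c) k i j x * h k x))"

lemma f_cont: "continuous_on X f"
  by (rule continuous_at_imp_continuous_on) (use DERIV_isCont[OF f'] in blast)

lemma jet_exists:
  assumes c: "c \<in> A" shows "\<exists>h hh. jet c h hh"
proof -
  have "Ck_upto (Suc (Suc 0)) (Co c) (Cc c) (uc c)"
    using u2 c by (simp only: Ck_closure_def numeral_2_eq_2)
  then have "\<forall>i. \<exists>h. continuous_on (Cc c) h \<and> (\<forall>x\<in>Co c. h x = pd i (uc c) x)"
    and "\<forall>i. \<forall>j. \<exists>h. continuous_on (Cc c) h \<and> (\<forall>x\<in>Co c. h x = pd j (pd i (uc c)) x)"
    unfolding Ck_upto.simps by blast+
  then obtain h hh where H: "\<And>i. continuous_on (Cc c) (h i) \<and> (\<forall>x\<in>Co c. h i x = pd i (uc c) x)"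
    and HH: "\<And>i j. continuous_on (Cc c) (hh i j) \<and> (\<forall>x\<in>Co c. hh i j x = pd j (pd i (uc c)) x)" by metis
  then have "jet c h (\<lambda>i j. hh j i)" 
    unfolding jet_def using H HH by (intro conjI allI ballI) (simp_all only:)
  then show ?thesis by blast
qed

lemma uc_Ck: "c \<in> A \<Longrightarrow> Ck_on 3 (Co c) (uc c)"
  using u3 by (simp add: Ck_open_def)

lemma u_Ck2: "Ck_open 2 A \<Omega> u"
  by (rule Ck_open_le[OF u3]) simp

lemma uc_Ck2: "c \<in> A \<Longrightarrow> Ck_on 2 (Co c) (uc c)"
  by (rule Ck_on_le[OF uc_Ck]) auto

lemma uc_cont:
  assumes "c \<in> A" shows "continuous_on (Cc c) (uc c)"
proof -
  have "continuous_on (closure \<Omega>) u" using u2 by (simp add: Ck_closure_def)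
  then have "continuous_on (Cc c) (\<lambda>x. u (cinv c x))"
    by (rule continuous_on_compose2[OF _ continuous_on_subset[OF cinv_continuous[OF assms]]])
       (use cinv_cmap[OF assms] in auto)
  then show ?thesis by (simp add: comp_def)
qed

lemma Cc_sub: "Cc c \<subseteq> cmap c ` cdom c" by blast

context
  fixes c h hh assumes c: "c \<in> A" and j: "jet c h hh"
begin

interpretation L: local_metric "cmap c ` cdom c" "g c" by (rule local_metric[OF c])

lemma jet_cont: "continuous_on (Cc c) (h k)" "continuous_on (Cc c) (hh k l)"
  using j by (simp_all add: jet_def)

lemma jet_eq: "x \<in> Co c \<Longrightarrow> pd k (uc c) x = h k x" "x \<in> Co c \<Longrightarrow> pd k (pd l (uc c)) x = hh k l x"
  using j unfolding jet_def by blast+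

lemma jV_eq: "x \<in> Co c \<Longrightarrow> gradient (g c) (uc c) x = jV c h x"
  by (simp add: gradient_def jV_def jet_eq)

lemma jK_eq: "x \<in> Co c \<Longrightarrow> hessian (g c) (uc c) x = jK c h hh x"
  by (simp add: hessian_def jK_def jet_eq)

lemma metric_cont: "continuous_on (Cc c) (\<lambda>x. L.gi x k l)" "continuous_on (Cc c) (christoffel (g c) m k l)"
    "continuous_on (Cc c) (\<lambda>x. ricci (g c) x $ k $ l)"
  by (rule continuous_on_subset[OF Ck_on_continuous[OF L.gi_Ck[of 0]] Cc_sub]
      continuous_on_subset[OF Ck_on_continuous[OF L.christoffel_Ck[of 0]] Cc_sub]
      continuous_on_subset[OF Ck_on_continuous[OF L.ricci_Ck[of 0]] Cc_sub])+

lemma jV_nth: "jV c h x $ k = (\<Sum>l\<in>UNIV. L.gi x k l * h l x)"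
  by (simp add: jV_def matrix_vector_mult_def)

lemma jV_cont: "continuous_on (Cc c) (\<lambda>x. jV c h x $ k)"
  unfolding jV_nth by (intro continuous_on_sum continuous_on_mult metric_cont jet_cont)

lemma jK_cont: "continuous_on (Cc c) (\<lambda>x. jK c h hh x $ k $ l)"
  unfolding jK_def vec_lambda_beta
  by (intro continuous_on_diff continuous_on_sum continuous_on_mult metric_cont jet_cont)

lemma grad_norm_sq_chart: "x \<in> Co c \<Longrightarrow> grad_norm_sq A g u (cinv c x) = grad_ip (g c) (uc c) (uc c) x"
  unfolding grad_norm_sq_gip
proof -
  assume x: "x \<in> Co c"
  then obtain p where p: "p \<in> cdom c" "p \<in> \<Omega>" "x = cmap c p" by blast
  have "Ck_open 1 A \<Omega> u" by (rule Ck_open_le[OF u3]) simp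
  from gip_chart[OF c p(1) open_\<Omega> p(2) this this] show "gip u u (cinv c x) = grad_ip (g c) (uc c) (uc c) x"
    using p cinv_cmap[OF c p(1)] by simp
qed

lemma grad_norm_sq_jet: "x \<in> Co c \<Longrightarrow> grad_norm_sq A g u (cinv c x) = (\<Sum>k\<in>UNIV. jV c h x $ k * h k x)"
  by (simp add: grad_norm_sq_chart grad_ip_def jV_eq jet_eq)

end

text \<open>\<open>\<partial>u/\<partial>\<eta> = -|\<nabla>u|\<close>, expressed through the limit of \<open>|\<nabla>u|\<^sup>2\<close> at the boundary so as to be independent of charts.\<close>

definition u\<nu> :: "'a \<Rightarrow> real" where
  "u\<nu> p = - sqrt (Lim (at p within \<Omega>) (grad_norm_sq A g u))"

text \<open>Vanishing of \<open>u\<close> on the boundary forces du = l dr, and positivity inside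
  gives l \<le> 0. The full trace of the extended Hessian is -f(0), by passing to the limit in the
  equation. Its tangential part is l times that of \<open>r\<close>, which is
  \<open>u\<nu> p\<close> times the mean curvature, and the difference is the normal part.\<close>

lemma boundary_jet:
  assumes c: "c \<in> A" and j: "jet c h hh" and ld: "local_defining_fun c \<Omega> p r"
  defines "x \<equiv> cmap c p"
  shows "\<exists>l. (\<forall>k. h k x = l * pd k r x) \<and> u\<nu> p = l * sqrt (grad_ip (g c) r r x)
     \<and> gradient (g c) r x \<bullet> (jK c h hh x *v gradient (g c) r x)
        = grad_ip (g c) r r x * (- f 0 - u\<nu> p * mean_curvature A g \<Omega> p)"
proof -
  let ?q = "grad_ip (g c) r r x" and ?v = "gradient (g c) r x" and ?K = "jK c h hh x"
  have p: "p \<in> cdom c" "p \<in> frontier \<Omega>" using ld by (auto simp: local_defining_iff)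
  have pcl: "p \<in> cdom c \<inter> closure \<Omega>" using p by (auto simp: frontier_def)
  have cp: "cinv c x = p" using cinv_cmap[OF c p(1)] by (simp add: x_def)
  interpret L: local_metric "cmap c ` cdom c" "g c" by (rule local_metric[OF c])
  have q: "?q > 0" by (rule defining_grad_pos[OF c ld, folded x_def])
  obtain V N z Q \<Theta> where V: "defining c V r" and st: "straightening N r z Q \<Theta>" and xN: "cmap c p \<in> N" and NV: "N \<subseteq> V"
    by (rule defining_straightening[OF c ld])
  interpret straightening N r z Q \<Theta> by (rule st)
  have x: "x \<in> N" "r x = 0" using xN V NV p(2) cp unfolding x_def[symmetric] defining_def by auto
  have ng: "y \<in> Co c" if "y \<in> N" "r y < 0" for y using defining_sides(1)[OF c V, of y] that NV by blast
  have np: "{y \<in> N. r y \<le> 0} \<subseteq> Cc c" using defining_sides(2)[OF c V] NV by blast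
  note uC = uc_Ck2[OF c]
  have A1: "continuous_on {y \<in> N. r y \<le> 0} (uc c)" by (rule continuous_on_subset[OF uc_cont[OF c] np])
  have A2: "uc c differentiable (at y)" if "y \<in> N" "r y < 0" for y
    by (rule Ck_on_differentiable[OF uC _ ng[OF that]]) simp
  have A3: "continuous_on {y \<in> N. r y \<le> 0} (h k)" for k by (rule continuous_on_subset[OF jet_cont(1)[OF c j] np])
  have A4: "pd k (uc c) y = h k y" if "y \<in> N" "r y < 0" for y k by (rule jet_eq(1)[OF c j ng[OF that]])
  have A5: "h k differentiable (at y)" if "y \<in> N" "r y < 0" for y k
  proof -
    have "pd k (uc c) differentiable (at y)"
      by (rule Ck_on_differentiable[OF Ck_on_pd[OF uC, of 1] _ ng[OF that]]) simp_all
    moreover have "pd k (uc c) differentiable (at y) \<longleftrightarrow> h k differentiable (at y)"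
      by (rule differentiable_cong_open[OF Co_open[OF c] ng[OF that]]) (rule jet_eq(1)[OF c j])
    ultimately show ?thesis by simp
  qed
  have A6: "continuous_on {y \<in> N. r y \<le> 0} (hh k l)" for k l by (rule continuous_on_subset[OF jet_cont(2)[OF c j] np])
  have A7: "pd k (h l) y = hh k l y" if "y \<in> N" "r y < 0" for y k l
  proof -
    have "pd k (pd l (uc c)) y = pd k (h l) y"
      by (rule pd_cong[OF Co_open[OF c] ng[OF that]]) (rule jet_eq(1)[OF c j])
    then show ?thesis using jet_eq(2)[OF c j ng[OF that]] by simp
  qed
  have A8: "uc c y = 0" if y: "y \<in> N" "r y = 0" for y
  proof -
    have "cinv c y \<in> frontier \<Omega>" using V NV y unfolding defining_def by blast
    then show ?thesis using dirichlet by simp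
  qed
  have A9: "uc c y > 0" if y: "y \<in> N" "r y < 0" for y
    using pos cinv_in[OF c ng[OF y]] by auto
  define l where "l = h z x / pd z r x"
  have hl: "h k x = l * pd k r x" for k
    unfolding l_def by (rule dirichlet_gradient[of "uc c" h, OF A1 A2 A3 A4 A8 x])
  have l0: "l \<le> 0" unfolding l_def by (rule normal_slope_nonpos[of "uc c" h, OF A1 A2 A3 A4 A9 A8[OF x] x])
  have Vl: "jV c h x $ k = l * ?v $ k" for k
    unfolding jV_nth[OF c j] L.gradient_nth hl by (simp add: sum_distrib_left mult_ac)
  have "(grad_norm_sq A g u \<longlongrightarrow> (\<Sum>k\<in>UNIV. jV c h x $ k * h k x)) (at p within \<Omega>)"
    unfolding x_def
  proof (rule boundary_limit[OF c p, of "\<lambda>x. \<Sum>k\<in>UNIV. jV c h x $ k * h k x"])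
    show "continuous_on (Cc c) (\<lambda>x. \<Sum>k\<in>UNIV. jV c h x $ k * h k x)"
      by (intro continuous_on_sum continuous_on_mult jV_cont[OF c j] jet_cont(1)[OF c j])
    show "grad_norm_sq A g u q = (\<Sum>k\<in>UNIV. jV c h (cmap c q) $ k * h k (cmap c q))" if "q \<in> cdom c \<inter> \<Omega>" for q
      using grad_norm_sq_jet[OF c j, of "cmap c q"] that cinv_cmap[OF c, of q] by simp
  qed
  then have "Lim (at p within \<Omega>) (grad_norm_sq A g u) = (\<Sum>k\<in>UNIV. jV c h x $ k * h k x)"
    by (rule tendsto_Lim[OF frontier_nontrivial[OF p(2)]])
  also have "\<dots> = l\<^sup>2 * ?q"
    unfolding Vl hl grad_ip_def by (simp add: sum_distrib_left power2_eq_square mult_ac)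
  finally have \<nu>: "u\<nu> p = l * sqrt ?q" using l0 by (simp add: u\<nu>_def real_sqrt_mult)
  have tr: "trace (matrix_inv (g c x) ** ?K) = - f 0"
  proof (rule tendsto_unique[OF frontier_nontrivial[OF p(2)]])
    have tre: "trace (matrix_inv (g c y) ** jK c h hh y) = (\<Sum>k\<in>UNIV. \<Sum>l\<in>UNIV. L.gi y k l * jK c h hh y $ l $ k)" for y
      by (simp add: trace_def matrix_matrix_mult_def)
    show "(laplacian A g u \<longlongrightarrow> trace (matrix_inv (g c x) ** ?K)) (at p within \<Omega>)"
      unfolding x_def
    proof (rule boundary_limit[OF c p, of "\<lambda>y. trace (matrix_inv (g c y) ** jK c h hh y)"])
      show "continuous_on (Cc c) (\<lambda>y. trace (matrix_inv (g c y) ** jK c h hh y))"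
        unfolding tre by (intro continuous_on_sum continuous_on_mult metric_cont(1)[OF c j] jK_cont[OF c j])
      fix q assume q: "q \<in> cdom c \<inter> \<Omega>"
      then show "laplacian A g u q = trace (matrix_inv (g c (cmap c q)) ** jK c h hh (cmap c q))"
        using lap_chart[OF c _ open_\<Omega> _ u_Ck2, of q] jK_eq[OF c j, of "cmap c q"] by (simp add: lap_def)
    qed
    have "(laplacian A g u \<longlongrightarrow> - f (uc c (cmap c p))) (at p within \<Omega>)"
    proof (rule boundary_limit[OF c p, of "\<lambda>y. - f (uc c y)"])
      show "continuous_on (Cc c) (\<lambda>y. - f (uc c y))"
        by (intro continuous_on_minus continuous_on_compose2[OF f_cont uc_cont[OF c]]) auto
      show "laplacian A g u q = - f (uc c (cmap c q))" if "q \<in> cdom c \<inter> \<Omega>" for q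
        using pde that cinv_cmap[OF c, of q] by simp
    qed
    then show "(laplacian A g u \<longlongrightarrow> - f 0) (at p within \<Omega>)"
      using dirichlet[OF p(2)] cinv_cmap[OF c p(1)] by simp
  qed
  obtain B where B: "orthonormal_basis_of (g c (cmap c p)) (boundary_tangent_space g \<Omega> c p) B"
    using tangent_basis_exists[OF c p(1)] by blast
  \<comment> \<open>The Christoffel terms involve first derivatives only and so carry the same
    factor \<open>l\<close>; hence the relation between second derivatives passes to the covariant
    Hessians.\<close>
  have eK: "e \<bullet> (?K *v e) = l * (e \<bullet> (hessian (g c) r x *v e))" if e: "e \<in> B" for e
  proof -
    have "dcov r (cmap c p) \<bullet> e = 0" by (rule curv_orthonormal(3)[OF c ld B e])
    then have e0: "(\<Sum>i\<in>UNIV. e $ i * pd i r x) = 0" by (simp add: x_def inner_vec_def mult.commute)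
    have dh: "(\<Sum>i\<in>UNIV. \<Sum>j\<in>UNIV. e $ i * hh i j x * e $ j) = l * (\<Sum>i\<in>UNIV. \<Sum>j\<in>UNIV. e $ i * pd i (pd j r) x * e $ j)"
      unfolding l_def by (rule dirichlet_hessian[of "uc c" h hh, OF A1 A2 A3 A4 A5 A6 A7 A8 x e0])
    have "e \<bullet> (?K *v e) = (\<Sum>i\<in>UNIV. \<Sum>j\<in>UNIV. e $ i * hh i j x * e $ j)
      - (\<Sum>i\<in>UNIV. \<Sum>j\<in>UNIV. e $ i * (\<Sum>k\<in>UNIV. christoffel (g c) k i j x * h k x) * e $ j)"
      unfolding inner_matrix_sum jK_def by (simp add: algebra_simps sum_subtractf)
    also have "(\<Sum>i\<in>UNIV. \<Sum>j\<in>UNIV. e $ i * (\<Sum>k\<in>UNIV. christoffel (g c) k i j x * h k x) * e $ j)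
      = l * (\<Sum>i\<in>UNIV. \<Sum>j\<in>UNIV. e $ i * (\<Sum>k\<in>UNIV. christoffel (g c) k i j x * pd k r x) * e $ j)"
      unfolding hl by (simp add: sum_distrib_left sum_distrib_right mult_ac)
    finally have "e \<bullet> (?K *v e) = l * ((\<Sum>i\<in>UNIV. \<Sum>j\<in>UNIV. e $ i * pd i (pd j r) x * e $ j)
       - (\<Sum>i\<in>UNIV. \<Sum>j\<in>UNIV. e $ i * (\<Sum>k\<in>UNIV. christoffel (g c) k i j x * pd k r x) * e $ j))"
      unfolding dh by (simp only: right_diff_distrib)
    then show ?thesis
      unfolding inner_matrix_sum hessian_def by (simp add: algebra_simps sum_subtractf)
  qed
  have "(\<Sum>e\<in>B. e \<bullet> (?K *v e)) = l * (\<Sum>e\<in>B. e \<bullet> (hessian (g c) r x *v e))"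
    unfolding sum_distrib_left by (rule sum.cong[OF refl eK])
  also have "(\<Sum>e\<in>B. e \<bullet> (hessian (g c) r x *v e)) = mean_curvature A g \<Omega> p * sqrt ?q"
    using curv_tangent_trace[OF c ld B] mean_curvature_eq[OF c ld] q by (simp add: x_def)
  finally have "u\<nu> p * mean_curvature A g \<Omega> p = - f 0 - (1 / sqrt ?q * (1 / sqrt ?q)) * (?v \<bullet> (?K *v ?v))"
    using tangent_trace[OF c ld B, of ?K] tr \<nu> unfolding x_def[symmetric] outward_normal_eq[OF c ld]
    by (simp add: matrix_vector_mult_scaleR)
  moreover have "1 / sqrt ?q * (1 / sqrt ?q) = 1 / ?q" using q by simp
  ultimately have "?v \<bullet> (?K *v ?v) = ?q * (- f 0 - u\<nu> p * mean_curvature A g \<Omega> p)"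
    using q by (simp add: field_simps)
  then show ?thesis using hl \<nu> by blast
qed

end

section \<open>Integrability on the domain, and the Laplacians of F(u) and |\<nabla>u|^2\<close>

lemma set_integrable_bounded_continuous:
  fixes b :: "'a::topological_space \<Rightarrow> real"
  assumes M: "sets M = sets borel" and S: "S \<in> sets borel" "emeasure M S < \<infinity>"
    and b: "continuous_on S b" "\<And>p. p \<in> S \<Longrightarrow> \<bar>b p\<bar> \<le> B"
  shows "set_integrable M S b"
proof -
  have "(\<lambda>p. indicator S p *\<^sub>R b p) \<in> borel_measurable M"
    unfolding measurable_cong_sets[OF M refl] by (rule borel_measurable_continuous_on_indicator[OF S(1) b(1)])
  then have "integrable M (\<lambda>p. indicator S p *\<^sub>R (indicator S p *\<^sub>R b p))"
    by (intro integrableI_bounded_set_indicator[where B = B]) (use S M b(2) in auto)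
  moreover have "(\<lambda>p. indicator S p *\<^sub>R (indicator S p *\<^sub>R b p)) = (\<lambda>p. indicator S p *\<^sub>R b p)"
    by (auto simp: fun_eq_iff indicator_def)
  ultimately show ?thesis by (simp only: set_integrable_def)
qed

context local_metric
begin

lemma lap_compose:
  assumes a: "Ck_on 2 S a" and F: "\<And>t. (F has_real_derivative f t) (at t)" "\<And>t. (f has_real_derivative f' t) (at t)" and x: "x \<in> S"
  shows "lap G (\<lambda>x. F (a x)) x = f (a x) * lap G a x + f' (a x) * grad_ip G a a x"
proof -
  have ad: "a differentiable (at y)" if "y \<in> S" for y by (rule Ck_on_differentiable[OF a _ that]) simp
  have pdd: "pd j a differentiable (at x)" for j
    by (rule Ck_on_differentiable[OF Ck_on_pd[OF a, of 1] _ x]) simp_all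
  have p1: "pd j (\<lambda>x. F (a x)) y = f (a y) * pd j a y" if "y \<in> S" for y j
    by (rule pd_chain(1)[OF F(1) ad[OF that]])
  have p2: "pd i (pd j (\<lambda>x. F (a x))) x = f' (a x) * (pd i a x * pd j a x) + f (a x) * pd i (pd j a) x" for i j
  proof -
    have "pd i (pd j (\<lambda>x. F (a x))) x = pd i (\<lambda>y. f (a y) * pd j a y) x" by (rule pd_cong[OF open_S x p1])
    also have "\<dots> = pd i (\<lambda>y. f (a y)) x * pd j a x + f (a x) * pd i (pd j a) x"
      by (rule pd_mult[OF pd_chain(2)[OF F(2) ad[OF x]] pdd])
    finally show ?thesis by (simp add: pd_chain(1)[OF F(2) ad[OF x]])
  qed
  have h: "hessian G (\<lambda>x. F (a x)) x $ i $ j = f (a x) * hessian G a x $ i $ j + f' (a x) * (pd i a x * pd j a x)" for i j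
    unfolding hessian_nth p1[OF x] p2 by (simp add: right_diff_distrib sum_distrib_left mult_ac)
  have "lap G (\<lambda>x. F (a x)) x = f (a x) * lap G a x + f' (a x) * (\<Sum>i\<in>UNIV. \<Sum>l\<in>UNIV. gi x i l * (pd l a x * pd i a x))"
    unfolding lap_sum h by (simp add: distrib_left sum.distrib sum_distrib_left mult_ac)
  also have "(\<Sum>i\<in>UNIV. \<Sum>l\<in>UNIV. gi x i l * (pd l a x * pd i a x)) = grad_ip G a a x"
    unfolding grad_ip_def gradient_nth by (simp add: sum_distrib_right mult.assoc)
  finally show ?thesis .
qed

lemma gradient_norm: "x \<in> S \<Longrightarrow> gradient G a x \<bullet> (G x *v gradient G a x) = grad_ip G a a x"
proof -
  assume x: "x \<in> S"
  have "G x *v gradient G a x = (\<chi> i. pd i a x)"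
    by (simp add: vec_eq_iff matrix_vector_mult_def G_gradient[OF x])
  then show ?thesis by (simp add: grad_ip_inner)
qed

end

context riemannian_domain
begin

text \<open>Continuous extendability up to the boundary, tested separately in each chart; with
  compactness of the closure it yields boundedness and integrability.\<close>

definition extends :: "('a \<Rightarrow> real) \<Rightarrow> bool" where
  "extends b \<longleftrightarrow> (\<forall>c\<in>A. \<exists>\<phi>. continuous_on (Cc c) \<phi> \<and> (\<forall>x\<in>Co c. b (cinv c x) = \<phi> x))"

lemma extends_mult:
  assumes "extends a" "extends b" shows "extends (\<lambda>p. a p * b p)"
  unfolding extends_def
proof
  fix c assume "c \<in> A"
  then obtain \<phi> \<psi> where "continuous_on (Cc c) \<phi>" "\<forall>x\<in>Co c. a (cinv c x) = \<phi> x" "continuous_on (Cc c) \<psi>" "\<forall>x\<in>Co c. b (cinv c x) = \<psi> x"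
    using assms unfolding extends_def by blast
  then show "\<exists>\<phi>. continuous_on (Cc c) \<phi> \<and> (\<forall>x\<in>Co c. a (cinv c x) * b (cinv c x) = \<phi> x)"
    by (intro exI[of _ "\<lambda>x. \<phi> x * \<psi> x"] conjI continuous_on_mult) auto
qed

lemma extends_chart:
  assumes b: "extends b" and c: "c \<in> A"
  obtains h where "continuous_on (cdom c \<inter> closure \<Omega>) h" "\<And>q. q \<in> cdom c \<inter> \<Omega> \<Longrightarrow> b q = h q"
proof -
  obtain \<phi> where \<phi>: "continuous_on (Cc c) \<phi>" "\<forall>x\<in>Co c. b (cinv c x) = \<phi> x" using b c unfolding extends_def by blast
  have "continuous_on (cdom c \<inter> closure \<Omega>) (\<lambda>q. \<phi> (cmap c q))"
    by (rule continuous_on_compose2[OF \<phi>(1) continuous_on_subset[OF cmap_continuous[OF c]]]) auto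
  moreover have "b q = \<phi> (cmap c q)" if "q \<in> cdom c \<inter> \<Omega>" for q
    using \<phi>(2) that cinv_cmap[OF c, of q] by force
  ultimately show thesis by (rule that)
qed

lemma extends_bounded:
  assumes b: "extends b" shows "\<exists>B. \<forall>q\<in>\<Omega>. \<bar>b q\<bar> \<le> B"
proof -
  have "\<exists>U B. open U \<and> p \<in> U \<and> (\<forall>q\<in>U \<inter> \<Omega>. \<bar>b q\<bar> \<le> B)" if p: "p \<in> closure \<Omega>" for p
  proof -
    obtain c where c: "c \<in> A" "p \<in> cdom c" using ex_chart by blast
    obtain h where h: "continuous_on (cdom c \<inter> closure \<Omega>) h" "\<And>q. q \<in> cdom c \<inter> \<Omega> \<Longrightarrow> b q = h q"
      using extends_chart[OF b c(1)] by blast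
    let ?D = "cdom c \<inter> closure \<Omega>"
    obtain T where T: "open T" "T \<inter> ?D = h -` ball (h p) 1 \<inter> ?D"
      using h(1)[unfolded continuous_on_open_invariant, rule_format, OF open_ball] by blast
    have "p \<in> h -` ball (h p) 1 \<inter> ?D" using p c(2) by simp
    then have pT: "p \<in> T" using T(2) by blast
    have "\<bar>b q\<bar> \<le> \<bar>h p\<bar> + 1" if q: "q \<in> (T \<inter> cdom c) \<inter> \<Omega>" for q
    proof -
      have "q \<in> T \<inter> ?D" using q closure_subset by blast
      then have "dist (h p) (h q) < 1" using T(2) by auto
      moreover have "b q = h q" using h(2) q by blast
      ultimately show ?thesis by (simp add: dist_real_def)
    qed
    then show ?thesis using T(1) pT c(2) cdom_open[OF c(1)]
      by (intro exI[of _ "T \<inter> cdom c"] exI[of _ "\<bar>h p\<bar> + 1"]) auto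
  qed
  then obtain U B where UB: "\<And>p. p \<in> closure \<Omega> \<Longrightarrow> open (U p) \<and> p \<in> U p \<and> (\<forall>q\<in>U p \<inter> \<Omega>. \<bar>b q\<bar> \<le> B p)" by metis
  have cov: "closure \<Omega> \<subseteq> (\<Union>p\<in>closure \<Omega>. U p)" using UB by blast
  obtain I where I: "I \<subseteq> closure \<Omega>" "finite I" "closure \<Omega> \<subseteq> (\<Union>p\<in>I. U p)"
    by (rule compactE_image[OF compact_closure _ cov]) (use UB in blast)
  have "\<bar>b q\<bar> \<le> (\<Sum>p\<in>I. \<bar>B p\<bar>)" if q: "q \<in> \<Omega>" for q
  proof -
    obtain p where p: "p \<in> I" "q \<in> U p" using I(3) q closure_subset by blast
    then have "\<bar>b q\<bar> \<le> B p" using UB[of p] I(1) q by blast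
    also have "\<dots> \<le> \<bar>B p\<bar>" by simp
    also have "\<dots> \<le> (\<Sum>p\<in>I. \<bar>B p\<bar>)" by (rule member_le_sum[OF p(1) _ I(2)]) simp
    finally show ?thesis .
  qed
  then show ?thesis by blast
qed

lemma extends_integrable:
  assumes b: "extends b" shows "set_integrable vol \<Omega> b"
proof -
  obtain B where B: "\<And>q. q \<in> \<Omega> \<Longrightarrow> \<bar>b q\<bar> \<le> B" using extends_bounded[OF b] by blast
  have "continuous_on (cdom c \<inter> \<Omega>) b" if c: "c \<in> A" for c
  proof -
    obtain h where h: "continuous_on (cdom c \<inter> closure \<Omega>) h" "\<And>q. q \<in> cdom c \<inter> \<Omega> \<Longrightarrow> b q = h q"
      using extends_chart[OF b c] by blast
    have "continuous_on (cdom c \<inter> \<Omega>) h" by (rule continuous_on_subset[OF h(1)]) (use closure_subset in blast)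
    then show ?thesis by (rule continuous_on_eq) (simp add: h(2))
  qed
  then have "continuous_on (\<Union>c\<in>A. cdom c \<inter> \<Omega>) b"
    by (intro continuous_on_open_UN) (use cdom_open open_\<Omega> in blast)+
  moreover have "(\<Union>c\<in>A. cdom c \<inter> \<Omega>) = \<Omega>" using ex_chart by blast
  ultimately have cb: "continuous_on \<Omega> b" by simp
  have s: "sets vol = sets borel" using volume_on_volume_measure by (simp add: volume_on_def)
  have "emeasure vol \<Omega> \<le> emeasure vol (closure \<Omega>)" by (rule emeasure_mono[OF closure_subset]) (simp add: s)
  then have fin: "emeasure vol \<Omega> < \<infinity>" using closure_finite by (rule order_le_less_trans)
  show ?thesis by (rule set_integrable_bounded_continuous[OF s _ fin cb B]) (simp add: open_\<Omega>)
qed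

end

context dirichlet_problem
begin

abbreviation (input) "gns \<equiv> grad_norm_sq A g u"

lemma extends_u: "continuous_on UNIV k \<Longrightarrow> extends (\<lambda>p. k (u p))"
  unfolding extends_def
proof
  fix c assume k: "continuous_on UNIV k" and c: "c \<in> A"
  have "continuous_on (Cc c) (\<lambda>x. k (uc c x))" by (rule continuous_on_compose2[OF k uc_cont[OF c]]) simp
  then show "\<exists>\<phi>. continuous_on (Cc c) \<phi> \<and> (\<forall>x\<in>Co c. k (u (cinv c x)) = \<phi> x)"
    by (intro exI[of _ "\<lambda>x. k (uc c x)"]) simp
qed

lemma extends_gns: "extends gns"
  unfolding extends_def
proof
  fix c assume c: "c \<in> A"
  obtain h hh where j: "jet c h hh" using jet_exists[OF c] by blast
  show "\<exists>\<phi>. continuous_on (Cc c) \<phi> \<and> (\<forall>x\<in>Co c. gns (cinv c x) = \<phi> x)"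
    by (rule exI[of _ "\<lambda>x. \<Sum>k\<in>UNIV. jV c h x $ k * h k x"])
       (intro conjI ballI grad_norm_sq_jet[OF c j] continuous_on_sum continuous_on_mult jV_cont[OF c j] jet_cont(1)[OF c j])
qed

lemma Ck_open_chain:
  assumes F: "\<And>t. (F has_real_derivative f t) (at t)"
  shows "Ck_open 2 A \<Omega> (\<lambda>p. F (u p))"
  unfolding Ck_open_def
proof
  fix c assume c: "c \<in> A"
  have u2': "Ck_on (Suc (Suc 0)) (Co c) (uc c)" using uc_Ck2[OF c] by (simp only: numeral_2_eq_2)
  have "Ck_on 0 (Co c) (\<lambda>x. f' (uc c x))"
    using continuous_on_compose2[OF f'_cont Ck_on_continuous[OF u2']] by simp
  then have "Ck_on (Suc 0) (Co c) (\<lambda>x. f (uc c x))"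
    by (rule Ck_on_chain[OF Co_open[OF c] f' Ck_on_Suc_imp[OF u2']])
  then have "Ck_on (Suc (Suc 0)) (Co c) (\<lambda>x. F (uc c x))"
    by (rule Ck_on_chain[OF Co_open[OF c] F u2'])
  then show "Ck_on 2 (Co c) ((\<lambda>p. F (u p)) \<circ> cinv c)" by (simp only: numeral_2_eq_2 comp_def)
qed

lemma laplacian_chain:
  assumes F: "\<And>t. (F has_real_derivative f t) (at t)" and p: "p \<in> \<Omega>"
  shows "laplacian A g (\<lambda>p. F (u p)) p = f' (u p) * gns p - f (u p) * f (u p)"
proof -
  obtain c where c: "c \<in> A" "p \<in> cdom c" using ex_chart by blast
  let ?x = "cmap c p"
  have x: "?x \<in> Co c" using c p by blast
  interpret local_metric "Co c" "g c" by (rule local_metric_on[OF c(1)]) (use cdom_open[OF c(1)] open_\<Omega> in auto)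
  have "laplacian A g (\<lambda>p. F (u p)) p = lap (g c) (\<lambda>x. F (uc c x)) ?x"
    using lap_chart[OF c open_\<Omega> p Ck_open_chain[OF F]] by (simp only: comp_def)
  also have "\<dots> = f (uc c ?x) * lap (g c) (uc c) ?x + f' (uc c ?x) * grad_ip (g c) (uc c) (uc c) ?x"
    by (rule lap_compose[OF uc_Ck2[OF c(1)] F f' x])
  also have "lap (g c) (uc c) ?x = - f (u p)" using lap_chart[OF c open_\<Omega> p u_Ck2] pde[OF p] by simp
  finally have E: "laplacian A g (\<lambda>p. F (u p)) p = f (uc c ?x) * - f (u p) + f' (uc c ?x) * grad_ip (g c) (uc c) (uc c) ?x" .
  obtain h hh where j: "jet c h hh" using jet_exists[OF c(1)] by blast
  have G: "gns p = grad_ip (g c) (uc c) (uc c) ?x" and U: "uc c ?x = u p"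
    using grad_norm_sq_chart[OF c(1) j x] cinv_cmap[OF c] by simp_all
  show ?thesis unfolding E G U by linarith
qed

text \<open>The differential of F(u) extends as \<phi>(u) du, and u = 0 on the boundary. The case
  \<phi> = 1 gives the data of \<open>u\<close> itself, the case \<phi> = \<open>f\<close> those of
  a primitive of \<open>f\<close> composed with \<open>u\<close>.\<close>

lemma normal_data_chain:
  assumes F: "\<And>t. (F has_real_derivative \<phi> t) (at t)" and \<phi>: "continuous_on UNIV \<phi>"
  shows "normal_data (\<lambda>p. F (u p)) (\<lambda>p. \<phi> 0 * u\<nu> p)"
  unfolding normal_data_def
proof
  fix c assume c: "c \<in> A"
  obtain h hh where j: "jet c h hh" using jet_exists[OF c] by blast
  have "normal_extension (\<lambda>p. F (u p)) (\<lambda>p. \<phi> 0 * u\<nu> p) c (\<lambda>k x. \<phi> (uc c x) * h k x)"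
    unfolding normal_extension_def
  proof (intro conjI allI ballI impI)
    fix k show "continuous_on (Cc c) (\<lambda>x. \<phi> (uc c x) * h k x)"
      by (intro continuous_on_mult jet_cont(1)[OF c j] continuous_on_compose2[OF \<phi> uc_cont[OF c]]) simp
  next
    fix k x assume x: "x \<in> Co c"
    have "uc c differentiable (at x)" by (rule Ck_on_differentiable[OF uc_Ck2[OF c] _ x]) simp
    from pd_chain(1)[OF F this, of k] show "pd k ((\<lambda>p. F (u p)) \<circ> cinv c) x = \<phi> (uc c x) * h k x"
      using jet_eq(1)[OF c j x, of k] by (simp add: comp_def)
  next
    fix p r assume ld: "local_defining_fun c \<Omega> p r"
    let ?x = "cmap c p"
    have p: "p \<in> cdom c" "p \<in> frontier \<Omega>" using ld by (auto simp: local_defining_iff)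
    obtain l where l: "\<And>k. h k ?x = l * pd k r ?x" "u\<nu> p = l * sqrt (grad_ip (g c) r r ?x)"
      using boundary_jet[OF c j ld] by blast
    have q: "grad_ip (g c) r r ?x > 0" by (rule defining_grad_pos[OF c ld])
    have "(\<Sum>k\<in>UNIV. gradient (g c) r ?x $ k * (\<phi> (uc c ?x) * h k ?x)) = \<phi> (uc c ?x) * l * grad_ip (g c) r r ?x"
      unfolding l(1) grad_ip_def by (simp add: sum_distrib_left mult_ac)
    moreover have "uc c ?x = 0" using dirichlet[OF p(2)] cinv_cmap[OF c p(1)] by simp
    ultimately show "\<phi> 0 * u\<nu> p * sqrt (grad_ip (g c) r r ?x) = (\<Sum>k\<in>UNIV. gradient (g c) r ?x $ k * (\<phi> (uc c ?x) * h k ?x))"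
      using q l(2) by simp
  qed
  then show "\<exists>h. normal_extension (\<lambda>p. F (u p)) (\<lambda>p. \<phi> 0 * u\<nu> p) c h" by blast
qed

text \<open>One order is lost: C^3 inside yields the C^2 regularity that Bochner's formula and the
  divergence theorem ask of |\<nabla>u|^2.\<close>

lemma gns_Ck: "Ck_open 2 A \<Omega> gns"
  unfolding Ck_open_def
proof
  fix c assume c: "c \<in> A"
  obtain h hh where j: "jet c h hh" using jet_exists[OF c] by blast
  interpret local_metric "Co c" "g c" by (rule local_metric_on[OF c]) (use cdom_open[OF c] open_\<Omega> in auto)
  have "Ck_on (Suc 2) (Co c) (uc c)" using uc_Ck[OF c] by (simp only: eval_nat_numeral)
  from grad_ip_Ck[OF this this] show "Ck_on 2 (Co c) (gns \<circ> cinv c)"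
    by (rule Ck_on_cong[OF Co_open[OF c], rotated]) (simp add: grad_norm_sq_chart[OF c j])
qed

context
  fixes c h hh assumes c: "c \<in> A" and j: "jet c h hh"
begin

interpretation local_metric "Co c" "g c"
  by (rule local_metric_on[OF c]) (use cdom_open[OF c] open_\<Omega> in auto)

text \<open>Bochner's formula with the equation inserted; \<Delta>u = -f(u) holds on an open set, so
  its gradient may be taken.\<close>

lemma gns_laplacian:
  assumes x: "x \<in> Co c"
  defines "D \<equiv> \<lambda>l i x. \<Sum>k\<in>UNIV. gi x i k * hessian (g c) (uc c) x $ l $ k"
  shows "laplacian A g gns (cinv c x) = 2 * ((\<Sum>i\<in>UNIV. \<Sum>l\<in>UNIV. D i l x * D l i x)
     + gradient (g c) (uc c) x \<bullet> (ricci (g c) x *v gradient (g c) (uc c) x) - f' (uc c x) * gns (cinv c x))"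
proof -
  obtain p where p: "p \<in> cdom c" "p \<in> \<Omega>" "x = cmap c p" using x by blast
  have px: "cinv c x = p" using p cinv_cmap[OF c p(1)] by simp
  have "laplacian A g gns (cinv c x) = lap (g c) (gns \<circ> cinv c) x"
    using lap_chart[OF c p(1) open_\<Omega> p(2) gns_Ck] p(3) px by simp
  also have "\<dots> = lap (g c) (grad_ip (g c) (uc c) (uc c)) x"
    by (rule lap_cong[OF Co_open[OF c] x]) (simp add: grad_norm_sq_chart[OF c j])
  also have "\<dots> = 2 * ((\<Sum>i\<in>UNIV. \<Sum>l\<in>UNIV. D i l x * D l i x)
     + gradient (g c) (uc c) x \<bullet> (ricci (g c) x *v gradient (g c) (uc c) x) + grad_ip (g c) (uc c) (lap (g c) (uc c)) x)"
    unfolding D_def by (rule bochner[OF uc_Ck[OF c] x])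
  also have "grad_ip (g c) (uc c) (lap (g c) (uc c)) x = grad_ip (g c) (uc c) (\<lambda>y. - f (uc c y)) x"
  proof (rule grad_ip_cong[OF Co_open[OF c] x refl])
    fix y assume "y \<in> Co c"
    then obtain q where q: "q \<in> cdom c" "q \<in> \<Omega>" "y = cmap c q" by blast
    show "lap (g c) (uc c) y = - f (uc c y)"
      using lap_chart[OF c q(1) open_\<Omega> q(2) u_Ck2] pde[OF q(2)] q(3) cinv_cmap[OF c q(1)] by simp
  qed
  also have "\<dots> = - f' (uc c x) * grad_ip (g c) (uc c) (uc c) x"
  proof -
    have "uc c differentiable (at x)" by (rule Ck_on_differentiable[OF uc_Ck2[OF c] _ x]) simp
    from pd_chain(1)[OF DERIV_minus[OF f'] this] have "pd i (\<lambda>y. - f (uc c y)) x = - f' (uc c x) * pd i (uc c) x" for i .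
    then show ?thesis by (simp add: grad_ip_def sum_distrib_left mult_ac sum_negf)
  qed
  finally show ?thesis unfolding grad_norm_sq_chart[OF c j x] by (simp only: mult_minus_left diff_conv_add_uminus)
qed

text \<open>Combines the trace inequality for the Hessian with the curvature bound at the vector X =
  \<nabla>u.\<close>

lemma gns_laplacian_ge:
  assumes x: "x \<in> Co c" and ric: "ricci_bounded_below A g \<Omega> \<kappa>"
  shows "laplacian A g gns (cinv c x) \<ge> 2 * ((f (uc c x))\<^sup>2 / real CARD('n) + (\<kappa> - f' (uc c x)) * gns (cinv c x))"
proof -
  obtain p where p: "p \<in> cdom c" "p \<in> \<Omega>" "x = cmap c p" using x by blast
  define D where "D = (\<lambda>l i x. \<Sum>k\<in>UNIV. gi x i k * hessian (g c) (uc c) x $ l $ k)"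
  have "lap (g c) (uc c) x = - f (uc c x)"
    using lap_chart[OF c p(1) open_\<Omega> p(2) u_Ck2] pde[OF p(2)] p(3) cinv_cmap[OF c p(1)] by simp
  then have "(f (uc c x))\<^sup>2 \<le> real CARD('n) * (\<Sum>i\<in>UNIV. \<Sum>l\<in>UNIV. D i l x * D l i x)"
    using lap_square_le[OF uc_Ck2[OF c] x] unfolding D_def by (simp only: power2_minus)
  then have "(f (uc c x))\<^sup>2 / real CARD('n) \<le> (\<Sum>i\<in>UNIV. \<Sum>l\<in>UNIV. D i l x * D l i x)"
    by (simp add: pos_divide_le_eq mult.commute)
  moreover have "gradient (g c) (uc c) x \<bullet> (ricci (g c) x *v gradient (g c) (uc c) x) \<ge> \<kappa> * gns (cinv c x)"
  proof -
    have "p \<in> \<Omega> \<inter> cdom c" using p by blast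
    note ric[unfolded ricci_bounded_below_def, rule_format, OF c this, of "gradient (g c) (uc c) x"]
    then show ?thesis unfolding p(3)[symmetric] gradient_norm[OF x] grad_norm_sq_chart[OF c j x] .
  qed
  moreover have "laplacian A g gns (cinv c x) = 2 * ((\<Sum>i\<in>UNIV. \<Sum>l\<in>UNIV. D i l x * D l i x)
     + gradient (g c) (uc c) x \<bullet> (ricci (g c) x *v gradient (g c) (uc c) x) - f' (uc c x) * gns (cinv c x))"
    unfolding D_def by (rule gns_laplacian[OF x])
  ultimately show ?thesis by (simp add: left_diff_distrib)
qed

text \<open>Third derivatives enter Bochner's formula only through the gradient of \<Delta>u, which
  the equation replaces by -f'(u) \<nabla>u. The rest has order at most two and extends
  continuously, so the Laplacian of |\<nabla>u|^2 is bounded.\<close>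

lemma gns_laplacian_extension:
  "\<exists>\<phi>. continuous_on (Cc c) \<phi> \<and> (\<forall>x\<in>Co c. laplacian A g gns (cinv c x) = \<phi> x)"
proof -
  define D where "D = (\<lambda>l i x. \<Sum>k\<in>UNIV. gi x i k * jK c h hh x $ l $ k)"
  define \<phi> where "\<phi> x = 2 * ((\<Sum>i\<in>UNIV. \<Sum>l\<in>UNIV. D i l x * D l i x) + jV c h x \<bullet> (ricci (g c) x *v jV c h x)
     - f' (uc c x) * (\<Sum>k\<in>UNIV. jV c h x $ k * h k x))" for x
  have "continuous_on (Cc c) \<phi>"
    unfolding \<phi>_def D_def inner_matrix_sum
    by (intro continuous_on_mult continuous_on_diff continuous_on_add continuous_on_sum continuous_on_const
         metric_cont[OF c j] jK_cont[OF c j] jV_cont[OF c j] jet_cont(1)[OF c j]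
         continuous_on_compose2[OF f'_cont uc_cont[OF c]] subset_UNIV)
  moreover have "laplacian A g gns (cinv c x) = \<phi> x" if x: "x \<in> Co c" for x
    unfolding gns_laplacian[OF x] \<phi>_def D_def grad_norm_sq_jet[OF c j x] jV_eq[OF c j x] jK_eq[OF c j x] ..
  ultimately show ?thesis by blast
qed

text \<open>The differential of |\<nabla>u|^2 is 2 Hess u applied to \<nabla>u and extends through
  the jet. On the boundary \<nabla>u = l \<nabla>r, so its normal component is given by the normal
  Hessian found in \<open>boundary_jet\<close>.\<close>

lemma gns_normal_extension:
  "normal_extension gns (\<lambda>p. - 2 * u\<nu> p * (f 0 + u\<nu> p * mean_curvature A g \<Omega> p)) c (\<lambda>k x. 2 * (jK c h hh x *v jV c h x) $ k)"
  unfolding normal_extension_def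
proof (intro conjI allI ballI impI)
  fix k show "continuous_on (Cc c) (\<lambda>x. 2 * (jK c h hh x *v jV c h x) $ k)"
    unfolding matrix_vector_mult_def vec_lambda_beta
    by (intro continuous_on_mult continuous_on_sum continuous_on_const jK_cont[OF c j] jV_cont[OF c j])
next
  fix k x assume x: "x \<in> Co c"
  have "pd k (gns \<circ> cinv c) x = pd k (grad_ip (g c) (uc c) (uc c)) x"
    by (rule pd_cong[OF Co_open[OF c] x]) (simp add: grad_norm_sq_chart[OF c j])
  then show "pd k (gns \<circ> cinv c) x = 2 * (jK c h hh x *v jV c h x) $ k"
    by (simp add: pd_grad_ip[OF uc_Ck2[OF c] uc_Ck2[OF c] x] matrix_vector_mult_def jV_eq[OF c j x] jK_eq[OF c j x])
next
  fix p r assume ld: "local_defining_fun c \<Omega> p r"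
  let ?x = "cmap c p"
  let ?q = "grad_ip (g c) r r ?x" and ?v = "gradient (g c) r ?x"
  have p: "p \<in> cdom c" "p \<in> frontier \<Omega>" using ld by (auto simp: local_defining_iff)
  obtain l where l: "\<And>k. h k ?x = l * pd k r ?x" "u\<nu> p = l * sqrt ?q"
    "?v \<bullet> (jK c h hh ?x *v ?v) = ?q * (- f 0 - u\<nu> p * mean_curvature A g \<Omega> p)"
    using boundary_jet[OF c j ld] by blast
  have q: "?q > 0" by (rule defining_grad_pos[OF c ld])
  have "(\<chi> k. h k ?x) = l *\<^sub>R dcov r ?x" by (simp add: vec_eq_iff l(1))
  then have V: "jV c h ?x = l *\<^sub>R ?v" by (simp add: jV_def gradient_def matrix_vector_mult_scaleR)
  have "(\<Sum>k\<in>UNIV. ?v $ k * (2 * (jK c h hh ?x *v jV c h ?x) $ k)) = 2 * l * (?v \<bullet> (jK c h hh ?x *v ?v))"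
    unfolding V by (simp add: inner_vec_def matrix_vector_mult_scaleR sum_distrib_left mult_ac)
  also have "\<dots> = - 2 * u\<nu> p * (f 0 + u\<nu> p * mean_curvature A g \<Omega> p) * sqrt ?q"
  proof -
    have "?q = sqrt ?q * sqrt ?q" using q by simp
    then have "l * ?q = u\<nu> p * sqrt ?q" unfolding l(2) by (simp only: mult.assoc)
    then have "l * (?q * (- f 0 - u\<nu> p * mean_curvature A g \<Omega> p)) = u\<nu> p * sqrt ?q * (- f 0 - u\<nu> p * mean_curvature A g \<Omega> p)"
      by (simp only: mult.assoc[symmetric])
    then show ?thesis unfolding l(3) by (simp add: algebra_simps)
  qed
  finally show "- 2 * u\<nu> p * (f 0 + u\<nu> p * mean_curvature A g \<Omega> p) * sqrt ?q
    = (\<Sum>k\<in>UNIV. ?v $ k * (2 * (jK c h hh ?x *v jV c h ?x) $ k))" by simp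
qed

end

lemma normal_data_u: "normal_data u u\<nu>"
  using normal_data_chain[OF DERIV_ident continuous_on_const] by simp

end

text \<open>Discriminant argument, giving Cauchy-Schwarz for integrals: t = -b/c minimizes the
  quadratic, and for c = 0 an affine function bounded below has slope 0.\<close>

lemma square_le_of_quadratic_nonneg:
  fixes a b c :: real
  assumes "\<And>t. a + 2 * t * b + t\<^sup>2 * c \<ge> 0" "c \<ge> 0"
  shows "b\<^sup>2 \<le> c * a"
proof (cases "c = 0")
  case True
  have "b = 0"
  proof (rule ccontr)
    assume "b \<noteq> 0"
    \<comment> \<open>At this value of t the affine expression equals -1.\<close>
    then show False using assms(1)[of "- (a + 1) / (2 * b)"] True by (simp add: field_simps)
  qed
  then show ?thesis using True by simp
next
  case False
  then have "a - b\<^sup>2 / c \<ge> 0" using assms(1)[of "- b / c"] by (simp add: power2_eq_square field_simps)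
  then show ?thesis using False assms(2) by (simp add: field_simps)
qed

context dirichlet_problem
begin

text \<open>\<open>J\<close> stands for the boundary integral of H N^2. The existential form exports
  exactly what the final elementary argument uses: nonnegativity, the Cauchy-Schwarz bound and the
  upper bound.\<close>

lemma reilly_estimate:
  fixes k :: real
  assumes dim: "CARD('n) \<ge> 2" "CARD('m::finite) = CARD('n) - 1"
    and ric: "ricci_bounded_below A g \<Omega> ((real CARD('n) - 1) * k)"
    and H: "\<And>p. p \<in> frontier \<Omega> \<Longrightarrow> mean_curvature A g \<Omega> p > 0"
  defines "\<mu> \<equiv> riemannian_measure TYPE('m) A g (frontier \<Omega>)" and "H \<equiv> mean_curvature A g \<Omega>"
  shows "\<exists>J\<ge>0. (LINT p:\<Omega>|vol. f (u p))\<^sup>2 \<le> (LINT p:frontier \<Omega>|\<mu>. 1 / H p) * J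
     \<and> J \<le> (real CARD('n) - 1) / real CARD('n) * (energy A g \<Omega> k f u + f 0 * (LINT p:\<Omega>|vol. f (u p)))"
    and "(LINT p:frontier \<Omega>|\<mu>. 1 / H p) \<ge> 0"
proof -
  let ?n = "real CARD('n)"
  define G where "G = (LINT p:\<Omega>|vol. gns p)"
  define P where "P = (LINT p:\<Omega>|vol. f' (u p) * gns p)"
  define A0 where "A0 = (LINT p:\<Omega>|vol. f (u p))"
  define A2 where "A2 = (LINT p:\<Omega>|vol. f (u p) * f (u p))"
  have iG: "set_integrable vol \<Omega> gns" by (rule extends_integrable[OF extends_gns])
  have iP: "set_integrable vol \<Omega> (\<lambda>p. f' (u p) * gns p)"
    by (rule extends_integrable[OF extends_mult[OF extends_u[OF f'_cont] extends_gns]])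
  have iA2: "set_integrable vol \<Omega> (\<lambda>p. f (u p) * f (u p))"
    by (rule extends_integrable[OF extends_mult[OF extends_u extends_u]]) (rule f_cont)+
  have Pn: "?n > 0" using dim by simp
  have \<Omega>_s: "\<Omega> \<in> sets vol" using volume_on_volume_measure open_\<Omega> by (simp add: volume_on_def)
  have E: "energy A g \<Omega> k f u = P - ?n * k * G"
  proof -
    have "deriv f t = f' t" for t by (rule DERIV_imp_deriv[OF f'])
    then have "energy A g \<Omega> k f u = (LINT p:\<Omega>|vol. f' (u p) * gns p - (?n * k) * gns p)"
      by (simp add: energy_def left_diff_distrib)
    also have "\<dots> = P - (LINT p:\<Omega>|vol. (?n * k) * gns p)"
      unfolding P_def by (rule set_integral_diff(2)[OF iP set_integrable_mult_right[OF iG]])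
    finally show ?thesis by (simp only: set_integral_mult_right G_def)
  qed
  obtain B1 where B1: "\<And>p. p \<in> \<Omega> \<Longrightarrow> \<bar>f (u p)\<bar> \<le> B1"
    using extends_bounded[OF extends_u[OF f_cont]] by blast
  have "\<bar>laplacian A g u p\<bar> \<le> B1" if "p \<in> \<Omega>" for p using B1[OF that] pde[OF that] by simp
  then have i\<nu>: "set_integrable \<mu> (frontier \<Omega>) u\<nu>"
    and d1: "(LINT p:\<Omega>|vol. laplacian A g u p) = (LINT p:frontier \<Omega>|\<mu>. u\<nu> p)"
    unfolding \<mu>_def using divergence_theorem(2,3)[OF dim(2) u_Ck2 _ normal_data_u] by blast+
  have nu: "(LINT p:frontier \<Omega>|\<mu>. u\<nu> p) = - A0"
  proof -
    have "(LINT p:frontier \<Omega>|\<mu>. u\<nu> p) = (LINT p:\<Omega>|vol. laplacian A g u p)" by (rule d1[symmetric])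
    also have "\<dots> = (LINT p:\<Omega>|vol. (-1) * f (u p))" by (rule set_lebesgue_integral_cong[OF \<Omega>_s]) (simp add: pde)
    finally show ?thesis by (simp only: set_integral_mult_right A0_def)
  qed
  obtain F where F: "\<And>t. (F has_real_derivative f t) (at t)"
  proof -
    have "isCont f x" for x by (rule DERIV_isCont[OF f'])
    then obtain F where "\<And>x. (F has_vector_derivative f x) (at x)"
      using einterval_antiderivative[of "-\<infinity>" \<infinity> f] by auto
    then show thesis by (intro that) (simp add: has_real_derivative_iff_has_vector_derivative)
  qed
  have eF: "extends (\<lambda>p. f' (u p) * gns p)" by (rule extends_mult[OF extends_u[OF f'_cont] extends_gns])
  obtain B2 where B2: "\<And>p. p \<in> \<Omega> \<Longrightarrow> \<bar>f' (u p) * gns p\<bar> \<le> B2" using extends_bounded[OF eF] by blast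
  have "\<bar>laplacian A g (\<lambda>p. F (u p)) p\<bar> \<le> B2 + B1 * B1" if p: "p \<in> \<Omega>" for p
  proof -
    have "\<bar>f (u p) * f (u p)\<bar> \<le> B1 * B1" unfolding abs_mult by (rule mult_mono) (use B1[OF p] in auto)
    then show ?thesis unfolding laplacian_chain[OF F p] using B2[OF p] by linarith
  qed
  then have d2: "(LINT p:\<Omega>|vol. laplacian A g (\<lambda>p. F (u p)) p) = (LINT p:frontier \<Omega>|\<mu>. f 0 * u\<nu> p)"
    unfolding \<mu>_def by (rule divergence_theorem(3)[OF dim(2) Ck_open_chain[OF F] _ normal_data_chain[OF F f_cont]])
  have A2: "A2 = P + f 0 * A0"
  proof -
    have "P - A2 = (LINT p:\<Omega>|vol. f' (u p) * gns p - f (u p) * f (u p))"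
      unfolding P_def A2_def by (rule set_integral_diff(2)[OF iP iA2, symmetric])
    also have "\<dots> = (LINT p:\<Omega>|vol. laplacian A g (\<lambda>p. F (u p)) p)"
      by (rule set_lebesgue_integral_cong[OF \<Omega>_s]) (simp add: laplacian_chain[OF F])
    also have "\<dots> = f 0 * (LINT p:frontier \<Omega>|\<mu>. u\<nu> p)" unfolding d2 by (rule set_integral_mult_right)
    finally show ?thesis by (simp add: nu)
  qed
  have ew: "extends (laplacian A g gns)"
    unfolding extends_def using gns_laplacian_extension jet_exists by blast
  obtain B3 where "\<And>p. p \<in> \<Omega> \<Longrightarrow> \<bar>laplacian A g gns p\<bar> \<le> B3" using extends_bounded[OF ew] by blast
  moreover have "normal_data gns (\<lambda>p. - 2 * u\<nu> p * (f 0 + u\<nu> p * H p))"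
    unfolding normal_data_def H_def using gns_normal_extension jet_exists by blast
  ultimately have d3: "set_integrable vol \<Omega> (laplacian A g gns)" "set_integrable \<mu> (frontier \<Omega>) (\<lambda>p. - 2 * u\<nu> p * (f 0 + u\<nu> p * H p))"
    "(LINT p:\<Omega>|vol. laplacian A g gns p) = (LINT p:frontier \<Omega>|\<mu>. - 2 * u\<nu> p * (f 0 + u\<nu> p * H p))"
    using divergence_theorem[OF dim(2) gns_Ck, folded \<mu>_def] by blast+
  define J where "J = (LINT p:frontier \<Omega>|\<mu>. H p * (u\<nu> p)\<^sup>2)"
  \<comment> \<open>H N^2 is recovered from two functions whose integrability the divergence theorem
    provides.\<close>
  have Jeq: "H p * (u\<nu> p)\<^sup>2 = (-1/2) * (- 2 * u\<nu> p * (f 0 + u\<nu> p * H p)) - f 0 * u\<nu> p" for p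
    by (simp add: power2_eq_square algebra_simps)
  have iJ: "set_integrable \<mu> (frontier \<Omega>) (\<lambda>p. H p * (u\<nu> p)\<^sup>2)"
    unfolding Jeq by (rule set_integral_diff(1)[OF set_integrable_mult_right[OF d3(2)] set_integrable_mult_right[OF i\<nu>]])
  have "J = (-1/2) * (LINT p:\<Omega>|vol. laplacian A g gns p) - f 0 * (LINT p:frontier \<Omega>|\<mu>. u\<nu> p)"
    unfolding J_def Jeq d3(3)
    by (subst set_integral_diff(2)[OF set_integrable_mult_right[OF d3(2)] set_integrable_mult_right[OF i\<nu>]]) (simp only: set_integral_mult_right)
  then have J: "(LINT p:\<Omega>|vol. laplacian A g gns p) = 2 * (f 0 * A0 - J)" unfolding nu by simp
  have "(LINT p:\<Omega>|vol. laplacian A g gns p) \<ge> (LINT p:\<Omega>|vol. (2 / ?n) * (f (u p) * f (u p)) + (2 * ((?n - 1) * k)) * gns p - 2 * (f' (u p) * gns p))"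
  proof (rule set_integral_mono[OF _ d3(1)])
    show "set_integrable vol \<Omega> (\<lambda>p. (2 / ?n) * (f (u p) * f (u p)) + (2 * ((?n - 1) * k)) * gns p - 2 * (f' (u p) * gns p))"
      by (intro set_integral_diff(1) set_integral_add(1) set_integrable_mult_right iA2 iG iP)
    fix p assume p: "p \<in> \<Omega>"
    obtain c where c: "c \<in> A" "p \<in> cdom c" using ex_chart by blast
    obtain h hh where j: "jet c h hh" using jet_exists[OF c(1)] by blast
    have x: "cmap c p \<in> Co c" using c p by blast
    show "(2 / ?n) * (f (u p) * f (u p)) + (2 * ((?n - 1) * k)) * gns p - 2 * (f' (u p) * gns p) \<le> laplacian A g gns p"
      using gns_laplacian_ge[OF c(1) j x ric] cinv_cmap[OF c] by (simp add: power2_eq_square algebra_simps)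
  qed
  also have "(LINT p:\<Omega>|vol. (2 / ?n) * (f (u p) * f (u p)) + (2 * ((?n - 1) * k)) * gns p - 2 * (f' (u p) * gns p))
    = (2 / ?n) * A2 + (2 * ((?n - 1) * k)) * G - 2 * P"
    by (subst set_integral_diff(2), (intro set_integral_add(1) set_integrable_mult_right iA2 iG iP)+,
        subst set_integral_add(2), (intro set_integrable_mult_right iA2 iG)+)
       (simp only: set_integral_mult_right A2_def G_def P_def)
  finally have "(2 / ?n) * A2 + (2 * ((?n - 1) * k)) * G - 2 * P \<le> 2 * (f 0 * A0 - J)" unfolding J .
  then have "J \<le> f 0 * A0 - A2 / ?n - (?n - 1) * k * G + P" by simp
  \<comment> \<open>After A2 = P + f(0) A0 is inserted, P and f(0) A0 both have the coefficient 1 -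
    1/n, and (n-1) k G is the same factor times n k G; with E = P - n k G it can be taken
    out.\<close>
  also have "\<dots> = (?n - 1) / ?n * (energy A g \<Omega> k f u + f 0 * A0)"
    unfolding E A2 using Pn by (simp add: field_simps)
  finally have Jle: "J \<le> (?n - 1) / ?n * (energy A g \<Omega> k f u + f 0 * A0)" .
  have Hp: "H p > 0" if "p \<in> frontier \<Omega>" for p using H[OF that] by (simp add: H_def)
  have iI: "set_integrable \<mu> (frontier \<Omega>) (\<lambda>p. 1 / H p)"
  proof -
    have s: "sets \<mu> = sets borel" using volume_on_frontier[OF dim(2)] by (simp add: volume_on_def \<mu>_def)
    have c: "continuous_on (frontier \<Omega>) (\<lambda>p. 1 / H p)"
      using mean_curvature_continuous Hp unfolding H_def by (intro continuous_on_divide continuous_on_const) fastforce+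
    obtain B where "\<And>p. p \<in> frontier \<Omega> \<Longrightarrow> \<bar>1 / H p\<bar> \<le> B"
      using compact_imp_bounded[OF compact_continuous_image[OF c frontier_compact]] unfolding bounded_real by auto
    then show ?thesis
      by (rule set_integrable_bounded_continuous[OF s frontier_borel frontier_finite[OF dim(2), folded \<mu>_def] c])
  qed
  have nonneg: "0 \<le> (LINT p:frontier \<Omega>|\<mu>. b p)" if "\<And>p. p \<in> frontier \<Omega> \<Longrightarrow> b p \<ge> 0" for b :: "'a \<Rightarrow> real"
    unfolding set_lebesgue_integral_def by (rule Bochner_Integration.integral_nonneg) (use that in \<open>simp add: indicator_def\<close>)
  have J0: "J \<ge> 0" unfolding J_def by (rule nonneg) (simp add: Hp less_imp_le)
  show I0: "(LINT p:frontier \<Omega>|\<mu>. 1 / H p) \<ge> 0" by (rule nonneg) (simp add: Hp less_imp_le)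
  have "J + 2 * t * (LINT p:frontier \<Omega>|\<mu>. u\<nu> p) + t\<^sup>2 * (LINT p:frontier \<Omega>|\<mu>. 1 / H p) \<ge> 0" for t
  proof -
    \<comment> \<open>The integrand is (H N + t)^2 / H, whose integral is a quadratic polynomial in
      t with leading coefficient \<integral>1/H.\<close>
    have "0 \<le> (LINT p:frontier \<Omega>|\<mu>. H p * (u\<nu> p)\<^sup>2 + (2 * t) * u\<nu> p + t\<^sup>2 * (1 / H p))"
    proof (rule nonneg)
      fix p assume "p \<in> frontier \<Omega>"
      then have "H p * (u\<nu> p)\<^sup>2 + (2 * t) * u\<nu> p + t\<^sup>2 * (1 / H p) = (H p * u\<nu> p + t)\<^sup>2 / H p"
        using Hp[of p] by (simp add: power2_eq_square field_simps)
      then show "0 \<le> H p * (u\<nu> p)\<^sup>2 + (2 * t) * u\<nu> p + t\<^sup>2 * (1 / H p)"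
        using Hp[OF \<open>p \<in> frontier \<Omega>\<close>] by simp
    qed
    also have "\<dots> = J + 2 * t * (LINT p:frontier \<Omega>|\<mu>. u\<nu> p) + t\<^sup>2 * (LINT p:frontier \<Omega>|\<mu>. 1 / H p)"
      by (subst set_integral_add(2), (intro set_integral_add(1) set_integrable_mult_right iJ i\<nu> iI)+,
          subst set_integral_add(2), (intro set_integrable_mult_right iJ i\<nu>)+)
         (simp only: set_integral_mult_right J_def)
    finally show ?thesis .
  qed
  from square_le_of_quadratic_nonneg[OF this I0]
  have "A0\<^sup>2 \<le> (LINT p:frontier \<Omega>|\<mu>. 1 / H p) * J" unfolding nu by simp
  then show "\<exists>J\<ge>0. (LINT p:\<Omega>|vol. f (u p))\<^sup>2 \<le> (LINT p:frontier \<Omega>|\<mu>. 1 / H p) * J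
     \<and> J \<le> (real CARD('n) - 1) / real CARD('n) * (energy A g \<Omega> k f u + f 0 * (LINT p:\<Omega>|vol. f (u p)))"
    using J0 Jle unfolding A0_def by blast
qed

end

theorem corollary5p3:
  fixes A :: "('a::{t2_space,second_countable_topology}, 'n::finite) chart set"
    and g :: "('a, 'n) tensor2"
    and \<Omega> :: "'a set"
    and k :: real
    and f :: "real \<Rightarrow> real"
    and u :: "'a \<Rightarrow> real"
  assumes dim: "CARD('n) \<ge> 2" "CARD('m::finite) = CARD('n) - 1"
    and manifold: "connected (UNIV :: 'a set)" "smooth_atlas A" "riemannian_metric A g"
    and domain: "open \<Omega>" "connected \<Omega>" "\<Omega> \<noteq> {}" "compact (closure \<Omega>)" "C2_boundary A \<Omega>"
    and f: "f C1_differentiable_on UNIV"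
    and u_regular: "Ck_open 3 A \<Omega> u" "Ck_closure 2 A \<Omega> u"
    and u_pos: "\<forall>p\<in>\<Omega>. u p > 0"
    and pde: "\<forall>p\<in>\<Omega>. laplacian A g u p = - f (u p)"
    and dirichlet: "\<forall>p\<in>frontier \<Omega>. u p = 0"
    and ricci: "ricci_bounded_below A g \<Omega> ((real CARD('n) - 1) * k)"
    and mean_convex: "\<forall>p\<in>frontier \<Omega>. mean_curvature A g \<Omega> p > 0"
    and energy_nonpos: "energy A g \<Omega> k f u \<le> 0"
  shows "(real CARD('n) - 1) / real CARD('n) * (f 0)\<^sup>2
           * (LINT p:frontier \<Omega>|riemannian_measure TYPE('m) A g (frontier \<Omega>). 1 / mean_curvature A g \<Omega> p)
         \<ge> f 0 * (LINT p:\<Omega>|volume_measure A g. f (u p))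
     \<and> (energy A g \<Omega> k f u < 0 \<longrightarrow>
         (real CARD('n) - 1) / real CARD('n) * (f 0)\<^sup>2
           * (LINT p:frontier \<Omega>|riemannian_measure TYPE('m) A g (frontier \<Omega>). 1 / mean_curvature A g \<Omega> p)
         > f 0 * (LINT p:\<Omega>|volume_measure A g. f (u p)))"
proof -
  obtain f' where f': "\<And>t. (f has_real_derivative f' t) (at t)" "continuous_on UNIV f'"
    using f unfolding C1_differentiable_on_def has_real_derivative_iff_has_vector_derivative by blast
  interpret dirichlet_problem A g \<Omega> u f f'
    by unfold_locales (use manifold domain u_regular u_pos pde dirichlet f' in auto)
  define c where "c = (real CARD('n) - 1) / real CARD('n)"
  define I where "I = (LINT p:frontier \<Omega>|riemannian_measure TYPE('m) A g (frontier \<Omega>). 1 / mean_curvature A g \<Omega> p)"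
  define A0 where "A0 = (LINT p:\<Omega>|volume_measure A g. f (u p))"
  define E where "E = energy A g \<Omega> k f u"
  define Y where "Y = f 0 * A0"
  define R where "R = c * (f 0)\<^sup>2 * I"
  have c: "c > 0" using dim(1) by (simp add: c_def)
  note est = reilly_estimate[OF dim ricci bspec[OF mean_convex], folded c_def I_def A0_def E_def Y_def]
  obtain J where J: "J \<ge> 0" "A0\<^sup>2 \<le> I * J" "J \<le> c * (E + Y)" using est(1) by blast
  have I: "I \<ge> 0" by (rule est(2))
  have R: "R \<ge> 0" using c I by (simp add: R_def)
  have E: "E \<le> 0" using energy_nonpos by (simp add: E_def)
  \<comment> \<open>If E + Y were negative, the nonnegative \<open>J\<close> would lie below a
    negative number.\<close>
  have EY: "0 \<le> E + Y" using J(1,3) c by (meson order_trans zero_le_mult_iff not_le)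
  have "Y\<^sup>2 = (f 0)\<^sup>2 * A0\<^sup>2" by (simp add: Y_def power_mult_distrib)
  also have "\<dots> \<le> (f 0)\<^sup>2 * (I * (c * (E + Y)))"
    using J(2) mult_left_mono[OF J(3) I] by (intro mult_left_mono) auto
  finally have Y2: "Y * Y \<le> R * (E + Y)" by (simp add: R_def power2_eq_square mult_ac)
  have "Y \<le> R"
  proof (cases "Y = 0")
    case False
    then have "Y > 0" using E EY by simp
    \<comment> \<open>E \<le> 0 is used in the form E + Y \<le> Y.\<close>
    moreover have "Y * Y \<le> R * Y" using Y2 mult_left_mono[OF _ R, of "E + Y" Y] E by simp
    ultimately show ?thesis by simp
  qed (simp add: R)
  moreover have "Y < R" if "E < 0"
  proof -
    have Y: "Y > 0" using that EY by simp
    \<comment> \<open>R = 0 would force Y^2 \<le> 0. With R > 0 the strict inequality E + Y < Y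
      survives multiplication by R.\<close>
    then have "R > 0" using Y2 R by (cases "R = 0") (auto simp: mult_le_0_iff)
    then have "R * (E + Y) < R * Y" using that by simp
    then have "Y * Y < R * Y" using Y2 by simp
    then show ?thesis using Y by simp
  qed
  ultimately show ?thesis unfolding R_def Y_def c_def I_def A0_def E_def by blast
qed

end
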